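(* Let $X$ be a quasi-diffusion process corresponding to $L$. Let $R\in(0,\infty)$, $p\ge d_0$, $p>d/2+1$, let $g$ be a Borel bounded function on $\bar C_{2R}$ and $f\in L_p(C_{2R})$. For $(t_0,x_0)\in C_{2R}$ define $$u(t_0,x_0)=E_{x_0}\int_0^{\gamma_{2R}}f(t_0+t,x_t)\,dt+E_{x_0}g(t_0+\gamma_{2R},x_{\gamma_{2R}}),$$ where $\gamma_{2R}$ is the first exit time of $(t_0+t,x_t)$ from $C_{2R}$. Then there exists a constant $N$, which depends only on $p,d,\|b\|$, and $\delta$, such that $$|u(z_1)-u(z_2)|\le N\Big(R^{-\alpha}\rho^\alpha(z_1,z_2)\sup_{\bar C_{2R}}|g|+R^{2-(d+2)/p}\|f\|_{L_p(C_{2R})}\Big)$$ for $z_1,z_2\in C_R$ and $\alpha\in(0,\alpha_0]$, where $\alpha_0=\alpha_0(d,\delta,\|b\|)\in(0,1)$ is the constant fixed in the context.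
   Context: Fix the dimension $d$, $\delta\in(0,1)$ and a number denoted $\|b\|\in(0,\infty)$. $\mathbb S_\delta$ is the set of symmetric $d\times d$ matrices with eigenvalues in $[\delta,\delta^{-1}]$. $a:\mathbb R^d\to\mathbb S_\delta$ and $b:\mathbb R^d\to\mathbb R^d$ are Borel with $\|b\|_{L_d(\mathbb R^d)}\le\|b\|$ (the right side is the fixed number). $L=(1/2)a^{ij}(x)D_{ij}+b^i(x)D_i$, where $D_i=\partial/\partial x^i$, $D_{ij}=D_iD_j$, with summation over repeated indices. A quasi-diffusion process corresponding to $L$ is a continuous time-homogeneous Markov process $X=(x_t,\infty,\mathcal M_t,P_x)$ in $\mathbb R^d$ with infinite lifetime (in Dynkin's sense; $P_x$ is the law for the starting point $x$, $E_x$ the expectation) such that for any $x\in\mathbb R^d$, $t\ge0$, $E_x\int_0^t|b(x_s)|\,ds<\infty$ and, for any twice continuously differentiable compactly supported $u$, $u(x)=E_xu(x_t)-E_x\int_0^tLu(x_s)\,ds$. A constant "depending only on" certain parameters is the same, for given values of those parameters, for all Borel $a:\mathbb R^d\to\mathbb S_\delta$, all Borel $b:\mathbb R^d\to\mathbb R^d$ with $\|b\|_{L_d(\mathbb R^d)}$ not exceeding the fixed number $\|b\|$, and all quasi-diffusion processes $X$ corresponding to the operator $L$ with these coefficients. Notation: $B_R=\{|x|<R\}$; $C_{T,R}=[0,T)\times B_R$; $C_{T,R}(t,x)=(t,x)+C_{T,R}$; $C_R=C_{R^2,R}$; $\rho(z_1,z_2)=|x_1-x_2|+|t_1-t_2|^{1/2}$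 for $z_i=(t_i,x_i)$; $\tau_R$ is the first exit time of $x_t$ from $B_R$. The constant $d_0=d_0(d,\delta,\|b\|)\in(d/2,d)$ is a fixed constant, known from earlier work of Krylov, with the following two properties for every (finite) $p\ge d_0$, every Borel $a:\mathbb R^d\to\mathbb S_\delta$, every Borel $b:\mathbb R^d\to\mathbb R^d$ with $\|b\|_{L_d(\mathbb R^d)}$ not exceeding the fixed number $\|b\|$, every quasi-diffusion process $X$ corresponding to the operator $L$ with these coefficients, and every Borel $f\ge0$ on $\mathbb R^d$. (i) For all $R\in(0,\infty)$, $E_0\int_0^{\tau_R}f(x_t)\,dt\le NR^{2-d/p}\|f\|_{L_p(B_R)}$ with $N=N(p,d,\delta,\|b\|)$. (ii) There are $N,\mu'>0$ and $R_0\ge2$, depending only on $p,d,\delta,\|b\|$, such that for all $\lambda>0$, $R\in[0,\infty)$, $E_0\int_0^\infty e^{-\lambda\phi_t(B_R^c)}f(x_t)\,dt\le N(R\sqrt\lambda+R_0)^{2-d/p}\lambda^{d/(2p)-1}\|\Psi_{R,\lambda}^{-1}f\|_{L_p(\mathbb R^d)}$, where $\phi_t(\Gamma)=\int_0^tI_\Gamma(x_s)\,ds$ and $\Psi_{R,\lambda}(x)=\exp(\sqrt\lambda\,\mu'\,\mathrm{dist}(x,B_{R+R_0/\sqrt\lambda}))$. A bounded Borel function $u$ on a set $Q\subset\mathbb R^{d+1}$ is caloric (relative to $X$) if for any $(s,y)$ and $T,R\in(0,\infty)$ with $\bar C_{T,R}(s,y)\subset Q$ and any $(t_0,x_0)\in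 C:=C_{T,R}(s,y)$, $u(t_0,x_0)=E_{x_0}u(t_0+\tau_C,x_{\tau_C})$, where $\tau_C$ is the first exit time of $(t_0+t,x_t)$ from $C$. The constant $\alpha_0\in(0,1)$, depending only on $d,\delta,\|b\|$, is a fixed constant such that, with some $N=N(d,\delta,\|b\|)$, for any $R\in(0,\infty)$, any caloric $u$ in $\bar C_{2R}$, any $\alpha\in(0,\alpha_0]$ and $z_1,z_2\in C_R$: $|u(z_1)-u(z_2)|\le NR^{-\alpha}\rho^\alpha(z_1,z_2)\sup_{\bar C_{2R}}|u|$. *)

theory Defs
  imports "HOL-Probability.Probability"
begin

section \<open>Coefficients and the operator\<close>

text \<open>The dimension $d$ is \<open>CARD('n)\<close>, points of the space are of type \<open>real ^ 'n\<close>.\<close>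

definition ellip_mats :: "real \<Rightarrow> (real ^ 'n ^ 'n) set" where
  "ellip_mats \<delta> = {A. transpose A = A \<and>
     (\<forall>c v. v \<noteq> 0 \<and> A *v v = c *\<^sub>R v \<longrightarrow> \<delta> \<le> c \<and> c \<le> 1 / \<delta>)}"

text \<open>The norm takes values in \<open>ennreal\<close>, so that it is meaningful for every Borel function.\<close>

definition Lp_norm :: "real \<Rightarrow> 'a::euclidean_space set \<Rightarrow> ('a \<Rightarrow> 'b::real_normed_vector) \<Rightarrow> ennreal" where
  "Lp_norm p Q f =
     (let I = (\<integral>\<^sup>+x\<in>Q. ennreal (norm (f x) powr p) \<partial>lborel)
      in if I = \<infinity> then \<infinity> else ennreal (enn2real I powr (1 / p)))"

definition admissible_coeffs ::
  "real \<Rightarrow> real \<Rightarrow> (real ^ 'n \<Rightarrow> real ^ 'n ^ 'n) \<Rightarrow> (real ^ 'n \<Rightarrow> real ^ 'n) \<Rightarrow> bool" where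
  "admissible_coeffs \<delta> nb a b \<longleftrightarrow>
     a \<in> borel_measurable borel \<and> (\<forall>x. a x \<in> ellip_mats \<delta>) \<and>
     b \<in> borel_measurable borel \<and> Lp_norm (real CARD('n)) UNIV b \<le> ennreal nb"

definition partial_deriv :: "'n \<Rightarrow> (real ^ 'n \<Rightarrow> real) \<Rightarrow> real ^ 'n \<Rightarrow> real" where
  "partial_deriv i u x = deriv (\<lambda>h. u (x + h *\<^sub>R axis i 1)) 0"

definition C2_compact_support :: "(real ^ 'n \<Rightarrow> real) \<Rightarrow> bool" where
  "C2_compact_support u \<longleftrightarrow>
     (\<forall>x. u differentiable (at x)) \<and>
     (\<forall>i x. partial_deriv i u differentiable (at x)) \<and>
     (\<forall>i j. continuous_on UNIV (partial_deriv i (partial_deriv j u))) \<and>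
     compact (closure {x. u x \<noteq> 0})"

definition diff_op ::
  "(real ^ 'n \<Rightarrow> real ^ 'n ^ 'n) \<Rightarrow> (real ^ 'n \<Rightarrow> real ^ 'n) \<Rightarrow> (real ^ 'n \<Rightarrow> real) \<Rightarrow> real ^ 'n \<Rightarrow> real" where
  "diff_op a b u x =
     1 / 2 * (\<Sum>i\<in>UNIV. \<Sum>j\<in>UNIV. a x $ i $ j * partial_deriv i (partial_deriv j u) x)
     + (\<Sum>i\<in>UNIV. b x $ i * partial_deriv i u x)"

section \<open>Quasi-diffusion processes\<close>

text \<open>
  Dynkin's notion of a time-homogeneous Markov process with infinite lifetime: the sample space
  \<open>\<Omega>\<close> and the sigma-algebra on it are common to all the laws \<open>P x\<close>, the filtration \<open>F\<close> is
  part of the data and need not be generated by the process, and \<open>\<Omega>\<close> is rich enough to contain all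
  shifted trajectories. Only times \<open>t \<ge> 0\<close> are meaningful.
\<close>

locale continuous_markov_process =
  fixes X :: "real \<Rightarrow> 'w \<Rightarrow> real ^ 'n"
    and F :: "real \<Rightarrow> 'w measure"
    and P :: "real ^ 'n \<Rightarrow> 'w measure"
  assumes prob_P: "prob_space (P x)"
    and sets_P: "sets (P x) = sets (P y)"
    and subalgebra_F: "0 \<le> t \<Longrightarrow> subalgebra (P x) (F t)"
    and mono_F: "0 \<le> s \<Longrightarrow> s \<le> t \<Longrightarrow> sets (F s) \<subseteq> sets (F t)"
    and adapted: "0 \<le> t \<Longrightarrow> X t \<in> F t \<rightarrow>\<^sub>M borel"
    and transition_measurable: "0 \<le> t \<Longrightarrow> \<Gamma> \<in> sets borel \<Longrightarrow>
      (\<lambda>x. measure (P x) {\<omega> \<in> space (P x). X t \<omega> \<in> \<Gamma>}) \<in> borel_measurable borel"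
    and start: "measure (P x) {\<omega> \<in> space (P x). X 0 \<omega> = x} = 1"
    and markov: "0 \<le> t \<Longrightarrow> 0 \<le> h \<Longrightarrow> \<Gamma> \<in> sets borel \<Longrightarrow>
      AE \<omega> in P x.
        real_cond_exp (P x) (F t) (indicator {\<omega> \<in> space (P x). X (t + h) \<omega> \<in> \<Gamma>}) \<omega>
        = measure (P (X t \<omega>)) {\<omega>' \<in> space (P (X t \<omega>)). X h \<omega>' \<in> \<Gamma>}"
    and shift: "0 \<le> t \<Longrightarrow> \<omega> \<in> space (P x) \<Longrightarrow>
      \<exists>\<omega>'\<in>space (P x). \<forall>s\<ge>0. X s \<omega>' = X (s + t) \<omega>"
    and continuous_paths: "\<omega> \<in> space (P x) \<Longrightarrow> continuous_on {0..} (\<lambda>t. X t \<omega>)"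

locale quasi_diffusion = continuous_markov_process X F P
  for X :: "real \<Rightarrow> 'w \<Rightarrow> real ^ 'n" and F P +
  fixes a :: "real ^ 'n \<Rightarrow> real ^ 'n ^ 'n" and b :: "real ^ 'n \<Rightarrow> real ^ 'n"
  assumes drift_integrable: "0 \<le> t \<Longrightarrow>
      (\<integral>\<^sup>+\<omega>. (\<integral>\<^sup>+s\<in>{0..t}. ennreal (norm (b (X s \<omega>))) \<partial>lborel) \<partial>P x) < \<infinity>"
    and generator: "0 \<le> t \<Longrightarrow> C2_compact_support u \<Longrightarrow>
      u x = (LINT \<omega>|P x. u (X t \<omega>)) - (LINT \<omega>|P x. (LINT s:{0..t}|lborel. diff_op a b u (X s \<omega>)))"

text \<open>
  \<open>\<Phi>\<close> holds for all quasi-diffusion processes, with sample space contained in the type \<open>'w\<close>, and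
  all admissible coefficients. A constant fixed outside of \<open>\<Phi>\<close> does not depend on these.
\<close>

definition all_quasi_diffusions ::
  "real \<Rightarrow> real \<Rightarrow> ((real \<Rightarrow> 'w \<Rightarrow> real ^ 'n) \<Rightarrow> (real ^ 'n \<Rightarrow> 'w measure) \<Rightarrow> bool) \<Rightarrow> bool" where
  "all_quasi_diffusions \<delta> nb \<Phi> \<longleftrightarrow>
     (\<forall>a b X F P. admissible_coeffs \<delta> nb a b \<longrightarrow> quasi_diffusion X F P a b \<longrightarrow> \<Phi> X P)"

section \<open>Cylinders and exit times\<close>

definition cyl :: "real \<times> (real ^ 'n) \<Rightarrow> real \<Rightarrow> real \<Rightarrow> (real \<times> (real ^ 'n)) set" where
  "cyl z T R = {fst z..<fst z + T} \<times> ball (snd z) R"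

abbreviation pcyl :: "real \<Rightarrow> (real \<times> (real ^ 'n)) set" where
  "pcyl R \<equiv> cyl (0, 0) (R\<^sup>2) R"

definition pdist :: "real \<times> (real ^ 'n) \<Rightarrow> real \<times> (real ^ 'n) \<Rightarrow> real" where
  "pdist z1 z2 = norm (snd z1 - snd z2) + sqrt \<bar>fst z1 - fst z2\<bar>"

text \<open>Exit time of a trajectory \<open>y\<close>; it is \<open>\<infinity>\<close> if the trajectory never leaves \<open>Q\<close>.\<close>

definition exit_time :: "'a set \<Rightarrow> (real \<Rightarrow> 'a) \<Rightarrow> ereal" where
  "exit_time Q y = Inf (ereal ` {t. 0 \<le> t \<and> y t \<notin> Q})"

definition before_exit :: "'a set \<Rightarrow> (real \<Rightarrow> 'a) \<Rightarrow> real set" where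
  "before_exit Q y = {t. 0 \<le> t \<and> ereal t < exit_time Q y}"

text \<open>Only used for bounded cylinders, where the exit time is finite.\<close>

definition exit_point :: "'a set \<Rightarrow> (real \<Rightarrow> 'a) \<Rightarrow> 'a" where
  "exit_point Q y = y (real_of_ereal (exit_time Q y))"

definition spacetime :: "(real \<Rightarrow> 'w \<Rightarrow> real ^ 'n) \<Rightarrow> real \<Rightarrow> 'w \<Rightarrow> real \<Rightarrow> real \<times> (real ^ 'n)" where
  "spacetime X t0 \<omega> t = (t0 + t, X t \<omega>)"

section \<open>The exponent \<open>d\<^sub>0\<close>\<close>

definition occupation :: "(real \<Rightarrow> 'w \<Rightarrow> real ^ 'n) \<Rightarrow> (real ^ 'n) set \<Rightarrow> real \<Rightarrow> 'w \<Rightarrow> real" where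
  "occupation X \<Gamma> t \<omega> = (LINT s:{0..t}|lborel. indicator \<Gamma> (X s \<omega>))"

definition exp_weight :: "real \<Rightarrow> real \<Rightarrow> real \<Rightarrow> real \<Rightarrow> real ^ 'n \<Rightarrow> real" where
  "exp_weight \<mu> R0 R lam x = exp (sqrt lam * \<mu> * infdist x (ball 0 (R + R0 / sqrt lam)))"

text \<open>Properties (i) and (ii) of \<open>d\<^sub>0\<close>, for one process and fixed constants.\<close>

definition exit_Lp_bound ::
  "real \<Rightarrow> real \<Rightarrow> (real \<Rightarrow> 'w \<Rightarrow> real ^ 'n) \<Rightarrow> (real ^ 'n \<Rightarrow> 'w measure) \<Rightarrow> bool" where
  "exit_Lp_bound p N X P \<longleftrightarrow>
     (\<forall>f R. f \<in> borel_measurable borel \<and> (\<forall>x. 0 \<le> f x) \<and> 0 < R \<longrightarrow>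
        (\<integral>\<^sup>+\<omega>. (\<integral>\<^sup>+t\<in>before_exit (ball 0 R) (\<lambda>t. X t \<omega>). ennreal (f (X t \<omega>)) \<partial>lborel) \<partial>P 0)
        \<le> ennreal (N * R powr (2 - real CARD('n) / p)) * Lp_norm p (ball 0 R) f)"

definition discounted_Lp_bound ::
  "real \<Rightarrow> real \<Rightarrow> real \<Rightarrow> real \<Rightarrow> (real \<Rightarrow> 'w \<Rightarrow> real ^ 'n) \<Rightarrow> (real ^ 'n \<Rightarrow> 'w measure) \<Rightarrow> bool" where
  "discounted_Lp_bound p N \<mu> R0 X P \<longleftrightarrow>
     (\<forall>f lam R. f \<in> borel_measurable borel \<and> (\<forall>x. 0 \<le> f x) \<and> 0 < lam \<and> 0 \<le> R \<longrightarrow>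
        (\<integral>\<^sup>+\<omega>. (\<integral>\<^sup>+t\<in>{0..}.
            ennreal (exp (- lam * occupation X (- ball 0 R) t \<omega>) * f (X t \<omega>)) \<partial>lborel) \<partial>P 0)
        \<le> ennreal (N * (R * sqrt lam + R0) powr (2 - real CARD('n) / p)
                     * lam powr (real CARD('n) / (2 * p) - 1))
          * Lp_norm p UNIV (\<lambda>x. f x / exp_weight \<mu> R0 R lam x))"

text \<open>
  As an assumption on \<open>d0\<close> it is enough to consider processes whose sample points are trajectories:
  the properties involve only the distribution of \<open>X\<close> on the space of trajectories. The
  same applies to the exponent \<open>\<alpha>\<^sub>0\<close> below. The argument of type \<open>'n itself\<close> fixes the dimension.
\<close>

definition is_d0 :: "'n::finite itself \<Rightarrow> real \<Rightarrow> real \<Rightarrow> real \<Rightarrow> bool" where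
  "is_d0 _ \<delta> nb d0 \<longleftrightarrow>
     real CARD('n) / 2 < d0 \<and> d0 < real CARD('n) \<and>
     (\<forall>p\<ge>d0.
        (\<exists>N>0. all_quasi_diffusions \<delta> nb
           (\<lambda>(X :: real \<Rightarrow> (real \<Rightarrow> real ^ 'n) \<Rightarrow> real ^ 'n) P. exit_Lp_bound p N X P)) \<and>
        (\<exists>N>0. \<exists>\<mu>>0. \<exists>R0\<ge>2. all_quasi_diffusions \<delta> nb
           (\<lambda>(X :: real \<Rightarrow> (real \<Rightarrow> real ^ 'n) \<Rightarrow> real ^ 'n) P. discounted_Lp_bound p N \<mu> R0 X P)))"

section \<open>Caloric functions and the exponent \<open>\<alpha>\<^sub>0\<close>\<close>

text \<open>
  A Borel function on a Borel set \<open>Q\<close> is represented by a Borel function on the whole space; its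
  values outside of \<open>Q\<close> do not matter, since almost surely the exit point is in the closure of
  the cylinder.
\<close>

definition caloric ::
  "(real \<Rightarrow> 'w \<Rightarrow> real ^ 'n) \<Rightarrow> (real ^ 'n \<Rightarrow> 'w measure) \<Rightarrow> (real \<times> (real ^ 'n)) set
     \<Rightarrow> (real \<times> (real ^ 'n) \<Rightarrow> real) \<Rightarrow> bool" where
  "caloric X P Q u \<longleftrightarrow>
     u \<in> borel_measurable borel \<and> bounded (u ` Q) \<and>
     (\<forall>z T R. 0 < T \<and> 0 < R \<and> closure (cyl z T R) \<subseteq> Q \<longrightarrow>
        (\<forall>t0 x0. (t0, x0) \<in> cyl z T R \<longrightarrow>
           u (t0, x0) = (LINT \<omega>|P x0. u (exit_point (cyl z T R) (spacetime X t0 \<omega>)))))"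

definition caloric_holder ::
  "real \<Rightarrow> real \<Rightarrow> (real \<Rightarrow> 'w \<Rightarrow> real ^ 'n) \<Rightarrow> (real ^ 'n \<Rightarrow> 'w measure) \<Rightarrow> bool" where
  "caloric_holder \<alpha>0 N X P \<longleftrightarrow>
     (\<forall>R u \<alpha> z1 z2. 0 < R \<and> caloric X P (closure (pcyl (2 * R))) u \<and> 0 < \<alpha> \<and> \<alpha> \<le> \<alpha>0 \<and>
        z1 \<in> pcyl R \<and> z2 \<in> pcyl R \<longrightarrow>
        \<bar>u z1 - u z2\<bar> \<le> N * R powr (- \<alpha>) * pdist z1 z2 powr \<alpha>
                          * (SUP z\<in>closure (pcyl (2 * R)). \<bar>u z\<bar>))"

definition is_alpha0 :: "'n::finite itself \<Rightarrow> real \<Rightarrow> real \<Rightarrow> real \<Rightarrow> bool" where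
  "is_alpha0 _ \<delta> nb \<alpha>0 \<longleftrightarrow>
     0 < \<alpha>0 \<and> \<alpha>0 < 1 \<and>
     (\<exists>N. all_quasi_diffusions \<delta> nb
        (\<lambda>(X :: real \<Rightarrow> (real \<Rightarrow> real ^ 'n) \<Rightarrow> real ^ 'n) P. caloric_holder \<alpha>0 N X P))"

section \<open>The function \<open>u\<close> and its estimate\<close>

definition sol ::
  "(real \<Rightarrow> 'w \<Rightarrow> real ^ 'n) \<Rightarrow> (real ^ 'n \<Rightarrow> 'w measure) \<Rightarrow> (real \<times> (real ^ 'n)) set
     \<Rightarrow> (real \<times> (real ^ 'n) \<Rightarrow> real) \<Rightarrow> (real \<times> (real ^ 'n) \<Rightarrow> real) \<Rightarrow> real \<times> (real ^ 'n) \<Rightarrow> real" where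
  "sol X P C f g = (\<lambda>(t0, x0).
     (LINT \<omega>|P x0. (LINT t:before_exit C (spacetime X t0 \<omega>)|lborel. f (t0 + t, X t \<omega>)))
     + (LINT \<omega>|P x0. g (exit_point C (spacetime X t0 \<omega>))))"

text \<open>
  The first conclusion says that the integral of \<open>f\<close> in the definition of \<open>u\<close> converges
  absolutely; without it \<open>sol\<close> could be a default value of the Lebesgue integral. An element \<open>f\<close> of
  \<open>L\<^sub>p\<close> is given by a Borel representative.
\<close>

definition holder_estimate ::
  "real \<Rightarrow> real \<Rightarrow> real \<Rightarrow> (real \<Rightarrow> 'w \<Rightarrow> real ^ 'n) \<Rightarrow> (real ^ 'n \<Rightarrow> 'w measure) \<Rightarrow> bool" where
  "holder_estimate \<alpha>0 p N X P \<longleftrightarrow>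
     (\<forall>R f g. 0 < R \<and>
        g \<in> borel_measurable borel \<and> bounded (g ` closure (pcyl (2 * R))) \<and>
        f \<in> borel_measurable borel \<and> Lp_norm p (pcyl (2 * R)) f < \<infinity> \<longrightarrow>
        (\<forall>t0 x0. (t0, x0) \<in> pcyl (2 * R) \<longrightarrow>
           (\<integral>\<^sup>+\<omega>. (\<integral>\<^sup>+t\<in>before_exit (pcyl (2 * R)) (spacetime X t0 \<omega>).
               ennreal \<bar>f (t0 + t, X t \<omega>)\<bar> \<partial>lborel) \<partial>P x0) < \<infinity>) \<and>
        (\<forall>z1\<in>pcyl R. \<forall>z2\<in>pcyl R. \<forall>\<alpha>. 0 < \<alpha> \<and> \<alpha> \<le> \<alpha>0 \<longrightarrow>
           \<bar>sol X P (pcyl (2 * R)) f g z1 - sol X P (pcyl (2 * R)) f g z2\<bar>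
           \<le> N * (R powr (- \<alpha>) * pdist z1 z2 powr \<alpha> * (SUP z\<in>closure (pcyl (2 * R)). \<bar>g z\<bar>)
                  + R powr (2 - (real CARD('n) + 2) / p)
                    * enn2real (Lp_norm p (pcyl (2 * R)) f))))"

text \<open>
  \<open>N\<close> is an admissible constant for all processes with sample space contained in the type \<open>'w\<close>.
\<close>

definition holder_constant ::
  "'w itself \<Rightarrow> 'n::finite itself \<Rightarrow> real \<Rightarrow> real \<Rightarrow> real \<Rightarrow> real \<Rightarrow> real \<Rightarrow> bool" where
  "holder_constant _ _ \<delta> nb \<alpha>0 p N \<longleftrightarrow>
     all_quasi_diffusions \<delta> nb
       (\<lambda>(X :: real \<Rightarrow> 'w \<Rightarrow> real ^ 'n) P. holder_estimate \<alpha>0 p N X P)"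

end

(* Only the Markov property at fixed times is given, so the Markov property at exit times has to be
   proved first. Functions that are harmonic up to an error C s over each time step s satisfy a
   growth estimate on balls, by Dynkin's formula for powers of S - |x - z|^2 together with the exit
   estimate (i) for p = d, which makes the drift negligible on small balls. A covering argument of
   Krylov and Safonov turns this into continuity. It applies to time averages of the semigroup P_t
   and gives the Markov property at exit times for P_{T-t} f, first for continuous f and then for
   Borel f. Hence (t, x) -> P_{T-t} f(x) is caloric, and the Hoelder estimate for caloric functions
   makes P_t strong Feller. The g-part of u is then caloric as well. For the f-part, the Hoelder
   estimate upgrades the resolvent estimate (ii) to P_t f <= N t^{-d/(2p)} |f|_p, which is
   integrated in t by means of Young's inequality; this needs p > d/2 + 1.
   The estimates for processes on other sample spaces follow by passing to trajectories. *)

theory Submission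
  imports Defs
begin

section \<open>Ellipticity\<close>

lemma quadratic_nonneg_imp_zero:
  fixes \<alpha> \<beta> :: real
  assumes "\<And>t. 0 \<le> 2 * t * \<alpha> + t\<^sup>2 * \<beta>"
  shows "\<alpha> = 0"
proof (rule ccontr)
  assume "\<alpha> \<noteq> 0"
  define B where "B = \<bar>\<beta>\<bar> + 1"
  have B: "B > 0" "\<beta> \<le> B" by (auto simp: B_def)
  have "0 \<le> 2 * (-\<alpha> / B) * \<alpha> + (-\<alpha> / B)\<^sup>2 * \<beta>" by (rule assms)
  also have "\<dots> \<le> 2 * (-\<alpha> / B) * \<alpha> + (-\<alpha> / B)\<^sup>2 * B"
    using B by (intro add_left_mono mult_left_mono) auto
  also have "\<dots> = - (\<alpha>\<^sup>2 / B)"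
    using B by (simp add: field_simps power2_eq_square)
  also have "\<dots> < 0" using B \<open>\<alpha> \<noteq> 0\<close> by simp
  finally show False by simp
qed

lemma symmetric_least_eigenvalue:
  fixes A :: "real ^ 'n ^ 'n"
  assumes sym: "transpose A = A"
  obtains v c where "v \<noteq> 0" "A *v v = c *\<^sub>R v" "\<And>x. c * (norm x)\<^sup>2 \<le> x \<bullet> (A *v x)"
proof -
  have lin: "linear (\<lambda>x. A *v x)" by (simp add: matrix_vector_mul_linear)
  have cont: "continuous_on (sphere 0 1) (\<lambda>x. x \<bullet> (A *v x))"
    by (intro continuous_intros linear_continuous_on linear_conv_bounded_linear[THEN iffD1] lin)
  obtain v where v: "v \<in> sphere 0 1" and vmin: "\<And>y. y \<in> sphere 0 1 \<Longrightarrow> v \<bullet> (A *v v) \<le> y \<bullet> (A *v y)"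
    using continuous_attains_inf[OF compact_sphere _ cont] by (auto simp: sphere_eq_empty)
  define c where "c = v \<bullet> (A *v v)"
  have nv: "norm v = 1" using v by simp
  have ineq: "c * (norm x)\<^sup>2 \<le> x \<bullet> (A *v x)" for x
  proof (cases "x = 0")
    case False
    have "c \<le> (x /\<^sub>R norm x) \<bullet> (A *v (x /\<^sub>R norm x))"
      unfolding c_def by (rule vmin) (use False in simp)
    also have "\<dots> = (x \<bullet> (A *v x)) / (norm x)\<^sup>2"
      by (simp add: linear_scale[OF lin] power2_eq_square divide_inverse)
    finally show ?thesis using False by (simp add: field_simps)
  qed simp
  have swap: "y \<bullet> (A *v x) = x \<bullet> (A *v y)" for x y
    by (metis dot_lmul_matrix inner_commute sym transpose_matrix_vector)
  define w where "w = A *v v - c *\<^sub>R v"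
  have "w \<bullet> w = 0"
  proof (rule quadratic_nonneg_imp_zero[where \<beta> = "w \<bullet> (A *v w) - c * (w \<bullet> w)"])
    fix t :: real
    have "0 \<le> (v + t *\<^sub>R w) \<bullet> (A *v (v + t *\<^sub>R w)) - c * (norm (v + t *\<^sub>R w))\<^sup>2"
      using ineq by simp
    also have "\<dots> = (v \<bullet> (A *v v) - c * (v \<bullet> v)) + 2 * t * (w \<bullet> (A *v v) - c * (w \<bullet> v))
        + t\<^sup>2 * (w \<bullet> (A *v w) - c * (w \<bullet> w))"
      by (simp add: linear_add[OF lin] linear_scale[OF lin] power2_norm_eq_inner[of "v + t *\<^sub>R w"] inner_add_left
          inner_add_right inner_commute[of v w] swap[of v w] algebra_simps power2_eq_square[of t])
    also have "v \<bullet> (A *v v) - c * (v \<bullet> v) = 0"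
      using nv by (simp add: c_def dot_square_norm)
    also have "w \<bullet> (A *v v) - c * (w \<bullet> v) = w \<bullet> w"
      by (simp add: w_def inner_diff_right inner_diff_left algebra_simps)
    finally show "0 \<le> 2 * t * (w \<bullet> w) + t\<^sup>2 * (w \<bullet> (A *v w) - c * (w \<bullet> w))" by simp
  qed
  then have "A *v v = c *\<^sub>R v" by (simp add: w_def)
  moreover have "v \<noteq> 0" using nv by auto
  ultimately show ?thesis using ineq that by blast
qed

lemma ellip_mats_lower:
  assumes "A \<in> ellip_mats \<delta>"
  shows "\<delta> * (norm x)\<^sup>2 \<le> x \<bullet> (A *v x)"
proof -
  from assms have "transpose A = A" by (simp add: ellip_mats_def)
  then obtain v c where "v \<noteq> 0" "A *v v = c *\<^sub>R v" and *: "\<And>x. c * (norm x)\<^sup>2 \<le> x \<bullet> (A *v x)"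
    using symmetric_least_eigenvalue by blast
  then have "\<delta> \<le> c" using assms by (auto simp: ellip_mats_def)
  then have "\<delta> * (norm x)\<^sup>2 \<le> c * (norm x)\<^sup>2" by (intro mult_right_mono) auto
  with *[of x] show ?thesis by linarith
qed

lemma ellip_mats_upper:
  assumes "A \<in> ellip_mats \<delta>"
  shows "x \<bullet> (A *v x) \<le> (norm x)\<^sup>2 / \<delta>"
proof -
  from assms have sym: "transpose A = A" by (simp add: ellip_mats_def)
  have neg: "(- A) *v x = - (A *v x)" for x
    by (simp add: vec_eq_iff matrix_vector_mult_def sum_negf)
  have "transpose (- A) = - A" using sym by (simp add: transpose_def vec_eq_iff)
  then obtain v c where "v \<noteq> 0" "(- A) *v v = c *\<^sub>R v"
    and *: "\<And>x. c * (norm x)\<^sup>2 \<le> x \<bullet> ((- A) *v x)"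
    using symmetric_least_eigenvalue by blast
  then have "v \<noteq> 0" "A *v v = (- c) *\<^sub>R v" by (simp_all add: neg) (metis minus_minus)
  then have "- c \<le> 1 / \<delta>" using assms by (force simp: ellip_mats_def)
  then have "- c * (norm x)\<^sup>2 \<le> 1 / \<delta> * (norm x)\<^sup>2" by (intro mult_right_mono) auto
  with *[of x] show ?thesis by (simp add: neg)
qed

lemma ellip_mats_diag:
  assumes "A \<in> ellip_mats \<delta>"
  shows "A $ i $ i \<le> 1 / \<delta>"
proof -
  have "axis i 1 \<bullet> (A *v axis i 1) = A $ i $ i"
    by (simp add: inner_axis' matrix_vector_mult_basis column_def)
  with ellip_mats_upper[OF assms, of "axis i 1"] show ?thesis by simp
qed

lemma ellip_mats_trace:
  fixes A :: "real ^ 'n ^ 'n"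
  assumes "A \<in> ellip_mats \<delta>"
  shows "(\<Sum>i\<in>UNIV. A $ i $ i) \<le> real CARD('n) / \<delta>"
  using sum_mono[of UNIV "\<lambda>i. A $ i $ i" "\<lambda>_. 1 / \<delta>"] ellip_mats_diag[OF assms] by simp

section \<open>Radial test functions\<close>

lemma has_real_derivative_pos_power:
  assumes "2 \<le> k"
  shows "((\<lambda>s. max 0 s ^ k) has_real_derivative real k * max 0 s ^ (k - 1)) (at (s::real))"
proof -
  consider "s > 0" | "s < 0" | "s = 0" by linarith
  then show ?thesis
  proof cases
    case 1
    have "((\<lambda>s. s ^ k) has_real_derivative real k * s ^ (k - 1)) (at s)"
      by (auto intro!: derivative_eq_intros)
    then have "((\<lambda>s. max 0 s ^ k) has_real_derivative real k * s ^ (k - 1)) (at s)"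
      by (rule DERIV_cong_ev[OF refl _ refl, THEN iffD1, rotated])
        (use 1 in \<open>auto simp: eventually_nhds intro!: exI[of _ "{0<..}"]\<close>)
    with 1 show ?thesis by simp
  next
    case 2
    have "((\<lambda>s::real. 0::real) has_real_derivative 0) (at s)" by simp
    then have "((\<lambda>s. max 0 s ^ k) has_real_derivative 0) (at s)"
      by (rule DERIV_cong_ev[OF refl _ refl, THEN iffD1, rotated])
        (use 2 assms in \<open>auto simp: eventually_nhds max_def zero_power intro!: exI[of _ "{..<0}"]\<close>)
    with 2 assms show ?thesis by (simp add: max_def zero_power)
  next
    case 3
    have "((\<lambda>h. max 0 h ^ k / h) \<longlongrightarrow> 0) (at (0::real))"
    proof (rule Lim_null_comparison)
      show "\<forall>\<^sub>F h in at 0. norm (max 0 h ^ k / h) \<le> \<bar>h\<bar> ^ (k - 1)"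
      proof (intro always_eventually allI)
        fix h :: real
        obtain m where m: "k = Suc m" "m > 0" using assms by (cases k) auto
        show "norm (max 0 h ^ k / h) \<le> \<bar>h\<bar> ^ (k - 1)"
          using m by (auto simp: max_def)
      qed
      have "((\<lambda>h::real. \<bar>h\<bar> ^ (k - 1)) \<longlongrightarrow> \<bar>0\<bar> ^ (k - 1)) (at 0)"
        by (intro tendsto_intros)
      then show "((\<lambda>h::real. \<bar>h\<bar> ^ (k - 1)) \<longlongrightarrow> 0) (at 0)"
        using assms by (simp add: zero_power)
    qed
    with 3 assms show ?thesis by (simp add: DERIV_def zero_power)
  qed
qed

definition bump :: "real ^ 'n \<Rightarrow> real \<Rightarrow> nat \<Rightarrow> real ^ 'n \<Rightarrow> real" where
  "bump z S k x = max 0 (S - (norm (x - z))\<^sup>2) ^ k"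

lemma bump_nonneg: "0 \<le> bump z S k x"
  by (simp add: bump_def)

lemma bump_le: "0 \<le> S \<Longrightarrow> bump z S k x \<le> S ^ k"
  unfolding bump_def by (intro power_mono) auto

lemma bump_has_derivative:
  assumes "2 \<le> k"
  shows "(bump z S k has_derivative (\<lambda>h. - 2 * real k * bump z S (k - 1) x * ((x - z) \<bullet> h))) (at x)"
proof -
  have "((\<lambda>x. S - (x - z) \<bullet> (x - z)) has_derivative (\<lambda>h. - 2 * ((x - z) \<bullet> h))) (at x)"
    by (auto intro!: derivative_eq_intros simp: inner_commute)
  from has_derivative_compose[OF this
      has_real_derivative_pos_power[OF assms, THEN has_field_derivative_imp_has_derivative]]
  show ?thesis
    unfolding bump_def[abs_def] power2_norm_eq_inner by (simp add: algebra_simps)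
qed

lemma continuous_on_bump: "continuous_on A (bump z S k)"
  unfolding bump_def[abs_def] by (intro continuous_intros)

lemma partial_deriv_eq:
  assumes "(u has_derivative D) (at x)"
  shows "partial_deriv i u x = D (axis i 1)"
proof -
  have "((\<lambda>h::real. x + h *\<^sub>R axis i 1) has_derivative (\<lambda>h. h *\<^sub>R axis i 1)) (at 0)"
    by (auto intro!: derivative_eq_intros)
  from has_derivative_compose[OF this, of u D]
  have "((\<lambda>h. u (x + h *\<^sub>R axis i 1)) has_derivative (\<lambda>h. D (h *\<^sub>R axis i 1))) (at 0)"
    using assms by simp
  then have "((\<lambda>h. u (x + h *\<^sub>R axis i 1)) has_real_derivative D (axis i 1)) (at 0)"
    by (rule has_derivative_imp_has_field_derivative)
      (simp add: linear_scale[OF has_derivative_linear[OF assms]])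
  then show ?thesis unfolding partial_deriv_def by (rule DERIV_imp_deriv)
qed

lemma partial_deriv_bump:
  assumes "2 \<le> k"
  shows "partial_deriv i (bump z S k) x = - 2 * real k * bump z S (k - 1) x * (x - z) $ i"
  using partial_deriv_eq[OF bump_has_derivative[OF assms]] by (simp add: inner_axis)

lemma partial_deriv_bump_has_derivative:
  assumes "3 \<le> k"
  shows "(partial_deriv j (bump z S k) has_derivative
    (\<lambda>h. - 2 * real k * (bump z S (k - 1) x * h $ j
       + (- 2 * real (k - 1) * bump z S (k - 2) x * ((x - z) \<bullet> h)) * (x - z) $ j))) (at x)"
proof -
  have eq: "partial_deriv j (bump z S k) = (\<lambda>x. - 2 * real k * (bump z S (k - 1) x * (x - z) $ j))"
    using assms by (auto simp: partial_deriv_bump fun_eq_iff algebra_simps)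
  have k2: "k - 1 - 1 = k - 2" by simp
  have b: "(bump z S (k - 1) has_derivative
      (\<lambda>h. - 2 * real (k - 1) * bump z S (k - 2) x * ((x - z) \<bullet> h))) (at x)"
    using bump_has_derivative[of "k - 1" z S x] assms unfolding k2 by simp
  have c: "((\<lambda>x. (x - z) $ j) has_derivative (\<lambda>h. h $ j)) (at x)"
    by (rule bounded_linear.has_derivative[OF bounded_linear_vec_nth]) (auto intro!: derivative_eq_intros)
  show ?thesis
    unfolding eq by (rule has_derivative_mult_right[OF has_derivative_mult[OF b c]])
qed

lemma partial_deriv2_bump:
  assumes "3 \<le> k"
  shows "partial_deriv i (partial_deriv j (bump z S k)) x =
    4 * real k * real (k - 1) * bump z S (k - 2) x * ((x - z) $ i * (x - z) $ j)
    - 2 * real k * bump z S (k - 1) x * (if i = j then 1 else 0)"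
proof -
  have "(axis i (1::real)) $ j = (if i = j then 1 else 0)" by (simp add: axis_def)
  then show ?thesis
    unfolding partial_deriv_eq[OF partial_deriv_bump_has_derivative[OF assms]]
    by (simp add: inner_axis algebra_simps)
qed

lemma C2_compact_support_bump:
  assumes "3 \<le> k"
  shows "C2_compact_support (bump z S k)"
  unfolding C2_compact_support_def
proof (intro conjI allI)
  show "bump z S k differentiable at x" for x
    using bump_has_derivative[of k z S x] assms by (auto simp: differentiable_def)
  show "partial_deriv i (bump z S k) differentiable at x" for i x
    using partial_deriv_bump_has_derivative[OF assms] unfolding differentiable_def by blast
  show "continuous_on UNIV (partial_deriv i (partial_deriv j (bump z S k)))" for i j
  proof -
    have "partial_deriv i (partial_deriv j (bump z S k)) = (\<lambda>x.
      4 * real k * real (k - 1) * bump z S (k - 2) x * ((x - z) $ i * (x - z) $ j)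
      - 2 * real k * bump z S (k - 1) x * (if i = j then 1 else 0))"
      using partial_deriv2_bump[OF assms] by blast
    then show ?thesis by (auto intro!: continuous_intros continuous_on_bump)
  qed
  have "{x. bump z S k x \<noteq> 0} \<subseteq> cball z (sqrt \<bar>S\<bar>)"
  proof
    fix x assume "x \<in> {x. bump z S k x \<noteq> 0}"
    then have "(norm (x - z))\<^sup>2 < S" using assms by (auto simp: bump_def max_def zero_power split: if_splits)
    then have "norm (x - z) \<le> sqrt \<bar>S\<bar>" by (intro real_le_rsqrt) auto
    then show "x \<in> cball z (sqrt \<bar>S\<bar>)" by (simp add: dist_norm norm_minus_commute)
  qed
  then have "bounded {x. bump z S k x \<noteq> 0}" using bounded_subset bounded_cball by blast
  then show "compact (closure {x. bump z S k x \<noteq> 0})" by (simp add: compact_closure)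
qed

lemma diff_op_bump:
  fixes a :: "real ^ 'n \<Rightarrow> real ^ 'n ^ 'n"
  assumes "3 \<le> k"
  shows "diff_op a b (bump z S k) x =
    2 * real k * real (k - 1) * bump z S (k - 2) x * ((x - z) \<bullet> (a x *v (x - z)))
    - real k * bump z S (k - 1) x * ((\<Sum>i\<in>UNIV. a x $ i $ i) + 2 * (b x \<bullet> (x - z)))"
proof -
  define y where "y = x - z"
  define P where "P = 4 * real k * real (k - 1) * bump z S (k - 2) x"
  define Q where "Q = 2 * real k * bump z S (k - 1) x"
  have quad: "y \<bullet> (a x *v y) = (\<Sum>i\<in>UNIV. \<Sum>j\<in>UNIV. a x $ i $ j * (y $ i * y $ j))"
    by (simp add: inner_vec_def matrix_vector_mult_def sum_distrib_left algebra_simps)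
  have "(\<Sum>i\<in>UNIV. \<Sum>j\<in>UNIV. a x $ i $ j * partial_deriv i (partial_deriv j (bump z S k)) x)
    = (\<Sum>i\<in>UNIV. \<Sum>j\<in>UNIV. P * (a x $ i $ j * (y $ i * y $ j)) - Q * (if i = j then a x $ i $ j else 0))"
    unfolding partial_deriv2_bump[OF assms] P_def Q_def y_def
    by (intro sum.cong refl) (auto simp: algebra_simps)
  also have "\<dots> = P * (y \<bullet> (a x *v y)) - Q * (\<Sum>i\<in>UNIV. a x $ i $ i)"
    by (simp add: sum_subtractf quad sum_distrib_left[symmetric])
  finally have 1: "(\<Sum>i\<in>UNIV. \<Sum>j\<in>UNIV. a x $ i $ j * partial_deriv i (partial_deriv j (bump z S k)) x)
    = P * (y \<bullet> (a x *v y)) - Q * (\<Sum>i\<in>UNIV. a x $ i $ i)" .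
  have 2: "(\<Sum>i\<in>UNIV. b x $ i * partial_deriv i (bump z S k) x) = - Q * (b x \<bullet> y)"
    using assms by (simp add: partial_deriv_bump inner_vec_def sum_distrib_left Q_def y_def sum_negf algebra_simps)
  show ?thesis
    unfolding diff_op_def 1 2 unfolding P_def Q_def y_def by (simp add: algebra_simps)
qed

section \<open>Exit times of continuous trajectories\<close>

definition hit :: "'a set \<Rightarrow> real \<Rightarrow> (real \<Rightarrow> 'a) \<Rightarrow> real" where
  "hit O1 T y = Inf (insert T {t. 0 \<le> t \<and> y t \<notin> O1})"

lemma hit_nonneg: "0 \<le> T \<Longrightarrow> 0 \<le> hit O1 T y"
  unfolding hit_def by (rule cInf_greatest) auto

lemma bdd_below_hit: "bdd_below (insert T {t. 0 \<le> t \<and> y t \<notin> O1})" for T :: real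
  by (rule bdd_belowI[of _ "min T 0"]) auto

lemma hit_le: "hit O1 T y \<le> T"
  unfolding hit_def by (rule cInf_lower) (auto intro: bdd_below_hit)

lemma hit_lower: "0 \<le> t \<Longrightarrow> y t \<notin> O1 \<Longrightarrow> hit O1 T y \<le> t"
  unfolding hit_def by (rule cInf_lower) (auto intro: bdd_below_hit)

lemma less_hit_imp_in: "0 \<le> t \<Longrightarrow> t < hit O1 T y \<Longrightarrow> y t \<in> O1"
  using hit_lower[of t y O1 T] by force

lemma closed_outside:
  fixes y :: "real \<Rightarrow> 'a::topological_space"
  assumes "continuous_on {0..} y" "open O1"
  shows "closed {t. 0 \<le> t \<and> y t \<notin> O1}"
proof -
  have "{t. 0 \<le> t \<and> y t \<notin> O1} = {t \<in> {0..}. y t \<in> - O1}" by auto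
  moreover have "closedin (top_of_set {0..}) {t \<in> {0..}. y t \<in> - O1}"
    using continuous_closedin_preimage[OF assms(1), of "- O1"] assms(2)
    by (simp add: vimage_def Int_def closed_def)
  ultimately show ?thesis by (metis closed_atLeast closedin_closed_trans)
qed

lemma hit_not_in:
  fixes y :: "real \<Rightarrow> 'a::topological_space"
  assumes "continuous_on {0..} y" "open O1" "hit O1 T y < T"
  shows "y (hit O1 T y) \<notin> O1"
proof -
  have "hit O1 T y \<in> insert T {t. 0 \<le> t \<and> y t \<notin> O1}"
    unfolding hit_def
    by (rule closed_contains_Inf) (auto intro: bdd_below_hit closed_insert closed_outside assms)
  with assms(3) show ?thesis by auto
qed

lemma less_hit_iff:
  fixes y :: "real \<Rightarrow> 'a::topological_space"
  assumes y: "continuous_on {0..} y" "open O1" and t: "0 \<le> t"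
  shows "t < hit O1 T y \<longleftrightarrow> t < T \<and> (\<forall>s\<in>{0..t}. y s \<in> O1)"
proof (intro iffI conjI ballI)
  assume *: "t < hit O1 T y"
  show "t < T" using * hit_le[of O1 T y] by linarith
  show "y s \<in> O1" if "s \<in> {0..t}" for s
    using that * by (intro less_hit_imp_in[of s O1 T y]) auto
next
  assume *: "t < T \<and> (\<forall>s\<in>{0..t}. y s \<in> O1)"
  show "t < hit O1 T y"
  proof (rule ccontr)
    assume "\<not> t < hit O1 T y"
    with * t have "hit O1 T y < T" "hit O1 T y \<in> {0..t}"
      using hit_nonneg[of T O1 y] by auto
    with hit_not_in[OF y, of T] * show False by auto
  qed
qed

lemma hit_in_closure:
  fixes y :: "real \<Rightarrow> 'a::topological_space"
  assumes y: "continuous_on {0..} y" and "y 0 \<in> O1" "0 \<le> s" "s \<le> hit O1 T y"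
  shows "y s \<in> closure O1"
proof (cases "s = 0")
  case True
  then show ?thesis using assms closure_subset by auto
next
  case False
  have sub: "y ` {0..<s} \<subseteq> O1"
    using assms by (auto intro: less_hit_imp_in[of _ O1 T])
  have "y ` closure {0..<s} \<subseteq> closure (y ` {0..<s})"
    using False assms by (intro image_closure_subset[OF continuous_on_subset[OF y] closed_closure closure_subset]) auto
  also have "\<dots> \<subseteq> closure O1" by (rule closure_mono[OF sub])
  finally have "y ` closure {0..<s} \<subseteq> closure O1" .
  moreover have "s \<in> closure {0..<s}" using False \<open>0 \<le> s\<close> by simp
  ultimately show ?thesis by blast
qed

lemma hit_mono: "O1 \<subseteq> O2 \<Longrightarrow> T \<le> T' \<Longrightarrow> 0 \<le> T \<Longrightarrow> hit O1 T y \<le> hit O2 T' y"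
  unfolding hit_def[of O2]
  by (rule cInf_greatest) (auto intro: hit_lower order_trans[OF hit_le])

lemma less_hit_before_exit:
  assumes "0 \<le> t" "t < hit O1 T y"
  shows "t \<in> before_exit O1 y"
proof -
  have "ereal (hit O1 T y) \<le> exit_time O1 y"
    unfolding exit_time_def by (rule Inf_greatest) (auto intro: hit_lower)
  moreover have "ereal t < ereal (hit O1 T y)" using assms by simp
  ultimately have "ereal t < exit_time O1 y" by (rule less_le_trans[rotated])
  then show ?thesis using assms by (simp add: before_exit_def)
qed

lemma exit_time_cyl:
  assumes "fst z \<le> t0" "t0 \<le> fst z + T"
  shows "exit_time (cyl z T R) (spacetime X t0 w)
    = ereal (hit (ball (snd z) R) (fst z + T - t0) (\<lambda>t. X t w))"
proof -
  let ?T = "fst z + T - t0"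
  let ?A = "{t. 0 \<le> t \<and> spacetime X t0 w t \<notin> cyl z T R}"
  let ?B = "insert ?T {t. 0 \<le> t \<and> X t w \<notin> ball (snd z) R}"
  have A: "?A = {t. 0 \<le> t \<and> (?T \<le> t \<or> X t w \<notin> ball (snd z) R)}"
    using assms by (auto simp: spacetime_def cyl_def)
  have ne: "?T \<in> ?A" using assms by (auto simp: A)
  have bdd: "bdd_below ?A" by (rule bdd_belowI[of _ 0]) auto
  have "Inf ?A = Inf ?B"
  proof (rule antisym)
    show "Inf ?A \<le> Inf ?B"
      using assms by (intro cInf_greatest cInf_lower bdd) (auto simp: A)
    show "Inf ?B \<le> Inf ?A"
    proof (rule cInf_greatest)
      show "?A \<noteq> {}" using ne by blast
      fix t assume "t \<in> ?A"
      then consider "?T \<le> t" | "0 \<le> t" "X t w \<notin> ball (snd z) R" by (auto simp: A)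
      then show "Inf ?B \<le> t"
      proof cases
        case 1
        have "Inf ?B \<le> ?T" by (rule cInf_lower) (auto intro: bdd_below_hit)
        with 1 show ?thesis by simp
      next
        case 2
        then show ?thesis by (intro cInf_lower bdd_below_hit) auto
      qed
    qed
  qed
  moreover have "Inf (ereal ` ?A) = ereal (Inf ?A)"
    by (rule ereal_Inf'[OF bdd, symmetric]) (use ne in blast)
  ultimately show ?thesis unfolding exit_time_def hit_def by simp
qed

lemma before_exit_cyl:
  assumes "fst z \<le> t0" "t0 \<le> fst z + T"
  shows "before_exit (cyl z T R) (spacetime X t0 w)
    = {t. 0 \<le> t \<and> t < hit (ball (snd z) R) (fst z + T - t0) (\<lambda>t. X t w)}"
  unfolding before_exit_def exit_time_cyl[OF assms] by simp

lemma exit_point_cyl: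
  assumes "fst z \<le> t0" "t0 \<le> fst z + T"
  shows "exit_point (cyl z T R) (spacetime X t0 w)
    = (let \<sigma> = hit (ball (snd z) R) (fst z + T - t0) (\<lambda>t. X t w) in (t0 + \<sigma>, X \<sigma> w))"
  unfolding exit_point_def exit_time_cyl[OF assms] by (simp add: Let_def spacetime_def)

definition grid :: "real \<Rightarrow> nat \<Rightarrow> real \<Rightarrow> real" where
  "grid T n s = real_of_int \<lceil>real n * s / T\<rceil> * T / real n"

lemma grid_ge: "0 < T \<Longrightarrow> 0 < n \<Longrightarrow> s \<le> grid T n s"
proof -
  assume *: "0 < T" "0 < n"
  have "real n * s / T * (T / real n) \<le> real_of_int \<lceil>real n * s / T\<rceil> * (T / real n)"
    by (rule mult_right_mono) (use * in auto)
  then show ?thesis using * by (simp add: grid_def)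
qed

lemma grid_less: "0 < T \<Longrightarrow> 0 < n \<Longrightarrow> grid T n s < s + T / real n"
proof -
  assume *: "0 < T" "0 < n"
  have "real_of_int \<lceil>real n * s / T\<rceil> * (T / real n) < (real n * s / T + 1) * (T / real n)"
    by (rule mult_strict_right_mono) (use * ceiling_correct[of "real n * s / T"] in auto)
  also have "\<dots> = s + T / real n" using * by (simp add: field_simps)
  finally show ?thesis by (simp add: grid_def)
qed

lemma grid_le: "0 < T \<Longrightarrow> 0 < n \<Longrightarrow> s \<le> T \<Longrightarrow> grid T n s \<le> T"
proof -
  assume *: "0 < T" "0 < n" "s \<le> T"
  then have "\<lceil>real n * s / T\<rceil> \<le> int n" by (simp add: ceiling_le_iff field_simps)
  then have "real_of_int \<lceil>real n * s / T\<rceil> \<le> real n" by linarith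
  with * show ?thesis by (simp add: grid_def field_simps)
qed

lemma tendsto_grid: "0 < T \<Longrightarrow> (\<lambda>n. grid T n s) \<longlonglongrightarrow> s"
proof (rule tendsto_sandwich[where f = "\<lambda>n. s" and h = "\<lambda>n. s + T / real n"])
  assume T: "0 < T"
  show "\<forall>\<^sub>F n in sequentially. s \<le> grid T n s"
    using eventually_gt_at_top[of 0] by eventually_elim (rule grid_ge[OF T])
  show "\<forall>\<^sub>F n in sequentially. grid T n s \<le> s + T / real n"
    using eventually_gt_at_top[of 0] by eventually_elim (rule less_imp_le[OF grid_less[OF T]])
  have "(\<lambda>n. s + T / real n) \<longlonglongrightarrow> s + 0" by (intro tendsto_intros lim_const_over_n)
  then show "(\<lambda>n. s + T / real n) \<longlonglongrightarrow> s" by simp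
qed simp

lemma grid_cases:
  assumes "0 < T" "0 < n" "0 \<le> s" "s \<le> T"
  obtains k where "k \<le> n" "grid T n s = real k * T / real n"
proof -
  define k where "k = nat \<lceil>real n * s / T\<rceil>"
  have "0 \<le> real n * s / T" using assms by simp
  then have "0 \<le> \<lceil>real n * s / T\<rceil>" by linarith
  then have 1: "real_of_int \<lceil>real n * s / T\<rceil> = real k" by (simp add: k_def)
  have "\<lceil>real n * s / T\<rceil> \<le> int n" using assms by (simp add: ceiling_le_iff field_simps)
  then have "k \<le> n" unfolding k_def by linarith
  then show ?thesis using that 1 by (simp add: grid_def)
qed

lemma grid_eq_iff:
  assumes "0 < T" "0 < n"
  shows "grid T n s = real k * T / real n \<longleftrightarrow> (real k - 1) * T / real n < s \<and> s \<le> real k * T / real n"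
proof -
  have "grid T n s = real k * T / real n \<longleftrightarrow> \<lceil>real n * s / T\<rceil> = int k"
    using assms by (simp add: grid_def) linarith
  also have "\<dots> \<longleftrightarrow> real k - 1 < real n * s / T \<and> real n * s / T \<le> real k"
    by (simp add: ceiling_eq_iff)
  also have "\<dots> \<longleftrightarrow> (real k - 1) * T / real n < s \<and> s \<le> real k * T / real n"
    using assms by (simp add: field_simps)
  finally show ?thesis .
qed

section \<open>The Markov property on path space\<close>

context continuous_markov_process
begin

definition Om :: "'w set" where "Om = space (P 0)"

lemma space_P [simp]: "space (P x) = Om"
  unfolding Om_def by (rule sets_eq_imp_space_eq[OF sets_P])

lemma space_F: "0 \<le> t \<Longrightarrow> space (F t) = Om"
  using subalgebra_F[of t 0] by (simp add: subalgebra_def)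

lemma sets_F: "0 \<le> t \<Longrightarrow> B \<in> sets (F t) \<Longrightarrow> B \<in> sets (P x)"
  using subalgebra_F[of t x] by (auto simp: subalgebra_def)

lemma sets_F_mono: "0 \<le> s \<Longrightarrow> s \<le> t \<Longrightarrow> B \<in> sets (F s) \<Longrightarrow> B \<in> sets (F t)"
  using mono_F by blast

lemma X_meas_F: "0 \<le> s \<Longrightarrow> s \<le> t \<Longrightarrow> X s \<in> F t \<rightarrow>\<^sub>M borel"
  using adapted[of s] mono_F[of s t] space_F[of s] space_F[of t]
  by (auto simp: measurable_def)

lemma Om_in_F: "0 \<le> t \<Longrightarrow> Om \<in> sets (F t)"
  using sets.top[of "F t"] by (simp add: space_F)

lemma X_in_F: "0 \<le> s \<Longrightarrow> s \<le> t \<Longrightarrow> \<Gamma> \<in> sets borel \<Longrightarrow> {w \<in> Om. X s w \<in> \<Gamma>} \<in> sets (F t)"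
  using measurable_sets[OF X_meas_F[of s t], of \<Gamma>] by (simp add: space_F vimage_def Int_def conj_commute)

sublocale P: prob_space "P x" for x
  by (rule prob_P)

lemma Om_nonempty: "Om \<noteq> {}"
  using P.not_empty[of 0] by simp

definition GX :: "'w measure" where
  "GX = sigma Om {{w \<in> Om. X t w \<in> \<Gamma>} | t \<Gamma>. 0 \<le> t \<and> \<Gamma> \<in> sets borel}"

lemma space_GX [simp]: "space GX = Om"
  by (auto simp: GX_def intro!: space_measure_of)

lemma sets_GX: "sets GX = sigma_sets Om {{w \<in> Om. X t w \<in> \<Gamma>} | t \<Gamma>. 0 \<le> t \<and> \<Gamma> \<in> sets borel}"
  by (auto simp: GX_def intro!: sets_measure_of)

lemma X_meas [measurable]: "0 \<le> t \<Longrightarrow> X t \<in> GX \<rightarrow>\<^sub>M borel"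
proof (rule measurableI)
  fix \<Gamma> :: "(real ^ 'n) set" assume "0 \<le> t" "\<Gamma> \<in> sets borel"
  then have "{w \<in> Om. X t w \<in> \<Gamma>} \<in> sets GX" unfolding sets_GX by (intro sigma_sets.Basic) blast
  then show "X t -` \<Gamma> \<inter> space GX \<in> sets GX" by (simp add: vimage_def Int_def conj_commute)
qed simp

lemma sets_GX_sub: "sets GX \<subseteq> sets (P x)"
proof -
  have "{{w \<in> Om. X t w \<in> \<Gamma>} | t \<Gamma>. 0 \<le> t \<and> \<Gamma> \<in> sets borel} \<subseteq> sets (P x)"
    using X_in_F sets_F by blast
  then have "sigma_sets Om {{w \<in> Om. X t w \<in> \<Gamma>} | t \<Gamma>. 0 \<le> t \<and> \<Gamma> \<in> sets borel} \<subseteq> sets (P x)"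
    using sets.sigma_sets_subset[of _ "P x"] by simp
  then show ?thesis by (simp add: sets_GX)
qed

lemma subalg_GX: "subalgebra (P x) GX"
  unfolding subalgebra_def using sets_GX_sub by simp

lemma meas_GX_P: "f \<in> GX \<rightarrow>\<^sub>M N \<Longrightarrow> f \<in> P x \<rightarrow>\<^sub>M N"
  using measurable_from_subalg[OF subalg_GX] .

lemma X_meas_P [measurable]: "0 \<le> t \<Longrightarrow> X t \<in> P x \<rightarrow>\<^sub>M borel"
  by (intro meas_GX_P X_meas)

lemma X_joint: "(\<lambda>(t, w). X (max 0 t) w) \<in> borel \<Otimes>\<^sub>M GX \<rightarrow>\<^sub>M borel"
proof (rule borel_measurable_LIMSEQ_metric)
  fix n :: nat
  have "(\<lambda>p. X (real k / real (Suc n)) (snd p)) \<in> borel \<Otimes>\<^sub>M GX \<rightarrow>\<^sub>M borel" for k :: nat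
    by (rule measurable_compose[OF measurable_snd X_meas]) simp
  moreover have "(\<lambda>p :: real \<times> 'w. nat \<lceil>real (Suc n) * fst p\<rceil>) \<in> borel \<Otimes>\<^sub>M GX \<rightarrow>\<^sub>M count_space UNIV"
    by measurable
  ultimately have "(\<lambda>p. X (real (nat \<lceil>real (Suc n) * fst p\<rceil>) / real (Suc n)) (snd p)) \<in> borel \<Otimes>\<^sub>M GX \<rightarrow>\<^sub>M borel"
    by (rule measurable_compose_countable)
  then show "(\<lambda>(t :: real, w). X (real (nat \<lceil>real (Suc n) * t\<rceil>) / real (Suc n)) w) \<in> borel \<Otimes>\<^sub>M GX \<rightarrow>\<^sub>M borel"
    by (simp add: case_prod_unfold)
next
  fix p :: "real \<times> 'w" assume "p \<in> space (borel \<Otimes>\<^sub>M GX)"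
  then obtain t :: real and w where p: "p = (t, w)" "w \<in> Om" by (auto simp: space_pair_measure)
  have "(\<lambda>n. real (nat \<lceil>real (Suc n) * t\<rceil>) / real (Suc n)) \<longlonglongrightarrow> max 0 t"
  proof (rule tendsto_sandwich)
    show "\<forall>\<^sub>F n in sequentially. max 0 t \<le> real (nat \<lceil>real (Suc n) * t\<rceil>) / real (Suc n)"
    proof (intro always_eventually allI)
      fix n
      have "real (Suc n) * t \<le> real (nat \<lceil>real (Suc n) * t\<rceil>)" by linarith
      then show "max 0 t \<le> real (nat \<lceil>real (Suc n) * t\<rceil>) / real (Suc n)"
        by (simp add: field_simps)
    qed
    show "\<forall>\<^sub>F n in sequentially. real (nat \<lceil>real (Suc n) * t\<rceil>) / real (Suc n) \<le> max 0 t + 1 / real (Suc n)"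
    proof (intro always_eventually allI)
      fix n
      have "real (Suc n) * t \<le> real (Suc n) * max 0 t" by (intro mult_left_mono) auto
      moreover have "0 \<le> real (Suc n) * max 0 t" by simp
      ultimately have "real (nat \<lceil>real (Suc n) * t\<rceil>) \<le> real (Suc n) * max 0 t + 1" by linarith
      then have "real (nat \<lceil>real (Suc n) * t\<rceil>) / real (Suc n) \<le> (real (Suc n) * max 0 t + 1) / real (Suc n)"
        by (rule divide_right_mono) simp
      also have "\<dots> = max 0 t + 1 / real (Suc n)" by (simp add: add_divide_distrib)
      finally show "real (nat \<lceil>real (Suc n) * t\<rceil>) / real (Suc n) \<le> max 0 t + 1 / real (Suc n)" .
    qed
    have "(\<lambda>n. max 0 t + 1 / real (Suc n)) \<longlonglongrightarrow> max 0 t + 0"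
      by (intro tendsto_intros LIMSEQ_Suc[OF lim_const_over_n[of 1]])
    then show "(\<lambda>n. max 0 t + 1 / real (Suc n)) \<longlonglongrightarrow> max 0 t" by simp
  qed simp
  from continuous_on_tendsto_compose[OF continuous_paths[of w 0] this] p have "(\<lambda>n. X (real (nat \<lceil>real (Suc n) * t\<rceil>) / real (Suc n)) w) \<longlonglongrightarrow> X (max 0 t) w"
    by simp
  then show "(\<lambda>n. (\<lambda>(t, w). X (real (nat \<lceil>real (Suc n) * t\<rceil>) / real (Suc n)) w) p) \<longlonglongrightarrow> (\<lambda>(t, w). X (max 0 t) w) p"
    by (simp add: p)
qed

lemma X_random_time:
  assumes "\<sigma> \<in> borel_measurable GX" "\<And>w. w \<in> Om \<Longrightarrow> 0 \<le> \<sigma> w"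
  shows "(\<lambda>w. X (\<sigma> w) w) \<in> GX \<rightarrow>\<^sub>M borel"
proof -
  have "(\<lambda>w. (\<sigma> w, w)) \<in> GX \<rightarrow>\<^sub>M borel \<Otimes>\<^sub>M GX" using assms(1) by measurable
  from measurable_compose[OF this X_joint]
  have "(\<lambda>w. X (max 0 (\<sigma> w)) w) \<in> GX \<rightarrow>\<^sub>M borel" by simp
  then show ?thesis
    by (rule measurable_cong[THEN iffD1, rotated]) (simp add: assms(2) max_absorb2)
qed

lemma paths: "w \<in> Om \<Longrightarrow> continuous_on {0..} (\<lambda>t. X t w)"
  using continuous_paths[of w 0] by simp

definition trans_kernel :: "real \<Rightarrow> real ^ 'n \<Rightarrow> (real ^ 'n) measure" where
  "trans_kernel h x = distr (P x) borel (X h)"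

lemma emeasure_trans_kernel:
  "0 \<le> h \<Longrightarrow> \<Gamma> \<in> sets borel \<Longrightarrow> emeasure (trans_kernel h x) \<Gamma> = emeasure (P x) {w \<in> Om. X h w \<in> \<Gamma>}"
  unfolding trans_kernel_def
  by (subst emeasure_distr) (auto simp: vimage_def Int_def conj_commute)

lemma trans_kernel_meas: "0 \<le> h \<Longrightarrow> trans_kernel h \<in> borel \<rightarrow>\<^sub>M subprob_algebra borel"
proof (rule measurable_subprob_algebra)
  fix x assume h: "0 \<le> h"
  show "subprob_space (trans_kernel h x)"
    unfolding trans_kernel_def using h by (intro prob_space_imp_subprob_space P.prob_space_distr) auto
next
  fix \<Gamma> :: "(real ^ 'n) set" assume "0 \<le> h" "\<Gamma> \<in> sets borel"
  then show "(\<lambda>x. emeasure (trans_kernel h x) \<Gamma>) \<in> borel_measurable borel"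
    using transition_measurable[of h \<Gamma>] by (simp add: emeasure_trans_kernel P.emeasure_eq_measure)
qed (simp add: trans_kernel_def)

lemma markov_sets:
  assumes "0 \<le> t" "0 \<le> h" "\<Gamma> \<in> sets borel" "B \<in> sets (F t)"
  shows "emeasure (P x) (B \<inter> {w \<in> Om. X (t + h) w \<in> \<Gamma>})
    = (\<integral>\<^sup>+w. emeasure (trans_kernel h (X t w)) \<Gamma> * indicator B w \<partial>P x)"
proof -
  interpret S: finite_measure_subalgebra "P x" "F t"
    by unfold_locales (use subalgebra_F assms in auto)
  let ?A = "{w \<in> Om. X (t + h) w \<in> \<Gamma>}"
  have BP: "B \<in> sets (P x)" and B_Om: "B \<subseteq> Om"
    using sets_F[OF assms(1,4)] sets.sets_into_space[OF assms(4)] space_F[OF assms(1)] by auto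
  have AP: "?A \<in> sets (P x)"
    by (rule sets_F[of "t + h"], simp add: assms, rule X_in_F) (use assms in auto)
  let ?k = "\<lambda>y. measure (P y) {w' \<in> Om. X h w' \<in> \<Gamma>}"
  have k_meas: "?k \<in> borel_measurable borel"
    using transition_measurable[of h \<Gamma>] assms by simp
  have kX: "(\<lambda>w. ?k (X t w)) \<in> borel_measurable (P x)"
    using measurable_compose[OF X_meas_P k_meas, of t] assms by simp
  have "measure (P x) (B \<inter> ?A) = (LINT w:B|P x. indicator ?A w)"
  proof -
    have "(LINT w:B|P x. indicator ?A w) = (LINT w|P x. indicator (B \<inter> ?A) w)"
      unfolding set_lebesgue_integral_def by (intro Bochner_Integration.integral_cong) (auto simp: indicator_def)
    also have "\<dots> = measure (P x) (B \<inter> ?A)"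
      using BP AP by (subst Bochner_Integration.integral_indicator) (auto intro!: arg_cong[where f = "measure (P x)"])
    finally show ?thesis by (rule sym)
  qed
  also have "\<dots> = (LINT w:B|P x. real_cond_exp (P x) (F t) (indicator ?A) w)"
    by (rule S.real_cond_exp_intA) (use AP assms(4) in \<open>auto intro!: P.integrable_const_bound[where B = 1]\<close>)
  also have "\<dots> = (LINT w:B|P x. ?k (X t w))"
  proof (rule set_lebesgue_integral_cong_AE)
    show "AE w\<in>B in P x. real_cond_exp (P x) (F t) (indicator ?A) w = ?k (X t w)"
      using markov[OF assms(1-3), of x] by (simp, elim eventually_mono) auto
  qed (use BP kX in auto)
  finally have eq: "measure (P x) (B \<inter> ?A) = (LINT w:B|P x. ?k (X t w))" .
  have "emeasure (P x) (B \<inter> ?A) = ennreal (LINT w|P x. indicator B w * ?k (X t w))"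
    using eq by (simp add: P.emeasure_eq_measure set_lebesgue_integral_def)
  also have "\<dots> = (\<integral>\<^sup>+w. ennreal (indicator B w * ?k (X t w)) \<partial>P x)"
    by (rule nn_integral_eq_integral[symmetric])
      (use BP kX in \<open>auto intro!: P.integrable_const_bound[where B = 1] simp: indicator_def\<close>)
  also have "\<dots> = (\<integral>\<^sup>+w. emeasure (trans_kernel h (X t w)) \<Gamma> * indicator B w \<partial>P x)"
    using assms by (intro nn_integral_cong) (auto simp: emeasure_trans_kernel P.emeasure_eq_measure indicator_def)
  finally show ?thesis .
qed

lemma markov_fun:
  assumes "0 \<le> t" "0 \<le> h" "f \<in> borel_measurable borel" "B \<in> sets (F t)"
  shows "(\<integral>\<^sup>+w. f (X (t + h) w) * indicator B w \<partial>P x)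
    = (\<integral>\<^sup>+w. (\<integral>\<^sup>+y. f y \<partial>trans_kernel h (X t w)) * indicator B w \<partial>P x)"
proof -
  have BP: "B \<in> sets (P x)" using sets_F[OF assms(1,4)] .
  let ?D = "density (P x) (indicator B)"
  have K: "(\<lambda>w. trans_kernel h (X t w)) \<in> ?D \<rightarrow>\<^sub>M subprob_algebra borel"
    using measurable_compose[OF X_meas_P trans_kernel_meas, of t h] assms by simp
  have ne: "space ?D \<noteq> {}" using Om_nonempty by simp
  have "distr ?D borel (X (t + h)) = ?D \<bind> (\<lambda>w. trans_kernel h (X t w))"
  proof (rule measure_eqI)
    show "sets (distr ?D borel (X (t + h))) = sets (?D \<bind> (\<lambda>w. trans_kernel h (X t w)))"
      using sets_bind_measurable[OF K ne] by simp
    fix \<Gamma> assume "\<Gamma> \<in> sets (distr ?D borel (X (t + h)))"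
    then have \<Gamma>: "\<Gamma> \<in> sets borel" by simp
    have Xm: "X (t + h) \<in> P x \<rightarrow>\<^sub>M borel" using assms by simp
    have "emeasure (distr ?D borel (X (t + h))) \<Gamma> = emeasure ?D {w \<in> Om. X (t + h) w \<in> \<Gamma>}"
      using Xm \<Gamma> by (subst emeasure_distr) (auto simp: vimage_def Int_def conj_commute)
    also have "\<dots> = emeasure (P x) (B \<inter> {w \<in> Om. X (t + h) w \<in> \<Gamma>})"
      using BP measurable_sets[OF Xm \<Gamma>]
      by (intro emeasure_restricted) (auto simp: vimage_def Int_def conj_commute)
    also have "\<dots> = (\<integral>\<^sup>+w. emeasure (trans_kernel h (X t w)) \<Gamma> * indicator B w \<partial>P x)"
      by (rule markov_sets) (use assms \<Gamma> in auto)
    also have "\<dots> = (\<integral>\<^sup>+w. emeasure (trans_kernel h (X t w)) \<Gamma> \<partial>?D)"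
      using BP measurable_emeasure_kernel[OF K \<Gamma>]
      by (subst nn_integral_density) (auto simp: mult.commute)
    also have "\<dots> = emeasure (?D \<bind> (\<lambda>w. trans_kernel h (X t w))) \<Gamma>"
      by (rule emeasure_bind[OF ne K \<Gamma>, symmetric])
    finally show "emeasure (distr ?D borel (X (t + h))) \<Gamma> = emeasure (?D \<bind> (\<lambda>w. trans_kernel h (X t w))) \<Gamma>" .
  qed
  then have "(\<integral>\<^sup>+y. f y \<partial>distr ?D borel (X (t + h))) = (\<integral>\<^sup>+y. f y \<partial>(?D \<bind> (\<lambda>w. trans_kernel h (X t w))))" by simp
  also have "\<dots> = (\<integral>\<^sup>+w. (\<integral>\<^sup>+y. f y \<partial>trans_kernel h (X t w)) \<partial>?D)"
    by (rule nn_integral_bind[OF assms(3) K])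
  also have "\<dots> = (\<integral>\<^sup>+w. (\<integral>\<^sup>+y. f y \<partial>trans_kernel h (X t w)) * indicator B w \<partial>P x)"
    using BP measurable_compose[OF K nn_integral_measurable_subprob_algebra[OF assms(3)]]
    by (subst nn_integral_density) (auto simp: mult.commute)
  also have "(\<integral>\<^sup>+y. f y \<partial>distr ?D borel (X (t + h))) = (\<integral>\<^sup>+w. f (X (t + h) w) * indicator B w \<partial>P x)"
    using assms BP measurable_compose[OF X_meas_P assms(3), of "t + h"]
    by (subst nn_integral_distr) (auto simp: nn_integral_density mult.commute)
  finally show ?thesis .
qed

fun cyl_prob :: "(real \<Rightarrow> (real ^ 'n) set) \<Rightarrow> real \<Rightarrow> real list \<Rightarrow> real ^ 'n \<Rightarrow> ennreal" where
  "cyl_prob \<Gamma> s [] y = 1"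
| "cyl_prob \<Gamma> s (t # ts) y = (\<integral>\<^sup>+z. indicator (\<Gamma> t) z * cyl_prob \<Gamma> t ts z \<partial>trans_kernel (t - s) y)"

lemma cyl_prob_meas:
  assumes "\<And>t. \<Gamma> t \<in> sets borel" "sorted (s # ts)"
  shows "cyl_prob \<Gamma> s ts \<in> borel_measurable borel"
  using assms(2)
proof (induction ts arbitrary: s)
  case (Cons t ts)
  have "cyl_prob \<Gamma> t ts \<in> borel_measurable borel"
    by (rule Cons.IH) (use Cons.prems in simp)
  then have 1: "(\<lambda>z. indicator (\<Gamma> t) z * cyl_prob \<Gamma> t ts z) \<in> borel_measurable borel"
    by (intro borel_measurable_times_ennreal borel_measurable_indicator assms(1))
  have 2: "trans_kernel (t - s) \<in> borel \<rightarrow>\<^sub>M subprob_algebra borel"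
    using Cons.prems by (intro trans_kernel_meas) simp
  have "cyl_prob \<Gamma> s (t # ts) = (\<lambda>y. \<integral>\<^sup>+z. indicator (\<Gamma> t) z * cyl_prob \<Gamma> t ts z \<partial>trans_kernel (t - s) y)"
    by (rule ext) (rule cyl_prob.simps)
  with measurable_compose[OF 2 nn_integral_measurable_subprob_algebra[OF 1]] show ?case by (simp only:)
next
  case Nil
  have "cyl_prob \<Gamma> s [] = (\<lambda>y. 1)" by (rule ext) (rule cyl_prob.simps)
  then show ?case by simp
qed

lemma markov_cyl:
  assumes \<Gamma>: "\<And>t. \<Gamma> t \<in> sets borel" and "0 \<le> s0" "0 \<le> s" "sorted (s # ts)" "B \<in> sets (F (s0 + s))"
  shows "emeasure (P x) (B \<inter> {w \<in> Om. \<forall>t\<in>set ts. X (s0 + t) w \<in> \<Gamma> t})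
    = (\<integral>\<^sup>+w. cyl_prob \<Gamma> s ts (X (s0 + s) w) * indicator B w \<partial>P x)"
  using assms(3-)
proof (induction ts arbitrary: s B)
  case Nil
  have "B \<subseteq> Om" "B \<in> sets (P x)"
    using Nil assms(2) sets.sets_into_space[of B "F (s0 + s)"] space_F[of "s0 + s"] sets_F[of "s0 + s" B x] by auto
  then show ?case by (simp add: Int_absorb2)
next
  case (Cons t ts)
  let ?A = "{w \<in> Om. X (s0 + t) w \<in> \<Gamma> t}"
  have ts: "0 \<le> t" "s \<le> t" "sorted (t # ts)" using Cons.prems by auto
  have B': "B \<inter> ?A \<in> sets (F (s0 + t))"
    using Cons.prems ts assms(2) by (intro sets.Int X_in_F \<Gamma>) (auto intro: sets_F_mono[of "s0 + s"])
  have Q: "cyl_prob \<Gamma> t ts \<in> borel_measurable borel" by (rule cyl_prob_meas[OF \<Gamma> ts(3)])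
  have "B \<inter> {w \<in> Om. \<forall>u\<in>set (t # ts). X (s0 + u) w \<in> \<Gamma> u}
    = (B \<inter> ?A) \<inter> {w \<in> Om. \<forall>u\<in>set ts. X (s0 + u) w \<in> \<Gamma> u}" by auto
  then have "emeasure (P x) (B \<inter> {w \<in> Om. \<forall>u\<in>set (t # ts). X (s0 + u) w \<in> \<Gamma> u})
    = (\<integral>\<^sup>+w. cyl_prob \<Gamma> t ts (X (s0 + t) w) * indicator (B \<inter> ?A) w \<partial>P x)"
    using Cons.IH[OF ts(1,3) B'] by simp
  also have "\<dots> = (\<integral>\<^sup>+w. (\<lambda>z. indicator (\<Gamma> t) z * cyl_prob \<Gamma> t ts z) (X ((s0 + s) + (t - s)) w) * indicator B w \<partial>P x)"
    by (intro nn_integral_cong) (auto simp: indicator_def)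
  also have "\<dots> = (\<integral>\<^sup>+w. cyl_prob \<Gamma> s (t # ts) (X (s0 + s) w) * indicator B w \<partial>P x)"
    unfolding cyl_prob.simps
    by (rule markov_fun) (use Cons.prems ts assms(2) Q \<Gamma> in auto)
  finally show ?case .
qed

definition PX :: "real ^ 'n \<Rightarrow> 'w measure" where
  "PX x = restr_to_subalg (P x) GX"

lemma sets_PX [simp, measurable_cong]: "sets (PX x) = sets GX"
  unfolding PX_def by (rule sets_restr_to_subalg[OF subalg_GX])

lemma space_PX [simp]: "space (PX x) = Om"
  using sets_eq_imp_space_eq[OF sets_PX] by simp

lemma emeasure_PX: "A \<in> sets GX \<Longrightarrow> emeasure (PX x) A = emeasure (P x) A"
  unfolding PX_def by (rule emeasure_restr_to_subalg[OF subalg_GX])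

lemma nn_integral_PX: "g \<in> borel_measurable GX \<Longrightarrow> (\<integral>\<^sup>+w. g w \<partial>PX x) = (\<integral>\<^sup>+w. g w \<partial>P x)"
  unfolding PX_def by (rule nn_integral_subalgebra2[OF subalg_GX])

lemma prob_space_PX: "prob_space (PX x)"
  unfolding PX_def by (rule prob_space_restr_to_subalg[OF subalg_GX prob_P])

definition cyls :: "'w set set" where
  "cyls = {{w \<in> Om. \<forall>t\<in>J. X t w \<in> \<Gamma> t} | J \<Gamma>. finite J \<and> J \<subseteq> {0..} \<and> (\<forall>t. \<Gamma> t \<in> sets borel)}"

lemma cyls_sub: "cyls \<subseteq> Pow Om" by (auto simp: cyls_def)

lemma Om_in_cyls: "Om \<in> cyls"
proof -
  have "Om = {w \<in> Om. \<forall>t\<in>{}. X t w \<in> (\<lambda>_. UNIV) t}" by auto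
  then show ?thesis unfolding cyls_def by (intro CollectI exI[of _ "{}"] exI[of _ "\<lambda>_. UNIV"]) auto
qed

lemma Int_stable_cyls: "Int_stable cyls"
proof (rule Int_stableI)
  fix A B assume "A \<in> cyls" "B \<in> cyls"
  then obtain J \<Gamma> J' \<Gamma>' where A: "A = {w \<in> Om. \<forall>t\<in>J. X t w \<in> \<Gamma> t}" "finite J" "J \<subseteq> {0..}" "\<forall>t. \<Gamma> t \<in> sets borel"
    and B: "B = {w \<in> Om. \<forall>t\<in>J'. X t w \<in> \<Gamma>' t}" "finite J'" "J' \<subseteq> {0..}" "\<forall>t. \<Gamma>' t \<in> sets borel"
    unfolding cyls_def by blast
  let ?\<Gamma> = "\<lambda>t. (if t \<in> J then \<Gamma> t else UNIV) \<inter> (if t \<in> J' then \<Gamma>' t else UNIV)"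
  have "A \<inter> B = {w \<in> Om. \<forall>t\<in>J \<union> J'. X t w \<in> ?\<Gamma> t}" using A B by auto
  moreover have "finite (J \<union> J')" "J \<union> J' \<subseteq> {0..}" "\<forall>t. ?\<Gamma> t \<in> sets borel" using A B by auto
  ultimately show "A \<inter> B \<in> cyls"
    unfolding cyls_def by (intro CollectI exI[of _ "J \<union> J'"] exI[of _ ?\<Gamma>] conjI)
qed

lemma sets_GX_cyls: "sets GX = sigma_sets Om cyls"
proof
  show "sets GX \<subseteq> sigma_sets Om cyls"
    unfolding sets_GX
  proof (rule sigma_sets_mono', rule subsetI)
    fix A assume "A \<in> {{w \<in> Om. X t w \<in> \<Gamma>} | t \<Gamma>. 0 \<le> t \<and> \<Gamma> \<in> sets borel}"
    then obtain t \<Gamma> where "A = {w \<in> Om. \<forall>u\<in>{t}. X u w \<in> (\<lambda>_. \<Gamma>) u}" "0 \<le> t" "\<Gamma> \<in> sets borel" by auto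
    then show "A \<in> cyls" unfolding cyls_def by (intro CollectI exI[of _ "{t}"] exI[of _ "\<lambda>_. \<Gamma>"]) auto
  qed
  have "cyls \<subseteq> sets GX"
  proof
    fix A assume "A \<in> cyls"
    then obtain J \<Gamma> where A: "A = {w \<in> Om. \<forall>t\<in>J. X t w \<in> \<Gamma> t}" "finite J" "J \<subseteq> {0..}" "\<forall>t. \<Gamma> t \<in> sets borel"
      unfolding cyls_def by blast
    have "{w \<in> space GX. \<forall>t\<in>J. X t w \<in> \<Gamma> t} \<in> sets GX"
      using A by (intro sets.sets_Collect_finite_All measurable_sets_Collect[OF X_meas]) auto
    then show "A \<in> sets GX" using A by simp
  qed
  then show "sigma_sets Om cyls \<subseteq> sets GX" using sets.sigma_sets_subset[of cyls GX] by simp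
qed

lemma AE_start: "AE w in P x. X 0 w = x"
proof -
  have "measure (P x) {w \<in> Om. X 0 w = x} = 1" using start[of x] unfolding space_P .
  then have "AE w in P x. w \<in> {w \<in> Om. X 0 w = x}" by (rule P.AE_prob_1)
  then show ?thesis by (rule AE_mp) (rule AE_I2, simp)
qed

lemma PX_meas: "PX \<in> borel \<rightarrow>\<^sub>M subprob_algebra GX"
proof (rule measurable_prob_algebraD, rule measurable_prob_algebra_generated[OF sets_GX_cyls Int_stable_cyls cyls_sub])
  fix A assume "A \<in> cyls"
  then obtain J \<Gamma> where A: "A = {w \<in> Om. \<forall>t\<in>J. X t w \<in> \<Gamma> t}" "finite J" "J \<subseteq> {0..}" "\<forall>t. \<Gamma> t \<in> sets borel"
    unfolding cyls_def by blast
  have AG: "A \<in> sets GX" using \<open>A \<in> cyls\<close> sets_GX_cyls by blast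
  let ?ts = "sorted_list_of_set J"
  have s: "sorted (0 # ?ts)" using A by auto
  have "emeasure (PX x) A = cyl_prob \<Gamma> 0 ?ts x" for x
  proof -
    have "emeasure (PX x) A = emeasure (P x) (Om \<inter> {w \<in> Om. \<forall>t\<in>set ?ts. X (0 + t) w \<in> \<Gamma> t})"
      using A AG by (auto simp: emeasure_PX intro!: arg_cong[where f = "emeasure (P x)"])
    also have "\<dots> = (\<integral>\<^sup>+w. cyl_prob \<Gamma> 0 ?ts (X (0 + 0) w) * indicator Om w \<partial>P x)"
      by (rule markov_cyl) (use A s in \<open>auto intro: Om_in_F\<close>)
    also have "\<dots> = (\<integral>\<^sup>+w. cyl_prob \<Gamma> 0 ?ts x \<partial>P x)"
      using AE_start[of x] AE_space[of "P x"] by (intro nn_integral_cong_AE, eventually_elim) simp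
    also have "\<dots> = cyl_prob \<Gamma> 0 ?ts x" by (simp add: P.emeasure_space_1[simplified])
    finally show ?thesis .
  qed
  then show "(\<lambda>x. emeasure (PX x) A) \<in> borel_measurable borel"
    using cyl_prob_meas[OF _ s, of \<Gamma>] A by simp
qed (simp_all add: prob_space_PX)

definition theta :: "real \<Rightarrow> 'w \<Rightarrow> 'w" where
  "theta t w = (SOME w'. w' \<in> Om \<and> (\<forall>s\<ge>0. X s w' = X (s + t) w))"

lemma theta:
  assumes "0 \<le> t" "w \<in> Om"
  shows "theta t w \<in> Om" "\<And>s. 0 \<le> s \<Longrightarrow> X s (theta t w) = X (s + t) w"
proof -
  have "\<exists>w'. w' \<in> Om \<and> (\<forall>s\<ge>0. X s w' = X (s + t) w)"
    using shift[of t w 0] assms by auto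
  from someI_ex[OF this] show "theta t w \<in> Om" "\<And>s. 0 \<le> s \<Longrightarrow> X s (theta t w) = X (s + t) w"
    by (auto simp: theta_def)
qed

lemma theta_meas: "0 \<le> t \<Longrightarrow> theta t \<in> GX \<rightarrow>\<^sub>M GX"
  unfolding GX_def
proof (rule measurable_measure_of, unfold GX_def[symmetric])
  assume t: "0 \<le> t"
  show "theta t \<in> space GX \<rightarrow> Om" using theta(1)[OF t] by auto
  fix A assume "A \<in> {{w \<in> Om. X t w \<in> \<Gamma>} | t \<Gamma>. 0 \<le> t \<and> \<Gamma> \<in> sets borel}"
  then obtain u \<Gamma> where A: "A = {w \<in> Om. X u w \<in> \<Gamma>}" "0 \<le> u" "\<Gamma> \<in> sets borel" by auto
  have "theta t -` A \<inter> space GX = X (u + t) -` \<Gamma> \<inter> space GX"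
    using theta[OF t] A by auto
  also have "\<dots> \<in> sets GX" by (rule measurable_sets[OF X_meas]) (use A t in auto)
  finally show "theta t -` A \<inter> space GX \<in> sets GX" .
qed auto

theorem markov_path:
  assumes "0 \<le> s" "g \<in> borel_measurable GX" "B \<in> sets (F s)"
  shows "(\<integral>\<^sup>+w. g (theta s w) * indicator B w \<partial>P x)
    = (\<integral>\<^sup>+w. (\<integral>\<^sup>+w'. g w' \<partial>P (X s w)) * indicator B w \<partial>P x)"
proof -
  have BP: "B \<in> sets (P x)" using sets_F[OF assms(1,3)] .
  have B_Om: "B \<subseteq> Om" using sets.sets_into_space[OF assms(3)] space_F[OF assms(1)] by auto
  let ?D = "density (P x) (indicator B)"
  have th: "theta s \<in> ?D \<rightarrow>\<^sub>M GX" using meas_GX_P[OF theta_meas[OF assms(1)]] by simp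
  have K: "(\<lambda>w. PX (X s w)) \<in> ?D \<rightarrow>\<^sub>M subprob_algebra GX"
    using measurable_compose[OF X_meas_P PX_meas, of s] assms by simp
  have ne: "space ?D \<noteq> {}" using Om_nonempty by simp
  have "distr ?D GX (theta s) = ?D \<bind> (\<lambda>w. PX (X s w))"
  proof (rule measure_eqI_generator_eq[OF Int_stable_cyls cyls_sub])
    show "sets (distr ?D GX (theta s)) = sigma_sets Om cyls" by (simp add: sets_GX_cyls)
    show "sets (?D \<bind> (\<lambda>w. PX (X s w))) = sigma_sets Om cyls"
      using sets_bind_measurable[OF K ne] by (simp add: sets_GX_cyls)
    show "range (\<lambda>_::nat. Om) \<subseteq> cyls" using Om_in_cyls by auto
    show "emeasure (distr ?D GX (theta s)) Om \<noteq> \<infinity>" for i :: nat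
    proof -
      have "emeasure (distr ?D GX (theta s)) Om = emeasure ?D (theta s -` Om \<inter> Om)"
        using th sets.top[of GX] by (subst emeasure_distr) auto
      also have "\<dots> = emeasure (P x) B"
        using B_Om BP measurable_sets[OF th sets.top[of GX]] theta(1)[OF assms(1)]
        by (subst emeasure_restricted) (auto intro!: arg_cong[where f = "emeasure (P x)"])
      finally show ?thesis by simp
    qed
    fix A assume "A \<in> cyls"
    then obtain J \<Gamma> where A: "A = {w \<in> Om. \<forall>t\<in>J. X t w \<in> \<Gamma> t}" "finite J" "J \<subseteq> {0..}" "\<forall>t. \<Gamma> t \<in> sets borel"
      unfolding cyls_def by blast
    have AG: "A \<in> sets GX" using \<open>A \<in> cyls\<close> sets_GX_cyls by blast
    let ?ts = "sorted_list_of_set J"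
    have so: "sorted (0 # ?ts)" using A by auto
    have Q: "cyl_prob \<Gamma> 0 ?ts y = emeasure (PX y) A" for y
    proof -
      have "emeasure (PX y) A = emeasure (P y) (Om \<inter> {w \<in> Om. \<forall>t\<in>set ?ts. X (0 + t) w \<in> \<Gamma> t})"
        using A AG by (auto simp: emeasure_PX intro!: arg_cong[where f = "emeasure (P y)"])
      also have "\<dots> = (\<integral>\<^sup>+w. cyl_prob \<Gamma> 0 ?ts (X (0 + 0) w) * indicator Om w \<partial>P y)"
        by (rule markov_cyl) (use A so in \<open>auto intro: Om_in_F\<close>)
      also have "\<dots> = (\<integral>\<^sup>+w. cyl_prob \<Gamma> 0 ?ts y \<partial>P y)"
        using AE_start[of y] AE_space[of "P y"] by (intro nn_integral_cong_AE, eventually_elim) simp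
      also have "\<dots> = cyl_prob \<Gamma> 0 ?ts y" by (simp add: P.emeasure_space_1[simplified])
      finally show ?thesis by simp
    qed
    have pre: "theta s -` A \<inter> Om = {w \<in> Om. \<forall>t\<in>set ?ts. X (s + t) w \<in> \<Gamma> t}"
      using A theta[OF assms(1)] by (auto simp: add.commute subset_eq)
    have "emeasure (distr ?D GX (theta s)) A = emeasure ?D (theta s -` A \<inter> Om)"
      using th AG by (subst emeasure_distr) auto
    also have "\<dots> = emeasure (P x) (B \<inter> {w \<in> Om. \<forall>t\<in>set ?ts. X (s + t) w \<in> \<Gamma> t})"
      using BP measurable_sets[OF th AG] by (simp add: emeasure_restricted pre)
    also have "\<dots> = (\<integral>\<^sup>+w. cyl_prob \<Gamma> 0 ?ts (X (s + 0) w) * indicator B w \<partial>P x)"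
      by (rule markov_cyl) (use A so assms in auto)
    also have "\<dots> = (\<integral>\<^sup>+w. emeasure (PX (X s w)) A \<partial>?D)"
      using BP measurable_emeasure_kernel[OF K AG] unfolding Q
      by (subst nn_integral_density) (auto simp: mult.commute)
    also have "\<dots> = emeasure (?D \<bind> (\<lambda>w. PX (X s w))) A"
      by (rule emeasure_bind[OF ne K AG, symmetric])
    finally show "emeasure (distr ?D GX (theta s)) A = emeasure (?D \<bind> (\<lambda>w. PX (X s w))) A" .
  qed auto
  then have "(\<integral>\<^sup>+y. g y \<partial>distr ?D GX (theta s)) = (\<integral>\<^sup>+y. g y \<partial>(?D \<bind> (\<lambda>w. PX (X s w))))" by simp
  also have "\<dots> = (\<integral>\<^sup>+w. (\<integral>\<^sup>+y. g y \<partial>PX (X s w)) \<partial>?D)"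
    by (rule nn_integral_bind[OF assms(2) K])
  also have "\<dots> = (\<integral>\<^sup>+w. (\<integral>\<^sup>+y. g y \<partial>PX (X s w)) * indicator B w \<partial>P x)"
    using BP measurable_compose[OF K nn_integral_measurable_subprob_algebra[OF assms(2)]]
    by (subst nn_integral_density) (auto simp: mult.commute)
  also have "\<dots> = (\<integral>\<^sup>+w. (\<integral>\<^sup>+w'. g w' \<partial>P (X s w)) * indicator B w \<partial>P x)"
    by (simp add: nn_integral_PX[OF assms(2)])
  also have "(\<integral>\<^sup>+y. g y \<partial>distr ?D GX (theta s)) = (\<integral>\<^sup>+w. g (theta s w) * indicator B w \<partial>P x)"
    using assms BP meas_GX_P[OF theta_meas[OF assms(1)]]
    by (subst nn_integral_distr) (auto simp: nn_integral_density mult.commute)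
  finally show ?thesis .
qed

lemma nn_expectation_meas:
  assumes "(\<lambda>(z, w). f z w) \<in> borel_measurable (M \<Otimes>\<^sub>M GX)" "v \<in> M \<rightarrow>\<^sub>M borel"
  shows "(\<lambda>z. \<integral>\<^sup>+w. f z w \<partial>P (v z)) \<in> borel_measurable M"
proof -
  have "(\<lambda>z. \<integral>\<^sup>+w. f z w \<partial>PX (v z)) \<in> borel_measurable M"
    by (rule nn_integral_measurable_subprob_algebra2[OF assms(1) measurable_compose[OF assms(2) PX_meas]])
  then show ?thesis
    by (rule measurable_cong[THEN iffD1, rotated])
      (rule nn_integral_PX, use measurable_Pair2[OF assms(1)] in auto)
qed

end

section \<open>Stopping at exit times on a grid\<close>

lemma closure_Rats_interval:
  fixes t :: real
  assumes "0 < t"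
  shows "closure ({0<..<t} \<inter> \<rat>) = {0..t}"
proof
  have "closure ({0<..<t} \<inter> \<rat>) \<subseteq> closure {0<..<t}" by (intro closure_mono) auto
  then show "closure ({0<..<t} \<inter> \<rat>) \<subseteq> {0..t}" using assms by simp
  have "{0<..<t} \<subseteq> closure ({0<..<t} \<inter> \<rat>)"
    using open_Int_closure_subset[of "{0<..<t}" "\<rat>"] by (simp add: Rats_closure_real)
  then have "closure {0<..<t} \<subseteq> closure ({0<..<t} \<inter> \<rat>)" by (rule closure_minimal) simp
  then show "{0..t} \<subseteq> closure ({0<..<t} \<inter> \<rat>)" using assms by simp
qed

context continuous_markov_process
begin

lemma stay_in_sets:
  assumes M: "space M = Om" "\<And>s. 0 \<le> s \<Longrightarrow> s \<le> t \<Longrightarrow> X s \<in> M \<rightarrow>\<^sub>M borel" and O1: "open O1" and t: "0 \<le> t"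
  shows "{w \<in> Om. \<forall>s\<in>{0..t}. X s w \<in> O1} \<in> sets M"
proof (cases "O1 = UNIV \<or> t = 0")
  case True
  then show ?thesis
  proof
    assume "t = 0"
    have "{w \<in> space M. X 0 w \<in> O1} \<in> sets M"
      by (rule measurable_sets_Collect[OF M(2)]) (use \<open>t = 0\<close> O1 in auto)
    then show ?thesis using \<open>t = 0\<close> M(1) by simp
  next
    assume "O1 = UNIV"
    then show ?thesis using sets.top[of M] M(1) by simp
  qed
next
  case False
  then have t: "0 < t" and ne: "- O1 \<noteq> {}" using t by auto
  define D where "D = (\<lambda>x. infdist x (- O1))"
  have D_cont: "continuous_on UNIV D" unfolding D_def by (intro continuous_intros)
  have D_meas: "D \<in> borel_measurable borel" by (rule borel_measurable_continuous_onI[OF D_cont])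
  have D_pos: "0 < D x \<longleftrightarrow> x \<in> O1" for x
    using in_closed_iff_infdist_zero[of "- O1" x] ne O1 infdist_nonneg[of x "- O1"]
    by (auto simp: D_def closed_def less_le)
  let ?Q = "{0<..<t} \<inter> \<rat>"
  have iff: "(\<forall>s\<in>{0..t}. X s w \<in> O1) \<longleftrightarrow> (\<exists>k::nat. \<forall>q\<in>?Q. 1 / real (Suc k) \<le> D (X q w))" if w: "w \<in> Om" for w
  proof -
    have c: "continuous_on {0..t} (\<lambda>s. D (X s w))"
      using continuous_on_subset[OF paths[OF w], of "{0..t}"]
      by (intro continuous_on_compose2[OF D_cont]) auto
    show ?thesis
    proof
      assume *: "\<forall>s\<in>{0..t}. X s w \<in> O1"
      obtain s where s: "s \<in> {0..t}" "\<forall>u\<in>{0..t}. D (X s w) \<le> D (X u w)"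
        using continuous_attains_inf[OF compact_Icc _ c] t by auto
      have "0 < D (X s w)" using * s D_pos by blast
      then obtain k where "1 / real (Suc k) < D (X s w)" using nat_approx_posE by blast
      then show "\<exists>k::nat. \<forall>q\<in>?Q. 1 / real (Suc k) \<le> D (X q w)"
        using s by (intro exI[of _ k] ballI) (force intro: less_imp_le less_le_trans)
    next
      assume "\<exists>k::nat. \<forall>q\<in>?Q. 1 / real (Suc k) \<le> D (X q w)"
      then obtain k :: nat where k: "\<And>q. q \<in> ?Q \<Longrightarrow> 1 / real (Suc k) \<le> D (X q w)" by blast
      show "\<forall>s\<in>{0..t}. X s w \<in> O1"
      proof
        fix s assume "s \<in> {0..t}"
        then have "1 / real (Suc k) \<le> D (X s w)"
          by (intro continuous_ge_on_closure[of ?Q "\<lambda>s. D (X s w)" s "1 / real (Suc k)"])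
            (simp_all only: closure_Rats_interval[OF t] c k)
        moreover have "0 < 1 / real (Suc k)" by simp
        ultimately have "0 < D (X s w)" by linarith
        then show "X s w \<in> O1" using D_pos by blast
      qed
    qed
  qed
  have Q: "countable ?Q" by (rule countable_Int2[OF countable_rat])
  have "{w \<in> space M. 1 / real (Suc k) \<le> D (X q w)} \<in> sets M" if "q \<in> ?Q" for k q
  proof -
    have "(\<lambda>w. D (X q w)) \<in> borel_measurable M"
      by (rule measurable_compose[OF M(2) D_meas]) (use that in auto)
    then show ?thesis by measurable
  qed
  then have "{w \<in> space M. \<forall>q\<in>?Q. 1 / real (Suc k) \<le> D (X q w)} \<in> sets M" for k
    by (intro sets.sets_Collect_countable_All' Q)
  then have "{w \<in> space M. \<exists>k::nat. \<forall>q\<in>?Q. 1 / real (Suc k) \<le> D (X q w)} \<in> sets M"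
    by (rule sets.sets_Collect_countable_Ex)
  moreover have "{w \<in> Om. \<forall>s\<in>{0..t}. X s w \<in> O1}
    = {w \<in> space M. \<exists>k::nat. \<forall>q\<in>?Q. 1 / real (Suc k) \<le> D (X q w)}"
    using iff M(1) by blast
  ultimately show ?thesis by simp
qed

lemma stay_in_F: "open O1 \<Longrightarrow> 0 \<le> t \<Longrightarrow> {w \<in> Om. \<forall>s\<in>{0..t}. X s w \<in> O1} \<in> sets (F t)"
  by (rule stay_in_sets) (auto simp: space_F intro: X_meas_F)

lemma stay_in_GX: "open O1 \<Longrightarrow> 0 \<le> t \<Longrightarrow> {w \<in> Om. \<forall>s\<in>{0..t}. X s w \<in> O1} \<in> sets GX"
  by (rule stay_in_sets) (auto intro: X_meas)

abbreviation "hitX O1 T w \<equiv> hit O1 T (\<lambda>t. X t w)"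

lemma less_hitX_set:
  assumes "open O1" "0 \<le> t"
  shows "{w \<in> Om. t < hitX O1 T w} = (if t < T then {w \<in> Om. \<forall>s\<in>{0..t}. X s w \<in> O1} else {})"
  using less_hit_iff[OF paths assms, of _ T] by auto

lemma less_hitX_F: "open O1 \<Longrightarrow> 0 \<le> t \<Longrightarrow> {w \<in> Om. t < hitX O1 T w} \<in> sets (F t)"
  by (simp add: less_hitX_set stay_in_F)

lemma hitX_meas:
  assumes "open O1" "0 \<le> T"
  shows "hitX O1 T \<in> borel_measurable GX"
proof (rule borel_measurable_iff_greater[THEN iffD2], rule allI)
  fix t :: real
  show "{w \<in> space GX. t < hitX O1 T w} \<in> sets GX"
  proof (cases "0 \<le> t")
    case True
    then show ?thesis using assms by (simp add: less_hitX_set stay_in_GX)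
  next
    case False
    then have "{w \<in> space GX. t < hitX O1 T w} = space GX"
      using less_le_trans[OF _ hit_nonneg[OF assms(2)], of t] by auto
    then show ?thesis using sets.top[of GX] by simp
  qed
qed

lemma X_hitX_meas: "open O1 \<Longrightarrow> 0 \<le> T \<Longrightarrow> (\<lambda>w. X (hitX O1 T w) w) \<in> GX \<rightarrow>\<^sub>M borel"
  by (intro X_random_time hitX_meas hit_nonneg)

definition stopping :: "real \<Rightarrow> ('w \<Rightarrow> real) \<Rightarrow> bool" where
  "stopping T \<sigma> \<longleftrightarrow> (\<forall>w\<in>Om. 0 \<le> \<sigma> w \<and> \<sigma> w \<le> T) \<and> \<sigma> \<in> borel_measurable GX
     \<and> (\<forall>t\<ge>0. {w \<in> Om. t < \<sigma> w} \<in> sets (F t))"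

lemma stoppingD:
  assumes "stopping T \<sigma>"
  shows "w \<in> Om \<Longrightarrow> 0 \<le> \<sigma> w" "w \<in> Om \<Longrightarrow> \<sigma> w \<le> T" "\<sigma> \<in> borel_measurable GX"
    "0 \<le> t \<Longrightarrow> {w \<in> Om. t < \<sigma> w} \<in> sets (F t)"
  using assms by (auto simp: stopping_def)

lemma stopping_hitX: "open O1 \<Longrightarrow> 0 \<le> T \<Longrightarrow> stopping T (hitX O1 T)"
  using hitX_meas[of O1 T] less_hitX_F[of O1 _ T] hit_nonneg[of T O1] hit_le[of O1 T]
  by (simp add: stopping_def)

lemma X_stopping_meas: "stopping T \<sigma> \<Longrightarrow> (\<lambda>w. X (\<sigma> w) w) \<in> GX \<rightarrow>\<^sub>M borel"
  by (intro X_random_time stoppingD)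

lemma grid_level_F:
  assumes "stopping T \<sigma>" "0 < T" "0 < n"
  shows "{w \<in> Om. grid T n (\<sigma> w) = real k * T / real n} \<in> sets (F (real k * T / real n))"
proof -
  let ?t = "real k * T / real n"
  have t: "0 \<le> ?t" using assms by simp
  have 1: "{w \<in> Om. ?t < \<sigma> w} \<in> sets (F ?t)" by (rule stoppingD(4)[OF assms(1) t])
  have 2: "{w \<in> Om. (real k - 1) * T / real n < \<sigma> w} \<in> sets (F ?t)"
  proof (cases "k = 0")
    case True
    have "{w \<in> Om. (real k - 1) * T / real n < \<sigma> w} = Om"
    proof (intro equalityI subsetI CollectI conjI)
      fix w assume "w \<in> Om"
      have "(real k - 1) * T / real n < 0" using True assms by (simp add: field_simps)
      then show "(real k - 1) * T / real n < \<sigma> w" using stoppingD(1)[OF assms(1) \<open>w \<in> Om\<close>] by linarith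
    qed auto
    then show ?thesis using Om_in_F[OF t] by simp
  next
    case False
    then have "0 \<le> (real k - 1) * T / real n" "(real k - 1) * T / real n \<le> ?t"
      using assms by (auto intro!: divide_right_mono mult_right_mono)
    then show ?thesis using sets_F_mono[OF _ _ stoppingD(4)[OF assms(1)]] by blast
  qed
  have "{w \<in> Om. grid T n (\<sigma> w) = ?t} = {w \<in> Om. (real k - 1) * T / real n < \<sigma> w} - {w \<in> Om. ?t < \<sigma> w}"
    using grid_eq_iff[OF assms(2,3)] by auto
  then show ?thesis using sets.Diff[OF 2 1] by simp
qed

lemma grid_expectation:
  assumes \<sigma>: "stopping T \<sigma>" and T: "0 < T" and n: "0 < n" and C: "0 \<le> C"
    and Z: "integrable (P x) Z" and Y: "\<And>s. 0 \<le> s \<Longrightarrow> s \<le> T \<Longrightarrow> integrable (P x) (Y s)"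
    and eq: "\<And>s B. 0 \<le> s \<Longrightarrow> s \<le> T \<Longrightarrow> B \<in> sets (F s) \<Longrightarrow>
      \<bar>(\<integral>w. Z w * indicator B w \<partial>P x) - (\<integral>w. Y s w * indicator B w \<partial>P x)\<bar> \<le> C * s * measure (P x) B"
  shows "integrable (P x) (\<lambda>w. Y (grid T n (\<sigma> w)) w)"
    "\<bar>(\<integral>w. Z w \<partial>P x) - (\<integral>w. Y (grid T n (\<sigma> w)) w \<partial>P x)\<bar> \<le> C * T"
proof -
  let ?t = "\<lambda>k. real k * T / real n"
  let ?D = "\<lambda>k. {w \<in> Om. grid T n (\<sigma> w) = ?t k}"
  have t0: "0 \<le> ?t k" for k using T by simp
  have tT: "?t k \<le> T" if "k \<le> n" for k using that T n by (simp add: field_simps)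
  have inj: "?t k = ?t l \<longleftrightarrow> k = l" for k l using T n by simp
  have DF: "?D k \<in> sets (F (?t k))" for k by (rule grid_level_F[OF \<sigma> T n])
  have DP: "?D k \<in> sets (P x)" for k using sets_F[OF t0 DF] .
  have one: "(\<Sum>k\<le>n. indicator (?D k) w) = (1::real)" if w: "w \<in> Om" for w
  proof -
    obtain k where k: "k \<le> n" "grid T n (\<sigma> w) = ?t k"
      using grid_cases[OF T n stoppingD(1)[OF \<sigma> w] stoppingD(2)[OF \<sigma> w]] by blast
    have "(\<Sum>j\<le>n. indicator (?D j) w) = (\<Sum>j\<le>n. if j = k then 1 else (0::real))"
      using k that inj by (intro sum.cong) (auto simp: indicator_def)
    then show ?thesis using k by simp
  qed
  have Yeq: "Y (grid T n (\<sigma> w)) w = (\<Sum>k\<le>n. Y (?t k) w * indicator (?D k) w)" if "w \<in> Om" for w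
  proof -
    have "Y (grid T n (\<sigma> w)) w = (\<Sum>k\<le>n. Y (grid T n (\<sigma> w)) w * indicator (?D k) w)"
      unfolding sum_distrib_left[symmetric] one[OF that] by simp
    also have "\<dots> = (\<Sum>k\<le>n. Y (?t k) w * indicator (?D k) w)"
      by (intro sum.cong refl) (auto simp: indicator_def)
    finally show ?thesis .
  qed
  have iY: "integrable (P x) (\<lambda>w. Y (?t k) w * indicator (?D k) w)" if "k \<le> n" for k
    by (intro integrable_real_mult_indicator DP Y t0 tT that)
  have iZ: "integrable (P x) (\<lambda>w. Z w * indicator (?D k) w)" for k
    by (intro integrable_real_mult_indicator DP Z)
  have "integrable (P x) (\<lambda>w. \<Sum>k\<le>n. Y (?t k) w * indicator (?D k) w)"
    by (intro Bochner_Integration.integrable_sum iY) simp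
  then show "integrable (P x) (\<lambda>w. Y (grid T n (\<sigma> w)) w)"
    by (subst Bochner_Integration.integrable_cong[OF refl Yeq]) auto
  have EY: "(\<integral>w. Y (grid T n (\<sigma> w)) w \<partial>P x) = (\<Sum>k\<le>n. \<integral>w. Y (?t k) w * indicator (?D k) w \<partial>P x)"
    by (subst Bochner_Integration.integral_sum[symmetric])
      (auto intro!: iY Bochner_Integration.integral_cong simp: Yeq)
  have EZ: "(\<integral>w. Z w \<partial>P x) = (\<Sum>k\<le>n. \<integral>w. Z w * indicator (?D k) w \<partial>P x)"
    by (subst Bochner_Integration.integral_sum[symmetric])
      (auto intro!: iZ Bochner_Integration.integral_cong simp: sum_distrib_left[symmetric] one)
  have "(\<Sum>k\<le>n. measure (P x) (?D k)) = (\<integral>w. (\<Sum>k\<le>n. indicator (?D k) w) \<partial>P x)"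
  proof -
    have "integrable (P x) (indicator (?D k) :: 'w \<Rightarrow> real)" for k
      by (rule P.integrable_const_bound[where B = 1]) (use DP in auto)
    then have "(\<integral>w. (\<Sum>k\<le>n. indicator (?D k) w) \<partial>P x) = (\<Sum>k\<le>n. \<integral>w. indicator (?D k) w \<partial>P x :: real)"
      by (intro Bochner_Integration.integral_sum)
    also have "\<dots> = (\<Sum>k\<le>n. measure (P x) (?D k))"
      by (intro sum.cong refl) (subst Bochner_Integration.integral_indicator, auto intro!: arg_cong[where f = "measure (P x)"])
    finally show ?thesis by (rule sym)
  qed
  also have "\<dots> = (\<integral>w. 1 \<partial>P x)" by (intro Bochner_Integration.integral_cong) (auto simp: one)
  also have "\<dots> = 1" using P.prob_space by simp
  finally have m1: "(\<Sum>k\<le>n. measure (P x) (?D k)) = 1" .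
  have "\<bar>(\<integral>w. Z w \<partial>P x) - (\<integral>w. Y (grid T n (\<sigma> w)) w \<partial>P x)\<bar>
    = \<bar>\<Sum>k\<le>n. (\<integral>w. Z w * indicator (?D k) w \<partial>P x) - (\<integral>w. Y (?t k) w * indicator (?D k) w \<partial>P x)\<bar>"
    unfolding EY EZ by (simp add: sum_subtractf)
  also have "\<dots> \<le> (\<Sum>k\<le>n. C * ?t k * measure (P x) (?D k))"
    by (rule order_trans[OF sum_abs]) (intro sum_mono eq t0 tT DF, simp)
  also have "\<dots> \<le> (\<Sum>k\<le>n. C * T * measure (P x) (?D k))"
    by (intro sum_mono mult_right_mono mult_left_mono C tT) auto
  also have "\<dots> = C * T" using m1 by (simp add: sum_distrib_left[symmetric])
  finally show "\<bar>(\<integral>w. Z w \<partial>P x) - (\<integral>w. Y (grid T n (\<sigma> w)) w \<partial>P x)\<bar> \<le> C * T" .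
qed

lemma X_grid_tendsto:
  assumes "stopping T \<sigma>" "0 < T" "w \<in> Om"
  shows "(\<lambda>n. X (grid T n (\<sigma> w)) w) \<longlonglongrightarrow> X (\<sigma> w) w"
proof (rule continuous_on_tendsto_compose[OF paths[OF assms(3)] tendsto_grid[OF assms(2)]])
  show "\<sigma> w \<in> {0..}" using stoppingD(1)[OF assms(1,3)] by simp
  show "\<forall>\<^sub>F n in sequentially. grid T n (\<sigma> w) \<in> {0..}"
    using eventually_gt_at_top[of 0]
  proof eventually_elim
    case (elim n)
    have "0 \<le> \<sigma> w" by (rule stoppingD(1)[OF assms(1,3)])
    also have "\<dots> \<le> grid T n (\<sigma> w)" by (rule grid_ge[OF assms(2) elim])
    finally show ?case by simp
  qed
qed

section \<open>Semigroup and Markov property for real functionals\<close>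

lemma expectation_meas:
  assumes "(\<lambda>(z, w). f z w) \<in> borel_measurable (M \<Otimes>\<^sub>M GX)" "v \<in> M \<rightarrow>\<^sub>M borel"
  shows "(\<lambda>z. \<integral>w. f z w \<partial>P (v z) :: real) \<in> borel_measurable M"
proof -
  have L: "(\<lambda>z. PX (v z)) \<in> M \<rightarrow>\<^sub>M subprob_algebra GX"
    by (rule measurable_compose[OF assms(2) PX_meas])
  have "(\<lambda>z. \<integral>w. f z w \<partial>PX (v z)) \<in> borel_measurable M"
  proof -
    note assms(1)[measurable] L[measurable] measurable_distr2[measurable]
    have "(\<lambda>z. integral\<^sup>L (distr (PX (v z)) (M \<Otimes>\<^sub>M GX) (\<lambda>w. (z, w))) (\<lambda>(z, w). f z w)) \<in> borel_measurable M"
      by measurable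
    then show ?thesis
      by (rule measurable_cong[THEN iffD1, rotated]) (simp add: integral_distr)
  qed
  then show ?thesis
    by (rule measurable_cong[THEN iffD1, rotated])
      (simp add: PX_def, rule integral_subalgebra2[OF subalg_GX], use measurable_Pair2[OF assms(1)] in auto)
qed

lemma markov_real:
  fixes G :: "'w \<Rightarrow> real"
  assumes s: "0 \<le> s" and G: "G \<in> borel_measurable GX" and B: "B \<in> sets (F s)"
    and int: "\<And>y. integrable (P y) G" and int\<theta>: "integrable (P x) (\<lambda>w. G (theta s w))"
  shows "integrable (P x) (\<lambda>w. (\<integral>w'. G w' \<partial>P (X s w)) * indicator B w)" (is ?I)
    "(\<integral>w. G (theta s w) * indicator B w \<partial>P x) = (\<integral>w. (\<integral>w'. G w' \<partial>P (X s w)) * indicator B w \<partial>P x)" (is ?E)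
proof -
  have BP: "B \<in> sets (P x)" using sets_F[OF s B] .
  have pos: "integrable (P x) (\<lambda>w. enn2real (\<integral>\<^sup>+w'. ennreal (H w') \<partial>P (X s w)) * indicator B w) \<and>
      enn2real (\<integral>\<^sup>+w. ennreal (H (theta s w) * indicator B w) \<partial>P x)
        = (\<integral>w. enn2real (\<integral>\<^sup>+w'. ennreal (H w') \<partial>P (X s w)) * indicator B w \<partial>P x)"
    if H: "H \<in> borel_measurable GX" "\<And>y. integrable (P y) H" "integrable (P x) (\<lambda>w. H (theta s w))" for H
  proof -
    let ?h = "\<lambda>y. \<integral>\<^sup>+w'. ennreal (H w') \<partial>P y"
    have fin: "?h y < \<infinity>" for y
      using H(2)[of y] by (simp add: real_integrable_def less_top)
    have h_meas: "?h \<in> borel_measurable borel"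
      using nn_expectation_meas[of "\<lambda>_ w. ennreal (H w)" borel "\<lambda>y. y"] H(1) by measurable
    have hX: "(\<lambda>w. ?h (X s w)) \<in> borel_measurable (P x)"
      by (rule measurable_compose[OF X_meas_P[OF s] h_meas])
    have eq: "(\<integral>\<^sup>+w. ennreal (H (theta s w) * indicator B w) \<partial>P x) = (\<integral>\<^sup>+w. ?h (X s w) * indicator B w \<partial>P x)"
    proof -
      have "(\<integral>\<^sup>+w. ennreal (H (theta s w) * indicator B w) \<partial>P x) = (\<integral>\<^sup>+w. (\<lambda>w. ennreal (H w)) (theta s w) * indicator B w \<partial>P x)"
        by (intro nn_integral_cong) (auto simp: indicator_def)
      also have "\<dots> = (\<integral>\<^sup>+w. ?h (X s w) * indicator B w \<partial>P x)"
        by (rule markov_path[OF s _ B]) (use H(1) in measurable)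
      finally show ?thesis .
    qed
    have "(\<integral>\<^sup>+w. ennreal (H (theta s w) * indicator B w) \<partial>P x) \<le> (\<integral>\<^sup>+w. ennreal (H (theta s w)) \<partial>P x)"
      by (intro nn_integral_mono) (auto simp: indicator_def)
    also have "\<dots> < \<infinity>" using H(3) by (simp add: real_integrable_def less_top)
    finally have fin2: "(\<integral>\<^sup>+w. ?h (X s w) * indicator B w \<partial>P x) < \<infinity>" using eq by simp
    have eq2: "ennreal (enn2real (?h (X s w)) * indicator B w) = ?h (X s w) * indicator B w" for w
      using fin[of "X s w"] by (auto simp: indicator_def)
    have meas: "(\<lambda>w. enn2real (?h (X s w)) * indicator B w) \<in> borel_measurable (P x)"
      using hX BP by measurable
    have I: "integrable (P x) (\<lambda>w. enn2real (?h (X s w)) * indicator B w)"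
      by (rule integrableI_nonneg[OF meas]) (use fin2 in \<open>auto simp: eq2\<close>)
    have "(\<integral>w. enn2real (?h (X s w)) * indicator B w \<partial>P x)
      = enn2real (\<integral>\<^sup>+w. ennreal (enn2real (?h (X s w)) * indicator B w) \<partial>P x)"
      by (rule integral_eq_nn_integral[OF meas]) auto
    then show ?thesis using I eq eq2 by simp
  qed
  have Gm: "(\<lambda>w. - G w) \<in> borel_measurable GX" using G by measurable
  note p1 = pos[OF G int int\<theta>]
  note p2 = pos[OF Gm Bochner_Integration.integrable_minus[OF int] Bochner_Integration.integrable_minus[OF int\<theta>]]
  have split: "(\<integral>w'. G w' \<partial>P y) * indicator B w = enn2real (\<integral>\<^sup>+w'. ennreal (G w') \<partial>P y) * indicator B w
      - enn2real (\<integral>\<^sup>+w'. ennreal (- G w') \<partial>P y) * indicator B w" for y w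
    by (subst real_lebesgue_integral_def[OF int]) (simp add: left_diff_distrib)
  show ?I unfolding split by (intro Bochner_Integration.integrable_diff p1[THEN conjunct1] p2[THEN conjunct1])
  have "integrable (P x) (\<lambda>w. G (theta s w) * indicator B w)"
    by (intro integrable_real_mult_indicator BP int\<theta>)
  then have "(\<integral>w. G (theta s w) * indicator B w \<partial>P x)
    = enn2real (\<integral>\<^sup>+w. ennreal (G (theta s w) * indicator B w) \<partial>P x)
      - enn2real (\<integral>\<^sup>+w. ennreal (- G (theta s w) * indicator B w) \<partial>P x)"
    by (subst real_lebesgue_integral_def) auto
  also have "\<dots> = (\<integral>w. (\<integral>w'. G w' \<partial>P (X s w)) * indicator B w \<partial>P x)"
    unfolding split p1[THEN conjunct2] p2[THEN conjunct2]
    by (rule Bochner_Integration.integral_diff[symmetric]) (intro p1[THEN conjunct1] p2[THEN conjunct1])+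
  finally show ?E .
qed

lemma integrable_bounded_GX:
  fixes G :: "'w \<Rightarrow> real"
  assumes "G \<in> borel_measurable GX" "\<And>w. w \<in> Om \<Longrightarrow> \<bar>G w\<bar> \<le> K"
  shows "integrable (P y) G"
  by (rule P.integrable_const_bound[where B = K]) (use assms in \<open>auto intro: meas_GX_P\<close>)

lemma markov_bounded:
  fixes G :: "'w \<Rightarrow> real"
  assumes s: "0 \<le> s" and G: "G \<in> borel_measurable GX" and B: "B \<in> sets (F s)"
    and bd: "\<And>w. w \<in> Om \<Longrightarrow> \<bar>G w\<bar> \<le> K"
  shows "(\<integral>w. G (theta s w) * indicator B w \<partial>P x) = (\<integral>w. (\<integral>w'. G w' \<partial>P (X s w)) * indicator B w \<partial>P x)"
  by (rule markov_real[OF s G B])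
    (use integrable_bounded_GX[OF G bd] integrable_bounded_GX[OF measurable_compose[OF theta_meas[OF s] G], of K]
      bd theta(1)[OF s] in auto)

definition sgp :: "real \<Rightarrow> (real ^ 'n \<Rightarrow> real) \<Rightarrow> real ^ 'n \<Rightarrow> real" where
  "sgp t f x = (\<integral>w. f (X t w) \<partial>P x)"

definition bdd_borel :: "real \<Rightarrow> (real ^ 'n \<Rightarrow> real) \<Rightarrow> bool" where
  "bdd_borel K f \<longleftrightarrow> f \<in> borel_measurable borel \<and> (\<forall>x. \<bar>f x\<bar> \<le> K)"

lemma bdd_borelD: "bdd_borel K f \<Longrightarrow> f \<in> borel_measurable borel" "bdd_borel K f \<Longrightarrow> \<bar>f x\<bar> \<le> K"
  by (auto simp: bdd_borel_def)

lemma bdd_borel_nonneg: "bdd_borel K f \<Longrightarrow> 0 \<le> K"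
  using bdd_borelD(2)[of K f 0] by linarith

lemma integrable_f_X: "0 \<le> t \<Longrightarrow> bdd_borel K f \<Longrightarrow> integrable (P x) (\<lambda>w. f (X t w))"
  by (rule integrable_bounded_GX[where K = K])
    (auto intro: measurable_compose[OF X_meas] bdd_borelD)

lemma P_integral_bounded:
  assumes "\<And>w. w \<in> Om \<Longrightarrow> \<bar>G w\<bar> \<le> K"
  shows "\<bar>\<integral>w. G w \<partial>P x\<bar> \<le> (K::real)"
proof -
  obtain w where "w \<in> Om" using Om_nonempty by blast
  then have K: "0 \<le> K" using assms[of w] by linarith
  show ?thesis
  proof (cases "integrable (P x) G")
    case True
    have "\<bar>\<integral>w. G w \<partial>P x\<bar> \<le> (\<integral>w. \<bar>G w\<bar> \<partial>P x)" by (rule integral_abs_bound)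
    also have "\<dots> \<le> (\<integral>w. K \<partial>P x)" using True assms by (intro integral_mono) auto
    also have "\<dots> = K" using P.prob_space by simp
    finally show ?thesis .
  qed (use K in \<open>simp add: not_integrable_integral_eq\<close>)
qed

lemma X_joint_comp:
  assumes "f \<in> borel_measurable borel"
  shows "(\<lambda>(t, w). f (X (max 0 t) w)) \<in> borel_measurable (borel \<Otimes>\<^sub>M GX)"
  using measurable_compose[OF X_joint assms] by (simp add: case_prod_unfold)

lemma sgp_joint_meas:
  assumes "f \<in> borel_measurable borel"
  shows "(\<lambda>(t, x). sgp (max 0 t) f x) \<in> borel_measurable (borel \<Otimes>\<^sub>M borel)"
proof -
  have m1: "(\<lambda>q :: (real \<times> (real ^ 'n)) \<times> 'w. (fst (fst q), snd q)) \<in> (borel \<Otimes>\<^sub>M borel) \<Otimes>\<^sub>M GX \<rightarrow>\<^sub>M borel \<Otimes>\<^sub>M GX"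
    by measurable
  have "(\<lambda>(p :: real \<times> (real ^ 'n), w). f (X (max 0 (fst p)) w)) \<in> borel_measurable ((borel \<Otimes>\<^sub>M borel) \<Otimes>\<^sub>M GX)"
    using measurable_compose[OF m1 X_joint_comp[OF assms]] by (simp add: case_prod_unfold)
  from expectation_meas[OF this, of snd] show ?thesis
    by (simp add: sgp_def case_prod_unfold)
qed

lemma sgp_bdd_borel: "0 \<le> t \<Longrightarrow> bdd_borel K f \<Longrightarrow> bdd_borel K (sgp t f)"
  unfolding bdd_borel_def
proof safe
  assume t: "0 \<le> t" and f: "f \<in> borel_measurable borel" "\<forall>x. \<bar>f x\<bar> \<le> K"
  show "sgp t f \<in> borel_measurable borel"
    using measurable_Pair2[OF sgp_joint_meas[OF f(1)], of t] t by (simp add: max_absorb2)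
  show "\<bar>sgp t f x\<bar> \<le> K" for x
    unfolding sgp_def by (rule P_integral_bounded) (use f in auto)
qed

lemma markov_sgp:
  assumes "0 \<le> s" "0 \<le> t" "bdd_borel K f" "B \<in> sets (F s)"
  shows "(\<integral>w. f (X (t + s) w) * indicator B w \<partial>P x) = (\<integral>w. sgp t f (X s w) * indicator B w \<partial>P x)"
proof -
  have "(\<integral>w. f (X (t + s) w) * indicator B w \<partial>P x) = (\<integral>w. (\<lambda>w. f (X t w)) (theta s w) * indicator B w \<partial>P x)"
    using assms by (intro Bochner_Integration.integral_cong) (auto simp: theta)
  also have "\<dots> = (\<integral>w. sgp t f (X s w) * indicator B w \<partial>P x)"
    unfolding sgp_def
    by (rule markov_bounded[OF assms(1) _ assms(4), where K = K])
      (use assms in \<open>auto intro: measurable_compose[OF X_meas] bdd_borelD\<close>)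
  finally show ?thesis .
qed

lemma P_integral_indicator_Om: "(\<integral>w. f w * indicator Om w \<partial>P x) = (\<integral>w. f w \<partial>P x)" for f :: "'w \<Rightarrow> real"
  by (intro Bochner_Integration.integral_cong) auto

lemma P_integral_start:
  assumes "g \<in> borel_measurable borel"
  shows "(\<integral>w. g (X 0 w) \<partial>P x) = (g x :: real)"
proof -
  have "(\<integral>w. g (X 0 w) \<partial>P x) = (\<integral>w. g x \<partial>P x)"
  proof (rule integral_cong_AE)
    show "AE w in P x. g (X 0 w) = g x" using AE_start[of x] by eventually_elim simp
  qed (use measurable_compose[OF X_meas_P assms, of 0] in auto)
  then show ?thesis using P.prob_space by simp
qed

end

section \<open>Facts about \<open>Lp_norm\<close>\<close>

lemma Lp_norm_mono:
  assumes "0 < p" "Q \<subseteq> Q'" "\<And>x. x \<in> Q \<Longrightarrow> norm (f x) \<le> norm (g x)"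
  shows "Lp_norm p Q f \<le> Lp_norm p Q' g"
proof -
  let ?I = "\<integral>\<^sup>+x\<in>Q. ennreal (norm (f x) powr p) \<partial>lborel"
  let ?J = "\<integral>\<^sup>+x\<in>Q'. ennreal (norm (g x) powr p) \<partial>lborel"
  have le: "?I \<le> ?J"
    using assms by (intro nn_integral_mono) (auto simp: indicator_def intro!: ennreal_leI powr_mono2)
  show ?thesis
  proof (cases "?J = \<infinity>")
    case False
    then have J: "?J < \<infinity>" by (simp add: less_top)
    then have I: "?I \<noteq> \<infinity>" using le by auto
    have "enn2real ?I powr (1 / p) \<le> enn2real ?J powr (1 / p)"
      using le J assms(1) by (intro powr_mono2 enn2real_mono) auto
    then show ?thesis using I False by (simp add: Lp_norm_def ennreal_leI)
  qed (simp add: Lp_norm_def)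
qed

lemma Lp_norm_norm: "Lp_norm p Q (\<lambda>x. norm (f x)) = Lp_norm p Q f"
  by (simp add: Lp_norm_def)

lemma Lp_norm_finite_iff: "Lp_norm p Q f < \<infinity> \<longleftrightarrow> (\<integral>\<^sup>+x\<in>Q. ennreal (norm (f x) powr p) \<partial>lborel) < \<infinity>"
  by (auto simp: Lp_norm_def Let_def less_top)

lemma Lp_norm_indicator:
  fixes A Q :: "'a::euclidean_space set"
  assumes "0 < p" "A \<inter> Q \<in> sets lborel" "emeasure lborel (A \<inter> Q) = ennreal m" "0 \<le> m"
  shows "Lp_norm p Q (indicator A :: 'a \<Rightarrow> real) = ennreal (m powr (1 / p))"
proof -
  have "(\<integral>\<^sup>+x\<in>Q. ennreal (norm (indicator A x :: real) powr p) \<partial>lborel) = (\<integral>\<^sup>+x. indicator (A \<inter> Q) x \<partial>lborel)"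
    using assms(1) by (intro nn_integral_cong) (auto simp: indicator_def)
  also have "\<dots> = ennreal m" using assms by simp
  finally show ?thesis using assms(4) by (simp add: Lp_norm_def)
qed

lemma Lp_norm_ball_small:
  fixes b :: "'a::euclidean_space \<Rightarrow> 'b::euclidean_space"
  assumes p: "0 < p" and b: "b \<in> borel_measurable borel" "Lp_norm p UNIV b < \<infinity>" and e: "0 < e"
  obtains r where "0 < r" "Lp_norm p (ball y r) b \<le> ennreal e"
proof -
  let ?f = "\<lambda>x. ennreal (norm (b x) powr p)"
  have f[measurable]: "?f \<in> borel_measurable lborel" using b(1) by simp
  let ?\<nu> = "density lborel ?f"
  let ?A = "\<lambda>n::nat. ball y (1 / real (Suc n))"
  have em: "emeasure ?\<nu> A = (\<integral>\<^sup>+x\<in>A. ?f x \<partial>lborel)" if "A \<in> sets borel" for A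
    using that f by (simp add: emeasure_density)
  have "emeasure ?\<nu> (?A n) \<noteq> \<infinity>" for n
  proof -
    have "emeasure ?\<nu> (?A n) \<le> (\<integral>\<^sup>+x\<in>UNIV. ?f x \<partial>lborel)"
      unfolding em[OF borel_open[OF open_ball]] by (intro nn_integral_mono) (auto simp: indicator_def)
    also have "\<dots> < \<infinity>" using b(2) unfolding Lp_norm_finite_iff .
    finally show ?thesis by simp
  qed
  moreover have "decseq ?A"
  proof (rule decseq_SucI)
    fix n
    show "?A (Suc n) \<subseteq> ?A n" by (intro subset_ball divide_left_mono) auto
  qed
  ultimately have "(\<lambda>n. emeasure ?\<nu> (?A n)) \<longlonglongrightarrow> emeasure ?\<nu> (\<Inter>n. ?A n)"
    by (intro Lim_emeasure_decseq) auto
  moreover have "(\<Inter>n. ?A n) = {y}"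
  proof (intro equalityI subsetI)
    fix x assume x: "x \<in> (\<Inter>n. ?A n)"
    show "x \<in> {y}"
    proof (rule ccontr)
      assume "x \<notin> {y}"
      then have "0 < dist y x" by simp
      then obtain n where "1 / real (Suc n) < dist y x" using nat_approx_posE by blast
      moreover have "dist y x < 1 / real (Suc n)" using x by auto
      ultimately show False by linarith
    qed
  qed auto
  moreover have "emeasure ?\<nu> {y} = 0"
  proof -
    have "emeasure ?\<nu> {y} = (\<integral>\<^sup>+x\<in>{y}. ?f x \<partial>lborel)" by (rule em) simp
    also have "\<dots> = 0"
      by (subst nn_integral_0_iff_AE) (use AE_lborel_singleton[of y] in \<open>auto elim!: eventually_mono simp: indicator_def\<close>)
    finally show ?thesis .
  qed
  ultimately have "(\<lambda>n. emeasure ?\<nu> (?A n)) \<longlonglongrightarrow> 0" by simp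
  moreover have "0 < ennreal (e powr p)" using e by simp
  ultimately have "\<forall>\<^sub>F n in sequentially. emeasure ?\<nu> (?A n) < ennreal (e powr p)"
    by (rule order_tendstoD)
  then obtain n where n: "emeasure ?\<nu> (?A n) < ennreal (e powr p)"
    unfolding eventually_sequentially by blast
  let ?I = "\<integral>\<^sup>+x\<in>?A n. ?f x \<partial>lborel"
  have I: "?I < ennreal (e powr p)" using n unfolding em[OF borel_open[OF open_ball]] .
  then have "enn2real ?I \<le> e powr p"
    using enn2real_mono[of ?I "ennreal (e powr p)"] by simp
  then have "enn2real ?I powr (1 / p) \<le> (e powr p) powr (1 / p)"
    using p by (intro powr_mono2) auto
  also have "\<dots> = e" using p e by (simp add: powr_powr)
  finally have "Lp_norm p (?A n) b \<le> ennreal e"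
    using I by (auto simp: Lp_norm_def Let_def intro: ennreal_leI)
  then show ?thesis using that[of "1 / real (Suc n)"] by simp
qed

section \<open>Dynkin's formula for radial test functions\<close>

context continuous_markov_process
begin

lemma X_path_joint:
  assumes "g \<in> borel_measurable borel"
  shows "(\<lambda>(w, s). g (X (max 0 s) w)) \<in> borel_measurable (GX \<Otimes>\<^sub>M lborel)"
proof -
  have "(\<lambda>p :: 'w \<times> real. (snd p, fst p)) \<in> GX \<Otimes>\<^sub>M lborel \<rightarrow>\<^sub>M borel \<Otimes>\<^sub>M GX" by measurable
  from measurable_compose[OF this X_joint_comp[OF assms]] show ?thesis
    by (simp add: case_prod_unfold)
qed

lemma X_path_meas: "w \<in> Om \<Longrightarrow> g \<in> borel_measurable borel \<Longrightarrow> (\<lambda>s. g (X (max 0 s) w)) \<in> borel_measurable lborel"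
  using measurable_Pair2[OF X_path_joint, of g w] by simp

lemma nn_path_integral_meas:
  fixes g :: "real ^ 'n \<Rightarrow> ennreal"
  assumes "g \<in> borel_measurable borel" "\<sigma> \<in> borel_measurable GX"
  shows "(\<lambda>w. \<integral>\<^sup>+s. g (X (max 0 s) w) * indicator {0..\<sigma> w} s \<partial>lborel) \<in> borel_measurable GX"
proof (rule lborel.borel_measurable_nn_integral)
  have "(\<lambda>(w, s). indicator {0..\<sigma> w} s :: ennreal) \<in> borel_measurable (GX \<Otimes>\<^sub>M lborel)"
  proof -
    have "(\<lambda>(w, s). indicator {0..\<sigma> w} s :: ennreal) = indicator {p. 0 \<le> snd p \<and> snd p \<le> \<sigma> (fst p)}"
      by (auto simp: fun_eq_iff indicator_def)
    moreover have "{p \<in> space (GX \<Otimes>\<^sub>M lborel). 0 \<le> snd p \<and> snd p \<le> \<sigma> (fst p)} \<in> sets (GX \<Otimes>\<^sub>M lborel)"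
      using assms(2) by measurable
    ultimately show ?thesis by (simp add: borel_measurable_indicator_iff Int_def conj_commute)
  qed
  then show "(\<lambda>(w, s). g (X (max 0 s) w) * indicator {0..\<sigma> w} s) \<in> borel_measurable (GX \<Otimes>\<^sub>M lborel)"
    using X_path_joint[OF assms(1)] by (simp add: case_prod_unfold)
qed

lemma path_integral_meas:
  fixes g :: "real ^ 'n \<Rightarrow> real"
  assumes "g \<in> borel_measurable borel" "\<sigma> \<in> borel_measurable GX"
  shows "(\<lambda>w. \<integral>s. g (X (max 0 s) w) * indicator {0..\<sigma> w} s \<partial>lborel) \<in> borel_measurable GX"
proof (rule lborel.borel_measurable_lebesgue_integral)
  have "(\<lambda>(w, s). indicator {0..\<sigma> w} s :: real) \<in> borel_measurable (GX \<Otimes>\<^sub>M lborel)"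
  proof -
    have "(\<lambda>(w, s). indicator {0..\<sigma> w} s :: real) = indicator {p. 0 \<le> snd p \<and> snd p \<le> \<sigma> (fst p)}"
      by (auto simp: fun_eq_iff indicator_def)
    moreover have "{p \<in> space (GX \<Otimes>\<^sub>M lborel). 0 \<le> snd p \<and> snd p \<le> \<sigma> (fst p)} \<in> sets (GX \<Otimes>\<^sub>M lborel)"
      using assms(2) by measurable
    ultimately show ?thesis by (simp add: borel_measurable_indicator_iff Int_def conj_commute)
  qed
  then show "(\<lambda>(w, s). g (X (max 0 s) w) * indicator {0..\<sigma> w} s) \<in> borel_measurable (GX \<Otimes>\<^sub>M lborel)"
    using X_path_joint[OF assms(1)] by (simp add: case_prod_unfold)
qed

end

context quasi_diffusion
begin

context
  fixes \<phi> :: "real ^ 'n \<Rightarrow> real" and Kw K T :: real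
  assumes w_C2: "C2_compact_support \<phi>" and w_bdd: "bdd_borel Kw \<phi>" and w_cont: "continuous_on UNIV \<phi>"
    and L_meas: "diff_op a b \<phi> \<in> borel_measurable borel"
    and L_bound: "\<And>y. \<bar>diff_op a b \<phi> y\<bar> \<le> K * (1 + norm (b y))"
    and b_meas: "b \<in> borel_measurable borel"
    and T_pos: "0 < T"
begin

definition pint :: "real \<Rightarrow> 'w \<Rightarrow> real" where
  "pint t w = (\<integral>s. diff_op a b \<phi> (X (max 0 s) w) * indicator {0..t} s \<partial>lborel)"

definition pdom :: "'w \<Rightarrow> ennreal" where
  "pdom w = (\<integral>\<^sup>+s. ennreal (K * (1 + norm (b (X (max 0 s) w)))) * indicator {0..T} s \<partial>lborel)"

lemma K_nonneg: "0 \<le> K"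
proof -
  have "0 \<le> K * (1 + norm (b 0))" using L_bound[of 0] by linarith
  moreover have "0 < 1 + norm (b 0)" by (simp add: add_pos_nonneg)
  ultimately show ?thesis by (simp add: zero_le_mult_iff)
qed

lemma pdom_meas: "pdom \<in> borel_measurable GX"
  unfolding pdom_def[abs_def] by (rule nn_path_integral_meas) (use b_meas in auto)

lemma pdom_finite: "(\<integral>\<^sup>+w. pdom w \<partial>P y) < \<infinity>"
proof -
  let ?g = "\<lambda>w. \<integral>\<^sup>+s\<in>{0..T}. ennreal (norm (b (X s w))) \<partial>lborel"
  have eq: "?g w = (\<integral>\<^sup>+s. ennreal (norm (b (X (max 0 s) w))) * indicator {0..T} s \<partial>lborel)" for w
    by (intro nn_integral_cong) (auto simp: indicator_def max_absorb2)
  have g_meas: "?g \<in> borel_measurable GX"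
    unfolding eq by (rule nn_path_integral_meas) (use b_meas in auto)
  have "pdom w = ennreal K * (ennreal T + ?g w)" if "w \<in> Om" for w
  proof -
    have m: "(\<lambda>s. norm (b (X (max 0 s) w))) \<in> borel_measurable lborel"
      by (rule X_path_meas[OF that]) (use b_meas in auto)
    have "pdom w = (\<integral>\<^sup>+s. ennreal K * (indicator {0..T} s + ennreal (norm (b (X (max 0 s) w))) * indicator {0..T} s) \<partial>lborel)"
      unfolding pdom_def using K_nonneg
      by (intro nn_integral_cong) (auto simp: indicator_def ennreal_mult ennreal_plus)
    also have "\<dots> = ennreal K * ((\<integral>\<^sup>+s. indicator {0..T} s \<partial>lborel) + (\<integral>\<^sup>+s. ennreal (norm (b (X (max 0 s) w))) * indicator {0..T} s \<partial>lborel))"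
      using m by (simp add: nn_integral_cmult nn_integral_add)
    also have "\<dots> = ennreal K * (ennreal T + ?g w)" using T_pos unfolding eq by simp
    finally show ?thesis .
  qed
  then have "(\<integral>\<^sup>+w. pdom w \<partial>P y) = (\<integral>\<^sup>+w. ennreal K * (ennreal T + ?g w) \<partial>P y)"
    by (intro nn_integral_cong) simp
  also have "\<dots> = ennreal K * (ennreal T * emeasure (P y) Om + (\<integral>\<^sup>+w. ?g w \<partial>P y))"
    using meas_GX_P[OF g_meas] by (simp add: nn_integral_cmult nn_integral_add)
  also have "\<dots> < \<infinity>"
    using drift_integrable[of T y] T_pos
    by (auto simp: P.emeasure_eq_measure ennreal_mult_less_top ennreal_mult_eq_top_iff less_top[symmetric])
  finally show ?thesis .
qed

lemma pint_meas: "\<sigma> \<in> borel_measurable GX \<Longrightarrow> (\<lambda>w. pint (\<sigma> w) w) \<in> borel_measurable GX"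
  unfolding pint_def by (rule path_integral_meas[OF L_meas])

lemma L_le_dom: "t \<le> T \<Longrightarrow> ennreal \<bar>diff_op a b \<phi> (X (max 0 s) w) * indicator {0..t} s\<bar>
    \<le> ennreal (K * (1 + norm (b (X (max 0 s) w)))) * indicator {0..T} s"
  using L_bound[of "X (max 0 s) w"] by (auto simp: indicator_def intro: ennreal_leI)

lemma L_path_integrable:
  assumes "w \<in> Om" "pdom w < \<infinity>" "t \<le> T"
  shows "integrable lborel (\<lambda>s. diff_op a b \<phi> (X (max 0 s) w) * indicator {0..t} s)"
proof (rule integrableI_bounded)
  show "(\<lambda>s. diff_op a b \<phi> (X (max 0 s) w) * indicator {0..t} s) \<in> borel_measurable lborel"
    using X_path_meas[OF assms(1) L_meas] by measurable
  have "(\<integral>\<^sup>+s. ennreal (norm (diff_op a b \<phi> (X (max 0 s) w) * indicator {0..t} s)) \<partial>lborel) \<le> pdom w"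
    unfolding pdom_def real_norm_def by (intro nn_integral_mono L_le_dom assms)
  with assms(2) show "(\<integral>\<^sup>+s. ennreal (norm (diff_op a b \<phi> (X (max 0 s) w) * indicator {0..t} s)) \<partial>lborel) < \<infinity>"
    by simp
qed

lemma pint_le_pdom: "t \<le> T \<Longrightarrow> ennreal \<bar>pint t w\<bar> \<le> pdom w"
proof (cases "integrable lborel (\<lambda>s. diff_op a b \<phi> (X (max 0 s) w) * indicator {0..t} s)")
  case True
  assume "t \<le> T"
  have "ennreal \<bar>pint t w\<bar> \<le> (\<integral>\<^sup>+s. ennreal (norm (diff_op a b \<phi> (X (max 0 s) w) * indicator {0..t} s)) \<partial>lborel)"
    unfolding pint_def real_norm_def[symmetric] by (rule integral_norm_bound_ennreal[OF True])
  also have "\<dots> \<le> pdom w"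
    unfolding pdom_def real_norm_def by (intro nn_integral_mono L_le_dom \<open>t \<le> T\<close>)
  finally show ?thesis .
qed (simp add: pint_def not_integrable_integral_eq)

lemma pint_integrable:
  assumes "\<sigma> \<in> borel_measurable GX" "\<And>w. w \<in> Om \<Longrightarrow> \<sigma> w \<le> T"
  shows "integrable (P y) (\<lambda>w. pint (\<sigma> w) w)"
proof (rule integrableI_bounded)
  show "(\<lambda>w. pint (\<sigma> w) w) \<in> borel_measurable (P y)"
    by (rule meas_GX_P[OF pint_meas[OF assms(1)]])
  have "(\<integral>\<^sup>+w. ennreal (norm (pint (\<sigma> w) w)) \<partial>P y) \<le> (\<integral>\<^sup>+w. pdom w \<partial>P y)"
    by (intro nn_integral_mono) (use pint_le_pdom assms(2) in auto)
  also have "\<dots> < \<infinity>" by (rule pdom_finite)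
  finally show "(\<integral>\<^sup>+w. ennreal (norm (pint (\<sigma> w) w)) \<partial>P y) < \<infinity>" .
qed

lemma generator_pint:
  assumes "0 \<le> t"
  shows "\<phi> y = (\<integral>w. \<phi> (X t w) \<partial>P y) - (\<integral>w. pint t w \<partial>P y)"
proof -
  have "(LINT s:{0..t}|lborel. diff_op a b \<phi> (X s w)) = pint t w" for w
    unfolding pint_def set_lebesgue_integral_def
    by (intro Bochner_Integration.integral_cong) (auto simp: indicator_def max_absorb2)
  then show ?thesis using generator[OF assms w_C2, of y] by simp
qed

lemma pint_shift:
  assumes "w \<in> Om" "pdom w < \<infinity>" "0 \<le> s" "s \<le> T"
  shows "pint T w = pint s w + pint (T - s) (theta s w)"
proof -
  let ?L = "\<lambda>u. diff_op a b \<phi> (X (max 0 u) w)"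
  have th: "pint (T - s) (theta s w) = (\<integral>u. ?L (s + u) * indicator {0..T - s} u \<partial>lborel)"
    unfolding pint_def using theta(2)[OF assms(3,1)] assms(3)
    by (intro Bochner_Integration.integral_cong) (auto simp: indicator_def max_absorb2 add.commute)
  also have "\<dots> = (\<integral>u. ?L u * indicator {s..T} u \<partial>lborel)"
    using lborel_integral_real_affine[of 1 "\<lambda>u. ?L u * indicator {s..T} u" s] assms
    by (simp, intro Bochner_Integration.integral_cong) (auto simp: indicator_def)
  finally have 1: "pint (T - s) (theta s w) = (\<integral>u. ?L u * indicator {s..T} u \<partial>lborel)" .
  have I: "integrable lborel (\<lambda>u. ?L u * indicator {0..t} u)" if "t \<le> T" for t
    by (rule L_path_integrable[OF assms(1,2) that])
  have Is: "integrable lborel (\<lambda>u. ?L u * indicator {s..T} u)"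
  proof (rule Bochner_Integration.integrable_bound[OF I[OF order_refl]])
    show "(\<lambda>u. ?L u * indicator {s..T} u) \<in> borel_measurable lborel"
      using X_path_meas[OF assms(1) L_meas] by measurable
  qed (use assms in \<open>auto simp: indicator_def\<close>)
  have "pint T w = (\<integral>u. ?L u * indicator {0..s} u + ?L u * indicator {s..T} u \<partial>lborel)"
    unfolding pint_def
  proof (rule integral_cong_AE)
    show "AE u in lborel. ?L u * indicator {0..T} u = ?L u * indicator {0..s} u + ?L u * indicator {s..T} u"
      using AE_lborel_singleton[of s] by eventually_elim (use assms in \<open>auto simp: indicator_def\<close>)
  qed (use X_path_meas[OF assms(1) L_meas] in measurable)
  also have "\<dots> = pint s w + (\<integral>u. ?L u * indicator {s..T} u \<partial>lborel)"
    unfolding pint_def by (rule Bochner_Integration.integral_add[OF I[OF assms(4)] Is])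
  finally show ?thesis using 1 by simp
qed

lemma AE_pdom_finite: "AE w in P y. pdom w < \<infinity>"
  using nn_integral_PInf_AE[OF meas_GX_P[OF pdom_meas]] pdom_finite[of y]
  by (auto simp: less_top elim!: eventually_mono)

theorem dynkin:
  assumes \<sigma>: "stopping T \<sigma>"
  shows "\<phi> x = (\<integral>w. \<phi> (X (\<sigma> w) w) \<partial>P x) - (\<integral>w. pint (\<sigma> w) w \<partial>P x)"
proof -
  define Y where "Y = (\<lambda>s w. \<phi> (X s w) - pint s w)"
  have const: "(\<lambda>w. t) \<in> borel_measurable GX" for t :: real by simp
  have iw: "integrable (P y) (\<lambda>w. \<phi> (X s w))" if "0 \<le> s" for s y
    by (rule integrable_f_X[OF that w_bdd])
  have ip: "integrable (P y) (\<lambda>w. pint s w)" if "s \<le> T" for s y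
    using pint_integrable[OF const[of s]] that by simp
  have iY: "integrable (P y) (Y s)" if "0 \<le> s" "s \<le> T" for s y
    unfolding Y_def by (intro Bochner_Integration.integrable_diff iw ip that)
  have mart: "\<bar>(\<integral>w. Y T w * indicator B w \<partial>P x) - (\<integral>w. Y s w * indicator B w \<partial>P x)\<bar> \<le> 0 * s * measure (P x) B"
    if s: "0 \<le> s" "s \<le> T" and B: "B \<in> sets (F s)" for s B
  proof -
    define G where "G = (\<lambda>w. \<phi> (X (T - s) w) - \<phi> (X 0 w) - pint (T - s) w)"
    have wm: "\<phi> \<in> borel_measurable borel" using w_bdd by (rule bdd_borelD)
    have G_meas: "G \<in> borel_measurable GX"
      unfolding G_def using s
      by (intro borel_measurable_diff measurable_compose[OF X_meas wm] pint_meas[OF const]) auto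
    have iG: "integrable (P y) G" for y
      unfolding G_def using s by (intro Bochner_Integration.integrable_diff iw ip) auto
    have EG: "(\<integral>w. G w \<partial>P y) = 0" for y
    proof -
      have "(\<integral>w. G w \<partial>P y) = (\<integral>w. \<phi> (X (T - s) w) \<partial>P y) - (\<integral>w. \<phi> (X 0 w) \<partial>P y) - (\<integral>w. pint (T - s) w \<partial>P y)"
        unfolding G_def using s iw[of "T - s" y] iw[of 0 y] ip[of "T - s" y] by simp
      also have "(\<integral>w. \<phi> (X 0 w) \<partial>P y) = \<phi> y" by (rule P_integral_start[OF wm])
      finally show ?thesis using generator_pint[of "T - s" y] s by simp
    qed
    have G\<theta>: "AE w in P x. G (theta s w) = Y T w - Y s w"
      using AE_pdom_finite[of x] AE_space[of "P x"]
    proof eventually_elim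
      case (elim w)
      then have "w \<in> Om" by simp
      then show ?case
        using pint_shift[OF \<open>w \<in> Om\<close> elim(1) s] theta(2)[OF s(1) \<open>w \<in> Om\<close>] s by (simp add: G_def Y_def)
    qed
    have G\<theta>m: "(\<lambda>w. G (theta s w)) \<in> borel_measurable (P x)"
      by (rule meas_GX_P[OF measurable_compose[OF theta_meas[OF s(1)] G_meas]])
    have Ym: "Y s \<in> borel_measurable (P x)" "Y T \<in> borel_measurable (P x)"
      using borel_measurable_integrable[OF iY] s T_pos by auto
    have iG\<theta>: "integrable (P x) (\<lambda>w. G (theta s w))"
      using integrable_cong_AE[OF G\<theta>m _ G\<theta>] iY[of T x] iY[OF s, of x] T_pos by auto
    have BP: "B \<in> sets (P x)" using sets_F[OF s(1) B] .
    have "(\<integral>w. Y T w * indicator B w \<partial>P x) - (\<integral>w. Y s w * indicator B w \<partial>P x)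
      = (\<integral>w. (Y T w - Y s w) * indicator B w \<partial>P x)"
      using iY[of T x] iY[OF s, of x] T_pos BP
      by (simp add: left_diff_distrib integrable_real_mult_indicator)
    also have "\<dots> = (\<integral>w. G (theta s w) * indicator B w \<partial>P x)"
    proof (rule integral_cong_AE)
      show "AE w in P x. (Y T w - Y s w) * indicator B w = G (theta s w) * indicator B w"
        using G\<theta> by eventually_elim simp
    qed (use Ym BP G\<theta>m in \<open>auto intro!: borel_measurable_times borel_measurable_diff borel_measurable_indicator\<close>)
    also have "\<dots> = (\<integral>w. (\<integral>w'. G w' \<partial>P (X s w)) * indicator B w \<partial>P x)"
      by (rule markov_real(2)[OF s(1) G_meas B iG iG\<theta>])
    also have "\<dots> = 0" by (simp add: EG)
    finally show ?thesis by simp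
  qed
  have T0: "0 \<le> T" using T_pos by simp
  have EYT: "(\<integral>w. Y T w \<partial>P x) = \<phi> x"
    using generator_pint[OF T0, of x] iw[OF T0, of x] ip[of T x] by (simp add: Y_def)
  note ge = grid_expectation[where C = 0, OF \<sigma> T_pos _ order_refl iY[OF T0 order_refl, of x] iY mart]
  have iYn: "integrable (P x) (\<lambda>w. Y (grid T (Suc n) (\<sigma> w)) w)" for n
    by (rule ge(1)) simp_all
  have EYn: "(\<integral>w. Y (grid T (Suc n) (\<sigma> w)) w \<partial>P x) = \<phi> x" for n
  proof -
    have "\<bar>(\<integral>w. Y T w \<partial>P x) - (\<integral>w. Y (grid T (Suc n) (\<sigma> w)) w \<partial>P x)\<bar> \<le> 0 * T"
      by (rule ge(2)) simp_all
    then show ?thesis unfolding EYT by simp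
  qed
  have "(\<lambda>n. \<integral>w. Y (grid T (Suc n) (\<sigma> w)) w \<partial>P x) \<longlonglongrightarrow> (\<integral>w. Y (\<sigma> w) w \<partial>P x)"
  proof (rule integral_dominated_convergence)
    show "integrable (P x) (\<lambda>w. Kw + enn2real (pdom w))"
    proof (intro Bochner_Integration.integrable_add P.integrable_const integrableI_bounded)
      show "(\<integral>\<^sup>+w. ennreal (norm (enn2real (pdom w))) \<partial>P x) < \<infinity>"
      proof -
        have "(\<integral>\<^sup>+w. ennreal (norm (enn2real (pdom w))) \<partial>P x) \<le> (\<integral>\<^sup>+w. pdom w \<partial>P x)"
          by (intro nn_integral_mono) (simp add: ennreal_enn2real_if)
        then show ?thesis using pdom_finite[of x] by simp
      qed
    qed (use meas_GX_P[OF pdom_meas] in auto)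
    have wm: "\<phi> \<in> borel_measurable borel" using w_bdd by (rule bdd_borelD)
    show "(\<lambda>w. Y (\<sigma> w) w) \<in> borel_measurable (P x)"
      unfolding Y_def
      by (intro borel_measurable_diff meas_GX_P[OF measurable_compose[OF X_stopping_meas[OF \<sigma>] wm]]
          meas_GX_P[OF pint_meas] stoppingD[OF \<sigma>])
    show "(\<lambda>w. Y (grid T (Suc n) (\<sigma> w)) w) \<in> borel_measurable (P x)" for n
      by (rule borel_measurable_integrable[OF iYn])
    show "AE w in P x. norm (Y (grid T (Suc n) (\<sigma> w)) w) \<le> Kw + enn2real (pdom w)" for n
      using AE_pdom_finite[of x] AE_space[of "P x"]
    proof eventually_elim
      case (elim w)
      then have w: "w \<in> Om" by simp
      have "grid T (Suc n) (\<sigma> w) \<le> T" using grid_le[OF T_pos _ stoppingD(2)[OF \<sigma> w], of "Suc n"] by simp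
      then have "ennreal \<bar>pint (grid T (Suc n) (\<sigma> w)) w\<bar> \<le> pdom w" by (rule pint_le_pdom)
      then have "\<bar>pint (grid T (Suc n) (\<sigma> w)) w\<bar> \<le> enn2real (pdom w)"
        using elim(1) enn2real_mono[of "ennreal \<bar>pint (grid T (Suc n) (\<sigma> w)) w\<bar>" "pdom w"] by simp
      with bdd_borelD(2)[OF w_bdd, of "X (grid T (Suc n) (\<sigma> w)) w"] show ?case
        unfolding Y_def real_norm_def by linarith
    qed
    show "AE w in P x. (\<lambda>n. Y (grid T (Suc n) (\<sigma> w)) w) \<longlonglongrightarrow> Y (\<sigma> w) w"
      using AE_pdom_finite[of x] AE_space[of "P x"]
    proof eventually_elim
      case (elim w)
      then have w: "w \<in> Om" by simp
      have 1: "(\<lambda>n. \<phi> (X (grid T (Suc n) (\<sigma> w)) w)) \<longlonglongrightarrow> \<phi> (X (\<sigma> w) w)"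
        by (rule continuous_on_tendsto_compose[OF w_cont LIMSEQ_Suc[OF X_grid_tendsto[OF \<sigma> T_pos w]]]) auto
      have 2: "(\<lambda>n. pint (grid T (Suc n) (\<sigma> w)) w) \<longlonglongrightarrow> pint (\<sigma> w) w"
        unfolding pint_def
      proof (rule integral_dominated_convergence)
        let ?L = "\<lambda>s. diff_op a b \<phi> (X (max 0 s) w)"
        show "integrable lborel (\<lambda>s. \<bar>?L s * indicator {0..T} s\<bar>)"
          by (intro integrable_abs L_path_integrable w elim(1)) simp
        show "(\<lambda>s. ?L s * indicator {0..t} s) \<in> borel_measurable lborel" for t
          using X_path_meas[OF w L_meas] by measurable
        then show "(\<lambda>s. ?L s * indicator {0..grid T (Suc n) (\<sigma> w)} s) \<in> borel_measurable lborel" for n .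
        have "grid T (Suc n) (\<sigma> w) \<le> T" for n using grid_le[OF T_pos _ stoppingD(2)[OF \<sigma> w], of "Suc n"] by simp
        then show "AE s in lborel. norm (?L s * indicator {0..grid T (Suc n) (\<sigma> w)} s) \<le> \<bar>?L s * indicator {0..T} s\<bar>" for n
          by (intro AE_I2) (auto simp: indicator_def intro: order_trans)
        show "AE s in lborel. (\<lambda>n. ?L s * indicator {0..grid T (Suc n) (\<sigma> w)} s) \<longlonglongrightarrow> ?L s * indicator {0..\<sigma> w} s"
        proof (intro AE_I2 tendsto_mult tendsto_const)
          fix s :: real
          show "(\<lambda>n. indicator {0..grid T (Suc n) (\<sigma> w)} s :: real) \<longlonglongrightarrow> indicator {0..\<sigma> w} s"
          proof (cases "s \<le> \<sigma> w")
            case True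
            then have "s \<le> grid T (Suc n) (\<sigma> w)" for n
              using grid_ge[OF T_pos, of "Suc n" "\<sigma> w"] by simp
            with True show ?thesis by (simp add: indicator_def)
          next
            case False
            have "\<forall>\<^sub>F n in sequentially. grid T (Suc n) (\<sigma> w) < s"
              using False by (intro order_tendstoD(2)[OF LIMSEQ_Suc[OF tendsto_grid[OF T_pos]]]) simp
            then have "\<forall>\<^sub>F n in sequentially. (indicator {0..grid T (Suc n) (\<sigma> w)} s :: real) = indicator {0..\<sigma> w} s"
              by eventually_elim (use False in \<open>auto simp: indicator_def\<close>)
            then show ?thesis by (rule tendsto_eventually)
          qed
        qed
      qed
      show ?case unfolding Y_def by (rule tendsto_diff[OF 1 2])
    qed
  qed
  then have "\<phi> x = (\<integral>w. Y (\<sigma> w) w \<partial>P x)" unfolding EYn by (rule LIMSEQ_unique[OF tendsto_const])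
  also have "\<dots> = (\<integral>w. \<phi> (X (\<sigma> w) w) \<partial>P x) - (\<integral>w. pint (\<sigma> w) w \<partial>P x)"
    unfolding Y_def
  proof (rule Bochner_Integration.integral_diff)
    have wm: "\<phi> \<in> borel_measurable borel" using w_bdd by (rule bdd_borelD)
    show "integrable (P x) (\<lambda>w. \<phi> (X (\<sigma> w) w))"
      by (rule integrable_bounded_GX[where K = Kw])
        (use measurable_compose[OF X_stopping_meas[OF \<sigma>] wm] bdd_borelD(2)[OF w_bdd] in auto)
    show "integrable (P x) (\<lambda>w. pint (\<sigma> w) w)" by (intro pint_integrable stoppingD[OF \<sigma>])
  qed
  finally show ?thesis .
qed

end

end

lemma ennreal_integral_le_nn_integral:
  fixes f :: "'a \<Rightarrow> real"
  shows "ennreal (\<integral>x. f x \<partial>M) \<le> (\<integral>\<^sup>+x. ennreal (f x) \<partial>M)"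
proof (cases "integrable M f")
  case True
  then have fin: "(\<integral>\<^sup>+x. ennreal (f x) \<partial>M) < \<infinity>" by (simp add: real_integrable_def less_top)
  have "(\<integral>x. f x \<partial>M) \<le> enn2real (\<integral>\<^sup>+x. ennreal (f x) \<partial>M)"
    unfolding real_lebesgue_integral_def[OF True] by simp
  then have "ennreal (\<integral>x. f x \<partial>M) \<le> ennreal (enn2real (\<integral>\<^sup>+x. ennreal (f x) \<partial>M))" by (rule ennreal_leI)
  also have "\<dots> = (\<integral>\<^sup>+x. ennreal (f x) \<partial>M)" using fin by simp
  finally show ?thesis .
qed (simp add: not_integrable_integral_eq)

lemma integral_le_of_nn_integral_le:
  fixes f :: "'a \<Rightarrow> real"
  assumes "(\<integral>\<^sup>+x. ennreal (f x) \<partial>M) \<le> ennreal c" "0 \<le> c"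
  shows "(\<integral>x. f x \<partial>M) \<le> c"
  using order_trans[OF ennreal_integral_le_nn_integral assms(1)] assms(2) by (simp add: ennreal_le_iff)

lemma emeasure_ball_powr:
  fixes x :: "real ^ 'n"
  assumes "0 \<le> r"
  shows "measure lborel (ball x r) = unit_ball_vol (real CARD('n)) * r ^ CARD('n)"
    "measure lborel (ball x r) powr (1 / real CARD('n)) = unit_ball_vol (real CARD('n)) powr (1 / real CARD('n)) * r"
proof -
  show 1: "measure lborel (ball x r) = unit_ball_vol (real CARD('n)) * r ^ CARD('n)"
    using content_ball[OF assms, of x] by simp
  have "(r ^ CARD('n)) powr (1 / real CARD('n)) = r"
  proof (cases "r = 0")
    case False
    then have "r ^ CARD('n) = r powr real CARD('n)" using assms by (simp add: powr_realpow)
    then show ?thesis using assms False by (simp add: powr_powr)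
  qed (simp add: zero_power)
  then show "measure lborel (ball x r) powr (1 / real CARD('n)) = unit_ball_vol (real CARD('n)) powr (1 / real CARD('n)) * r"
    unfolding 1 using assms by (simp add: powr_mult unit_ball_vol_nonneg)
qed

section \<open>Exit estimates\<close>

locale elliptic_diffusion = quasi_diffusion X F P a b
  for X :: "real \<Rightarrow> 'w \<Rightarrow> real ^ 'n" and F P a b +
  fixes \<delta> N0 :: real
  assumes \<delta>_pos: "0 < \<delta>" and a_meas: "a \<in> borel_measurable borel" and a_ell: "a x \<in> ellip_mats \<delta>"
    and b_meas: "b \<in> borel_measurable borel" and b_Lp: "Lp_norm (real CARD('n)) UNIV b < \<infinity>"
    and N0_pos: "0 < N0"
    and exit_bd: "f \<in> borel_measurable borel \<Longrightarrow> (\<And>y. 0 \<le> f y) \<Longrightarrow> 0 < r \<Longrightarrow>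
      (\<integral>\<^sup>+w. (\<integral>\<^sup>+t\<in>before_exit (ball x r) (\<lambda>t. X t w). ennreal (f (X t w)) \<partial>lborel) \<partial>P x)
        \<le> ennreal (N0 * r) * Lp_norm (real CARD('n)) (ball x r) f"
begin

abbreviation "drift x r \<equiv> Lp_norm (real CARD('n)) (ball x r) b"

lemma d_pos: "0 < real CARD('n)" by simp

lemma drift_mono: "ball x r \<subseteq> ball x' r' \<Longrightarrow> drift x r \<le> drift x' r'"
  by (rule Lp_norm_mono) auto

lemma drift_small:
  assumes "0 < e"
  obtains r where "0 < r" "drift y r \<le> ennreal e"
  using Lp_norm_ball_small[OF d_pos b_meas b_Lp assms] by blast

lemma ell_lower: "\<delta> * (norm v)\<^sup>2 \<le> v \<bullet> (a y *v v)"
  by (rule ellip_mats_lower[OF a_ell])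

lemma ell_nonneg: "0 \<le> v \<bullet> (a y *v v)"
  using order_trans[OF _ ell_lower[of v y]] \<delta>_pos by simp

lemma trace_le: "(\<Sum>i\<in>UNIV. a y $ i $ i) \<le> real CARD('n) / \<delta>"
  by (rule ellip_mats_trace[OF a_ell])

lemma trace_nonneg: "0 \<le> (\<Sum>i\<in>UNIV. a y $ i $ i)"
proof (rule sum_nonneg)
  fix i
  have "axis i 1 \<bullet> (a y *v axis i 1) = a y $ i $ i"
    by (simp add: inner_axis' matrix_vector_mult_basis column_def)
  then show "0 \<le> a y $ i $ i" using ell_nonneg[of "axis i 1" y] by simp
qed

lemma diff_op_bump_meas:
  assumes "3 \<le> k"
  shows "diff_op a b (bump z S k) \<in> borel_measurable borel"
proof -
  have comp: "(\<lambda>y. a y $ i $ j) \<in> borel_measurable borel" for i j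
  proof -
    have "(\<lambda>A :: real ^ 'n ^ 'n. A $ i $ j) \<in> borel_measurable borel"
      by (intro borel_measurable_continuous_onI continuous_intros)
    from measurable_compose[OF a_meas this] show ?thesis .
  qed
  have q: "(\<lambda>y. (y - z) \<bullet> (a y *v (y - z))) = (\<lambda>y. \<Sum>i\<in>UNIV. \<Sum>j\<in>UNIV. (y - z) $ i * (a y $ i $ j * (y - z) $ j))"
    by (simp add: inner_vec_def matrix_vector_mult_def sum_distrib_left)
  have yz: "(\<lambda>y. (y - z) $ i) \<in> borel_measurable borel" for i
    by (intro borel_measurable_continuous_onI continuous_intros)
  have m1: "(\<lambda>y. (y - z) \<bullet> (a y *v (y - z))) \<in> borel_measurable borel"
    unfolding q by (intro borel_measurable_sum borel_measurable_times comp yz)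
  have m2: "(\<lambda>y. \<Sum>i\<in>UNIV. a y $ i $ i) \<in> borel_measurable borel"
    by (intro borel_measurable_sum comp)
  have m3: "(\<lambda>y. b y \<bullet> (y - z)) \<in> borel_measurable borel"
    using b_meas by (intro borel_measurable_inner) auto
  have m4: "bump z S j \<in> borel_measurable borel" for j
    by (rule borel_measurable_continuous_onI[OF continuous_on_bump])
  have "diff_op a b (bump z S k) = (\<lambda>x. 2 * real k * real (k - 1) * bump z S (k - 2) x * ((x - z) \<bullet> (a x *v (x - z)))
    - real k * bump z S (k - 1) x * ((\<Sum>i\<in>UNIV. a x $ i $ i) + 2 * (b x \<bullet> (x - z))))"
    using diff_op_bump[OF assms] by blast
  then show ?thesis
    using m1 m2 m3 m4
    by (auto intro!: borel_measurable_diff borel_measurable_times borel_measurable_add)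
qed

lemma bump_0: "S \<le> (norm (y - z))\<^sup>2 \<Longrightarrow> 0 < j \<Longrightarrow> bump z S j y = 0"
  by (simp add: bump_def max_absorb1)

lemma diff_op_bump_bound:
  assumes k: "3 \<le> k" and S: "0 < S"
  shows "\<exists>K. \<forall>y. \<bar>diff_op a b (bump z S k) y\<bar> \<le> K * (1 + norm (b y))"
proof (intro exI allI)
  fix y
  define A where "A = 2 * real k * real (k - 1) * S ^ (k - 2) * (S / \<delta>)"
  define B where "B = real k * S ^ (k - 1)"
  have AB: "0 \<le> A" "0 \<le> B" using S \<delta>_pos by (auto simp: A_def B_def)
  have dd: "0 \<le> real CARD('n) / \<delta>" using \<delta>_pos by simp
  show "\<bar>diff_op a b (bump z S k) y\<bar> \<le> (A + B * (real CARD('n) / \<delta>) + 2 * B * sqrt S) * (1 + norm (b y))"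
  proof (cases "S \<le> (norm (y - z))\<^sup>2")
    case True
    have "0 \<le> (A + B * (real CARD('n) / \<delta>) + 2 * B * sqrt S) * (1 + norm (b y))"
      using AB dd S by (intro mult_nonneg_nonneg add_nonneg_nonneg) auto
    with True k show ?thesis by (simp add: diff_op_bump bump_0)
  next
    case False
    then have n2: "(norm (y - z))\<^sup>2 \<le> S" by simp
    then have n: "norm (y - z) \<le> sqrt S" by (rule real_le_rsqrt)
    have q: "(y - z) \<bullet> (a y *v (y - z)) \<le> S / \<delta>"
      using ellip_mats_upper[OF a_ell[of y], of "y - z"] divide_right_mono[OF n2, of \<delta>] \<delta>_pos by simp
    have 1: "2 * real k * real (k - 1) * bump z S (k - 2) y * ((y - z) \<bullet> (a y *v (y - z))) \<le> A"
      unfolding A_def using bump_le[of S z "k - 2" y] bump_nonneg[of z S "k - 2" y] S q ell_nonneg[of "y - z" y]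
      by (intro mult_mono mult_left_mono) auto
    have 10: "0 \<le> 2 * real k * real (k - 1) * bump z S (k - 2) y * ((y - z) \<bullet> (a y *v (y - z)))"
      using bump_nonneg[of z S "k - 2" y] ell_nonneg[of "y - z" y] by simp
    have "\<bar>b y \<bullet> (y - z)\<bar> \<le> norm (b y) * norm (y - z)" by (rule Cauchy_Schwarz_ineq2)
    also have "\<dots> \<le> norm (b y) * sqrt S" by (intro mult_left_mono n) simp
    finally have "\<bar>(\<Sum>i\<in>UNIV. a y $ i $ i) + 2 * (b y \<bullet> (y - z))\<bar> \<le> real CARD('n) / \<delta> + 2 * (norm (b y) * sqrt S)"
      using trace_le[of y] trace_nonneg[of y] by linarith
    then have 2: "\<bar>real k * bump z S (k - 1) y * ((\<Sum>i\<in>UNIV. a y $ i $ i) + 2 * (b y \<bullet> (y - z)))\<bar>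
        \<le> B * (real CARD('n) / \<delta> + 2 * (norm (b y) * sqrt S))"
      unfolding abs_mult B_def using bump_le[of S z "k - 1" y] bump_nonneg[of z S "k - 1" y] S
      by (intro mult_mono) auto
    have "\<bar>diff_op a b (bump z S k) y\<bar> \<le> A + B * (real CARD('n) / \<delta> + 2 * (norm (b y) * sqrt S))"
      unfolding diff_op_bump[OF k] using 1 10 2 by linarith
    also have "\<dots> \<le> (A + B * (real CARD('n) / \<delta>) + 2 * B * sqrt S) * (1 + norm (b y))"
    proof -
      have "0 \<le> A * norm (b y)" "0 \<le> B * (real CARD('n) / \<delta>) * norm (b y)" "0 \<le> 2 * B * sqrt S"
        using AB dd S by (intro mult_nonneg_nonneg; simp)+
      then show ?thesis by (simp add: distrib_left distrib_right)
    qed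
    finally show ?thesis .
  qed
qed

lemma bump_dynkin_lower:
  assumes k: "3 \<le> k" and S: "0 < S" and T: "0 < T" and O1: "open O1" "O1 \<subseteq> ball x r" and r: "0 < r"
    and c: "0 \<le> c0" "0 \<le> c1" "0 \<le> \<beta>"
    and lower: "\<And>y. y \<in> O1 \<Longrightarrow> - (c0 + c1 * norm (b y)) \<le> diff_op a b (bump z S k) y"
    and drift: "drift x r \<le> ennreal \<beta>"
  shows "bump z S k x - c0 * T - c1 * (N0 * r * \<beta>) \<le> (\<integral>w. bump z S k (X (hitX O1 T w) w) \<partial>P x)"
proof -
  let ?\<phi> = "bump z S k" and ?\<sigma> = "hitX O1 T"
  obtain K where K: "\<And>y. \<bar>diff_op a b ?\<phi> y\<bar> \<le> K * (1 + norm (b y))"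
    using diff_op_bump_bound[OF k S] by blast
  have w_bdd: "bdd_borel (S ^ k) ?\<phi>"
    unfolding bdd_borel_def using bump_le[of S z k] bump_nonneg[of z S k] S
    by (auto intro: borel_measurable_continuous_onI continuous_on_bump)
  note L_meas = diff_op_bump_meas[OF k]
  have \<sigma>: "stopping T ?\<sigma>" by (rule stopping_hitX) (use O1 T in auto)
  note D = dynkin[OF C2_compact_support_bump[OF k] w_bdd continuous_on_bump L_meas K b_meas T \<sigma>, of x]
  let ?D = "\<lambda>w. \<integral>\<^sup>+s. ennreal (norm (b (X (max 0 s) w))) * indicator {0..?\<sigma> w} s \<partial>lborel"
  have pw: "ennreal (- pint ?\<phi> (?\<sigma> w) w) \<le> ennreal (c0 * T) + ennreal c1 * ?D w" if w: "w \<in> Om" for w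
  proof -
    let ?L = "\<lambda>s. diff_op a b ?\<phi> (X (max 0 s) w)"
    have b_m: "(\<lambda>s. norm (b (X (max 0 s) w))) \<in> borel_measurable lborel"
      by (rule X_path_meas[OF w]) (use b_meas in auto)
    have "- pint ?\<phi> (?\<sigma> w) w = (\<integral>s. - (?L s * indicator {0..?\<sigma> w} s) \<partial>lborel)"
      by (subst pint_def[OF C2_compact_support_bump[OF k] w_bdd continuous_on_bump L_meas K b_meas T]) simp
    then have "ennreal (- pint ?\<phi> (?\<sigma> w) w) \<le> (\<integral>\<^sup>+s. ennreal (- (?L s * indicator {0..?\<sigma> w} s)) \<partial>lborel)"
      using ennreal_integral_le_nn_integral by metis
    also have "\<dots> \<le> (\<integral>\<^sup>+s. ennreal c0 * indicator {0..T} s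
        + ennreal c1 * (ennreal (norm (b (X (max 0 s) w))) * indicator {0..?\<sigma> w} s) \<partial>lborel)"
    proof (rule nn_integral_mono_AE)
      show "AE s in lborel. ennreal (- (?L s * indicator {0..?\<sigma> w} s)) \<le> ennreal c0 * indicator {0..T} s
        + ennreal c1 * (ennreal (norm (b (X (max 0 s) w))) * indicator {0..?\<sigma> w} s)"
        using AE_lborel_singleton[of "?\<sigma> w"]
      proof eventually_elim
        case (elim s)
        show ?case
        proof (cases "0 \<le> s \<and> s < ?\<sigma> w")
          case True
          then have "X s w \<in> O1" by (intro less_hit_imp_in[of s O1 T]) auto
          then have "- ?L s \<le> c0 + c1 * norm (b (X s w))" using lower[of "X s w"] True by (simp add: max_absorb2)
          then have "ennreal (- ?L s) \<le> ennreal (c0 + c1 * norm (b (X s w)))" by (rule ennreal_leI)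
          then show ?thesis
            using True hit_le[of O1 T "\<lambda>t. X t w"] c
            by (simp add: ennreal_plus ennreal_mult max_absorb2)
        qed (use elim in \<open>auto simp: indicator_def\<close>)
      qed
    qed
    also have "\<dots> = ennreal c0 * ennreal T + ennreal c1 * ?D w"
      using b_m T by (simp add: nn_integral_add nn_integral_cmult)
    finally show ?thesis using c T by (simp add: ennreal_mult)
  qed
  have D_bd: "(\<integral>\<^sup>+w. ?D w \<partial>P x) \<le> ennreal (N0 * r * \<beta>)"
  proof -
    have "(\<integral>\<^sup>+w. ?D w \<partial>P x)
      \<le> (\<integral>\<^sup>+w. (\<integral>\<^sup>+t\<in>before_exit (ball x r) (\<lambda>t. X t w). ennreal (norm (b (X t w))) \<partial>lborel) \<partial>P x)"
    proof (rule nn_integral_mono, rule nn_integral_mono_AE)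
      fix w
      show "AE s in lborel. ennreal (norm (b (X (max 0 s) w))) * indicator {0..?\<sigma> w} s
        \<le> ennreal (norm (b (X s w))) * indicator (before_exit (ball x r) (\<lambda>t. X t w)) s"
        using AE_lborel_singleton[of "?\<sigma> w"]
      proof eventually_elim
        case (elim s)
        show ?case
        proof (cases "0 \<le> s \<and> s < ?\<sigma> w")
          case True
          moreover have "?\<sigma> w \<le> hitX (ball x r) T w" using T by (intro hit_mono[OF O1(2)]) auto
          ultimately have "s \<in> before_exit (ball x r) (\<lambda>t. X t w)"
            by (intro less_hit_before_exit[of s "ball x r" T]) auto
          then show ?thesis using True by (simp add: max_absorb2)
        qed (use elim in \<open>auto simp: indicator_def\<close>)
      qed
    qed
    also have "\<dots> \<le> ennreal (N0 * r) * Lp_norm (real CARD('n)) (ball x r) (\<lambda>y. norm (b y))"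
      by (rule exit_bd) (use b_meas r in auto)
    also have "\<dots> \<le> ennreal (N0 * r) * ennreal \<beta>"
      unfolding Lp_norm_norm by (intro mult_left_mono drift) simp
    finally show ?thesis using N0_pos r c by (simp add: ennreal_mult)
  qed
  have D_meas: "?D \<in> borel_measurable (P x)"
    by (rule meas_GX_P[OF nn_path_integral_meas]) (use b_meas stoppingD(3)[OF \<sigma>] in auto)
  have "(\<integral>\<^sup>+w. ennreal (- pint ?\<phi> (?\<sigma> w) w) \<partial>P x) \<le> (\<integral>\<^sup>+w. ennreal (c0 * T) + ennreal c1 * ?D w \<partial>P x)"
    by (intro nn_integral_mono) (use pw in simp)
  also have "\<dots> = ennreal (c0 * T) + ennreal c1 * (\<integral>\<^sup>+w. ?D w \<partial>P x)"
    using D_meas P.emeasure_space_1[of x] by (simp add: nn_integral_add nn_integral_cmult)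
  also have "\<dots> \<le> ennreal (c0 * T) + ennreal c1 * ennreal (N0 * r * \<beta>)"
    by (intro add_left_mono mult_left_mono D_bd) simp
  also have "\<dots> = ennreal (c0 * T + c1 * (N0 * r * \<beta>))"
    using c T N0_pos r by (simp add: ennreal_plus ennreal_mult)
  finally have "(\<integral>w. - pint ?\<phi> (?\<sigma> w) w \<partial>P x) \<le> c0 * T + c1 * (N0 * r * \<beta>)"
    by (rule integral_le_of_nn_integral_le) (use c T N0_pos r in auto)
  then show ?thesis using D by simp
qed

lemma stay_prob:
  assumes r: "0 < r" and T: "0 < T" and \<beta>: "0 \<le> \<beta>" and drift: "drift x r \<le> ennreal \<beta>"
  shows "1 - 3 * real CARD('n) * T / (\<delta> * r\<^sup>2) - 6 * N0 * \<beta> \<le> measure (P x) {w \<in> Om. hitX (ball x r) T w = T}"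
proof -
  let ?\<phi> = "bump x (r\<^sup>2) 3" and ?\<sigma> = "hitX (ball x r) T"
  let ?c0 = "3 * (r\<^sup>2)\<^sup>2 * (real CARD('n) / \<delta>)" and ?c1 = "6 * (r\<^sup>2)\<^sup>2 * r"
  have E: "{w \<in> Om. ?\<sigma> w = T} \<in> sets (P x)"
  proof -
    have "?\<sigma> -` {T} \<inter> space GX \<in> sets GX"
      by (rule measurable_sets[OF hitX_meas]) (use T in auto)
    moreover have "{w \<in> Om. ?\<sigma> w = T} = ?\<sigma> -` {T} \<inter> space GX" by auto
    ultimately show ?thesis using sets_GX_sub[of x] by auto
  qed
  have low: "- (?c0 + ?c1 * norm (b y)) \<le> diff_op a b ?\<phi> y" if "y \<in> ball x r" for y
  proof -
    have n: "norm (y - x) \<le> r" using that by (simp add: dist_norm norm_minus_commute)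
    have "\<bar>b y \<bullet> (y - x)\<bar> \<le> norm (b y) * norm (y - x)" by (rule Cauchy_Schwarz_ineq2)
    also have "\<dots> \<le> norm (b y) * r" by (intro mult_left_mono n) simp
    finally have tr: "(\<Sum>i\<in>UNIV. a y $ i $ i) + 2 * (b y \<bullet> (y - x)) \<le> real CARD('n) / \<delta> + 2 * (norm (b y) * r)"
      using trace_le[of y] by linarith
    have "bump x (r\<^sup>2) 2 y * ((\<Sum>i\<in>UNIV. a y $ i $ i) + 2 * (b y \<bullet> (y - x)))
      \<le> bump x (r\<^sup>2) 2 y * (real CARD('n) / \<delta> + 2 * (norm (b y) * r))"
      by (intro mult_left_mono tr bump_nonneg)
    also have "\<dots> \<le> (r\<^sup>2)\<^sup>2 * (real CARD('n) / \<delta> + 2 * (norm (b y) * r))"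
      using bump_le[of "r\<^sup>2" x 2 y] r \<delta>_pos by (intro mult_right_mono) auto
    finally have 1: "bump x (r\<^sup>2) 2 y * ((\<Sum>i\<in>UNIV. a y $ i $ i) + 2 * (b y \<bullet> (y - x)))
      \<le> (r\<^sup>2)\<^sup>2 * (real CARD('n) / \<delta> + 2 * (norm (b y) * r))" .
    have 2: "0 \<le> bump x (r\<^sup>2) 1 y * ((y - x) \<bullet> (a y *v (y - x)))"
      by (intro mult_nonneg_nonneg bump_nonneg ell_nonneg)
    have "diff_op a b ?\<phi> y = 12 * (bump x (r\<^sup>2) 1 y * ((y - x) \<bullet> (a y *v (y - x))))
      - 3 * (bump x (r\<^sup>2) 2 y * ((\<Sum>i\<in>UNIV. a y $ i $ i) + 2 * (b y \<bullet> (y - x))))"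
      by (simp add: diff_op_bump algebra_simps)
    then show ?thesis using 1 2 by (simp add: algebra_simps)
  qed
  have "?\<phi> x - ?c0 * T - ?c1 * (N0 * r * \<beta>) \<le> (\<integral>w. ?\<phi> (X (?\<sigma> w) w) \<partial>P x)"
    by (rule bump_dynkin_lower) (use r T \<beta> drift low \<delta>_pos in auto)
  also have "\<dots> \<le> (\<integral>w. (r\<^sup>2) ^ 3 * indicator {w \<in> Om. ?\<sigma> w = T} w \<partial>P x)"
  proof (rule integral_mono)
    have wm: "?\<phi> \<in> borel_measurable borel" by (rule borel_measurable_continuous_onI[OF continuous_on_bump])
    show "integrable (P x) (\<lambda>w. ?\<phi> (X (?\<sigma> w) w))"
      using measurable_compose[OF X_hitX_meas[of "ball x r" T] wm] T bump_le[of "r\<^sup>2" x 3] bump_nonneg[of x "r\<^sup>2" 3]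
      by (intro integrable_bounded_GX[where K = "(r\<^sup>2) ^ 3"]) auto
    show "integrable (P x) (\<lambda>w. (r\<^sup>2) ^ 3 * indicator {w \<in> Om. ?\<sigma> w = T} w)"
      by (intro integrable_mult_right P.integrable_const_bound[where B = 1]) (use E in auto)
    fix w assume "w \<in> space (P x)"
    then have w: "w \<in> Om" by simp
    show "?\<phi> (X (?\<sigma> w) w) \<le> (r\<^sup>2) ^ 3 * indicator {w \<in> Om. ?\<sigma> w = T} w"
    proof (cases "?\<sigma> w = T")
      case True
      then show ?thesis using w bump_le[of "r\<^sup>2" x 3] by simp
    next
      case False
      then have "?\<sigma> w < T" using hit_le[of "ball x r" T "\<lambda>t. X t w"] by simp
      then have "X (?\<sigma> w) w \<notin> ball x r" by (rule hit_not_in[OF paths[OF w] open_ball])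
      then have "r \<le> norm (X (?\<sigma> w) w - x)" by (simp add: dist_norm norm_minus_commute)
      then have "r\<^sup>2 \<le> (norm (X (?\<sigma> w) w - x))\<^sup>2" using r by (intro power_mono) auto
      then show ?thesis using False by (simp add: bump_0)
    qed
  qed
  also have "\<dots> = (r\<^sup>2) ^ 3 * measure (P x) {w \<in> Om. ?\<sigma> w = T}"
    using E by (simp add: Int_absorb2)
  finally have main: "?\<phi> x - ?c0 * T - ?c1 * (N0 * r * \<beta>) \<le> (r\<^sup>2) ^ 3 * measure (P x) {w \<in> Om. ?\<sigma> w = T}" .
  define q where "q = r\<^sup>2"
  have q: "0 < q" using r by (simp add: q_def)
  have "q ^ 3 * (3 * real CARD('n) * T / (\<delta> * q)) = 3 * q\<^sup>2 * (real CARD('n) / \<delta>) * T"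
    using q \<delta>_pos by (simp add: power2_eq_square power3_eq_cube)
  moreover have "q ^ 3 * (6 * N0 * \<beta>) = ?c1 * (N0 * r * \<beta>)"
    by (simp add: q_def power2_eq_square power3_eq_cube)
  moreover have "?\<phi> x = q ^ 3" using q by (simp add: bump_def q_def)
  ultimately have "q ^ 3 * (1 - 3 * real CARD('n) * T / (\<delta> * q) - 6 * N0 * \<beta>) = ?\<phi> x - ?c0 * T - ?c1 * (N0 * r * \<beta>)"
    by (simp add: right_diff_distrib q_def)
  with main have "q ^ 3 * (1 - 3 * real CARD('n) * T / (\<delta> * q) - 6 * N0 * \<beta>) \<le> q ^ 3 * measure (P x) {w \<in> Om. ?\<sigma> w = T}"
    by (simp add: q_def)
  then have "1 - 3 * real CARD('n) * T / (\<delta> * q) - 6 * N0 * \<beta> \<le> measure (P x) {w \<in> Om. ?\<sigma> w = T}"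
    using q by (simp add: mult_le_cancel_left_pos)
  then show ?thesis by (simp add: q_def)
qed

lemma occupation_bound:
  assumes r: "0 < r" and A: "A \<in> sets borel" and m: "measure lborel (A \<inter> ball x r) \<le> m"
  shows "(\<integral>\<^sup>+w. (\<integral>\<^sup>+t\<in>before_exit (ball x r) (\<lambda>t. X t w). indicator A (X t w) \<partial>lborel) \<partial>P x)
    \<le> ennreal (N0 * r * m powr (1 / real CARD('n)))"
proof -
  have m0: "0 \<le> m" using m measure_nonneg[of lborel "A \<inter> ball x r"] by linarith
  have "emeasure lborel (A \<inter> ball x r) \<le> emeasure lborel (ball x r)"
    by (rule emeasure_mono) auto
  also have "\<dots> < \<infinity>" by (rule emeasure_bounded_finite[OF bounded_ball])
  finally have em: "emeasure lborel (A \<inter> ball x r) = ennreal (measure lborel (A \<inter> ball x r))"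
    by (intro emeasure_eq_ennreal_measure) auto
  have "(\<integral>\<^sup>+w. (\<integral>\<^sup>+t\<in>before_exit (ball x r) (\<lambda>t. X t w). indicator A (X t w) \<partial>lborel) \<partial>P x)
    = (\<integral>\<^sup>+w. (\<integral>\<^sup>+t\<in>before_exit (ball x r) (\<lambda>t. X t w). ennreal (indicator A (X t w)) \<partial>lborel) \<partial>P x)"
    by (simp add: ennreal_indicator)
  also have "\<dots> \<le> ennreal (N0 * r) * Lp_norm (real CARD('n)) (ball x r) (indicator A :: _ \<Rightarrow> real)"
    by (rule exit_bd) (use A r in auto)
  also have "Lp_norm (real CARD('n)) (ball x r) (indicator A :: _ \<Rightarrow> real) = ennreal (measure lborel (A \<inter> ball x r) powr (1 / real CARD('n)))"
    by (rule Lp_norm_indicator[OF d_pos _ em]) (use A in auto)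
  also have "ennreal (N0 * r) * \<dots> \<le> ennreal (N0 * r) * ennreal (m powr (1 / real CARD('n)))"
    using m by (intro mult_left_mono ennreal_leI powr_mono2) auto
  also have "\<dots> = ennreal (N0 * r * m powr (1 / real CARD('n)))"
    using N0_pos r by (simp add: ennreal_mult)
  finally show ?thesis .
qed

end

section \<open>Almost harmonic functions\<close>

context continuous_markov_process
begin

text \<open>
  The strong Markov property is not available here, so harmonicity is only expressed
  through the fixed times \<open>s\<close>; an exit time is reached through \<open>grid\<close>.
\<close>

definition harmonic_witness ::
  "real \<Rightarrow> (real ^ 'n \<Rightarrow> real) \<Rightarrow> real \<Rightarrow> ('w \<Rightarrow> real) \<Rightarrow> real \<Rightarrow> bool" where
  "harmonic_witness C U K Z K' \<longleftrightarrow> 0 \<le> C \<and> bdd_borel K U \<and>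
    Z \<in> borel_measurable GX \<and> (\<forall>w\<in>Om. \<bar>Z w\<bar> \<le> K') \<and>
      (\<forall>x s B. 0 \<le> s \<longrightarrow> B \<in> sets (F s) \<longrightarrow>
        \<bar>(\<integral>w. Z w * indicator B w \<partial>P x) - (\<integral>w. U (X s w) * indicator B w \<partial>P x)\<bar> \<le> C * s * measure (P x) B)"

definition near_harmonic :: "real \<Rightarrow> (real ^ 'n \<Rightarrow> real) \<Rightarrow> bool" where
  "near_harmonic C U \<longleftrightarrow> (\<exists>K Z K'. harmonic_witness C U K Z K')"

lemma harmonic_witnessD:
  assumes "harmonic_witness C U K Z K'"
  shows "0 \<le> C" "bdd_borel K U" "Z \<in> borel_measurable GX" "\<And>w. w \<in> Om \<Longrightarrow> \<bar>Z w\<bar> \<le> K'"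
    "\<And>x s B. 0 \<le> s \<Longrightarrow> B \<in> sets (F s) \<Longrightarrow>
        \<bar>(\<integral>w. Z w * indicator B w \<partial>P x) - (\<integral>w. U (X s w) * indicator B w \<partial>P x)\<bar> \<le> C * s * measure (P x) B"
  using assms unfolding harmonic_witness_def by blast+

lemma near_harmonic_nonneg: "near_harmonic C U \<Longrightarrow> 0 \<le> C"
  by (auto simp: near_harmonic_def dest: harmonic_witnessD)

lemma near_harmonic_add_const:
  assumes "near_harmonic C U"
  shows "near_harmonic C (\<lambda>x. U x + c)"
proof -
  from assms obtain K Z K' where W: "harmonic_witness C U K Z K'" unfolding near_harmonic_def by blast
  note C = harmonic_witnessD(1)[OF W] and U = harmonic_witnessD(2)[OF W] and Z = harmonic_witnessD(3,4)[OF W]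
    and eq = harmonic_witnessD(5)[OF W]
  have U': "bdd_borel (K + \<bar>c\<bar>) (\<lambda>x. U x + c)"
    using U unfolding bdd_borel_def by (auto intro: order_trans[OF abs_triangle_ineq] add_mono)
  have "\<bar>(\<integral>w. (Z w + c) * indicator B w \<partial>P x) - (\<integral>w. (U (X s w) + c) * indicator B w \<partial>P x)\<bar> \<le> C * s * measure (P x) B"
    if s: "0 \<le> s" and B: "B \<in> sets (F s)" for x s B
  proof -
    have BP: "B \<in> sets (P x)" by (rule sets_F[OF s B])
    have iB: "integrable (P x) (\<lambda>w. c * indicator B w)"
      by (intro integrable_mult_right P.integrable_const_bound[where B = 1]) (use BP in auto)
    have "(\<integral>w. (Z w + c) * indicator B w \<partial>P x) = (\<integral>w. Z w * indicator B w \<partial>P x) + (\<integral>w. c * indicator B w \<partial>P x)"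
      unfolding distrib_right
      by (rule Bochner_Integration.integral_add[OF integrable_real_mult_indicator[OF BP integrable_bounded_GX[OF Z]] iB])
    moreover have "(\<integral>w. (U (X s w) + c) * indicator B w \<partial>P x) = (\<integral>w. U (X s w) * indicator B w \<partial>P x) + (\<integral>w. c * indicator B w \<partial>P x)"
      unfolding distrib_right
      by (rule Bochner_Integration.integral_add[OF integrable_real_mult_indicator[OF BP integrable_f_X[OF s U]] iB])
    ultimately show ?thesis using eq[OF s B, of x] by linarith
  qed
  moreover have "(\<lambda>w. Z w + c) \<in> borel_measurable GX" using Z(1) by measurable
  moreover have "\<forall>w\<in>Om. \<bar>Z w + c\<bar> \<le> K' + \<bar>c\<bar>" using Z(2) by (auto intro: order_trans[OF abs_triangle_ineq] add_mono)
  ultimately have "harmonic_witness C (\<lambda>x. U x + c) (K + \<bar>c\<bar>) (\<lambda>w. Z w + c) (K' + \<bar>c\<bar>)"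
    unfolding harmonic_witness_def using C U' by blast
  then show ?thesis unfolding near_harmonic_def by blast
qed

lemma near_harmonic_uminus:
  assumes "near_harmonic C U"
  shows "near_harmonic C (\<lambda>x. - U x)"
proof -
  from assms obtain K Z K' where W: "harmonic_witness C U K Z K'" unfolding near_harmonic_def by blast
  note C = harmonic_witnessD(1)[OF W] and U = harmonic_witnessD(2)[OF W] and Z = harmonic_witnessD(3,4)[OF W]
    and eq = harmonic_witnessD(5)[OF W]
  have U': "bdd_borel K (\<lambda>x. - U x)" using U by (auto simp: bdd_borel_def)
  have "\<bar>(\<integral>w. (- Z w) * indicator B w \<partial>P x) - (\<integral>w. (- U (X s w)) * indicator B w \<partial>P x)\<bar> \<le> C * s * measure (P x) B"
    if s: "0 \<le> s" and B: "B \<in> sets (F s)" for x s B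
    using eq[OF s B, of x] by simp
  moreover have "(\<lambda>w. - Z w) \<in> borel_measurable GX" using Z(1) by measurable
  moreover have "\<forall>w\<in>Om. \<bar>- Z w\<bar> \<le> K'" using Z(2) by auto
  ultimately have "harmonic_witness C (\<lambda>x. - U x) K (\<lambda>w. - Z w) K'"
    unfolding harmonic_witness_def using C U' by blast
  then show ?thesis unfolding near_harmonic_def by blast
qed

lemma near_harmonic_ge:
  assumes nh: "near_harmonic C U" and \<sigma>: "stopping T \<sigma>" and T: "0 < T"
    and \<theta>: "\<theta> \<in> borel_measurable GX" "\<And>w. w \<in> Om \<Longrightarrow> \<bar>\<theta> w\<bar> \<le> K1"
    and ev: "\<And>w. w \<in> Om \<Longrightarrow> X 0 w = x \<Longrightarrow> \<forall>\<^sub>F n in sequentially. \<theta> w \<le> U (X (grid T n (\<sigma> w)) w)"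
  shows "(\<integral>w. \<theta> w \<partial>P x) - C * T \<le> U x"
proof -
  from nh obtain K Z K' where W: "harmonic_witness C U K Z K'" unfolding near_harmonic_def by blast
  note C = harmonic_witnessD(1)[OF W] and U = harmonic_witnessD(2)[OF W] and Z = harmonic_witnessD(3,4)[OF W]
    and eq = harmonic_witnessD(5)[OF W]
  have iZ: "integrable (P x) Z" by (rule integrable_bounded_GX[OF Z])
  have "\<bar>(\<integral>w. Z w * indicator Om w \<partial>P x) - (\<integral>w. U (X 0 w) * indicator Om w \<partial>P x)\<bar> \<le> C * 0 * measure (P x) Om"
    by (rule eq) (auto intro: Om_in_F)
  then have EZ: "(\<integral>w. Z w \<partial>P x) = U x"
    unfolding P_integral_indicator_Om using P_integral_start[OF bdd_borelD(1)[OF U]] by simp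
  note ge = grid_expectation[where Y = "\<lambda>s w. U (X s w)", OF \<sigma> T _ C iZ integrable_f_X[OF _ U] eq]
  let ?V = "\<lambda>n w. U (X (grid T (Suc n) (\<sigma> w)) w)"
  have iV: "integrable (P x) (?V n)" for n by (rule ge(1)) simp_all
  have EV: "(\<integral>w. ?V n w \<partial>P x) \<le> U x + C * T" for n
  proof -
    have "\<bar>(\<integral>w. Z w \<partial>P x) - (\<integral>w. ?V n w \<partial>P x)\<bar> \<le> C * T" by (rule ge(2)) simp_all
    then show ?thesis unfolding EZ by linarith
  qed
  have i\<theta>: "integrable (P x) \<theta>" by (rule integrable_bounded_GX[OF \<theta>])
  have "(\<lambda>n. \<integral>w. min (\<theta> w) (?V n w) \<partial>P x) \<longlonglongrightarrow> (\<integral>w. \<theta> w \<partial>P x)"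
  proof (rule integral_dominated_convergence)
    show "integrable (P x) (\<lambda>w. \<bar>\<theta> w\<bar> + K)" using i\<theta> by simp
    show "\<theta> \<in> borel_measurable (P x)" by (rule borel_measurable_integrable[OF i\<theta>])
    show "(\<lambda>w. min (\<theta> w) (?V n w)) \<in> borel_measurable (P x)" for n
      using borel_measurable_integrable[OF i\<theta>] borel_measurable_integrable[OF iV[of n]] by (intro borel_measurable_min)
    show "AE w in P x. norm (min (\<theta> w) (?V n w)) \<le> \<bar>\<theta> w\<bar> + K" for n
    proof (rule AE_I2)
      fix w
      show "norm (min (\<theta> w) (?V n w)) \<le> \<bar>\<theta> w\<bar> + K"
        using bdd_borelD(2)[OF U, of "X (grid T (Suc n) (\<sigma> w)) w"] unfolding real_norm_def by linarith
    qed
    show "AE w in P x. (\<lambda>n. min (\<theta> w) (?V n w)) \<longlonglongrightarrow> \<theta> w"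
      using AE_start[of x] AE_space[of "P x"]
    proof eventually_elim
      case (elim w)
      then have "\<forall>\<^sub>F n in sequentially. \<theta> w \<le> U (X (grid T n (\<sigma> w)) w)" by (intro ev) auto
      then have "\<forall>\<^sub>F n in sequentially. \<theta> w \<le> ?V n w" by (subst eventually_sequentially_Suc)
      then have "\<forall>\<^sub>F n in sequentially. min (\<theta> w) (?V n w) = \<theta> w" by eventually_elim simp
      then show ?case by (rule tendsto_eventually)
    qed
  qed
  moreover have "(\<integral>w. min (\<theta> w) (?V n w) \<partial>P x) \<le> U x + C * T" for n
  proof -
    have "(\<integral>w. min (\<theta> w) (?V n w) \<partial>P x) \<le> (\<integral>w. ?V n w \<partial>P x)"
      by (rule integral_mono[OF integrable_min[OF i\<theta> iV] iV]) simp
    then show ?thesis using EV[of n] by linarith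
  qed
  ultimately have "(\<integral>w. \<theta> w \<partial>P x) \<le> U x + C * T"
    by (intro LIMSEQ_le_const2) auto
  then show ?thesis by simp
qed

lemma path_Fubini:
  fixes f :: "'w \<Rightarrow> real \<Rightarrow> ennreal"
  assumes "(\<lambda>(w, s). f w s) \<in> borel_measurable (GX \<Otimes>\<^sub>M lborel)"
  shows "(\<integral>\<^sup>+w. (\<integral>\<^sup>+s. f w s \<partial>lborel) \<partial>P x) = (\<integral>\<^sup>+s. (\<integral>\<^sup>+w. f w s \<partial>P x) \<partial>lborel)"
proof -
  interpret Q: pair_sigma_finite "P x" "lborel :: real measure" ..
  have "(\<lambda>p. (fst p, snd p)) \<in> P x \<Otimes>\<^sub>M lborel \<rightarrow>\<^sub>M GX \<Otimes>\<^sub>M (lborel :: real measure)"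
    by (intro measurable_Pair measurable_compose[OF measurable_fst] measurable_snd measurable_from_subalg[OF subalg_GX]) simp
  from measurable_compose[OF this assms] have "(\<lambda>(w, s). f w s) \<in> borel_measurable (P x \<Otimes>\<^sub>M lborel)"
    by (simp add: case_prod_unfold)
  then show ?thesis by (rule Q.Fubini'[symmetric])
qed

lemma indicator_joint_meas:
  assumes "A \<in> sets borel" "\<sigma> \<in> borel_measurable GX"
  shows "(\<lambda>(w, s). indicator A (X (max 0 s) w) * indicator {0..<\<sigma> w} s :: ennreal) \<in> borel_measurable (GX \<Otimes>\<^sub>M lborel)"
proof -
  have "(\<lambda>(w, s). indicator {0..<\<sigma> w} s :: ennreal) \<in> borel_measurable (GX \<Otimes>\<^sub>M lborel)"
  proof -
    have "(\<lambda>(w, s). indicator {0..<\<sigma> w} s :: ennreal) = indicator {p. 0 \<le> snd p \<and> snd p < \<sigma> (fst p)}"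
      by (auto simp: fun_eq_iff indicator_def)
    moreover have "{p \<in> space (GX \<Otimes>\<^sub>M lborel). 0 \<le> snd p \<and> snd p < \<sigma> (fst p)} \<in> sets (GX \<Otimes>\<^sub>M lborel)"
      using assms(2) by measurable
    ultimately show ?thesis by (simp add: borel_measurable_indicator_iff Int_def conj_commute)
  qed
  moreover have "(\<lambda>(w, s). indicator A (X (max 0 s) w) :: ennreal) \<in> borel_measurable (GX \<Otimes>\<^sub>M lborel)"
    by (rule X_path_joint) (use assms(1) in auto)
  ultimately show ?thesis by (simp add: case_prod_unfold)
qed

lemma hitX_eq_set:
  assumes "open O1" "0 \<le> T"
  shows "{w \<in> Om. hitX O1 T w = T} \<in> sets GX"
proof -
  have "hitX O1 T -` {T} \<inter> space GX \<in> sets GX"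
    by (rule measurable_sets[OF hitX_meas]) (use assms in auto)
  moreover have "{w \<in> Om. hitX O1 T w = T} = hitX O1 T -` {T} \<inter> space GX" by auto
  ultimately show ?thesis by simp
qed

lemma P_integral_indicator:
  assumes "E \<in> sets GX"
  shows "(\<integral>w. c * indicator E w \<partial>P x) = c * measure (P x) E"
proof -
  have "E \<in> sets (P x)" using assms sets_GX_sub by blast
  moreover have "E \<subseteq> Om" using sets.sets_into_space[OF assms] by simp
  ultimately show ?thesis by (simp add: Int_absorb2)
qed

end

lemma ball_subsetI:
  fixes x z :: "'a::metric_space"
  assumes "dist x z + r \<le> R"
  shows "ball x r \<subseteq> ball z R"
proof
  fix y assume "y \<in> ball x r"
  then have "dist z y < R" using assms dist_triangle[of z y x] by (simp add: dist_commute)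
  then show "y \<in> ball z R" by simp
qed

lemma grid_self: "0 < T \<Longrightarrow> 0 < n \<Longrightarrow> grid T n T = T"
  by (simp add: grid_def)

context elliptic_diffusion
begin

definition vol_const :: real where
  "vol_const = unit_ball_vol (real CARD('n)) powr (1 / real CARD('n))"

lemma vol_const_pos: "0 < vol_const"
proof -
  have "0 < unit_ball_vol (real CARD('n))" by (rule unit_ball_vol_pos) simp
  then show ?thesis unfolding vol_const_def by (metis less_irrefl powr_gt_zero)
qed

lemma prob_stay_le:
  assumes O1: "open O1" "O1 \<subseteq> ball x r" and r: "0 < r" and T: "0 < T"
  shows "T * measure (P x) {w \<in> Om. hitX O1 T w = T} \<le> N0 * vol_const * r\<^sup>2"
proof -
  let ?E = "{w \<in> Om. hitX O1 T w = T}"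
  have E: "?E \<in> sets GX" by (rule hitX_eq_set) (use O1 T in auto)
  then have EP: "?E \<in> sets (P x)" using sets_GX_sub by blast
  have "ennreal (T * measure (P x) ?E) = (\<integral>\<^sup>+w. ennreal T * indicator ?E w \<partial>P x)"
    using EP T by (simp add: nn_integral_cmult P.emeasure_eq_measure ennreal_mult)
  also have "\<dots> \<le> (\<integral>\<^sup>+w. (\<integral>\<^sup>+t\<in>before_exit (ball x r) (\<lambda>t. X t w). indicator UNIV (X t w) \<partial>lborel) \<partial>P x)"
  proof (rule nn_integral_mono)
    fix w
    show "ennreal T * indicator ?E w \<le> (\<integral>\<^sup>+t\<in>before_exit (ball x r) (\<lambda>t. X t w). indicator UNIV (X t w) \<partial>lborel)"
    proof (cases "w \<in> ?E")
      case True
      have "{0..<T} \<subseteq> before_exit (ball x r) (\<lambda>t. X t w)"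
      proof
        fix s assume s: "s \<in> {0..<T}"
        have "hitX O1 T w \<le> hitX (ball x r) T w" using T by (intro hit_mono[OF O1(2)]) auto
        then show "s \<in> before_exit (ball x r) (\<lambda>t. X t w)"
          using s True by (intro less_hit_before_exit[of s "ball x r" T]) auto
      qed
      then have "(\<integral>\<^sup>+t. indicator {0..<T} t \<partial>lborel) \<le> (\<integral>\<^sup>+t\<in>before_exit (ball x r) (\<lambda>t. X t w). indicator UNIV (X t w) \<partial>lborel)"
        by (intro nn_integral_mono) (auto simp: indicator_def)
      then show ?thesis using True T by simp
    qed simp
  qed
  also have "\<dots> \<le> ennreal (N0 * r * measure lborel (ball x r) powr (1 / real CARD('n)))"
    by (rule occupation_bound[OF r]) auto
  also have "\<dots> = ennreal (N0 * vol_const * r\<^sup>2)"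
    using r emeasure_ball_powr(2)[of r x] by (simp add: vol_const_def power2_eq_square algebra_simps)
  finally show ?thesis
    using N0_pos vol_const_pos by (subst (asm) ennreal_le_iff) auto
qed

lemma annulus_lower:
  fixes z :: "real ^ 'n"
  assumes k: "3 \<le> k" "32 * real CARD('n) / \<delta>\<^sup>2 \<le> real (k - 1)" and \<rho>: "0 < \<rho>"
    and y: "\<rho> / 2 < norm (y - z)" "norm (y - z) < 4 * \<rho>"
  shows "- (0 + 8 * real k * (16 * \<rho>\<^sup>2) ^ (k - 1) * \<rho> * norm (b y)) \<le> diff_op a b (bump z (16 * \<rho>\<^sup>2) k) y"
proof -
  let ?S = "16 * \<rho>\<^sup>2" and ?tr = "\<Sum>i\<in>UNIV. a y $ i $ i" and ?s = "(norm (y - z))\<^sup>2"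
  have S: "0 < ?S" using \<rho> by simp
  have "?s < (4 * \<rho>)\<^sup>2" using y \<rho> by (intro power_strict_mono) auto
  then have s_less: "?s < ?S" by (simp add: power_mult_distrib)
  have "(\<rho> / 2)\<^sup>2 \<le> ?s" using y \<rho> by (intro power_mono) auto
  then have s_ge: "\<rho>\<^sup>2 / 4 \<le> ?s" by (simp add: power_divide)
  let ?B = "bump z ?S (k - 2) y"
  have k1: "k - 1 = Suc (k - 2)" using k by simp
  have bk: "bump z ?S (k - 1) y = ?B * (?S - ?s)"
    unfolding k1 bump_def using s_less by simp
  have B0: "0 \<le> ?B" by (rule bump_nonneg)
  have q: "\<delta> * (\<rho>\<^sup>2 / 4) \<le> (y - z) \<bullet> (a y *v (y - z))"
    by (rule order_trans[OF _ ell_lower]) (intro mult_left_mono s_ge, use \<delta>_pos in simp)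
  have tr: "(?S - ?s) * ?tr \<le> ?S * (real CARD('n) / \<delta>)"
    using s_less trace_le[of y] trace_nonneg[of y] S by (intro mult_mono) auto
  have "?S * (real CARD('n) / \<delta>) = 32 * real CARD('n) / \<delta>\<^sup>2 * (\<delta> * \<rho>\<^sup>2 / 2)"
    using \<delta>_pos by (simp add: power2_eq_square)
  also have "\<dots> \<le> real (k - 1) * (\<delta> * \<rho>\<^sup>2 / 2)"
    using k(2) \<delta>_pos by (intro mult_right_mono) auto
  also have "\<dots> = 2 * real (k - 1) * (\<delta> * (\<rho>\<^sup>2 / 4))" by simp
  also have "\<dots> \<le> 2 * real (k - 1) * ((y - z) \<bullet> (a y *v (y - z)))"
    by (intro mult_left_mono q) simp
  finally have "0 \<le> 2 * real (k - 1) * ((y - z) \<bullet> (a y *v (y - z))) - (?S - ?s) * ?tr"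
    using tr by simp
  then have main: "0 \<le> real k * ?B * (2 * real (k - 1) * ((y - z) \<bullet> (a y *v (y - z))) - (?S - ?s) * ?tr)"
    using B0 by (intro mult_nonneg_nonneg) auto
  have "\<bar>b y \<bullet> (y - z)\<bar> \<le> norm (b y) * norm (y - z)" by (rule Cauchy_Schwarz_ineq2)
  also have "\<dots> \<le> norm (b y) * (4 * \<rho>)" using y by (intro mult_left_mono) auto
  finally have "bump z ?S (k - 1) y * (b y \<bullet> (y - z)) \<le> ?S ^ (k - 1) * (norm (b y) * (4 * \<rho>))"
    using bump_le[of ?S z "k - 1" y] bump_nonneg[of z ?S "k - 1" y] S
    by (intro order_trans[OF mult_left_mono[of "b y \<bullet> (y - z)" "norm (b y) * (4 * \<rho>)"] mult_right_mono]) (use \<rho> in auto)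
  then have dr: "2 * real k * (bump z ?S (k - 1) y * (b y \<bullet> (y - z))) \<le> 2 * real k * (?S ^ (k - 1) * (norm (b y) * (4 * \<rho>)))"
    by (intro mult_left_mono) auto
  have "diff_op a b (bump z ?S k) y = real k * ?B * (2 * real (k - 1) * ((y - z) \<bullet> (a y *v (y - z))) - (?S - ?s) * ?tr)
    - 2 * real k * (bump z ?S (k - 1) y * (b y \<bullet> (y - z)))"
    unfolding diff_op_bump[OF k(1)] bk by (simp add: algebra_simps)
  then show ?thesis using main dr by (simp add: algebra_simps)
qed

lemma doubling:
  "\<exists>\<kappa>>0. \<kappa> \<le> 1 \<and> (\<exists>\<epsilon>>0. \<exists>K\<ge>0. \<forall>C U z \<rho> l. near_harmonic C U \<longrightarrow> 0 < \<rho> \<longrightarrow> drift z (8 * \<rho>) \<le> ennreal \<epsilon> \<longrightarrow> 0 \<le> l \<longrightarrow>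
     (\<forall>y\<in>ball z (5 * \<rho>). 0 \<le> U y) \<longrightarrow> (\<forall>y\<in>ball z \<rho>. l \<le> U y) \<longrightarrow>
     (\<forall>y\<in>ball z (2 * \<rho>). \<kappa> * l - C * K * \<rho>\<^sup>2 \<le> U y))"
proof -
  obtain k0 :: nat where k0: "32 * real CARD('n) / \<delta>\<^sup>2 \<le> real k0" using real_arch_simple by blast
  define k where "k = k0 + 3"
  have k: "3 \<le> k" "32 * real CARD('n) / \<delta>\<^sup>2 \<le> real (k - 1)" using k0 by (auto simp: k_def)
  define \<kappa>0 :: real where "\<kappa>0 = (3 / 4) ^ k"
  have \<kappa>0: "0 < \<kappa>0" "\<kappa>0 \<le> 1" by (auto simp: \<kappa>0_def power_le_one)
  define \<epsilon> where "\<epsilon> = \<kappa>0 / (12 * real k * N0)"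
  have \<epsilon>: "0 < \<epsilon>" using \<kappa>0 k N0_pos by (simp add: \<epsilon>_def)
  define K where "K = 144 * N0 * vol_const / \<kappa>0"
  have K: "0 < K" using \<kappa>0 N0_pos vol_const_pos by (simp add: K_def)
  have "\<kappa>0 / 2 * l - C * K * \<rho>\<^sup>2 \<le> U x"
    if nh: "near_harmonic C U" and \<rho>: "0 < \<rho>" and dr: "drift z (8 * \<rho>) \<le> ennreal \<epsilon>" and l: "0 \<le> l"
      and U0: "\<forall>y\<in>ball z (5 * \<rho>). 0 \<le> U y" and Ul: "\<forall>y\<in>ball z \<rho>. l \<le> U y" and x: "x \<in> ball z (2 * \<rho>)"
    for C U z \<rho> l x
  proof (cases "x \<in> ball z \<rho>")
    case True
    have C: "0 \<le> C" by (rule near_harmonic_nonneg[OF nh])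
    have "\<kappa>0 / 2 * l \<le> 1 * l" using \<kappa>0 l by (intro mult_right_mono) auto
    moreover have "0 \<le> C * K * \<rho>\<^sup>2" using C K by simp
    ultimately show ?thesis using Ul True by fastforce
  next
    case False
    let ?S = "16 * \<rho>\<^sup>2"
    define O1 where "O1 = {y. \<rho> / 2 < norm (y - z) \<and> norm (y - z) < 4 * \<rho>}"
    have O1_open: "open O1" unfolding O1_def by (intro open_Collect_conj open_Collect_less continuous_intros)
    have xz: "\<rho> \<le> norm (x - z)" "norm (x - z) < 2 * \<rho>" using False x by (auto simp: dist_norm norm_minus_commute)
    have x_in: "x \<in> O1" using xz \<rho> by (simp add: O1_def)
    have O1_sub: "O1 \<subseteq> ball x (6 * \<rho>)"
    proof
      fix y assume "y \<in> O1"
      then have "norm (y - z) < 4 * \<rho>" by (simp add: O1_def)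
      moreover have "norm (x - y) \<le> norm (x - z) + norm (y - z)" using norm_triangle_ineq4[of "x - z" "y - z"] by simp
      ultimately show "y \<in> ball x (6 * \<rho>)" using xz by (simp add: dist_norm)
    qed
    have "ball x (6 * \<rho>) \<subseteq> ball z (8 * \<rho>)"
      by (rule ball_subsetI) (use x in \<open>simp add: dist_commute\<close>)
    then have dr': "drift x (6 * \<rho>) \<le> ennreal \<epsilon>" using drift_mono dr order_trans by blast
    define T where "T = K * \<rho>\<^sup>2"
    have T: "0 < T" using K \<rho> by (simp add: T_def)
    let ?\<sigma> = "hitX O1 T"
    have \<sigma>: "stopping T ?\<sigma>" by (rule stopping_hitX) (use O1_open T in auto)
    define I where "I = {w \<in> Om. X (?\<sigma> w) w \<in> cball z (\<rho> / 2)}"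
    have I: "I \<in> sets GX"
      using measurable_sets[OF X_stopping_meas[OF \<sigma>], of "cball z (\<rho> / 2)"] by (simp add: I_def vimage_def Int_def conj_commute)
    let ?E = "{w \<in> Om. ?\<sigma> w = T}"
    have E: "?E \<in> sets GX" by (rule hitX_eq_set) (use O1_open T in auto)
    let ?c1 = "8 * real k * ?S ^ (k - 1) * \<rho>"
    have "bump z ?S k x - 0 * T - ?c1 * (N0 * (6 * \<rho>) * \<epsilon>) \<le> (\<integral>w. bump z ?S k (X (?\<sigma> w) w) \<partial>P x)"
    proof (rule bump_dynkin_lower[OF k(1) _ T O1_open O1_sub])
      show "- (0 + ?c1 * norm (b y)) \<le> diff_op a b (bump z ?S k) y" if "y \<in> O1" for y
        by (rule annulus_lower[OF k \<rho>]) (use that in \<open>auto simp: O1_def\<close>)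
    qed (use \<rho> \<epsilon> dr' in auto)
    also have "\<dots> \<le> (\<integral>w. ?S ^ k * indicator I w + ?S ^ k * indicator ?E w \<partial>P x)"
    proof (rule integral_mono)
      have wm: "bump z ?S k \<in> borel_measurable borel" by (rule borel_measurable_continuous_onI[OF continuous_on_bump])
      show "integrable (P x) (\<lambda>w. bump z ?S k (X (?\<sigma> w) w))"
        using measurable_compose[OF X_stopping_meas[OF \<sigma>] wm] bump_le[of ?S z k] bump_nonneg[of z ?S k]
        by (intro integrable_bounded_GX[where K = "?S ^ k"]) auto
      have "integrable (P x) (indicator A :: 'w \<Rightarrow> real)" if "A \<in> sets GX" for A
        by (rule P.integrable_const_bound[where B = 1]) (use that sets_GX_sub[of x] in auto)
      with I E show "integrable (P x) (\<lambda>w. ?S ^ k * indicator I w + ?S ^ k * indicator ?E w)"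
        by (intro Bochner_Integration.integrable_add integrable_mult_right)
      fix w assume "w \<in> space (P x)"
      then have w: "w \<in> Om" by simp
      have S0: "0 \<le> ?S ^ k" by simp
      have le: "bump z ?S k (X (?\<sigma> w) w) \<le> ?S ^ k" by (rule bump_le) simp
      show "bump z ?S k (X (?\<sigma> w) w) \<le> ?S ^ k * indicator I w + ?S ^ k * indicator ?E w"
      proof (cases "w \<in> I \<or> w \<in> ?E")
        case True
        then have "1 \<le> indicator I w + (indicator ?E w :: real)" by (auto simp: indicator_def)
        from mult_left_mono[OF this S0] le show ?thesis by (simp only: distrib_left)
      next
        case False
        then have "?\<sigma> w < T" using hit_le[of O1 T "\<lambda>t. X t w"] w by auto
        then have "X (?\<sigma> w) w \<notin> O1" by (rule hit_not_in[OF paths[OF w] O1_open])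
        moreover have "\<not> norm (X (?\<sigma> w) w - z) \<le> \<rho> / 2" using False w by (auto simp: I_def dist_norm norm_minus_commute)
        ultimately have "4 * \<rho> \<le> norm (X (?\<sigma> w) w - z)" by (auto simp: O1_def)
        then have "(4 * \<rho>)\<^sup>2 \<le> (norm (X (?\<sigma> w) w - z))\<^sup>2" using \<rho> by (intro power_mono) auto
        then have "bump z ?S k (X (?\<sigma> w) w) = 0" using k by (intro bump_0) (auto simp: power_mult_distrib)
        then show ?thesis by simp
      qed
    qed
    also have "\<dots> = ?S ^ k * measure (P x) I + ?S ^ k * measure (P x) ?E"
    proof -
      have "integrable (P x) (indicator A :: 'w \<Rightarrow> real)" if "A \<in> sets GX" for A
        by (rule P.integrable_const_bound[where B = 1]) (use that sets_GX_sub[of x] in auto)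
      from this[OF I] this[OF E] have "(\<integral>w. ?S ^ k * indicator I w + ?S ^ k * indicator ?E w \<partial>P x)
        = (\<integral>w. ?S ^ k * indicator I w \<partial>P x) + (\<integral>w. ?S ^ k * indicator ?E w \<partial>P x)"
        by (intro Bochner_Integration.integral_add integrable_mult_right)
      then show ?thesis unfolding P_integral_indicator[OF I] P_integral_indicator[OF E] .
    qed
    finally have 1: "bump z ?S k x - ?c1 * (N0 * (6 * \<rho>) * \<epsilon>) \<le> ?S ^ k * (measure (P x) I + measure (P x) ?E)"
      by (simp add: distrib_left)
    have bx: "?S ^ k * \<kappa>0 \<le> bump z ?S k x"
    proof -
      have "(norm (x - z))\<^sup>2 \<le> (2 * \<rho>)\<^sup>2" using xz \<rho> by (intro power_mono) auto
      then have "?S * (3 / 4) \<le> max 0 (?S - (norm (x - z))\<^sup>2)" by (simp add: power_mult_distrib)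
      then have "(?S * (3 / 4)) ^ k \<le> max 0 (?S - (norm (x - z))\<^sup>2) ^ k" by (intro power_mono) auto
      then show ?thesis by (simp only: bump_def \<kappa>0_def power_mult_distrib)
    qed
    have Sk: "?S ^ k = ?S * ?S ^ (k - 1)" using k by (cases k) auto
    have "?c1 * (N0 * (6 * \<rho>) * \<epsilon>) = ?S ^ k * (3 * real k * N0 * \<epsilon>)"
      unfolding Sk by (simp add: power2_eq_square)
    also have "3 * real k * N0 * \<epsilon> = \<kappa>0 / 4"
      using k N0_pos by (simp add: \<epsilon>_def)
    finally have "?c1 * (N0 * (6 * \<rho>) * \<epsilon>) = ?S ^ k * (\<kappa>0 / 4)" .
    then have "?S ^ k * (\<kappa>0 - \<kappa>0 / 4) \<le> ?S ^ k * (measure (P x) I + measure (P x) ?E)"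
      unfolding right_diff_distrib using 1 bx by linarith
    then have 2: "\<kappa>0 - \<kappa>0 / 4 \<le> measure (P x) I + measure (P x) ?E"
      by (rule mult_left_le_imp_le) (use \<rho> in simp)
    have "T * measure (P x) ?E \<le> N0 * vol_const * (6 * \<rho>)\<^sup>2"
      by (rule prob_stay_le) (use O1_open O1_sub \<rho> T in auto)
    also have "\<dots> = T * (\<kappa>0 / 4)" using \<kappa>0 by (simp add: T_def K_def power2_eq_square)
    finally have 3: "measure (P x) ?E \<le> \<kappa>0 / 4"
      using T by (simp add: mult_le_cancel_left_pos)
    have PI: "\<kappa>0 / 2 \<le> measure (P x) I" using 2 3 by simp
    have "(\<integral>w. l * indicator I w \<partial>P x) - C * T \<le> U x"
    proof (rule near_harmonic_ge[OF nh \<sigma> T])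
      show "(\<lambda>w. l * indicator I w) \<in> borel_measurable GX" using I by measurable
      show "\<bar>l * indicator I w\<bar> \<le> l" for w using l by (simp add: indicator_def)
      fix w assume w: "w \<in> Om" "X 0 w = x"
      have lim: "(\<lambda>n. X (grid T n (?\<sigma> w)) w) \<longlonglongrightarrow> X (?\<sigma> w) w" by (rule X_grid_tendsto[OF \<sigma> T w(1)])
      have "X (?\<sigma> w) w \<in> closure O1"
        by (rule hit_in_closure[OF paths[OF w(1)], of O1 _ T]) (use w x_in stoppingD(1)[OF \<sigma> w(1)] in auto)
      also have "closure O1 \<subseteq> cball z (4 * \<rho>)"
        by (rule closure_minimal) (auto simp: O1_def dist_norm norm_minus_commute)
      also have "\<dots> \<subseteq> ball z (5 * \<rho>)" using \<rho> by (auto simp: subset_eq)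
      finally have in5: "X (?\<sigma> w) w \<in> ball z (5 * \<rho>)" .
      show "\<forall>\<^sub>F n in sequentially. l * indicator I w \<le> U (X (grid T n (?\<sigma> w)) w)"
      proof (cases "w \<in> I")
        case True
        then have "X (?\<sigma> w) w \<in> ball z \<rho>" using \<rho> by (auto simp: I_def)
        then have "\<forall>\<^sub>F n in sequentially. X (grid T n (?\<sigma> w)) w \<in> ball z \<rho>"
          by (rule topological_tendstoD[OF lim open_ball])
        then show ?thesis by eventually_elim (use Ul True in auto)
      next
        case False
        have "\<forall>\<^sub>F n in sequentially. X (grid T n (?\<sigma> w)) w \<in> ball z (5 * \<rho>)"
          by (rule topological_tendstoD[OF lim open_ball in5])
        then show ?thesis by eventually_elim (use U0 False in auto)
      qed
    qed
    moreover have "\<kappa>0 / 2 * l \<le> (\<integral>w. l * indicator I w \<partial>P x)"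
      using mult_left_mono[OF PI l] unfolding P_integral_indicator[OF I] by (simp add: mult.commute)
    ultimately show ?thesis by (simp add: T_def mult.assoc)
  qed
  then show ?thesis
    using \<kappa>0 \<epsilon> K by (intro exI[of _ "\<kappa>0 / 2"] conjI exI[of _ \<epsilon>] exI[of _ K]) auto
qed

end

section \<open>Growth of sets under passage to balls of large density\<close>

lemma emeasure_UN_countable_le:
  assumes I: "countable I" and A: "\<And>i. i \<in> I \<Longrightarrow> A i \<in> sets M"
  shows "emeasure M (\<Union>i\<in>I. A i) \<le> (\<integral>\<^sup>+i. emeasure M (A i) \<partial>count_space I)"
proof (cases "finite I")
  case True
  then have "emeasure M (\<Union>i\<in>I. A i) \<le> (\<Sum>i\<in>I. emeasure M (A i))"
    by (rule emeasure_subadditive_finite) (use A in auto)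
  then show ?thesis using nn_integral_count_space_finite[OF True, of "\<lambda>i. emeasure M (A i)"] by simp
next
  case False
  note bij = bij_betw_from_nat_into[OF I False]
  have r: "range (from_nat_into I) = I" using bij by (simp add: bij_betw_def)
  have "emeasure M (\<Union>i\<in>I. A i) = emeasure M (\<Union>n. A (from_nat_into I n))"
    using r by (metis image_image)
  also have "\<dots> \<le> (\<Sum>n. emeasure M (A (from_nat_into I n)))"
    by (rule emeasure_subadditive_countably) (use A r in auto)
  also have "\<dots> = (\<integral>\<^sup>+n. emeasure M (A (from_nat_into I n)) \<partial>count_space UNIV)"
    by (rule nn_integral_count_space_nat[symmetric])
  also have "\<dots> = (\<integral>\<^sup>+i. emeasure M (A i) \<partial>count_space I)"
    by (rule nn_integral_bij_count_space[OF bij])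
  finally show ?thesis .
qed

lemma emeasure_ball_eq:
  "emeasure lborel (ball x r :: (real ^ 'n) set) = ennreal (measure lborel (ball x r))"
  by (rule emeasure_eq_ennreal_measure) (use emeasure_bounded_finite[OF bounded_ball, of x r] in auto)

lemma measure_ball_pos: "0 < r \<Longrightarrow> 0 < measure lborel (ball (x :: real ^ 'n) r)"
  using emeasure_ball_powr(1)[of r x] unit_ball_vol_pos[of "real CARD('n)"] by simp

lemma measure_ball_scale:
  fixes x y :: "real ^ 'n"
  assumes "0 \<le> c" "0 \<le> r"
  shows "measure lborel (ball x (c * r)) = c ^ CARD('n) * measure lborel (ball y r)"
  using emeasure_ball_powr(1)[of "c * r" x] emeasure_ball_powr(1)[of r y] assms by (simp add: power_mult_distrib)

lemma bounded_finite_measure: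
  fixes A :: "(real ^ 'n) set"
  assumes "bounded A" "A \<in> sets borel"
  shows "emeasure lborel A = ennreal (measure lborel A)"
  by (rule emeasure_eq_ennreal_measure) (use emeasure_bounded_finite[OF assms(1)] in auto)

definition thick :: "real \<Rightarrow> (real ^ 'n) set \<Rightarrow> real ^ 'n \<Rightarrow> real \<Rightarrow> bool" where
  "thick \<eta> \<Gamma> x r \<longleftrightarrow> measure lborel (ball x r - \<Gamma>) \<le> \<eta> * measure lborel (ball x r)"

lemma measure_ball_Diff_meas:
  fixes \<Gamma> :: "(real ^ 'n) set"
  assumes "\<Gamma> \<in> sets borel"
  shows "(\<lambda>x. measure lborel (ball x r - \<Gamma>)) \<in> borel_measurable borel"
proof -
  let ?Q = "{p :: (real ^ 'n) \<times> (real ^ 'n). dist (fst p) (snd p) < r} \<inter> (UNIV \<times> (- \<Gamma>))"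
  have "{p :: (real ^ 'n) \<times> (real ^ 'n). dist (fst p) (snd p) < r} \<in> sets (borel \<Otimes>\<^sub>M borel)"
    unfolding borel_prod by (intro borel_open open_Collect_less continuous_intros)
  moreover have "UNIV \<times> (- \<Gamma>) \<in> sets ((borel :: (real ^ 'n) measure) \<Otimes>\<^sub>M borel)"
    using assms by (intro pair_measureI) auto
  ultimately have "?Q \<in> sets (borel \<Otimes>\<^sub>M lborel)"
    using sets_pair_measure_cong[of borel borel lborel borel] by auto
  from lborel.measurable_emeasure_Pair[OF this]
  have "(\<lambda>x. emeasure lborel (Pair x -` ?Q)) \<in> borel_measurable borel" .
  moreover have "Pair x -` ?Q = ball x r - \<Gamma>" for x by auto
  ultimately show ?thesis by (simp add: measure_def)
qed

text \<open>A weak form of the Lebesgue density theorem.\<close>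

lemma thick_AE:
  fixes \<Gamma> :: "(real ^ 'n) set"
  assumes \<Gamma>: "\<Gamma> \<in> sets borel" "bounded \<Gamma>" and \<eta>: "0 < \<eta>" "\<eta> < 1"
    and r: "\<And>j::nat. 0 < r j" "r \<longlonglongrightarrow> 0"
  shows "measure lborel {x \<in> \<Gamma>. \<forall>j. \<not> thick \<eta> \<Gamma> x (r j)} = 0"
proof -
  define N where "N = {x \<in> \<Gamma>. \<forall>j. \<not> thick \<eta> \<Gamma> x (r j)}"
  have "N = \<Gamma> \<inter> {x \<in> space borel. \<forall>j. \<eta> * measure lborel (ball (0 :: real ^ 'n) (r j)) < measure lborel (ball x (r j) - \<Gamma>)}"
    using less_imp_le[OF r(1)] by (auto simp: N_def thick_def not_le emeasure_ball_powr(1))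
  also have "\<dots> \<in> sets borel"
    using measure_ball_Diff_meas[OF \<Gamma>(1)]
    by (intro sets.Int \<Gamma> sets.sets_Collect_countable_All borel_measurable_less) auto
  finally have N: "N \<in> sets borel" .
  have bN: "bounded N" by (rule bounded_subset[OF \<Gamma>(2)]) (auto simp: N_def)
  note emN = bounded_finite_measure[OF bN N]
  have "measure lborel N = 0"
  proof (rule ccontr)
    assume "measure lborel N \<noteq> 0"
    then have mN: "0 < measure lborel N" by (simp add: less_le measure_nonneg)
    define e where "e = \<eta> * measure lborel N"
    have e: "0 < e" using mN \<eta> by (simp add: e_def)
    obtain W where W: "open W" "N \<subseteq> W" "emeasure lborel (W - N) < ennreal e"
      using outer_regular_lborel[of N e] N e by auto
    define K where "K = {(x, j). x \<in> N \<and> ball x (r j) \<subseteq> W}"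
    have "\<exists>i. i \<in> K \<and> x \<in> ball (fst i) (r (snd i)) \<and> r (snd i) < d" if x: "x \<in> N" and d: "0 < d" for x d
    proof -
      obtain d' where d': "0 < d'" "ball x d' \<subseteq> W" using W x open_contains_ball by blast
      have "\<forall>\<^sub>F j in sequentially. r j < min d d'" using r(2) d d' by (intro order_tendstoD) auto
      then obtain j where j: "r j < min d d'" unfolding eventually_sequentially by blast
      have "ball x (r j) \<subseteq> W" using j d'(2) subset_ball[of "r j" d' x] by auto
      then show ?thesis using x j r(1)[of j] by (intro exI[of _ "(x, j)"]) (auto simp: K_def)
    qed
    from Vitali_covering_theorem_balls[OF this]
    obtain C where C: "countable C" "C \<subseteq> K"
      "pairwise (\<lambda>i j. disjnt (ball (fst i) (r (snd i))) (ball (fst j) (r (snd j)))) C"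
      "negligible (N - (\<Union>i\<in>C. ball (fst i) (r (snd i))))" by blast
    let ?b = "\<lambda>i. ball (fst i) (r (snd i)) :: (real ^ 'n) set"
    have Ub: "(\<Union>i\<in>C. ?b i) \<in> sets borel" by (intro borel_open open_UN) auto
    have disj: "disjoint_family_on ?b C"
      using C(3) by (auto simp: disjoint_family_on_def pairwise_def disjnt_def)
    have "N - (\<Union>i\<in>C. ?b i) \<in> null_sets lebesgue" using C(4) by (simp add: negligible_iff_null_sets)
    then have null: "N - (\<Union>i\<in>C. ?b i) \<in> null_sets lborel"
      using N Ub by (subst (asm) null_sets_completion_iff) auto
    have "emeasure lborel N \<le> emeasure lborel ((\<Union>i\<in>C. ?b i \<inter> N) \<union> (N - (\<Union>i\<in>C. ?b i)))"
      using N Ub by (intro emeasure_mono) (auto intro!: sets.countable_UN' C(1))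
    also have "\<dots> \<le> emeasure lborel (\<Union>i\<in>C. ?b i \<inter> N) + emeasure lborel (N - (\<Union>i\<in>C. ?b i))"
      using N Ub by (intro emeasure_subadditive) (auto intro!: sets.countable_UN' C(1))
    also have "emeasure lborel (N - (\<Union>i\<in>C. ?b i)) = 0" using null by auto
    also have "emeasure lborel (\<Union>i\<in>C. ?b i \<inter> N) + 0 \<le> (\<integral>\<^sup>+i. emeasure lborel (?b i \<inter> N) \<partial>count_space C)"
      using emeasure_UN_countable_le[OF C(1), of "\<lambda>i. ?b i \<inter> N" lborel] N by simp
    also have "\<dots> \<le> (\<integral>\<^sup>+i. ennreal (1 - \<eta>) * emeasure lborel (?b i) \<partial>count_space C)"
    proof (rule nn_integral_mono)
      fix i assume "i \<in> space (count_space C)"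
      then have i: "i \<in> K" using C by auto
      then obtain x j where ij: "i = (x, j)" "x \<in> N" by (auto simp: K_def)
      have "\<not> thick \<eta> \<Gamma> x (r j)" using ij by (auto simp: N_def)
      then have nt: "\<eta> * measure lborel (ball x (r j)) < measure lborel (ball x (r j) - \<Gamma>)" by (simp add: thick_def)
      have "measure lborel (ball x (r j) \<inter> N) \<le> measure lborel (ball x (r j) \<inter> \<Gamma>)"
        using N \<Gamma>(1) emeasure_bounded_finite[of "ball x (r j) \<inter> \<Gamma>"]
        by (intro measure_mono_fmeasurable) (auto simp: fmeasurable_def N_def bounded_Int)
      also have "\<dots> = measure lborel (ball x (r j)) - measure lborel (ball x (r j) - \<Gamma>)"
      proof -
        have "measure lborel ((ball x (r j) \<inter> \<Gamma>) \<union> (ball x (r j) - \<Gamma>)) = measure lborel (ball x (r j) \<inter> \<Gamma>) + measure lborel (ball x (r j) - \<Gamma>)"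
          using \<Gamma>(1) by (intro measure_Union) (auto simp: bounded_finite_measure bounded_diff bounded_Int)
        then show ?thesis by (simp add: Int_Diff_Un)
      qed
      finally have "measure lborel (ball x (r j) \<inter> N) \<le> (1 - \<eta>) * measure lborel (ball x (r j))"
        using nt by (simp add: algebra_simps)
      then show "emeasure lborel (?b i \<inter> N) \<le> ennreal (1 - \<eta>) * emeasure lborel (?b i)"
        using \<eta> N ij by (simp add: emeasure_ball_eq bounded_finite_measure bounded_Int ennreal_mult[symmetric])
    qed
    also have "\<dots> = ennreal (1 - \<eta>) * (\<integral>\<^sup>+i. emeasure lborel (?b i) \<partial>count_space C)"
      by (rule nn_integral_cmult) simp
    also have "(\<integral>\<^sup>+i. emeasure lborel (?b i) \<partial>count_space C) = emeasure lborel (\<Union>i\<in>C. ?b i)"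
      by (rule emeasure_UN_countable[symmetric]) (use C disj in auto)
    also have "ennreal (1 - \<eta>) * \<dots> \<le> ennreal (1 - \<eta>) * emeasure lborel W"
    proof -
      have "?b i \<subseteq> W" if "i \<in> C" for i
        using subsetD[OF C(2) that] by (cases i) (simp add: K_def)
      then show ?thesis using W(1) by (intro mult_left_mono emeasure_mono UN_least) auto
    qed
    also have "emeasure lborel W \<le> emeasure lborel N + emeasure lborel (W - N)"
      using emeasure_subadditive[of N lborel "W - N"] N W by (simp add: Un_absorb1)
    also have "\<dots> \<le> ennreal (measure lborel N + e)"
      using W(3) e by (simp add: emN ennreal_plus measure_nonneg)
    finally have "ennreal (measure lborel N) \<le> ennreal (1 - \<eta>) * ennreal (measure lborel N + e)"
      using \<eta> by (simp add: emN mult_left_mono)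
    then have "measure lborel N \<le> (1 - \<eta>) * (measure lborel N + e)"
      using \<eta> e mN by (simp add: ennreal_mult[symmetric] del: ennreal_plus)
    also have "\<dots> = (1 - \<eta>\<^sup>2) * measure lborel N"
      by (simp add: e_def algebra_simps power2_eq_square)
    also have "\<dots> < measure lborel N" using mN \<eta> by (simp add: algebra_simps)
    finally show False by simp
  qed
  then show ?thesis by (simp add: N_def)
qed

lemma thick_growth:
  fixes \<Gamma> :: "(real ^ 'n) set"
  assumes \<Gamma>: "\<Gamma> \<in> sets borel" "bounded \<Gamma>" and \<eta>: "0 < \<eta>" "\<eta> < 1" and \<rho>: "0 < \<rho>"
    and thin: "\<And>x. x \<in> \<Gamma> \<Longrightarrow> \<not> thick \<eta> \<Gamma> x \<rho>"
  defines "\<Gamma>1 \<equiv> \<Union>{ball x (2 * (\<rho> / 2 ^ j)) | x j. x \<in> \<Gamma> \<and> 0 < j \<and> thick \<eta> \<Gamma> x (\<rho> / 2 ^ j)}"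
  shows "(1 + \<eta> / 5 ^ CARD('n)) * measure lborel \<Gamma> \<le> measure lborel (\<Gamma>1 :: (real ^ 'n) set)"
proof -
  let ?r = "\<lambda>j::nat. \<rho> / 2 ^ j"
  have lim: "?r \<longlonglongrightarrow> 0" using LIMSEQ_divide_realpow_zero[of 2 \<rho>] by simp
  define N where "N = {x \<in> \<Gamma>. \<forall>j. \<not> thick \<eta> \<Gamma> x (?r j)}"
  have mN: "measure lborel N = 0"
    unfolding N_def by (rule thick_AE[OF \<Gamma> \<eta> _ lim]) (use \<rho> in auto)
  have NB: "N \<in> sets borel"
  proof -
    have "N = \<Gamma> \<inter> {x \<in> space borel. \<forall>j. \<eta> * measure lborel (ball (0 :: real ^ 'n) (?r j)) < measure lborel (ball x (?r j) - \<Gamma>)}"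
      using \<rho> by (auto simp: N_def thick_def not_le emeasure_ball_powr(1))
    also have "\<dots> \<in> sets borel"
      using measure_ball_Diff_meas[OF \<Gamma>(1)]
      by (intro sets.Int \<Gamma> sets.sets_Collect_countable_All borel_measurable_less) auto
    finally show ?thesis .
  qed
  define J where "J = (\<lambda>x. LEAST j. thick \<eta> \<Gamma> x (?r j))"
  have J: "thick \<eta> \<Gamma> x (?r (J x))" "0 < J x" "\<not> thick \<eta> \<Gamma> x (2 * ?r (J x))" if "x \<in> \<Gamma> - N" for x
  proof -
    obtain j where "thick \<eta> \<Gamma> x (?r j)" using \<open>x \<in> \<Gamma> - N\<close> by (auto simp: N_def)
    then show 1: "thick \<eta> \<Gamma> x (?r (J x))" unfolding J_def by (rule LeastI)
    show 2: "0 < J x"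
    proof (rule ccontr)
      assume "\<not> 0 < J x"
      then show False using 1 thin[of x] that by simp
    qed
    then have "\<not> thick \<eta> \<Gamma> x (?r (J x - 1))" unfolding J_def by (intro not_less_Least) simp
    moreover have "?r (J x - 1) = 2 * ?r (J x)" using 2 by (cases "J x") auto
    ultimately show "\<not> thick \<eta> \<Gamma> x (2 * ?r (J x))" by simp
  qed
  let ?R = "\<lambda>x. 2 * ?r (J x)"
  have R0: "0 < ?R x" for x using \<rho> by simp
  have cov: "\<Gamma> - N \<subseteq> (\<Union>x\<in>\<Gamma> - N. ball x (?R x))" using R0 by auto
  have R_le: "0 < ?R x \<and> ?R x \<le> 2 * \<rho>" for x using \<rho> by (simp add: divide_le_eq)
  from Vitali_covering_lemma_balls[OF cov R_le] obtain C where C: "countable C" "C \<subseteq> \<Gamma> - N"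
    "pairwise (\<lambda>i j. disjnt (ball i (?R i)) (ball j (?R j))) C"
    "\<Gamma> - N \<subseteq> (\<Union>i\<in>C. ball i (5 * ?R i))" by blast
  have b1: "ball x (?R x) \<subseteq> \<Gamma>1" if "x \<in> C" for x
    using J[of x] that C(2) unfolding \<Gamma>1_def by (intro Union_upper) blast
  have \<Gamma>1_open: "open \<Gamma>1" unfolding \<Gamma>1_def by (intro open_Union) auto
  have \<Gamma>1_bdd: "bounded \<Gamma>1"
  proof -
    obtain M where M: "\<And>x. x \<in> \<Gamma> \<Longrightarrow> norm x \<le> M" using \<Gamma>(2) by (auto simp: bounded_iff)
    have "norm y \<le> M + 2 * \<rho>" if "y \<in> \<Gamma>1" for y
    proof -
      obtain x j where xj: "y \<in> ball x (2 * (\<rho> / 2 ^ j))" "x \<in> \<Gamma>" using \<open>y \<in> \<Gamma>1\<close> by (auto simp: \<Gamma>1_def)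
      have "2 * (\<rho> / 2 ^ j) \<le> 2 * \<rho>" using \<rho> by (simp add: divide_le_eq)
      moreover have "norm y \<le> norm x + norm (x - y)" using norm_triangle_sub[of y x] by (simp add: norm_minus_commute)
      ultimately show ?thesis using xj M[of x] by (simp add: dist_norm)
    qed
    then show ?thesis by (auto simp: bounded_iff)
  qed
  have \<Gamma>1B: "\<Gamma>1 \<in> sets borel" using \<Gamma>1_open by simp
  let ?S = "\<integral>\<^sup>+x. emeasure lborel (ball x (?R x)) \<partial>count_space C"
  have "emeasure lborel \<Gamma> \<le> emeasure lborel (\<Gamma> - N) + emeasure lborel N"
    using emeasure_subadditive[of "\<Gamma> - N" lborel N] \<Gamma> NB by (simp add: N_def Un_absorb2 Collect_mono_iff subset_eq)
  also have "emeasure lborel N = 0"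
    using bounded_finite_measure[OF bounded_subset[OF \<Gamma>(2)] NB] mN by (simp add: N_def)
  also have "emeasure lborel (\<Gamma> - N) + 0 \<le> emeasure lborel (\<Union>i\<in>C. ball i (5 * ?R i))"
    using C(4) by (simp, intro emeasure_mono) (auto intro!: borel_open)
  also have "\<dots> \<le> (\<integral>\<^sup>+i. emeasure lborel (ball i (5 * ?R i)) \<partial>count_space C)"
    by (rule emeasure_UN_countable_le[OF C(1)]) simp
  also have "\<dots> = (\<integral>\<^sup>+i. ennreal (5 ^ CARD('n)) * emeasure lborel (ball i (?R i)) \<partial>count_space C)"
  proof (rule nn_integral_cong)
    fix i
    show "emeasure lborel (ball i (5 * ?R i)) = ennreal (5 ^ CARD('n)) * emeasure lborel (ball i (?R i))"
      unfolding emeasure_ball_eq using measure_ball_scale[of 5 "?R i" i i] R0[of i]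
      by (subst ennreal_mult[symmetric]) auto
  qed
  also have "\<dots> = ennreal (5 ^ CARD('n)) * ?S" by (rule nn_integral_cmult) simp
  finally have 1: "emeasure lborel \<Gamma> \<le> ennreal (5 ^ CARD('n)) * ?S" .
  have disj: "disjoint_family_on (\<lambda>x. ball x (?R x) - \<Gamma>) C"
    using C(3) by (auto simp: disjoint_family_on_def pairwise_def disjnt_def)
  have "ennreal \<eta> * ?S = (\<integral>\<^sup>+x. ennreal \<eta> * emeasure lborel (ball x (?R x)) \<partial>count_space C)"
    by (rule nn_integral_cmult[symmetric]) simp
  also have "\<dots> \<le> (\<integral>\<^sup>+x. emeasure lborel (ball x (?R x) - \<Gamma>) \<partial>count_space C)"
  proof (rule nn_integral_mono)
    fix x assume "x \<in> space (count_space C)"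
    then have "\<not> thick \<eta> \<Gamma> x (?R x)" using J(3)[of x] C(2) by auto
    then have "\<eta> * measure lborel (ball x (?R x)) \<le> measure lborel (ball x (?R x) - \<Gamma>)" by (simp add: thick_def)
    then show "ennreal \<eta> * emeasure lborel (ball x (?R x)) \<le> emeasure lborel (ball x (?R x) - \<Gamma>)"
      using \<eta> \<Gamma>(1) by (simp add: emeasure_ball_eq bounded_finite_measure bounded_diff ennreal_mult[symmetric] ennreal_leI)
  qed
  also have "\<dots> = emeasure lborel (\<Union>x\<in>C. ball x (?R x) - \<Gamma>)"
    by (rule emeasure_UN_countable[symmetric]) (use C(1) disj \<Gamma>(1) in auto)
  also have "\<dots> \<le> emeasure lborel (\<Gamma>1 - \<Gamma>)"
    using b1 \<Gamma>(1) \<Gamma>1B by (intro emeasure_mono) auto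
  finally have 2: "ennreal \<eta> * ?S \<le> emeasure lborel (\<Gamma>1 - \<Gamma>)" .
  have sub: "emeasure lborel \<Gamma> \<le> emeasure lborel (\<Gamma>1 \<inter> \<Gamma>)"
  proof -
    have "emeasure lborel \<Gamma> \<le> emeasure lborel (\<Gamma> - N) + emeasure lborel N"
      using emeasure_subadditive[of "\<Gamma> - N" lborel N] \<Gamma> NB by (simp add: N_def Un_absorb2 Collect_mono_iff subset_eq)
    also have "emeasure lborel N = 0"
      using bounded_finite_measure[OF bounded_subset[OF \<Gamma>(2)] NB] mN by (simp add: N_def)
    also have "emeasure lborel (\<Gamma> - N) + 0 \<le> emeasure lborel (\<Gamma>1 \<inter> \<Gamma>)"
    proof -
      have "x \<in> \<Gamma>1" if x: "x \<in> \<Gamma> - N" for x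
      proof -
        have "ball x (?R x) \<subseteq> \<Gamma>1" using J[OF x] x unfolding \<Gamma>1_def by (intro Union_upper) blast
        then show ?thesis using R0[of x] by auto
      qed
      then show ?thesis using \<Gamma>(1) \<Gamma>1B by (simp, intro emeasure_mono) auto
    qed
    finally show ?thesis .
  qed
  have m1: "measure lborel \<Gamma> \<le> measure lborel (\<Gamma>1 \<inter> \<Gamma>)"
    using sub \<Gamma> \<Gamma>1B \<Gamma>1_bdd by (simp add: bounded_finite_measure bounded_Int)
  have "?S \<le> ennreal (measure lborel (\<Gamma>1 - \<Gamma>) / \<eta>)"
  proof -
    have "?S = ennreal (1 / \<eta>) * (ennreal \<eta> * ?S)"
      using \<eta> by (simp add: mult.assoc[symmetric] ennreal_mult[symmetric])
    also have "\<dots> \<le> ennreal (1 / \<eta>) * ennreal (measure lborel (\<Gamma>1 - \<Gamma>))"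
      using 2 \<Gamma>1_bdd \<Gamma>1B \<Gamma>(1) by (intro mult_left_mono) (simp_all add: bounded_finite_measure bounded_diff)
    finally show ?thesis using \<eta> by (simp add: ennreal_mult[symmetric])
  qed
  with 1 have "emeasure lborel \<Gamma> \<le> ennreal (5 ^ CARD('n)) * ennreal (measure lborel (\<Gamma>1 - \<Gamma>) / \<eta>)"
    by (meson mult_left_mono order_trans zero_le)
  then have "measure lborel \<Gamma> \<le> 5 ^ CARD('n) * (measure lborel (\<Gamma>1 - \<Gamma>) / \<eta>)"
    using \<eta> \<Gamma> by (simp add: bounded_finite_measure ennreal_mult[symmetric])
  then have "\<eta> / 5 ^ CARD('n) * measure lborel \<Gamma> \<le> measure lborel (\<Gamma>1 - \<Gamma>)"
    using \<eta> by (simp add: field_simps)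
  moreover have "measure lborel \<Gamma>1 = measure lborel (\<Gamma>1 \<inter> \<Gamma>) + measure lborel (\<Gamma>1 - \<Gamma>)"
  proof -
    have "measure lborel ((\<Gamma>1 \<inter> \<Gamma>) \<union> (\<Gamma>1 - \<Gamma>)) = measure lborel (\<Gamma>1 \<inter> \<Gamma>) + measure lborel (\<Gamma>1 - \<Gamma>)"
      using \<Gamma>1_bdd \<Gamma>1B \<Gamma>(1) by (intro measure_Union) (auto simp: bounded_finite_measure bounded_diff bounded_Int)
    then show ?thesis by (simp add: Int_Diff_Un)
  qed
  ultimately show ?thesis using m1 by (simp add: distrib_right)
qed

section \<open>Oscillation decay of almost harmonic functions\<close>

context elliptic_diffusion
begin

lemma X_in_GX: "0 \<le> s \<Longrightarrow> \<Gamma> \<in> sets borel \<Longrightarrow> {w \<in> Om. X s w \<in> \<Gamma>} \<in> sets GX"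
  unfolding sets_GX by (intro sigma_sets.Basic) blast

definition density_const :: "real \<Rightarrow> real \<Rightarrow> real \<Rightarrow> bool" where
  "density_const h \<eta> \<epsilon> \<longleftrightarrow> 0 < h \<and> 0 < \<eta> \<and> \<eta> < 1 \<and> 0 < \<epsilon> \<and>
    (\<forall>C U z r l \<Gamma>. near_harmonic C U \<longrightarrow> 0 < r \<longrightarrow> drift z r \<le> ennreal \<epsilon> \<longrightarrow> 0 \<le> l \<longrightarrow>
     (\<forall>y\<in>ball z r. 0 \<le> U y) \<longrightarrow> \<Gamma> \<in> sets borel \<longrightarrow> (\<forall>y\<in>\<Gamma>. l \<le> U y) \<longrightarrow> thick \<eta> \<Gamma> z r \<longrightarrow>
     (\<forall>y\<in>ball z (r / 2). l / 4 - C * h * r\<^sup>2 \<le> U y))"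

definition doubling_const :: "real \<Rightarrow> real \<Rightarrow> real \<Rightarrow> bool" where
  "doubling_const \<kappa> \<epsilon> K \<longleftrightarrow> 0 < \<kappa> \<and> \<kappa> \<le> 1 \<and> 0 < \<epsilon> \<and> 0 \<le> K \<and>
    (\<forall>C U z \<rho> l. near_harmonic C U \<longrightarrow> 0 < \<rho> \<longrightarrow> drift z (8 * \<rho>) \<le> ennreal \<epsilon> \<longrightarrow>
     (\<forall>y\<in>ball z (5 * \<rho>). 0 \<le> U y) \<longrightarrow> (\<forall>y\<in>ball z \<rho>. l \<le> U y) \<longrightarrow>
     (\<forall>y\<in>ball z (2 * \<rho>). \<kappa> * l - C * K * \<rho>\<^sup>2 \<le> U y))"

definition growth_const :: "real \<Rightarrow> real \<Rightarrow> real \<Rightarrow> real \<Rightarrow> bool" where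
  "growth_const \<kappa> \<eta> \<epsilon> K \<longleftrightarrow> 0 < \<kappa> \<and> \<kappa> \<le> 1 \<and> 0 < \<eta> \<and> \<eta> < 1 \<and> 0 < \<epsilon> \<and> 0 \<le> K \<and>
    (\<forall>C U z r l \<Gamma>. near_harmonic C U \<longrightarrow> 0 < r \<longrightarrow> drift z (8 * r) \<le> ennreal \<epsilon> \<longrightarrow>
     (\<forall>y\<in>ball z (5 * r). 0 \<le> U y) \<longrightarrow> \<Gamma> \<in> sets borel \<longrightarrow> (\<forall>y\<in>\<Gamma>. l \<le> U y) \<longrightarrow> thick \<eta> \<Gamma> z r \<longrightarrow>
     (\<forall>y\<in>ball z (2 * r). \<kappa> * l - C * K * r\<^sup>2 \<le> U y))"

definition spread_const :: "real \<Rightarrow> real \<Rightarrow> real \<Rightarrow> bool" where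
  "spread_const \<kappa> \<epsilon> K \<longleftrightarrow> 0 < \<kappa> \<and> \<kappa> \<le> 1 \<and> 0 < \<epsilon> \<and> 0 \<le> K \<and>
    (\<forall>C U y R l \<Gamma>. near_harmonic C U \<longrightarrow> 0 < R \<longrightarrow> drift y (20 * R) \<le> ennreal \<epsilon> \<longrightarrow> 0 \<le> l \<longrightarrow>
     (\<forall>\<phi>\<in>ball y (20 * R). 0 \<le> U \<phi>) \<longrightarrow> \<Gamma> \<in> sets borel \<longrightarrow> \<Gamma> \<subseteq> ball y R \<longrightarrow> (\<forall>\<phi>\<in>\<Gamma>. l \<le> U \<phi>) \<longrightarrow>
     measure lborel (ball y R) / 2 \<le> measure lborel \<Gamma> \<longrightarrow>
     (\<forall>\<phi>\<in>ball y R. \<kappa> * l - C * K * R\<^sup>2 \<le> U \<phi>))"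

lemma occupation_fixed_time:
  assumes r: "0 < r" and T: "0 < T" and A: "A \<in> sets borel" and m: "measure lborel (A \<inter> ball x r) \<le> m"
    and small: "N0 * r * m powr (1 / real CARD('n)) < T * c" and c: "0 < c"
  obtains s where "0 < s" "s < T"
    "measure (P x) {w \<in> Om. X s w \<in> A \<and> s < hitX (ball x r) T w} \<le> c"
proof -
  let ?\<sigma> = "hitX (ball x r) T"
  let ?E = "\<lambda>s. {w \<in> Om. X s w \<in> A \<and> s < ?\<sigma> w}"
  have \<sigma>m: "?\<sigma> \<in> borel_measurable GX" by (rule hitX_meas) (use T in auto)
  have E: "?E s \<in> sets GX" if "0 \<le> s" for s
  proof -
    have "{w \<in> space GX. X s w \<in> A} \<in> sets GX" using X_in_GX[OF that A] by simp
    moreover have "{w \<in> space GX. s < ?\<sigma> w} \<in> sets GX" using \<sigma>m by measurable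
    ultimately have "{w \<in> space GX. X s w \<in> A} \<inter> {w \<in> space GX. s < ?\<sigma> w} \<in> sets GX" by (rule sets.Int)
    moreover have "{w \<in> space GX. X s w \<in> A} \<inter> {w \<in> space GX. s < ?\<sigma> w} = ?E s" by auto
    ultimately show ?thesis by simp
  qed
  let ?f = "\<lambda>w s. indicator A (X (max 0 s) w) * indicator {0..<?\<sigma> w} s :: ennreal"
  have "(\<integral>\<^sup>+s. (\<integral>\<^sup>+w. ?f w s \<partial>P x) \<partial>lborel) = (\<integral>\<^sup>+w. (\<integral>\<^sup>+s. ?f w s \<partial>lborel) \<partial>P x)"
    by (rule path_Fubini[OF indicator_joint_meas[OF A \<sigma>m], symmetric])
  also have "\<dots> \<le> (\<integral>\<^sup>+w. (\<integral>\<^sup>+t\<in>before_exit (ball x r) (\<lambda>t. X t w). indicator A (X t w) \<partial>lborel) \<partial>P x)"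
  proof (intro nn_integral_mono)
    fix w s
    show "?f w s \<le> indicator A (X s w) * indicator (before_exit (ball x r) (\<lambda>t. X t w)) s"
      using less_hit_before_exit[of s "ball x r" T "\<lambda>t. X t w"] by (auto simp: indicator_def max_absorb2)
  qed
  also have "\<dots> \<le> ennreal (N0 * r * m powr (1 / real CARD('n)))" by (rule occupation_bound[OF r A m])
  also have "\<dots> < ennreal (T * c)" using small N0_pos r by (intro ennreal_lessI) (use T c in auto)
  finally have less: "(\<integral>\<^sup>+s. (\<integral>\<^sup>+w. ?f w s \<partial>P x) \<partial>lborel) < ennreal (T * c)" .
  have "\<exists>s. 0 < s \<and> s < T \<and> measure (P x) (?E s) \<le> c"
  proof (rule ccontr)
    assume "\<not> ?thesis"
    then have big: "c < measure (P x) (?E s)" if "0 < s" "s < T" for s using that by force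
    have "ennreal (T * c) = (\<integral>\<^sup>+s. ennreal c * indicator {0<..<T} s \<partial>lborel)"
      using T c by (simp add: nn_integral_cmult ennreal_mult[symmetric] mult.commute)
    also have "\<dots> \<le> (\<integral>\<^sup>+s. (\<integral>\<^sup>+w. ?f w s \<partial>P x) \<partial>lborel)"
    proof (rule nn_integral_mono)
      fix s
      show "ennreal c * indicator {0<..<T} s \<le> (\<integral>\<^sup>+w. ?f w s \<partial>P x)"
      proof (cases "0 < s \<and> s < T")
        case True
        have "(\<integral>\<^sup>+w. ?f w s \<partial>P x) = (\<integral>\<^sup>+w. indicator (?E s) w \<partial>P x)"
          using True by (intro nn_integral_cong) (auto simp: indicator_def max_absorb2)
        also have "\<dots> = ennreal (measure (P x) (?E s))"
          using E[of s] True sets_GX_sub[of x] by (subst nn_integral_indicator) (auto simp: P.emeasure_eq_measure)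
        finally show ?thesis using big[of s] True by (simp add: ennreal_leI less_imp_le)
      qed simp
    qed
    finally show False using less by simp
  qed
  then show ?thesis using that by blast
qed

lemma density_lower: "\<exists>h \<eta> \<epsilon>. density_const h \<eta> \<epsilon>"
proof -
  define h where "h = \<delta> / (12 * real CARD('n))"
  have h: "0 < h" using \<delta>_pos by (simp add: h_def)
  define \<epsilon> where "\<epsilon> = 1 / (24 * N0)"
  have \<epsilon>: "0 < \<epsilon>" using N0_pos by (simp add: \<epsilon>_def)
  define c where "c = min (1 / 2) (h / (32 * N0 * vol_const))"
  have c: "0 < c" "c \<le> 1 / 2" "c \<le> h / (32 * N0 * vol_const)" using h N0_pos vol_const_pos by (auto simp: c_def)
  define \<eta> where "\<eta> = c ^ CARD('n)"
  have \<eta>0: "0 < \<eta>" using c by (simp add: \<eta>_def)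
  have "\<eta> \<le> c ^ 1" unfolding \<eta>_def using c by (intro power_decreasing) auto
  then have \<eta>1: "\<eta> < 1" using c by simp
  have "c = \<eta> powr (1 / real CARD('n))"
    unfolding \<eta>_def using c by (simp add: powr_realpow[symmetric] powr_powr)
  then have \<eta>_root: "\<eta> powr (1 / real CARD('n)) = c" by simp
  have "l / 4 - C * h * r\<^sup>2 \<le> U x"
    if nh: "near_harmonic C U" and r: "0 < r" and dr: "drift z r \<le> ennreal \<epsilon>" and l: "0 \<le> l"
      and U0: "\<forall>y\<in>ball z r. 0 \<le> U y" and \<Gamma>: "\<Gamma> \<in> sets borel" "\<forall>y\<in>\<Gamma>. l \<le> U y" and th: "thick \<eta> \<Gamma> z r"
      and x: "x \<in> ball z (r / 2)" for C U z r l \<Gamma> x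
  proof -
    define \<rho> where "\<rho> = r / 4"
    have \<rho>: "0 < \<rho>" using r by (simp add: \<rho>_def)
    define T where "T = h * \<rho>\<^sup>2"
    have T: "0 < T" using h \<rho> by (simp add: T_def)
    have sub: "ball x \<rho> \<subseteq> ball z r" by (rule ball_subsetI) (use x r in \<open>simp add: \<rho>_def dist_commute\<close>)
    have csub: "cball x \<rho> \<subseteq> ball z r"
    proof
      fix y assume "y \<in> cball x \<rho>"
      then have "dist x y \<le> r / 4" by (simp add: \<rho>_def)
      moreover have "dist z x < r / 2" using x by simp
      moreover have "dist z y \<le> dist z x + dist x y" by (rule dist_triangle)
      ultimately have "dist z y < r" using r by linarith
      then show "y \<in> ball z r" by simp
    qed
    define A where "A = ball z r - \<Gamma>"
    have A: "A \<in> sets borel" using \<Gamma> by (auto simp: A_def)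
    let ?m = "\<eta> * measure lborel (ball z r)"
    have m: "measure lborel (A \<inter> ball x \<rho>) \<le> ?m"
    proof -
      have "measure lborel (A \<inter> ball x \<rho>) \<le> measure lborel A"
        using A emeasure_bounded_finite[of A] by (intro measure_mono_fmeasurable) (auto simp: fmeasurable_def A_def bounded_diff)
      also have "\<dots> \<le> ?m" using th by (simp add: thick_def A_def)
      finally show ?thesis .
    qed
    have "?m powr (1 / real CARD('n)) = c * (vol_const * r)"
      using \<eta>0 r emeasure_ball_powr(2)[of r z] by (simp add: powr_mult \<eta>_root vol_const_def measure_nonneg)
    then have "N0 * \<rho> * ?m powr (1 / real CARD('n)) = 4 * (N0 * vol_const * c) * \<rho>\<^sup>2"
      by (simp add: \<rho>_def power2_eq_square)
    also have "N0 * vol_const * c \<le> h / 32"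
      using c(3) N0_pos vol_const_pos by (simp add: field_simps)
    then have "4 * (N0 * vol_const * c) * \<rho>\<^sup>2 \<le> h / 8 * \<rho>\<^sup>2" by (intro mult_right_mono) auto
    also have "\<dots> < T * (1 / 4)" using h \<rho> by (simp add: T_def)
    finally have small: "N0 * \<rho> * ?m powr (1 / real CARD('n)) < T * (1 / 4)" .
    obtain s where s: "0 < s" "s < T" and bad: "measure (P x) {w \<in> Om. X s w \<in> A \<and> s < hitX (ball x \<rho>) T w} \<le> 1 / 4"
      using occupation_fixed_time[OF \<rho> T A m small] by auto
    let ?B = "{w \<in> Om. X s w \<in> A \<and> s < hitX (ball x \<rho>) T w}"
    let ?E = "{w \<in> Om. hitX (ball x \<rho>) T w = T}"
    let ?\<sigma> = "hitX (ball x \<rho>) s"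
    define D where "D = {w \<in> Om. ?\<sigma> w = s} \<inter> {w \<in> Om. X s w \<in> \<Gamma>}"
    have XG: "{w \<in> Om. X s w \<in> Q} \<in> sets GX" if "Q \<in> sets borel" for Q
      using X_in_GX[OF _ that, of s] s by simp
    have D: "D \<in> sets GX" unfolding D_def using s \<Gamma> by (intro sets.Int hitX_eq_set XG) auto
    have B: "?B \<in> sets GX"
    proof -
      have "?B = {w \<in> Om. X s w \<in> A} \<inter> {w \<in> space GX. s < hitX (ball x \<rho>) T w}" by auto
      moreover have "{w \<in> space GX. s < hitX (ball x \<rho>) T w} \<in> sets GX"
        using hitX_meas[OF open_ball less_imp_le[OF T], of x \<rho>] by measurable
      ultimately show ?thesis using XG[OF A] by simp
    qed
    have "1 - 3 * real CARD('n) * T / (\<delta> * \<rho>\<^sup>2) - 6 * N0 * \<epsilon> \<le> measure (P x) ?E"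
      by (rule stay_prob) (use \<rho> T \<epsilon> order_trans[OF drift_mono[OF sub] dr] in auto)
    moreover have "3 * real CARD('n) * T / (\<delta> * \<rho>\<^sup>2) = 1 / 4"
      using \<delta>_pos \<rho> by (simp add: T_def h_def field_simps)
    moreover have "6 * N0 * \<epsilon> = 1 / 4" using N0_pos by (simp add: \<epsilon>_def)
    ultimately have PE: "1 / 2 \<le> measure (P x) ?E" by linarith
    have "?E \<subseteq> D \<union> ?B"
    proof
      fix w assume "w \<in> ?E"
      then have w: "w \<in> Om" and ET: "hitX (ball x \<rho>) T w = T" by auto
      have in_ball: "X u w \<in> ball x \<rho>" if "0 \<le> u" "u < T" for u
        using less_hit_imp_in[of u "ball x \<rho>" T "\<lambda>t. X t w"] that ET by simp
      have "?\<sigma> w = s"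
      proof (rule ccontr)
        assume "?\<sigma> w \<noteq> s"
        then have lt: "?\<sigma> w < s" using hit_le[of "ball x \<rho>" s "\<lambda>t. X t w"] by simp
        then have "X (?\<sigma> w) w \<notin> ball x \<rho>" by (rule hit_not_in[OF paths[OF w] open_ball])
        then show False using in_ball[of "?\<sigma> w"] lt s hit_nonneg[of s "ball x \<rho>" "\<lambda>t. X t w"] by simp
      qed
      moreover have "X s w \<in> ball z r" using in_ball[of s] s sub by auto
      ultimately show "w \<in> D \<union> ?B" using w ET s by (auto simp: D_def A_def)
    qed
    then have "measure (P x) ?E \<le> measure (P x) (D \<union> ?B)"
      using D B sets_GX_sub[of x] by (intro P.finite_measure_mono) auto
    also have "\<dots> \<le> measure (P x) D + measure (P x) ?B"
      using D B sets_GX_sub[of x] by (intro measure_Un_le) auto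
    finally have PD: "1 / 4 \<le> measure (P x) D" using PE bad by linarith
    have \<sigma>: "stopping s ?\<sigma>" by (rule stopping_hitX) (use s in auto)
    have "(\<integral>w. l * indicator D w \<partial>P x) - C * s \<le> U x"
    proof (rule near_harmonic_ge[OF nh \<sigma> s(1)])
      show "(\<lambda>w. l * indicator D w) \<in> borel_measurable GX" using D by measurable
      show "\<bar>l * indicator D w\<bar> \<le> l" for w using l by (simp add: indicator_def)
      fix w assume w: "w \<in> Om" "X 0 w = x"
      show "\<forall>\<^sub>F n in sequentially. l * indicator D w \<le> U (X (grid s n (?\<sigma> w)) w)"
      proof (cases "w \<in> D")
        case True
        show ?thesis using eventually_gt_at_top[of 0]
        proof eventually_elim
          case (elim n)
          have "X (grid s n (?\<sigma> w)) w \<in> \<Gamma>" using True grid_self[OF s(1) elim] by (simp add: D_def)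
          then show ?case using \<Gamma>(2) True by simp
        qed
      next
        case False
        have lim: "(\<lambda>n. X (grid s n (?\<sigma> w)) w) \<longlonglongrightarrow> X (?\<sigma> w) w" by (rule X_grid_tendsto[OF \<sigma> s(1) w(1)])
        have "X (?\<sigma> w) w \<in> closure (ball x \<rho>)"
          by (rule hit_in_closure[OF paths[OF w(1)], of "ball x \<rho>" _ s]) (use w \<rho> stoppingD(1)[OF \<sigma> w(1)] in auto)
        then have "X (?\<sigma> w) w \<in> ball z r" using csub \<rho> by auto
        then have "\<forall>\<^sub>F n in sequentially. X (grid s n (?\<sigma> w)) w \<in> ball z r"
          by (rule topological_tendstoD[OF lim open_ball])
        then show ?thesis by eventually_elim (use U0 False in auto)
      qed
    qed
    moreover have "l / 4 \<le> (\<integral>w. l * indicator D w \<partial>P x)"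
      using mult_left_mono[OF PD l] unfolding P_integral_indicator[OF D] by simp
    moreover have "C * s \<le> C * h * r\<^sup>2"
    proof -
      have "s \<le> h * (r / 4)\<^sup>2" using s by (simp add: T_def \<rho>_def)
      also have "\<dots> \<le> h * r\<^sup>2" using h r by (intro mult_left_mono power_mono) auto
      finally show ?thesis using mult_left_mono[OF _ near_harmonic_nonneg[OF nh]] by (simp add: mult.assoc)
    qed
    ultimately show ?thesis by linarith
  qed
  then have "density_const h \<eta> \<epsilon>"
    unfolding density_const_def using h \<eta>0 \<eta>1 \<epsilon> by blast
  then show ?thesis by blast
qed

lemma doubling_signed: "\<exists>\<kappa> \<epsilon> K. doubling_const \<kappa> \<epsilon> K"
proof -
  obtain \<kappa> \<epsilon> K where *: "0 < \<kappa>" "\<kappa> \<le> 1" "0 < \<epsilon>" "0 \<le> K" and D: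
    "\<And>C U z \<rho> l. near_harmonic C U \<Longrightarrow> 0 < \<rho> \<Longrightarrow> drift z (8 * \<rho>) \<le> ennreal \<epsilon> \<Longrightarrow> 0 \<le> l \<Longrightarrow>
     (\<forall>y\<in>ball z (5 * \<rho>). 0 \<le> U y) \<Longrightarrow> (\<forall>y\<in>ball z \<rho>. l \<le> U y) \<Longrightarrow>
     (\<forall>y\<in>ball z (2 * \<rho>). \<kappa> * l - C * K * \<rho>\<^sup>2 \<le> U y)"
    using doubling by blast
  have "\<kappa> * l - C * K * \<rho>\<^sup>2 \<le> U y"
    if nh: "near_harmonic C U" and \<rho>: "0 < \<rho>" and dr: "drift z (8 * \<rho>) \<le> ennreal \<epsilon>"
      and U0: "\<forall>y\<in>ball z (5 * \<rho>). 0 \<le> U y" and Ul: "\<forall>y\<in>ball z \<rho>. l \<le> U y" and y: "y \<in> ball z (2 * \<rho>)" for C U z \<rho> l y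
  proof (cases "0 \<le> l")
    case True
    then show ?thesis using D[OF nh \<rho> dr True U0 Ul] y by blast
  next
    case False
    have "\<kappa> * l \<le> 0" using False *(1) by (simp add: mult_le_0_iff)
    moreover have "0 \<le> C * K * \<rho>\<^sup>2" using near_harmonic_nonneg[OF nh] *(4) by simp
    moreover have "y \<in> ball z (5 * \<rho>)" using y \<rho> by simp
    ultimately show ?thesis using U0 by force
  qed
  then have "doubling_const \<kappa> \<epsilon> K"
    unfolding doubling_const_def using * by blast
  then show ?thesis by blast
qed

lemma density_growth: "\<exists>\<kappa> \<eta> \<epsilon> K. growth_const \<kappa> \<eta> \<epsilon> K"
proof -
  obtain \<kappa> \<epsilon>1 K where "doubling_const \<kappa> \<epsilon>1 K" using doubling_signed by blast
  then have \<kappa>: "0 < \<kappa>" "\<kappa> \<le> 1" and \<epsilon>1: "0 < \<epsilon>1" and K: "0 \<le> K" and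
    D: "\<And>C U z \<rho> l. near_harmonic C U \<Longrightarrow> 0 < \<rho> \<Longrightarrow> drift z (8 * \<rho>) \<le> ennreal \<epsilon>1 \<Longrightarrow>
     (\<forall>y\<in>ball z (5 * \<rho>). 0 \<le> U y) \<Longrightarrow> (\<forall>y\<in>ball z \<rho>. l \<le> U y) \<Longrightarrow>
     (\<forall>y\<in>ball z (2 * \<rho>). \<kappa> * l - C * K * \<rho>\<^sup>2 \<le> U y)"
    unfolding doubling_const_def by simp_all
  obtain h \<eta> \<epsilon>2 where "density_const h \<eta> \<epsilon>2" using density_lower by blast
  then have h: "0 < h" and \<eta>: "0 < \<eta>" "\<eta> < 1" and \<epsilon>2: "0 < \<epsilon>2" and
    G: "\<And>C U z r l \<Gamma>. near_harmonic C U \<Longrightarrow> 0 < r \<Longrightarrow> drift z r \<le> ennreal \<epsilon>2 \<Longrightarrow> 0 \<le> l \<Longrightarrow>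
     (\<forall>y\<in>ball z r. 0 \<le> U y) \<Longrightarrow> \<Gamma> \<in> sets borel \<Longrightarrow> (\<forall>y\<in>\<Gamma>. l \<le> U y) \<Longrightarrow> thick \<eta> \<Gamma> z r \<Longrightarrow>
     (\<forall>y\<in>ball z (r / 2). l / 4 - C * h * r\<^sup>2 \<le> U y)"
    unfolding density_const_def by blast+
  define \<epsilon> where "\<epsilon> = min \<epsilon>1 \<epsilon>2"
  have \<epsilon>_le: "ennreal \<epsilon> \<le> ennreal \<epsilon>1" "ennreal \<epsilon> \<le> ennreal \<epsilon>2" by (auto simp: \<epsilon>_def intro!: ennreal_leI)
  have "\<kappa>\<^sup>2 / 4 * l - C * (h + 2 * K) * r\<^sup>2 \<le> U y"
    if nh: "near_harmonic C U" and r: "0 < r" and dr: "drift z (8 * r) \<le> ennreal \<epsilon>"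
      and U0: "\<forall>y\<in>ball z (5 * r). 0 \<le> U y" and \<Gamma>: "\<Gamma> \<in> sets borel" "\<forall>y\<in>\<Gamma>. l \<le> U y" and th: "thick \<eta> \<Gamma> z r"
      and y: "y \<in> ball z (2 * r)" for C U z r l \<Gamma> y
  proof -
    have C: "0 \<le> C" by (rule near_harmonic_nonneg[OF nh])
    have Ch: "0 \<le> C * h * r\<^sup>2" "0 \<le> C * K * r\<^sup>2" using C h K by auto
    have dr': "drift z r' \<le> ennreal \<epsilon>1" "drift z r' \<le> ennreal \<epsilon>2" if "r' \<le> 8 * r" for r'
      using order_trans[OF drift_mono[OF subset_ball[OF that]] dr] \<epsilon>_le order_trans by blast+
    have U0': "\<forall>y\<in>ball z r'. 0 \<le> U y" if "r' \<le> 5 * r" for r' using U0 subset_ball[OF that] by blast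
    show ?thesis
    proof (cases "0 \<le> l")
      case True
      have 1: "\<forall>y\<in>ball z (r / 2). l / 4 - C * h * r\<^sup>2 \<le> U y"
        by (rule G[OF nh r dr'(2) True U0' \<Gamma> th]) (use r in auto)
      have 2: "\<forall>y\<in>ball z (2 * (r / 2)). \<kappa> * (l / 4 - C * h * r\<^sup>2) - C * K * (r / 2)\<^sup>2 \<le> U y"
        by (rule D[OF nh _ dr'(1) U0' 1]) (use r in auto)
      then have 2: "\<forall>y\<in>ball z r. \<kappa> * (l / 4 - C * h * r\<^sup>2) - C * K * (r / 2)\<^sup>2 \<le> U y" by simp
      have 3: "\<forall>y\<in>ball z (2 * r). \<kappa> * (\<kappa> * (l / 4 - C * h * r\<^sup>2) - C * K * (r / 2)\<^sup>2) - C * K * r\<^sup>2 \<le> U y"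
        by (rule D[OF nh r dr'(1) U0' 2]) (use r in auto)
      have "\<kappa> * \<kappa> * (C * h * r\<^sup>2) \<le> 1 * (C * h * r\<^sup>2)" using \<kappa> Ch by (intro mult_right_mono mult_le_one) auto
      moreover have "\<kappa> * (C * K * (r / 2)\<^sup>2) \<le> 1 * (C * K * r\<^sup>2)"
        using \<kappa> C K r by (intro mult_mono) (auto simp: power_divide)
      moreover have "\<kappa> * (\<kappa> * (l / 4 - C * h * r\<^sup>2) - C * K * (r / 2)\<^sup>2) - C * K * r\<^sup>2
        = \<kappa>\<^sup>2 / 4 * l - \<kappa> * \<kappa> * (C * h * r\<^sup>2) - \<kappa> * (C * K * (r / 2)\<^sup>2) - C * K * r\<^sup>2"
        by (simp add: algebra_simps power2_eq_square)
      moreover have "C * (h + 2 * K) * r\<^sup>2 = C * h * r\<^sup>2 + 2 * (C * K * r\<^sup>2)" by (simp add: algebra_simps)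
      ultimately show ?thesis using 3 y by fastforce
    next
      case False
      have "\<kappa>\<^sup>2 / 4 * l \<le> 0" using False by (simp add: mult_le_0_iff)
      moreover have "0 \<le> C * (h + 2 * K) * r\<^sup>2" using C h K by simp
      moreover have "0 \<le> U y" using U0 y r by simp
      ultimately show ?thesis by linarith
    qed
  qed
  moreover have "\<kappa>\<^sup>2 / 4 \<le> 1" using \<kappa> power_le_one[of \<kappa> 2] by simp
  moreover have "0 < \<kappa>\<^sup>2 / 4" "0 < \<epsilon>" "0 \<le> h + 2 * K" using \<kappa> h K \<epsilon>1 \<epsilon>2 by (auto simp: \<epsilon>_def)
  ultimately have "growth_const (\<kappa>\<^sup>2 / 4) \<eta> \<epsilon> (h + 2 * K)"
    unfolding growth_const_def using \<eta> by blast
  then show ?thesis by blast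
qed

lemma spread: "\<exists>\<kappa> \<epsilon> K. spread_const \<kappa> \<epsilon> K"
proof -
  obtain \<kappa>2 \<epsilon>2 K2 where "doubling_const \<kappa>2 \<epsilon>2 K2" using doubling_signed by blast
  then have \<kappa>2: "0 < \<kappa>2" "\<kappa>2 \<le> 1" and \<epsilon>2: "0 < \<epsilon>2" and K2: "0 \<le> K2" and
    D: "\<And>C U z \<rho> l. near_harmonic C U \<Longrightarrow> 0 < \<rho> \<Longrightarrow> drift z (8 * \<rho>) \<le> ennreal \<epsilon>2 \<Longrightarrow>
     (\<forall>y\<in>ball z (5 * \<rho>). 0 \<le> U y) \<Longrightarrow> (\<forall>y\<in>ball z \<rho>. l \<le> U y) \<Longrightarrow>
     (\<forall>y\<in>ball z (2 * \<rho>). \<kappa>2 * l - C * K2 * \<rho>\<^sup>2 \<le> U y)"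
    unfolding doubling_const_def by simp_all
  obtain \<kappa>1 \<eta> \<epsilon>1 K1 where "growth_const \<kappa>1 \<eta> \<epsilon>1 K1" using density_growth by blast
  then have \<kappa>1: "0 < \<kappa>1" "\<kappa>1 \<le> 1" and \<eta>: "0 < \<eta>" "\<eta> < 1" and \<epsilon>1: "0 < \<epsilon>1" and K1: "0 \<le> K1" and
    G: "\<And>C U z r l \<Gamma>. near_harmonic C U \<Longrightarrow> 0 < r \<Longrightarrow> drift z (8 * r) \<le> ennreal \<epsilon>1 \<Longrightarrow>
     (\<forall>y\<in>ball z (5 * r). 0 \<le> U y) \<Longrightarrow> \<Gamma> \<in> sets borel \<Longrightarrow> (\<forall>y\<in>\<Gamma>. l \<le> U y) \<Longrightarrow> thick \<eta> \<Gamma> z r \<Longrightarrow>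
     (\<forall>y\<in>ball z (2 * r). \<kappa>1 * l - C * K1 * r\<^sup>2 \<le> U y)"
    unfolding growth_const_def by blast+
  define c where "c = 1 + \<eta> / 5 ^ CARD('n)"
  have c: "1 < c" using \<eta> by (simp add: c_def)
  obtain m :: nat where m: "2 * 2 ^ CARD('n) < c ^ m" using real_arch_pow[OF c] by blast
  obtain q :: nat where q: "real m < 2 ^ q" using real_arch_pow[of 2 "real m"] by auto
  define \<epsilon> where "\<epsilon> = min \<epsilon>1 \<epsilon>2"
  have \<epsilon>_le: "ennreal \<epsilon> \<le> ennreal \<epsilon>1" "ennreal \<epsilon> \<le> ennreal \<epsilon>2" by (auto simp: \<epsilon>_def intro!: ennreal_leI)
  define \<kappa> where "\<kappa> = \<kappa>2 ^ (q + 2) * \<kappa>1 ^ m"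
  define K where "K = real m * K1 + real (q + 2) * (K2 * 16)"
  have \<kappa>: "0 < \<kappa>" "\<kappa> \<le> 1" using \<kappa>1 \<kappa>2 by (auto simp: \<kappa>_def intro!: mult_le_one power_le_one)
  have K: "0 \<le> K" using K1 K2 by (simp add: K_def)
  have "\<kappa> * l - C * K * R\<^sup>2 \<le> U x"
    if nh: "near_harmonic C U" and R: "0 < R" and dr: "drift y (20 * R) \<le> ennreal \<epsilon>" and l: "0 \<le> l"
      and U0: "\<forall>\<phi>\<in>ball y (20 * R). 0 \<le> U \<phi>" and \<Gamma>: "\<Gamma> \<in> sets borel" "\<Gamma> \<subseteq> ball y R" "\<forall>\<phi>\<in>\<Gamma>. l \<le> U \<phi>"
      and half: "measure lborel (ball y R) / 2 \<le> measure lborel \<Gamma>" and x: "x \<in> ball y R" for C U y R l \<Gamma> x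
  proof -
    have C: "0 \<le> C" by (rule near_harmonic_nonneg[OF nh])
    define \<rho> where "\<rho> = R / 2 ^ q"
    have \<rho>: "0 < \<rho>" "\<rho> \<le> R" using R by (auto simp: \<rho>_def divide_le_eq)
    have m\<rho>: "real m * \<rho> \<le> R" using q R by (simp add: \<rho>_def field_simps)
    have dr': "drift z r' \<le> ennreal \<epsilon>1" "drift z r' \<le> ennreal \<epsilon>2" if "z \<in> ball y (2 * R)" "r' \<le> 18 * R" for z r'
    proof -
      have "ball z r' \<subseteq> ball y (20 * R)" by (rule ball_subsetI) (use that in \<open>simp add: dist_commute\<close>)
      then have "drift z r' \<le> ennreal \<epsilon>" using drift_mono dr order_trans by blast
      then show "drift z r' \<le> ennreal \<epsilon>1" "drift z r' \<le> ennreal \<epsilon>2"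
        using \<epsilon>_le order_trans by blast+
    qed
    have U0': "\<forall>\<phi>\<in>ball z r'. 0 \<le> U \<phi>" if "z \<in> ball y (2 * R)" "r' \<le> 18 * R" for z r'
    proof -
      have "ball z r' \<subseteq> ball y (20 * R)" by (rule ball_subsetI) (use that in \<open>simp add: dist_commute\<close>)
      then show ?thesis using U0 by blast
    qed
    define L where "L = (\<lambda>k::nat. \<kappa>1 ^ k * l - real k * (C * K1 * R\<^sup>2))"
    have L_step: "L (Suc k) \<le> \<kappa>1 * L k - C * K1 * r\<^sup>2" if "r\<^sup>2 \<le> R\<^sup>2" for k r
    proof -
      have "\<kappa>1 * (real k * (C * K1 * R\<^sup>2)) \<le> 1 * (real k * (C * K1 * R\<^sup>2))"
        using \<kappa>1 C K1 by (intro mult_right_mono) auto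
      moreover have "C * K1 * r\<^sup>2 \<le> C * K1 * R\<^sup>2" using that C K1 by (intro mult_left_mono) auto
      ultimately show ?thesis by (simp add: L_def algebra_simps)
    qed
    have L_dec: "L (Suc k) \<le> L k" for k
    proof -
      have "\<kappa>1 ^ Suc k * l \<le> \<kappa>1 ^ k * l" using \<kappa>1 l by (intro mult_right_mono power_decreasing) auto
      moreover have "0 \<le> C * K1 * R\<^sup>2" using C K1 by simp
      ultimately show ?thesis by (simp add: L_def algebra_simps)
    qed
    have alt: "(\<exists>z\<in>ball y (2 * R). \<forall>\<phi>\<in>ball z \<rho>. L k \<le> U \<phi>) \<or>
      (\<exists>\<Gamma>'. \<Gamma>' \<in> sets borel \<and> \<Gamma>' \<subseteq> ball y (R + real k * \<rho>) \<and> c ^ k * (measure lborel (ball y R) / 2) \<le> measure lborel \<Gamma>'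
        \<and> (\<forall>\<phi>\<in>\<Gamma>'. L k \<le> U \<phi>))" if "k \<le> m" for k
      using that
    proof (induction k)
      case 0
      then show ?case using \<Gamma> half by (intro disjI2 exI[of _ \<Gamma>]) (simp add: L_def)
    next
      case (Suc k)
      then have "(\<exists>z\<in>ball y (2 * R). \<forall>\<phi>\<in>ball z \<rho>. L k \<le> U \<phi>) \<or>
        (\<exists>\<Gamma>'. \<Gamma>' \<in> sets borel \<and> \<Gamma>' \<subseteq> ball y (R + real k * \<rho>) \<and> c ^ k * (measure lborel (ball y R) / 2) \<le> measure lborel \<Gamma>'
        \<and> (\<forall>\<phi>\<in>\<Gamma>'. L k \<le> U \<phi>))" by simp
      then show ?case
      proof
        assume "\<exists>z\<in>ball y (2 * R). \<forall>\<phi>\<in>ball z \<rho>. L k \<le> U \<phi>"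
        then show ?thesis using order_trans[OF L_dec] by blast
      next
        assume "\<exists>\<Gamma>'. \<Gamma>' \<in> sets borel \<and> \<Gamma>' \<subseteq> ball y (R + real k * \<rho>) \<and> c ^ k * (measure lborel (ball y R) / 2) \<le> measure lborel \<Gamma>'
          \<and> (\<forall>\<phi>\<in>\<Gamma>'. L k \<le> U \<phi>)"
        then obtain \<Gamma>' where \<Gamma>': "\<Gamma>' \<in> sets borel" "\<Gamma>' \<subseteq> ball y (R + real k * \<rho>)"
          "c ^ k * (measure lborel (ball y R) / 2) \<le> measure lborel \<Gamma>'" "\<forall>\<phi>\<in>\<Gamma>'. L k \<le> U \<phi>" by blast
        have "real k * \<rho> \<le> real m * \<rho>" using Suc.prems \<rho> by (intro mult_right_mono) auto
        then have k\<rho>: "R + real k * \<rho> \<le> 2 * R" using m\<rho> by linarith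
        then have sub2: "\<Gamma>' \<subseteq> ball y (2 * R)" using \<Gamma>'(2) subset_ball[OF k\<rho>] by blast
        have bd\<Gamma>': "bounded \<Gamma>'" by (rule bounded_subset[OF bounded_ball \<Gamma>'(2)])
        have grow: "L (Suc k) \<le> U \<phi>" if z: "z \<in> \<Gamma>'" and th: "thick \<eta> \<Gamma>' z r" and r: "0 < r" "r \<le> \<rho>" and \<phi>: "\<phi> \<in> ball z (2 * r)" for z r \<phi>
        proof -
          have z2: "z \<in> ball y (2 * R)" using z sub2 by blast
          have "\<forall>y\<in>ball z (2 * r). \<kappa>1 * L k - C * K1 * r\<^sup>2 \<le> U y"
            by (rule G[OF nh r(1) dr'(1)[OF z2] U0'[OF z2] \<Gamma>'(1,4) th]) (use r \<rho> in linarith)+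
          moreover have "r\<^sup>2 \<le> R\<^sup>2" using r \<rho> by (intro power_mono) auto
          ultimately show ?thesis using L_step[of r k] \<phi> by force
        qed
        show ?thesis
        proof (cases "\<exists>z\<in>\<Gamma>'. thick \<eta> \<Gamma>' z \<rho>")
          case True
          then obtain z where z: "z \<in> \<Gamma>'" "thick \<eta> \<Gamma>' z \<rho>" by blast
          have "\<forall>\<phi>\<in>ball z \<rho>. L (Suc k) \<le> U \<phi>"
            using grow[OF z(1,2) \<rho>(1) order_refl] \<rho> by auto
          then show ?thesis using z(1) sub2 by blast
        next
          case False
          define \<Gamma>1 where "\<Gamma>1 = \<Union>{ball x (2 * (\<rho> / 2 ^ j)) | x j. x \<in> \<Gamma>' \<and> 0 < j \<and> thick \<eta> \<Gamma>' x (\<rho> / 2 ^ j)}"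
          have mg: "c * measure lborel \<Gamma>' \<le> measure lborel \<Gamma>1"
            unfolding c_def \<Gamma>1_def by (rule thick_growth[OF \<Gamma>'(1) bd\<Gamma>' \<eta> \<rho>(1)]) (use False in blast)
          have half_le: "2 * (\<rho> / 2 ^ j) \<le> \<rho>" if j0: "0 < j" for j
          proof -
            obtain i where "j = Suc i" using j0 by (cases j) auto
            then show ?thesis using \<rho> by (simp add: divide_le_eq)
          qed
          have "open \<Gamma>1" unfolding \<Gamma>1_def by (intro open_Union) auto
          moreover have "\<Gamma>1 \<subseteq> ball y (R + real (Suc k) * \<rho>)"
          proof
            fix \<phi> assume "\<phi> \<in> \<Gamma>1"
            then obtain x j where xj: "\<phi> \<in> ball x (2 * (\<rho> / 2 ^ j))" "x \<in> \<Gamma>'" "0 < j" by (auto simp: \<Gamma>1_def)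
            have "dist y x < R + real k * \<rho>" using xj(2) \<Gamma>'(2) by auto
            moreover have "dist x \<phi> < \<rho>" using xj(1) half_le[OF xj(3)] by simp
            moreover have "dist y \<phi> \<le> dist y x + dist x \<phi>" by (rule dist_triangle)
            ultimately have "dist y \<phi> < R + real (Suc k) * \<rho>" by (simp add: distrib_right)
            then show "\<phi> \<in> ball y (R + real (Suc k) * \<rho>)" by simp
          qed
          moreover have "c ^ Suc k * (measure lborel (ball y R) / 2) \<le> measure lborel \<Gamma>1"
          proof -
            have "c * (c ^ k * (measure lborel (ball y R) / 2)) \<le> c * measure lborel \<Gamma>'"
              using \<Gamma>'(3) c by (intro mult_left_mono) auto
            then show ?thesis using mg by simp
          qed
          moreover have "\<forall>\<phi>\<in>\<Gamma>1. L (Suc k) \<le> U \<phi>"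
          proof
            fix \<phi> assume "\<phi> \<in> \<Gamma>1"
            then obtain x j where xj: "\<phi> \<in> ball x (2 * (\<rho> / 2 ^ j))" "x \<in> \<Gamma>'" "0 < j" "thick \<eta> \<Gamma>' x (\<rho> / 2 ^ j)"
              by (auto simp: \<Gamma>1_def)
            show "L (Suc k) \<le> U \<phi>"
              by (rule grow[OF xj(2,4) _ _ xj(1)]) (use \<rho> half_le[OF xj(3)] in auto)
          qed
          ultimately show ?thesis by (intro disjI2 exI[of _ \<Gamma>1]) auto
        qed
      qed
    qed
    have "\<exists>z\<in>ball y (2 * R). \<forall>\<phi>\<in>ball z \<rho>. L m \<le> U \<phi>"
    proof (rule ccontr)
      assume "\<not> ?thesis"
      then obtain \<Gamma>' where \<Gamma>': "\<Gamma>' \<in> sets borel" "\<Gamma>' \<subseteq> ball y (R + real m * \<rho>)"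
        "c ^ m * (measure lborel (ball y R) / 2) \<le> measure lborel \<Gamma>'" using alt[OF order_refl] by blast
      have "measure lborel \<Gamma>' \<le> measure lborel (ball y (2 * R))"
        using \<Gamma>'(1,2) subset_ball[of "R + real m * \<rho>" "2 * R" y] m\<rho> emeasure_bounded_finite[OF bounded_ball, of y "2 * R"]
        by (intro measure_mono_fmeasurable) (auto simp: fmeasurable_def)
      also have "\<dots> = 2 ^ CARD('n) * measure lborel (ball y R)" by (rule measure_ball_scale) (use R in auto)
      finally have "c ^ m * (measure lborel (ball y R) / 2) \<le> 2 ^ CARD('n) * measure lborel (ball y R)"
        using \<Gamma>'(3) by linarith
      then have "c ^ m \<le> 2 * 2 ^ CARD('n)" using measure_ball_pos[OF R, of y] by simp
      then show False using m by linarith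
    qed
    then obtain z where z: "z \<in> ball y (2 * R)" "\<forall>\<phi>\<in>ball z \<rho>. L m \<le> U \<phi>" by blast
    have exp: "\<forall>\<phi>\<in>ball z (2 ^ j * \<rho>). \<kappa>2 ^ j * (\<kappa>1 ^ m * l) - C * (real m * K1 + real j * (K2 * 16)) * R\<^sup>2 \<le> U \<phi>"
      if "j \<le> q + 2" for j
      using that
    proof (induction j)
      case 0
      then show ?case using z(2) by (simp add: L_def algebra_simps)
    next
      case (Suc j)
      let ?A = "\<kappa>2 ^ j * (\<kappa>1 ^ m * l)" and ?B = "C * (real m * K1 + real j * (K2 * 16)) * R\<^sup>2"
      have "(2::real) ^ j \<le> 2 ^ (q + 1)" using Suc.prems by (intro power_increasing) auto
      then have "2 ^ j * \<rho> \<le> 2 ^ (q + 1) * \<rho>" using \<rho> by (intro mult_right_mono) auto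
      also have "\<dots> = 2 * R" by (simp add: \<rho>_def)
      finally have j\<rho>: "2 ^ j * \<rho> \<le> 2 * R" .
      have f1: "\<forall>\<phi>\<in>ball z (2 * (2 ^ j * \<rho>)). \<kappa>2 * (?A - ?B) - C * K2 * (2 ^ j * \<rho>)\<^sup>2 \<le> U \<phi>"
      proof (rule D[OF nh _ dr'(2)[OF z(1)] U0'[OF z(1)]])
        show "0 < 2 ^ j * \<rho>" using \<rho> by simp
        show "8 * (2 ^ j * \<rho>) \<le> 18 * R" using j\<rho> R by linarith
        show "5 * (2 ^ j * \<rho>) \<le> 18 * R" using j\<rho> R by linarith
        show "\<forall>\<phi>\<in>ball z (2 ^ j * \<rho>). ?A - ?B \<le> U \<phi>" using Suc by simp
      qed
      have f2: "\<kappa>2 ^ Suc j * (\<kappa>1 ^ m * l) - C * (real m * K1 + real (Suc j) * (K2 * 16)) * R\<^sup>2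
        \<le> \<kappa>2 * (?A - ?B) - C * K2 * (2 ^ j * \<rho>)\<^sup>2"
      proof -
        have "\<kappa>2 * ?B \<le> 1 * ?B" using \<kappa>2 C K1 K2 by (intro mult_right_mono) auto
        moreover have "C * K2 * (2 ^ j * \<rho>)\<^sup>2 \<le> C * K2 * (16 * R\<^sup>2)"
        proof (rule mult_left_mono)
          have "(2 ^ j * \<rho>)\<^sup>2 \<le> (2 * R)\<^sup>2" using j\<rho> \<rho> by (intro power_mono) auto
          also have "\<dots> \<le> 16 * R\<^sup>2" by (simp add: power_mult_distrib)
          finally show "(2 ^ j * \<rho>)\<^sup>2 \<le> 16 * R\<^sup>2" .
        qed (use C K2 in auto)
        moreover have "\<kappa>2 ^ Suc j * (\<kappa>1 ^ m * l) - C * (real m * K1 + real (Suc j) * (K2 * 16)) * R\<^sup>2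
          = \<kappa>2 * ?A - ?B - C * K2 * (16 * R\<^sup>2)" by (simp add: algebra_simps)
        moreover have "\<kappa>2 * (?A - ?B) = \<kappa>2 * ?A - \<kappa>2 * ?B" by (rule right_diff_distrib)
        ultimately show ?thesis by linarith
      qed
      have f3: "2 ^ Suc j * \<rho> = 2 * (2 ^ j * \<rho>)" by simp
      show ?case
      proof
        fix \<phi> assume "\<phi> \<in> ball z (2 ^ Suc j * \<rho>)"
        then have "\<phi> \<in> ball z (2 * (2 ^ j * \<rho>))" by (simp only: f3)
        from order_trans[OF f2 bspec[OF f1 this]]
        show "\<kappa>2 ^ Suc j * (\<kappa>1 ^ m * l) - C * (real m * K1 + real (Suc j) * (K2 * 16)) * R\<^sup>2 \<le> U \<phi>" .
      qed
    qed
    have "x \<in> ball z (2 ^ (q + 2) * \<rho>)"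
    proof -
      have "2 ^ (q + 2) * \<rho> = 4 * R" by (simp add: \<rho>_def)
      moreover have "dist z x \<le> dist z y + dist y x" by (rule dist_triangle)
      ultimately show ?thesis using z(1) x R by (simp add: dist_commute)
    qed
    then show ?thesis using exp[OF order_refl] by (simp add: \<kappa>_def K_def mult.assoc)
  qed
  moreover have "0 < \<epsilon>" using \<epsilon>1 \<epsilon>2 by (simp add: \<epsilon>_def)
  ultimately have "spread_const \<kappa> \<epsilon> K" unfolding spread_const_def using \<kappa> K by blast
  then show ?thesis by blast
qed

theorem near_harmonic_continuous:
  assumes nh: "near_harmonic C U"
  shows "continuous_on UNIV U"
proof -
  obtain K Z K' where "harmonic_witness C U K Z K'" using nh unfolding near_harmonic_def by blast
  note U = harmonic_witnessD(2)[OF this]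
  have C: "0 \<le> C" by (rule near_harmonic_nonneg[OF nh])
  obtain \<kappa> \<epsilon> K1 where "spread_const \<kappa> \<epsilon> K1" using spread by blast
  then have \<kappa>: "0 < \<kappa>" "\<kappa> \<le> 1" and \<epsilon>: "0 < \<epsilon>" and K1: "0 \<le> K1" and
    S: "\<And>U y R l \<Gamma>. near_harmonic C U \<Longrightarrow> 0 < R \<Longrightarrow> drift y (20 * R) \<le> ennreal \<epsilon> \<Longrightarrow> 0 \<le> l \<Longrightarrow>
     (\<forall>\<phi>\<in>ball y (20 * R). 0 \<le> U \<phi>) \<Longrightarrow> \<Gamma> \<in> sets borel \<Longrightarrow> \<Gamma> \<subseteq> ball y R \<Longrightarrow> (\<forall>\<phi>\<in>\<Gamma>. l \<le> U \<phi>) \<Longrightarrow>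
     measure lborel (ball y R) / 2 \<le> measure lborel \<Gamma> \<Longrightarrow>
     (\<forall>\<phi>\<in>ball y R. \<kappa> * l - C * K1 * R\<^sup>2 \<le> U \<phi>)"
    unfolding spread_const_def by blast+
  have "isCont U y" for y
  proof -
    define M where "M = (\<lambda>r. SUP \<phi>\<in>ball y r. U \<phi>)"
    define m where "m = (\<lambda>r. INF \<phi>\<in>ball y r. U \<phi>)"
    have bdd: "bdd_above (U ` ball y r)" "bdd_below (U ` ball y r)" for r
      using bdd_borelD(2)[OF U] by (auto intro!: bdd_aboveI2[where M = K] bdd_belowI2[where m = "- K"] simp: abs_le_iff minus_le_iff)
    have UM: "U \<phi> \<le> M r" "m r \<le> U \<phi>" if "\<phi> \<in> ball y r" for \<phi> r
      unfolding M_def m_def using that bdd by (auto intro: cSUP_upper cINF_lower)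
    define osc where "osc = (\<lambda>r. M r - m r)"
    have osc0: "0 \<le> osc r" if "0 < r" for r
      using UM[of y r] that by (simp add: osc_def)
    have osc_mono: "osc r \<le> osc r'" if "0 < r" "r \<le> r'" for r r'
    proof -
      have "M r \<le> M r'" unfolding M_def using that bdd by (intro cSUP_subset_mono) auto
      moreover have "m r' \<le> m r" unfolding m_def using that bdd by (intro cINF_superset_mono) auto
      ultimately show ?thesis by (simp add: osc_def)
    qed
    obtain r1 where r1: "0 < r1" "drift y r1 \<le> ennreal \<epsilon>" using drift_small[OF \<epsilon>] by blast
    have decay: "osc R \<le> (1 - \<kappa> / 2) * osc (20 * R) + C * K1 * R\<^sup>2" if R: "0 < R" "20 * R \<le> r1" for R
    proof -
      have dr: "drift y (20 * R) \<le> ennreal \<epsilon>"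
        by (rule order_trans[OF drift_mono[OF subset_ball[OF R(2)]] r1(2)])
      let ?l = "osc (20 * R) / 2" and ?mid = "(M (20 * R) + m (20 * R)) / 2"
      have l0: "0 \<le> ?l" using osc0[of "20 * R"] R by simp
      have ne: "ball y R \<noteq> {}" using R by simp
      have oR: "osc R = M R - m R" "osc (20 * R) = M (20 * R) - m (20 * R)" by (simp_all add: osc_def)
      have mR: "m R = (INF \<phi>\<in>ball y R. U \<phi>)" and MR: "M R = (SUP \<phi>\<in>ball y R. U \<phi>)" by (simp_all add: m_def M_def)
      have sub: "ball y R \<subseteq> ball y (20 * R)" using R by (intro subset_ball) simp
      define \<Gamma> where "\<Gamma> = ball y R \<inter> {\<phi>. ?mid \<le> U \<phi>}"
      have Um: "U \<in> borel_measurable borel" by (rule bdd_borelD(1)[OF U])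
      have "{\<phi> \<in> space borel. ?mid \<le> U \<phi>} \<in> sets borel" using Um by measurable
      then have \<Gamma>: "\<Gamma> \<in> sets borel" by (simp add: \<Gamma>_def)
      have "measure lborel (ball y R) = measure lborel (\<Gamma> \<union> (ball y R - \<Gamma>))"
        by (rule arg_cong[where f = "measure lborel"]) (auto simp: \<Gamma>_def)
      also have "\<dots> = measure lborel \<Gamma> + measure lborel (ball y R - \<Gamma>)"
        using \<Gamma> bounded_finite_measure[of \<Gamma>] bounded_finite_measure[of "ball y R - \<Gamma>"]
        by (intro measure_Union) (auto simp: \<Gamma>_def bounded_diff bounded_Int)
      finally consider "measure lborel (ball y R) / 2 \<le> measure lborel \<Gamma>"
        | "measure lborel (ball y R) / 2 \<le> measure lborel (ball y R - \<Gamma>)" by linarith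
      then show ?thesis
      proof cases
        case 1
        have "\<forall>\<phi>\<in>ball y R. \<kappa> * ?l - C * K1 * R\<^sup>2 \<le> U \<phi> + (- m (20 * R))"
        proof (rule S[OF near_harmonic_add_const[OF nh] R(1) dr l0 _ \<Gamma> _ _ 1])
          show "\<forall>\<phi>\<in>ball y (20 * R). 0 \<le> U \<phi> + - m (20 * R)" using UM(2)[of _ "20 * R"] by simp
          show "\<Gamma> \<subseteq> ball y R" by (auto simp: \<Gamma>_def)
          show "\<forall>\<phi>\<in>\<Gamma>. ?l \<le> U \<phi> + - m (20 * R)" by (auto simp: \<Gamma>_def osc_def field_simps)
        qed
        then have "\<forall>\<phi>\<in>ball y R. \<kappa> * ?l - C * K1 * R\<^sup>2 + m (20 * R) \<le> U \<phi>" by force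
        then have "\<kappa> * ?l - C * K1 * R\<^sup>2 + m (20 * R) \<le> m R" unfolding mR using ne by (intro cINF_greatest) auto
        moreover have "M R \<le> M (20 * R)" unfolding M_def using ne bdd sub by (intro cSUP_subset_mono) auto
        ultimately have "osc R \<le> osc (20 * R) - \<kappa> * ?l + C * K1 * R\<^sup>2" unfolding oR by linarith
        then show ?thesis by (simp add: left_diff_distrib)
      next
        case 2
        have "\<forall>\<phi>\<in>ball y R. \<kappa> * ?l - C * K1 * R\<^sup>2 \<le> - U \<phi> + M (20 * R)"
        proof (rule S[OF near_harmonic_add_const[OF near_harmonic_uminus[OF nh]] R(1) dr l0 _ _ _ _ 2])
          show "\<forall>\<phi>\<in>ball y (20 * R). 0 \<le> - U \<phi> + M (20 * R)" using UM(1)[of _ "20 * R"] by simp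
          show "ball y R - \<Gamma> \<in> sets borel" using \<Gamma> by simp
          show "\<forall>\<phi>\<in>ball y R - \<Gamma>. ?l \<le> - U \<phi> + M (20 * R)" by (auto simp: \<Gamma>_def osc_def field_simps)
        qed auto
        then have "\<forall>\<phi>\<in>ball y R. U \<phi> \<le> M (20 * R) - (\<kappa> * ?l - C * K1 * R\<^sup>2)" by force
        then have "M R \<le> M (20 * R) - (\<kappa> * ?l - C * K1 * R\<^sup>2)" unfolding MR using ne by (intro cSUP_least) auto
        moreover have "m (20 * R) \<le> m R" unfolding m_def using ne bdd sub by (intro cINF_superset_mono) auto
        ultimately have "osc R \<le> osc (20 * R) - \<kappa> * ?l + C * K1 * R\<^sup>2" unfolding oR by linarith
        then show ?thesis by (simp add: left_diff_distrib)
      qed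
    qed
    have small: "\<exists>r>0. osc r < e" if e: "0 < e" for e
    proof (rule ccontr)
      assume "\<not> ?thesis"
      then have ge: "e \<le> osc r" if "0 < r" for r using that by force
      define w where "w = (INF r\<in>{0<..}. osc r)"
      have bb: "bdd_below (osc ` {0<..})" using osc0 by (intro bdd_belowI2[where m = 0]) auto
      have "e \<le> w" unfolding w_def using ge by (intro cINF_greatest) auto
      then have w: "0 < w" using e by simp
      have w_le: "w \<le> osc r" if "0 < r" for r unfolding w_def using bb that by (intro cINF_lower) auto
      have "w < w * (1 + \<kappa> / 8)" using w \<kappa> by simp
      then obtain r0 where r0: "0 < r0" "osc r0 < w * (1 + \<kappa> / 8)"
        using cINF_less_iff[OF _ bb, of "w * (1 + \<kappa> / 8)"] unfolding w_def by auto
      define R where "R = min (min (r0 / 20) (r1 / 20)) (min 1 (\<kappa> * w / (8 * (C * K1 + 1))))"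
      have CK: "0 < C * K1 + 1" using C K1 by (simp add: add_nonneg_pos)
      have R: "0 < R" "20 * R \<le> r0" "20 * R \<le> r1" "R \<le> 1" "R \<le> \<kappa> * w / (8 * (C * K1 + 1))"
        using r0 r1 \<kappa> w CK by (auto simp: R_def)
      have "R\<^sup>2 \<le> R" using R by (simp add: power2_eq_square mult_le_one mult_left_le)
      then have "C * K1 * R\<^sup>2 \<le> (C * K1 + 1) * R" using C K1 R by (intro mult_mono) auto
      also have "\<dots> \<le> (C * K1 + 1) * (\<kappa> * w / (8 * (C * K1 + 1)))" using R CK by (intro mult_left_mono) auto
      also have "\<dots> = \<kappa> * w / 8"
      proof -
        have "A * (B / (8 * A)) = B / 8" if "0 < A" for A B :: real using that by simp
        from this[OF CK] show ?thesis .
      qed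
      finally have e1: "C * K1 * R\<^sup>2 \<le> \<kappa> * w / 8" .
      have "osc (20 * R) \<le> w * (1 + \<kappa> / 8)" using osc_mono[of "20 * R" r0] r0 R by simp
      then have "(1 - \<kappa> / 2) * osc (20 * R) \<le> (1 - \<kappa> / 2) * (w * (1 + \<kappa> / 8))" using \<kappa> by (intro mult_left_mono) auto
      then have "osc R \<le> (1 - \<kappa> / 2) * (w * (1 + \<kappa> / 8)) + \<kappa> * w / 8"
        using decay[OF R(1,3)] e1 by linarith
      also have "\<dots> = w - \<kappa> * w / 4 - \<kappa> * \<kappa> * w / 16" by (simp add: field_simps)
      also have "\<dots> < w"
      proof -
        have "0 < \<kappa> * w" "0 < \<kappa> * \<kappa> * w" using \<kappa> w by auto
        then show ?thesis by linarith
      qed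
      finally show False using w_le[OF R(1)] by linarith
    qed
    show ?thesis
      unfolding continuous_at_eps_delta
    proof (intro allI impI)
      fix e :: real assume "0 < e"
      then obtain r where r: "0 < r" "osc r < e" using small by blast
      have "dist (U \<phi>) (U y) < e" if "dist \<phi> y < r" for \<phi>
      proof -
        have "\<phi> \<in> ball y r" "y \<in> ball y r" using that r by (auto simp: dist_commute)
        then show ?thesis using UM[of \<phi> r] UM[of y r] r(2) by (auto simp: osc_def dist_real_def abs_less_iff)
      qed
      then show "\<exists>d>0. \<forall>x'. dist x' y < d \<longrightarrow> dist (U x') (U y) < e" using r(1) by blast
    qed
  qed
  then show ?thesis by (simp add: continuous_at_imp_continuous_on)
qed

end

section \<open>The Markov property at exit times\<close>

context elliptic_diffusion
begin

context
  fixes f :: "real ^ 'n \<Rightarrow> real" and K \<epsilon> :: real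
  assumes f_bdd: "bdd_borel K f" and \<epsilon>: "0 < \<epsilon>"
begin

definition tavg :: "real \<Rightarrow> 'w \<Rightarrow> real" where
  "tavg t w = (\<integral>s. f (X (max 0 s) w) * indicator {t<..t + \<epsilon>} s \<partial>lborel) / \<epsilon>"

lemma tavg_def': "tavg t w = (\<integral>s. f (X (max 0 s) w) * indicator {t<..t + \<epsilon>} s \<partial>lborel) / \<epsilon>"
  by (rule tavg_def)

lemma f_path_meas: "w \<in> Om \<Longrightarrow> (\<lambda>s. f (X (max 0 s) w)) \<in> borel_measurable lborel"
  by (rule X_path_meas[OF _ bdd_borelD(1)[OF f_bdd]])

lemma f_path_integrable:
  assumes "w \<in> Om"
  shows "integrable lborel (\<lambda>s. f (X (max 0 s) w) * indicator {u<..v} s)"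
proof (cases "u \<le> v")
  case True
  show ?thesis
  proof (rule Bochner_Integration.integrable_bound)
    show "integrable lborel (\<lambda>s. K * indicator {u<..v} s)"
      using True by (intro integrable_mult_right integrable_real_indicator) auto
    show "(\<lambda>s. f (X (max 0 s) w) * indicator {u<..v} s) \<in> borel_measurable lborel"
      using f_path_meas[OF assms] by measurable
    show "AE s in lborel. norm (f (X (max 0 s) w) * indicator {u<..v} s) \<le> norm (K * indicator {u<..v} s)"
      using bdd_borelD(2)[OF f_bdd] bdd_borel_nonneg[OF f_bdd] by (intro AE_I2) (auto simp: indicator_def)
  qed
qed simp

lemma tavg_lipschitz:
  assumes "w \<in> Om" "0 \<le> r"
  shows "\<bar>tavg (t + r) w - tavg t w\<bar> \<le> 2 * K / \<epsilon> * r"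
proof -
  let ?g = "\<lambda>s. f (X (max 0 s) w)"
  let ?I = "\<lambda>t s. ?g s * indicator {t<..t + \<epsilon>} s"
  have i: "integrable lborel (?I t)" for t by (rule f_path_integrable[OF assms(1)])
  have "\<bar>(\<integral>s. ?I (t + r) s \<partial>lborel) - (\<integral>s. ?I t s \<partial>lborel)\<bar> = \<bar>\<integral>s. ?I (t + r) s - ?I t s \<partial>lborel\<bar>"
    by (simp only: Bochner_Integration.integral_diff[OF i i])
  also have "\<dots> \<le> (\<integral>s. \<bar>?I (t + r) s - ?I t s\<bar> \<partial>lborel)" by (rule integral_abs_bound)
  also have "\<dots> \<le> (\<integral>s. K * indicator {t<..t + r} s + K * indicator {t + \<epsilon><..t + \<epsilon> + r} s \<partial>lborel)"
  proof (rule integral_mono)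
    show "integrable lborel (\<lambda>s. \<bar>?I (t + r) s - ?I t s\<bar>)"
      by (intro integrable_abs Bochner_Integration.integrable_diff i)
    show "integrable lborel (\<lambda>s. K * indicator {t<..t + r} s + K * indicator {t + \<epsilon><..t + \<epsilon> + r} s)"
      using assms(2) by (intro Bochner_Integration.integrable_add integrable_mult_right integrable_real_indicator) auto
    fix s
    show "\<bar>?I (t + r) s - ?I t s\<bar> \<le> K * indicator {t<..t + r} s + K * indicator {t + \<epsilon><..t + \<epsilon> + r} s"
      using bdd_borelD(2)[OF f_bdd, of "X (max 0 s) w"] assms(2) \<epsilon> by (auto simp: indicator_def)
  qed
  also have "\<dots> = 2 * K * r"
    using assms(2) by (subst Bochner_Integration.integral_add) (auto intro!: integrable_mult_right integrable_real_indicator)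
  finally have "\<bar>(\<integral>s. ?I (t + r) s \<partial>lborel) - (\<integral>s. ?I t s \<partial>lborel)\<bar> / \<epsilon> \<le> 2 * K * r / \<epsilon>"
    using \<epsilon> by (intro divide_right_mono) auto
  then show ?thesis using \<epsilon> by (simp add: tavg_def' diff_divide_distrib[symmetric] abs_divide)
qed

lemma tavg_bound:
  assumes "w \<in> Om"
  shows "\<bar>tavg t w\<bar> \<le> K"
proof -
  have i: "integrable lborel (\<lambda>s. f (X (max 0 s) w) * indicator {t<..t + \<epsilon>} s)" by (rule f_path_integrable[OF assms])
  have "\<bar>\<integral>s. f (X (max 0 s) w) * indicator {t<..t + \<epsilon>} s \<partial>lborel\<bar> \<le> (\<integral>s. \<bar>f (X (max 0 s) w) * indicator {t<..t + \<epsilon>} s\<bar> \<partial>lborel)"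
    by (rule integral_abs_bound)
  also have "\<dots> \<le> (\<integral>s. K * indicator {t<..t + \<epsilon>} s \<partial>lborel)"
  proof (rule integral_mono)
    show "integrable lborel (\<lambda>s. \<bar>f (X (max 0 s) w) * indicator {t<..t + \<epsilon>} s\<bar>)" by (rule integrable_abs[OF i])
    show "integrable lborel (\<lambda>s. K * indicator {t<..t + \<epsilon>} s)"
      using \<epsilon> by (intro integrable_mult_right integrable_real_indicator) auto
    show "\<bar>f (X (max 0 s) w) * indicator {t<..t + \<epsilon>} s\<bar> \<le> K * indicator {t<..t + \<epsilon>} s" for s
      using bdd_borelD(2)[OF f_bdd, of "X (max 0 s) w"] by (auto simp: indicator_def)
  qed
  also have "\<dots> = K * \<epsilon>" using \<epsilon> by simp
  finally have "\<bar>\<integral>s. f (X (max 0 s) w) * indicator {t<..t + \<epsilon>} s \<partial>lborel\<bar> / \<epsilon> \<le> K * \<epsilon> / \<epsilon>"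
    using \<epsilon> by (intro divide_right_mono) auto
  then show ?thesis using \<epsilon> by (simp add: tavg_def' abs_divide)
qed

lemma tavg_meas: "tavg t \<in> borel_measurable GX"
proof -
  have "(\<lambda>w. \<integral>s. f (X (max 0 s) w) * indicator {t<..t + \<epsilon>} s \<partial>lborel) \<in> borel_measurable GX"
  proof (rule lborel.borel_measurable_lebesgue_integral)
    show "(\<lambda>(w, s). f (X (max 0 s) w) * indicator {t<..t + \<epsilon>} s) \<in> borel_measurable (GX \<Otimes>\<^sub>M lborel)"
    proof -
      have "(\<lambda>p :: 'w \<times> real. indicator {t<..t + \<epsilon>} (snd p) :: real) \<in> borel_measurable (GX \<Otimes>\<^sub>M lborel)" by measurable
      then show ?thesis using X_path_joint[OF bdd_borelD(1)[OF f_bdd]] by (simp add: case_prod_unfold)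
    qed
  qed
  then show ?thesis unfolding tavg_def'[abs_def] by measurable
qed

lemma tavg_theta:
  assumes "w \<in> Om" "0 \<le> r" "0 \<le> t"
  shows "tavg t (theta r w) = tavg (t + r) w"
proof -
  let ?g = "\<lambda>s. f (X (max 0 s) w) * indicator {t + r<..t + r + \<epsilon>} s"
  have "(\<integral>s. ?g s \<partial>lborel) = (\<integral>s. ?g (r + s) \<partial>lborel)"
    using lborel_integral_real_affine[of 1 ?g r] by simp
  also have "\<dots> = (\<integral>s. f (X (max 0 s) (theta r w)) * indicator {t<..t + \<epsilon>} s \<partial>lborel)"
    using theta(2)[OF assms(2,1)] assms
    by (intro Bochner_Integration.integral_cong) (auto simp: indicator_def max_absorb2 add.commute)
  finally show ?thesis by (simp add: tavg_def')
qed

definition vavg :: "real \<Rightarrow> real ^ 'n \<Rightarrow> real" where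
  "vavg t y = (\<integral>w. tavg t w \<partial>P y)"

lemma vavg_def': "vavg t y = (\<integral>w. tavg t w \<partial>P y)"
  by (rule vavg_def)

lemma vavg_bdd: "bdd_borel K (vavg t)"
proof -
  have "(\<lambda>(y, w). tavg t w) \<in> borel_measurable (borel \<Otimes>\<^sub>M GX)"
    using tavg_meas by measurable
  from expectation_meas[OF this, of "\<lambda>y. y"] have "vavg t \<in> borel_measurable borel"
    by (simp add: vavg_def'[abs_def])
  moreover have "\<bar>vavg t y\<bar> \<le> K" for y
    unfolding vavg_def' by (rule P_integral_bounded[OF tavg_bound])
  ultimately show ?thesis by (simp add: bdd_borel_def)
qed

lemma vavg_markov:
  assumes "0 \<le> r" "0 \<le> t" "B \<in> sets (F r)"
  shows "(\<integral>w. tavg (t + r) w * indicator B w \<partial>P x) = (\<integral>w. vavg t (X r w) * indicator B w \<partial>P x)"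
proof -
  have "(\<integral>w. tavg (t + r) w * indicator B w \<partial>P x) = (\<integral>w. tavg t (theta r w) * indicator B w \<partial>P x)"
    using assms by (intro Bochner_Integration.integral_cong) (auto simp: tavg_theta)
  also have "\<dots> = (\<integral>w. vavg t (X r w) * indicator B w \<partial>P x)"
    unfolding vavg_def' by (rule markov_bounded[OF assms(1) tavg_meas assms(3) tavg_bound])
  finally show ?thesis .
qed

lemma tavg_integrable: "integrable (P x) (tavg t)"
  by (rule integrable_bounded_GX[OF tavg_meas tavg_bound])

lemma vavg_near_harmonic:
  assumes "0 \<le> t"
  shows "near_harmonic (2 * K / \<epsilon>) (vavg t)"
proof -
  have C: "0 \<le> 2 * K / \<epsilon>" using bdd_borel_nonneg[OF f_bdd] \<epsilon> by simp
  have "\<bar>(\<integral>w. tavg t w * indicator B w \<partial>P x) - (\<integral>w. vavg t (X r w) * indicator B w \<partial>P x)\<bar> \<le> 2 * K / \<epsilon> * r * measure (P x) B"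
    if r: "0 \<le> r" and B: "B \<in> sets (F r)" for x r B
  proof -
    have BP: "B \<in> sets (P x)" by (rule sets_F[OF r B])
    have i: "integrable (P x) (\<lambda>w. tavg u w * indicator B w)" for u
      by (rule integrable_real_mult_indicator[OF BP tavg_integrable])
    have iB: "integrable (P x) (\<lambda>w. 2 * K / \<epsilon> * r * indicator B w)"
      by (intro integrable_mult_right P.integrable_const_bound[where B = 1]) (use BP in auto)
    have "\<bar>(\<integral>w. tavg t w * indicator B w \<partial>P x) - (\<integral>w. tavg (t + r) w * indicator B w \<partial>P x)\<bar>
      = \<bar>\<integral>w. tavg t w * indicator B w - tavg (t + r) w * indicator B w \<partial>P x\<bar>"
      by (simp only: Bochner_Integration.integral_diff[OF i i])
    also have "\<dots> \<le> (\<integral>w. \<bar>tavg t w * indicator B w - tavg (t + r) w * indicator B w\<bar> \<partial>P x)" by (rule integral_abs_bound)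
    also have "\<dots> \<le> (\<integral>w. 2 * K / \<epsilon> * r * indicator B w \<partial>P x)"
    proof (rule integral_mono[OF integrable_abs[OF Bochner_Integration.integrable_diff[OF i i]] iB])
      fix w assume "w \<in> space (P x)"
      then show "\<bar>tavg t w * indicator B w - tavg (t + r) w * indicator B w\<bar> \<le> 2 * K / \<epsilon> * r * indicator B w"
        using tavg_lipschitz[of w r t] r by (auto simp: indicator_def abs_minus_commute)
    qed
    also have "\<dots> = 2 * K / \<epsilon> * r * measure (P x) B"
      using BP sets.sets_into_space[OF BP] by (simp add: Int_absorb2)
    finally show ?thesis unfolding vavg_markov[OF r assms B] .
  qed
  then have "harmonic_witness (2 * K / \<epsilon>) (vavg t) K (tavg t) K"
    unfolding harmonic_witness_def using C vavg_bdd tavg_meas tavg_bound by blast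
  then show ?thesis unfolding near_harmonic_def by blast
qed

lemma vavg_cont: "0 \<le> t \<Longrightarrow> continuous_on UNIV (vavg t)"
  by (rule near_harmonic_continuous[OF vavg_near_harmonic])

lemma vavg_lipschitz: "\<bar>vavg s y - vavg t y\<bar> \<le> 2 * K / \<epsilon> * \<bar>s - t\<bar>"
proof -
  have *: "\<bar>vavg (u + r) y - vavg u y\<bar> \<le> 2 * K / \<epsilon> * r" if "0 \<le> r" for u r
  proof -
    have "\<bar>vavg (u + r) y - vavg u y\<bar> = \<bar>\<integral>w. tavg (u + r) w - tavg u w \<partial>P y\<bar>"
      unfolding vavg_def' by (simp only: Bochner_Integration.integral_diff[OF tavg_integrable tavg_integrable])
    also have "\<dots> \<le> 2 * K / \<epsilon> * r" by (rule P_integral_bounded) (rule tavg_lipschitz[OF _ that])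
    finally show ?thesis .
  qed
  show ?thesis
  proof (cases "t \<le> s")
    case True
    then show ?thesis using *[of "s - t" t] by simp
  next
    case False
    then show ?thesis using *[of "t - s" s] by (simp add: abs_minus_commute)
  qed
qed

lemma vavg_tendsto:
  assumes s: "s \<longlonglongrightarrow> s0" and y: "y \<longlonglongrightarrow> y0" and s0: "0 \<le> s0"
  shows "(\<lambda>n. vavg (s n) (y n)) \<longlonglongrightarrow> vavg s0 y0"
proof -
  have "(\<lambda>n. vavg s0 (y n)) \<longlonglongrightarrow> vavg s0 y0"
    by (rule continuous_on_tendsto_compose[OF vavg_cont[OF s0] y]) auto
  moreover have "(\<lambda>n. vavg (s n) (y n) - vavg s0 (y n)) \<longlonglongrightarrow> 0"
  proof (rule Lim_null_comparison)
    show "\<forall>\<^sub>F n in sequentially. norm (vavg (s n) (y n) - vavg s0 (y n)) \<le> 2 * K / \<epsilon> * \<bar>s n - s0\<bar>"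
      unfolding real_norm_def by (intro always_eventually allI vavg_lipschitz)
    have "(\<lambda>n. 2 * K / \<epsilon> * \<bar>s n - s0\<bar>) \<longlonglongrightarrow> 2 * K / \<epsilon> * \<bar>s0 - s0\<bar>"
      by (intro tendsto_intros s)
    then show "(\<lambda>n. 2 * K / \<epsilon> * \<bar>s n - s0\<bar>) \<longlonglongrightarrow> 0" by simp
  qed
  ultimately show ?thesis using tendsto_add by fastforce
qed

lemma vavg_stopping:
  assumes \<sigma>: "stopping T \<sigma>" and T: "0 < T"
  shows "vavg T x = (\<integral>w. vavg (T - \<sigma> w) (X (\<sigma> w) w) \<partial>P x)"
    "(\<lambda>w. vavg (T - \<sigma> w) (X (\<sigma> w) w)) \<in> borel_measurable (P x)"
proof -
  let ?Y = "\<lambda>s w. vavg (T - s) (X s w)"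
  let ?Yn = "\<lambda>n w. ?Y (grid T (Suc n) (\<sigma> w)) w"
  have iY: "integrable (P x) (?Y s)" if "0 \<le> s" for s
    by (rule integrable_f_X[OF that vavg_bdd])
  have eq: "\<bar>(\<integral>w. tavg T w * indicator B w \<partial>P x) - (\<integral>w. ?Y s w * indicator B w \<partial>P x)\<bar> \<le> 0 * s * measure (P x) B"
    if "0 \<le> s" "s \<le> T" "B \<in> sets (F s)" for s B
    using vavg_markov[of s "T - s" B x] that by simp
  note ge = grid_expectation[where Y = ?Y and C = 0, OF \<sigma> T _ order_refl tavg_integrable iY eq]
  have iYn: "integrable (P x) (?Yn n)" for n by (rule ge(1)) simp_all
  have EYn: "(\<integral>w. ?Yn n w \<partial>P x) = vavg T x" for n
  proof -
    have "\<bar>(\<integral>w. tavg T w \<partial>P x) - (\<integral>w. ?Yn n w \<partial>P x)\<bar> \<le> 0 * T" by (rule ge(2)) simp_all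
    then show ?thesis by (simp add: vavg_def')
  qed
  have lim: "(\<lambda>n. ?Yn n w) \<longlonglongrightarrow> ?Y (\<sigma> w) w" if w: "w \<in> Om" for w
  proof (rule vavg_tendsto)
    show "(\<lambda>n. T - grid T (Suc n) (\<sigma> w)) \<longlonglongrightarrow> T - \<sigma> w"
      by (intro tendsto_intros LIMSEQ_Suc[OF tendsto_grid[OF T]])
    show "(\<lambda>n. X (grid T (Suc n) (\<sigma> w)) w) \<longlonglongrightarrow> X (\<sigma> w) w"
      by (rule LIMSEQ_Suc[OF X_grid_tendsto[OF \<sigma> T w]])
    show "0 \<le> T - \<sigma> w" using stoppingD(2)[OF \<sigma> w] by simp
  qed
  show m: "(\<lambda>w. ?Y (\<sigma> w) w) \<in> borel_measurable (P x)"
    by (rule borel_measurable_LIMSEQ_real[of _ ?Yn]) (use lim borel_measurable_integrable[OF iYn] in auto)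
  have "(\<lambda>n. \<integral>w. ?Yn n w \<partial>P x) \<longlonglongrightarrow> (\<integral>w. ?Y (\<sigma> w) w \<partial>P x)"
  proof (rule integral_dominated_convergence[where w = "\<lambda>_. K"])
    show "?Yn n \<in> borel_measurable (P x)" for n by (rule borel_measurable_integrable[OF iYn])
    show "AE w in P x. (\<lambda>n. ?Yn n w) \<longlonglongrightarrow> ?Y (\<sigma> w) w" by (rule AE_I2) (use lim in simp)
    show "AE w in P x. norm (?Yn n w) \<le> K" for n
      by (rule AE_I2) (use bdd_borelD(2)[OF vavg_bdd] in simp)
  qed (use m in auto)
  then show "vavg T x = (\<integral>w. ?Y (\<sigma> w) w \<partial>P x)"
    unfolding EYn by (rule LIMSEQ_unique[OF tendsto_const])
qed

end

lemma tavg_tendsto: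
  assumes f: "bdd_borel K f" "continuous_on UNIV f" and w: "w \<in> Om" and t: "0 \<le> t"
  shows "(\<lambda>n. tavg f (1 / real (Suc n)) t w) \<longlonglongrightarrow> f (X t w)"
proof (rule LIMSEQ_I)
  fix r :: real assume r: "0 < r"
  let ?g = "\<lambda>s. f (X (max 0 s) w)"
  have "continuous_on UNIV ?g"
  proof -
    have "continuous_on UNIV (\<lambda>s. X (max 0 s) w)"
      by (rule continuous_on_compose2[OF paths[OF w]]) (auto intro!: continuous_intros)
    then show ?thesis by (intro continuous_on_compose2[OF f(2)]) auto
  qed
  then have "isCont ?g t" by (simp add: continuous_on_eq_continuous_at)
  then obtain d where d: "0 < d" "\<And>s. dist s t < d \<Longrightarrow> dist (?g s) (?g t) < r / 2"
    unfolding continuous_at_eps_delta using r half_gt_zero by blast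
  obtain N :: nat where N: "1 / real (Suc N) < d" using nat_approx_posE[OF d(1)] by blast
  have "norm (tavg f (1 / real (Suc n)) t w - f (X t w)) < r" if n: "N \<le> n" for n
  proof -
    let ?\<epsilon> = "1 / real (Suc n)"
    have \<epsilon>: "0 < ?\<epsilon>" by simp
    have "?\<epsilon> \<le> 1 / real (Suc N)" using n by (intro divide_left_mono) auto
    then have \<epsilon>d: "?\<epsilon> < d" using N by linarith
    let ?I = "{t<..t + ?\<epsilon>}"
    have i1: "integrable lborel (\<lambda>s. ?g s * indicator ?I s)" by (rule f_path_integrable[OF f(1) \<epsilon> w])
    have i2: "integrable lborel (\<lambda>s. ?g t * indicator ?I s)" by (intro integrable_mult_right integrable_real_indicator) auto
    have i3: "integrable lborel (\<lambda>s. r / 2 * indicator ?I s)" by (intro integrable_mult_right integrable_real_indicator) auto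
    have c: "(\<integral>s. c * indicator ?I s \<partial>lborel) = c * ?\<epsilon>" for c :: real by simp
    have "\<bar>(\<integral>s. ?g s * indicator ?I s \<partial>lborel) - ?g t * ?\<epsilon>\<bar> = \<bar>\<integral>s. ?g s * indicator ?I s - ?g t * indicator ?I s \<partial>lborel\<bar>"
      by (simp only: Bochner_Integration.integral_diff[OF i1 i2] c)
    also have "\<dots> \<le> (\<integral>s. \<bar>?g s * indicator ?I s - ?g t * indicator ?I s\<bar> \<partial>lborel)" by (rule integral_abs_bound)
    also have "\<dots> \<le> (\<integral>s. r / 2 * indicator ?I s \<partial>lborel)"
    proof (rule integral_mono[OF integrable_abs[OF Bochner_Integration.integrable_diff[OF i1 i2]] i3])
      fix s
      show "\<bar>?g s * indicator ?I s - ?g t * indicator ?I s\<bar> \<le> r / 2 * indicator ?I s"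
      proof (cases "s \<in> ?I")
        case True
        then have "dist s t < d" using \<epsilon>d by (auto simp: dist_real_def)
        then have "dist (?g s) (?g t) < r / 2" by (rule d(2))
        then show ?thesis using True by (simp add: dist_real_def)
      qed simp
    qed
    also have "\<dots> = r / 2 * ?\<epsilon>" by (rule c)
    finally have A: "\<bar>(\<integral>s. ?g s * indicator ?I s \<partial>lborel) - ?g t * ?\<epsilon>\<bar> \<le> r / 2 * ?\<epsilon>" .
    have eq: "tavg f ?\<epsilon> t w - ?g t = ((\<integral>s. ?g s * indicator ?I s \<partial>lborel) - ?g t * ?\<epsilon>) / ?\<epsilon>"
      using \<epsilon> by (simp only: tavg_def'[OF f(1) \<epsilon>] diff_divide_distrib) simp
    have div: "\<bar>A / e\<bar> \<le> r / 2" if "0 < e" "\<bar>A\<bar> \<le> r / 2 * e" for A e :: real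
      using that by (simp add: abs_divide divide_simps)
    have "\<bar>tavg f ?\<epsilon> t w - ?g t\<bar> \<le> r / 2" unfolding eq by (rule div[OF \<epsilon> A])
    then show ?thesis using r t by (simp add: max_absorb2)
  qed
  then show "\<exists>no. \<forall>n\<ge>no. norm (tavg f (1 / real (Suc n)) t w - f (X t w)) < r" by blast
qed

lemma vavg_tendsto_sgp:
  assumes f: "bdd_borel K f" "continuous_on UNIV f" and t: "0 \<le> t"
  shows "(\<lambda>n. vavg f (1 / real (Suc n)) t y) \<longlonglongrightarrow> sgp t f y"
proof -
  have e: "0 < 1 / real (Suc n)" for n by simp
  have "(\<lambda>n. \<integral>w. tavg f (1 / real (Suc n)) t w \<partial>P y) \<longlonglongrightarrow> (\<integral>w. f (X t w) \<partial>P y)"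
  proof (rule integral_dominated_convergence[where w = "\<lambda>_. K"])
    show "(\<lambda>w. f (X t w)) \<in> borel_measurable (P y)" by (rule borel_measurable_integrable[OF integrable_f_X[OF t f(1)]])
    show "tavg f (1 / real (Suc n)) t \<in> borel_measurable (P y)" for n by (rule meas_GX_P[OF tavg_meas[OF f(1) e]])
    show "AE w in P y. (\<lambda>n. tavg f (1 / real (Suc n)) t w) \<longlonglongrightarrow> f (X t w)"
      by (rule AE_I2) (use tavg_tendsto[OF f _ t] in simp)
    show "AE w in P y. norm (tavg f (1 / real (Suc n)) t w) \<le> K" for n
      by (rule AE_I2) (use tavg_bound[OF f(1) e] in simp)
  qed simp
  then show ?thesis by (simp only: vavg_def'[OF f(1) e] sgp_def)
qed

lemma sgp_stopping_meas:
  assumes f: "f \<in> borel_measurable borel" and \<sigma>: "stopping T \<sigma>"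
  shows "(\<lambda>w. sgp (T - \<sigma> w) f (X (\<sigma> w) w)) \<in> borel_measurable GX"
proof -
  have "(\<lambda>w. (T - \<sigma> w, X (\<sigma> w) w)) \<in> GX \<rightarrow>\<^sub>M borel \<Otimes>\<^sub>M borel"
    using stoppingD(3)[OF \<sigma>] X_stopping_meas[OF \<sigma>] by measurable
  from measurable_compose[OF this sgp_joint_meas[OF f]]
  have "(\<lambda>w. sgp (max 0 (T - \<sigma> w)) f (X (\<sigma> w) w)) \<in> borel_measurable GX" by simp
  then show ?thesis
    by (rule measurable_cong[THEN iffD1, rotated]) (use stoppingD(2)[OF \<sigma>] in \<open>simp add: max_absorb2\<close>)
qed

lemma sgp_stopping_cont:
  assumes f: "bdd_borel K f" "continuous_on UNIV f" and \<sigma>: "stopping T \<sigma>" and T: "0 < T"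
  shows "sgp T f x = (\<integral>w. sgp (T - \<sigma> w) f (X (\<sigma> w) w) \<partial>P x)"
proof -
  have e: "0 < 1 / real (Suc n)" for n by simp
  have "(\<lambda>n. \<integral>w. vavg f (1 / real (Suc n)) (T - \<sigma> w) (X (\<sigma> w) w) \<partial>P x) \<longlonglongrightarrow> (\<integral>w. sgp (T - \<sigma> w) f (X (\<sigma> w) w) \<partial>P x)"
  proof (rule integral_dominated_convergence[where w = "\<lambda>_. K"])
    show "(\<lambda>w. sgp (T - \<sigma> w) f (X (\<sigma> w) w)) \<in> borel_measurable (P x)"
      by (rule meas_GX_P[OF sgp_stopping_meas[OF bdd_borelD(1)[OF f(1)] \<sigma>]])
    show "(\<lambda>w. vavg f (1 / real (Suc n)) (T - \<sigma> w) (X (\<sigma> w) w)) \<in> borel_measurable (P x)" for n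
      by (rule vavg_stopping(2)[OF f(1) e \<sigma> T])
    show "AE w in P x. (\<lambda>n. vavg f (1 / real (Suc n)) (T - \<sigma> w) (X (\<sigma> w) w)) \<longlonglongrightarrow> sgp (T - \<sigma> w) f (X (\<sigma> w) w)"
      by (rule AE_I2) (use vavg_tendsto_sgp[OF f] stoppingD(2)[OF \<sigma>] in simp)
    show "AE w in P x. norm (vavg f (1 / real (Suc n)) (T - \<sigma> w) (X (\<sigma> w) w)) \<le> K" for n
      by (rule AE_I2) (use bdd_borelD(2)[OF vavg_bdd[OF f(1) e]] in simp)
  qed simp
  moreover have "(\<lambda>n. \<integral>w. vavg f (1 / real (Suc n)) (T - \<sigma> w) (X (\<sigma> w) w) \<partial>P x) \<longlonglongrightarrow> sgp T f x"
    unfolding vavg_stopping(1)[OF f(1) e \<sigma> T, symmetric] by (rule vavg_tendsto_sgp[OF f less_imp_le[OF T]])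
  ultimately show ?thesis by (rule LIMSEQ_unique[rotated])
qed

lemma open_indicator_approx:
  fixes W :: "(real ^ 'n) set"
  assumes W: "open W" "W \<noteq> UNIV"
  defines "g \<equiv> \<lambda>k x. min 1 (real k * infdist x (- W))"
  shows "bdd_borel 1 (g k)" "continuous_on UNIV (g k)" "0 \<le> g k x" "(\<lambda>k. g k x) \<longlonglongrightarrow> indicator W x"
proof -
  show c: "continuous_on UNIV (g k)" unfolding g_def by (intro continuous_intros)
  show g0: "0 \<le> g k x" for k x by (simp add: g_def infdist_nonneg)
  have g1: "g k x \<le> 1" for k x by (simp add: g_def)
  show "bdd_borel 1 (g k)"
    using g0 g1 borel_measurable_continuous_onI[OF c] by (auto simp: bdd_borel_def abs_le_iff intro: order_trans[OF _ g0])
  show "(\<lambda>k. g k x) \<longlonglongrightarrow> indicator W x"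
  proof (cases "x \<in> W")
    case True
    have "closed (- W)" "- W \<noteq> {}" using W by (auto simp: closed_def)
    from infdist_pos_not_in_closed[OF this, of x] True have d: "0 < infdist x (- W)" by simp
    obtain N :: nat where N: "1 / infdist x (- W) < real N" using reals_Archimedean2 by blast
    have "\<forall>\<^sub>F k in sequentially. g k x = indicator W x"
      using eventually_ge_at_top[of N]
    proof eventually_elim
      case (elim k)
      have "1 < real N * infdist x (- W)" using N d by (simp add: field_simps)
      also have "\<dots> \<le> real k * infdist x (- W)" using elim d by (intro mult_right_mono) auto
      finally show ?case using True by (simp add: g_def)
    qed
    then show ?thesis by (rule tendsto_eventually)
  next
    case False
    then have "g k x = indicator W x" for k by (simp add: g_def)
    then show ?thesis by simp
  qed
qed

lemma sgp_stopping:
  assumes f: "bdd_borel K f" and \<sigma>: "stopping T \<sigma>" and T: "0 < T"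
  shows "sgp T f x = (\<integral>w. sgp (T - \<sigma> w) f (X (\<sigma> w) w) \<partial>P x)"
proof -
  let ?R = "\<lambda>f. \<integral>w. sgp (T - \<sigma> w) f (X (\<sigma> w) w) \<partial>P x"
  have T0: "0 \<le> T" using T by simp
  have \<sigma>T: "0 \<le> T - \<sigma> w" if "w \<in> Om" for w using stoppingD(2)[OF \<sigma> that] by simp
  have lim_sgp: "(\<lambda>k. sgp t (g k) y) \<longlonglongrightarrow> sgp t h y"
    if t: "0 \<le> t" and g: "\<And>k. bdd_borel K (g k)" and h: "h \<in> borel_measurable borel" and l: "\<And>z. (\<lambda>k. g k z) \<longlonglongrightarrow> h z" for t g h y K
    unfolding sgp_def
  proof (rule integral_dominated_convergence[where w = "\<lambda>_. K"])
    show "(\<lambda>w. h (X t w)) \<in> borel_measurable (P y)" by (rule measurable_compose[OF X_meas_P[OF t] h])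
    show "(\<lambda>w. g k (X t w)) \<in> borel_measurable (P y)" for k by (rule measurable_compose[OF X_meas_P[OF t] bdd_borelD(1)[OF g]])
    show "AE w in P y. norm (g k (X t w)) \<le> K" for k by (rule AE_I2) (use bdd_borelD(2)[OF g] in simp)
  qed (use l in auto)
  have lim_R: "(\<lambda>k. ?R (g k)) \<longlonglongrightarrow> ?R h"
    if g: "\<And>k. bdd_borel K (g k)" and h: "h \<in> borel_measurable borel" and l: "\<And>z. (\<lambda>k. g k z) \<longlonglongrightarrow> h z" for g h K
  proof (rule integral_dominated_convergence[where w = "\<lambda>_. K"])
    show "(\<lambda>w. sgp (T - \<sigma> w) h (X (\<sigma> w) w)) \<in> borel_measurable (P x)" by (rule meas_GX_P[OF sgp_stopping_meas[OF h \<sigma>]])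
    show "(\<lambda>w. sgp (T - \<sigma> w) (g k) (X (\<sigma> w) w)) \<in> borel_measurable (P x)" for k
      by (rule meas_GX_P[OF sgp_stopping_meas[OF bdd_borelD(1)[OF g] \<sigma>]])
    show "AE w in P x. (\<lambda>k. sgp (T - \<sigma> w) (g k) (X (\<sigma> w) w)) \<longlonglongrightarrow> sgp (T - \<sigma> w) h (X (\<sigma> w) w)"
      by (rule AE_I2) (use lim_sgp[OF _ g h l] \<sigma>T in simp)
    show "AE w in P x. norm (sgp (T - \<sigma> w) (g k) (X (\<sigma> w) w)) \<le> K" for k
      by (rule AE_I2) (use bdd_borelD(2)[OF sgp_bdd_borel[OF \<sigma>T g]] in simp)
  qed simp
  have R_bound: "\<bar>sgp (T - \<sigma> w) h (X (\<sigma> w) w)\<bar> \<le> K" if "bdd_borel K h" "w \<in> Om" for h K w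
    using bdd_borelD(2)[OF sgp_bdd_borel[OF \<sigma>T[OF that(2)] that(1)]] .
  have R_int: "integrable (P x) (\<lambda>w. sgp (T - \<sigma> w) h (X (\<sigma> w) w))" if "bdd_borel K h" for h K
    by (rule integrable_bounded_GX[OF sgp_stopping_meas[OF bdd_borelD(1)[OF that] \<sigma>] R_bound[OF that]])
  have sgp_add2: "sgp t (\<lambda>z. g z + h z) y = sgp t g y + sgp t h y" if "0 \<le> t" "bdd_borel K g" "bdd_borel K' h" for t g h y K K'
    unfolding sgp_def by (rule Bochner_Integration.integral_add[OF integrable_f_X integrable_f_X]) (use that in auto)
  have R_add: "?R (\<lambda>z. g z + h z) = ?R g + ?R h" if "bdd_borel K g" "bdd_borel K' h" for g h K K'
  proof -
    have "?R (\<lambda>z. g z + h z) = (\<integral>w. sgp (T - \<sigma> w) g (X (\<sigma> w) w) + sgp (T - \<sigma> w) h (X (\<sigma> w) w) \<partial>P x)"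
      using sgp_add2[OF \<sigma>T that] by (intro Bochner_Integration.integral_cong) auto
    also have "\<dots> = ?R g + ?R h" by (rule Bochner_Integration.integral_add[OF R_int[OF that(1)] R_int[OF that(2)]])
    finally show ?thesis .
  qed
  have sgp_mult: "sgp t (\<lambda>z. c * g z) y = c * sgp t g y" for t c g y by (simp add: sgp_def)
  have ind_bdd: "bdd_borel 1 (indicator A)" if "A \<in> sets borel" for A :: "(real ^ 'n) set"
    using that by (auto simp: bdd_borel_def indicator_def)
  have const: "sgp t (\<lambda>_. 1) y = 1" for t y by (simp add: sgp_def P.prob_space[simplified])
  have R_const: "(\<integral>w. 1 \<partial>P x) = (1::real)" by (simp add: P.prob_space[simplified])
  have sets: "sgp T (indicator A) x = ?R (indicator A)" if "A \<in> sets borel" for A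
  proof -
    have A: "A \<in> sigma_sets UNIV {S. open S}" using that by (simp add: borel_def)
    have "Int_stable {S :: (real ^ 'n) set. open S}" "{S :: (real ^ 'n) set. open S} \<subseteq> Pow UNIV" by (auto simp: Int_stable_def)
    from this A show ?thesis
    proof (induction rule: sigma_sets_induct_disjoint)
      case (basic W)
      then have W: "open W" by simp
      show ?case
      proof (cases "W = UNIV")
        case True
        have "indicator W = (\<lambda>_. 1::real)" using True by auto
        then show ?thesis by (simp only: const R_const)
      next
        case False
        note g = open_indicator_approx[OF W False]
        have hm: "(indicator W :: _ \<Rightarrow> real) \<in> borel_measurable borel" using W by simp
        show ?thesis
          using lim_sgp[OF T0 g(1) hm g(4), of x] lim_R[OF g(1) hm g(4)] sgp_stopping_cont[OF g(1,2) \<sigma> T]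
          by (simp add: LIMSEQ_unique)
      qed
    next
      case empty
      have "indicator {} = (\<lambda>_. 0::real)" by auto
      then show ?case by (simp add: sgp_def)
    next
      case (compl A)
      have A: "A \<in> sets borel" using compl by (simp add: borel_def)
      have eq: "indicator (UNIV - A) = (\<lambda>z. (\<lambda>_. 1) z + (\<lambda>z. -1 * indicator A z) z :: real)" by (auto simp: indicator_def)
      have b1: "bdd_borel 1 (\<lambda>_. 1)" by (simp add: bdd_borel_def)
      have b2: "bdd_borel 1 (\<lambda>z. -1 * indicator A z)" using A by (auto simp: bdd_borel_def indicator_def)
      show ?case
        by (simp only: eq sgp_add2[OF T0 b1 b2] R_add[OF b1 b2] sgp_mult Bochner_Integration.integral_mult_right_zero const R_const compl.IH)
    next
      case (union A)
      have A: "A i \<in> sets borel" for i using union by (auto simp: borel_def)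
      let ?g = "\<lambda>k. indicator (\<Union>i<k. A i) :: _ \<Rightarrow> real"
      have g_eq: "sgp T (?g k) x = ?R (?g k)" for k
      proof (induction k)
        case 0
        have "?g 0 = (\<lambda>_. 0::real)" by auto
        then show ?case by (simp add: sgp_def)
      next
        case (Suc k)
        have "A i \<inter> A k = {}" if "i < k" for i
          using disjoint_family_onD[OF union(1), of i k] that by simp
        then have "(\<Union>i<k. A i) \<inter> A k = {}" by blast
        then have eq: "?g (Suc k) = (\<lambda>z. ?g k z + indicator (A k) z)"
          by (auto simp: fun_eq_iff indicator_def lessThan_Suc)
        have b1: "bdd_borel 1 (?g k)" using A by (intro ind_bdd) auto
        show ?case unfolding eq sgp_add2[OF T0 b1 ind_bdd[OF A]] R_add[OF b1 ind_bdd[OF A]] Suc union.IH ..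
      qed
      have b: "bdd_borel 1 (?g k)" for k using A by (intro ind_bdd) auto
      have hm: "(indicator (\<Union>i. A i) :: _ \<Rightarrow> real) \<in> borel_measurable borel" using A by auto
      have l: "(\<lambda>k. ?g k z) \<longlonglongrightarrow> indicator (\<Union>i. A i) z" for z
        by (rule LIMSEQ_indicator_UN)
      show ?case
        using lim_sgp[OF T0 b hm l, of x] lim_R[OF b hm l] g_eq by (simp add: LIMSEQ_unique)
    qed
  qed
  have K0: "0 \<le> K" by (rule bdd_borel_nonneg[OF f])
  define f1 where "f1 = (\<lambda>z. f z + K)"
  have fK: "\<bar>f z\<bar> \<le> K" for z by (rule bdd_borelD(2)[OF f])
  have f1m: "f1 \<in> borel_measurable borel" using bdd_borelD(1)[OF f] by (simp add: f1_def)
  have f1_nonneg: "0 \<le> f1 z" and f1_le: "f1 z \<le> 2 * K" for z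
    using fK[of z] unfolding f1_def by linarith+
  note f1 = f1m f1_nonneg
  have f1_bdd: "bdd_borel (2 * K) f1" using f1 f1_le by (auto simp: bdd_borel_def)
  have "\<forall>C. (\<forall>z. f1 z \<le> C) \<longrightarrow> sgp T f1 x = ?R f1"
    using f1
  proof (induction rule: borel_measurable_induct_real)
    case (set A)
    then show ?case by (intro allI impI sets)
  next
    case (mult u c)
    show ?case
    proof (intro allI impI)
      fix C assume C: "\<forall>z. c * u z \<le> C"
      show "sgp T (\<lambda>z. c * u z) x = ?R (\<lambda>z. c * u z)"
      proof (cases "c = 0")
        case True
        then show ?thesis by (simp add: sgp_def)
      next
        case False
        with mult(1) have "0 < c" by simp
        with C have "\<forall>z. u z \<le> C / c" by (simp add: field_simps)
        then have "sgp T u x = ?R u" using mult.IH by blast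
        then show ?thesis by (simp only: sgp_mult Bochner_Integration.integral_mult_right_zero)
      qed
    qed
  next
    case (add u v)
    show ?case
    proof (intro allI impI)
      fix C assume C: "\<forall>z. v z + u z \<le> C"
      have u: "u z \<le> C" and v: "v z \<le> C" for z using C[rule_format, of z] add(2)[of z] add(4)[of z] by linarith+
      have bu: "bdd_borel C u" and bv: "bdd_borel C v" unfolding bdd_borel_def using add u v by auto
      have "sgp T u x = ?R u" "sgp T v x = ?R v" using add.IH u v by blast+
      then show "sgp T (\<lambda>z. v z + u z) x = ?R (\<lambda>z. v z + u z)"
        by (simp only: sgp_add2[OF T0 bv bu] R_add[OF bv bu])
    qed
  next
    case (seq U)
    show ?case
    proof (intro allI impI)
      fix C assume C: "\<forall>z. f1 z \<le> C"
      have l: "(\<lambda>k. U k z) \<longlonglongrightarrow> f1 z" for z by (rule seq(4)) simp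
      have U: "U k z \<le> C" for k z
      proof -
        have "U k z \<le> f1 z" using seq(3) by (intro incseq_le l) (auto simp: incseq_def le_fun_def)
        then show ?thesis using C[rule_format, of z] by linarith
      qed
      have b: "bdd_borel C (U k)" for k unfolding bdd_borel_def using seq(1,2) U by auto
      have eq: "sgp T (U k) x = ?R (U k)" for k using seq.IH U by blast
      show "sgp T f1 x = ?R f1"
        by (rule LIMSEQ_unique[OF lim_sgp[OF T0 b f1(1) l] lim_R[OF b f1(1) l, folded eq]])
    qed
  qed
  then have eq1: "sgp T f1 x = ?R f1" using f1_le by blast
  have f_eq: "f = (\<lambda>z. f1 z + (\<lambda>z. - K * 1) z)" by (simp add: f1_def)
  have bK: "bdd_borel K (\<lambda>z. - K * 1)" using K0 by (simp add: bdd_borel_def)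
  show ?thesis
    by (subst (1 2) f_eq)
      (simp only: sgp_add2[OF T0 f1_bdd bK] R_add[OF f1_bdd bK] eq1 sgp_mult Bochner_Integration.integral_mult_right_zero const R_const)
qed

end

section \<open>The strong Feller property\<close>

lemma closure_cyl:
  assumes "0 < T" "0 < R"
  shows "closure (cyl z T R) = {fst z..fst z + T} \<times> cball (snd z) R"
  using assms by (simp add: cyl_def closure_Times)

lemma hit_shift: "hit (ball c R) T (\<lambda>t. y t - x0) = hit (ball (c + x0) R) T (y :: real \<Rightarrow> 'a::real_normed_vector)"
proof -
  have "y t - x0 \<notin> ball c R \<longleftrightarrow> y t \<notin> ball (c + x0) R" for t
    by (simp add: dist_norm algebra_simps)
  then show ?thesis by (simp only: hit_def)
qed

lemma Lp_norm_shift: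
  fixes x0 :: "'a::euclidean_space"
  assumes "f \<in> borel_measurable borel"
  shows "Lp_norm p UNIV (\<lambda>x. f (x + x0)) = Lp_norm p UNIV (f :: 'a \<Rightarrow> real)"
proof -
  have "(\<integral>\<^sup>+x. ennreal (norm (f x) powr p) \<partial>lborel) = (\<integral>\<^sup>+x. ennreal (norm (f x) powr p) \<partial>distr lborel borel ((+) x0))"
    by (simp only: lborel_distr_plus)
  also have "\<dots> = (\<integral>\<^sup>+x. ennreal (norm (f (x0 + x)) powr p) \<partial>lborel)"
    using assms by (intro nn_integral_distr) measurable
  finally show ?thesis by (simp add: Lp_norm_def add.commute)
qed

locale holder_diffusion = elliptic_diffusion X F P a b \<delta> N0
  for X :: "real \<Rightarrow> 'w \<Rightarrow> real ^ 'n" and F P a b \<delta> N0 +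
  fixes \<alpha>0 N\<alpha> p Np \<mu> R0 :: real
  assumes \<alpha>0_pos: "0 < \<alpha>0" and p_large: "real CARD('n) / 2 + 1 < p"
    and \<mu>_pos: "0 < \<mu>" and Np_pos: "0 < Np" and R0_pos: "0 < R0"
    and holder: "caloric_holder \<alpha>0 N\<alpha> (\<lambda>t w. X t w - x0) (\<lambda>y. P (y + x0))"
    and disc: "discounted_Lp_bound p Np \<mu> R0 (\<lambda>t w. X t w - x0) (\<lambda>y. P (y + x0))"
begin

lemma exit_point_shift:
  assumes "fst z \<le> t0" "t0 \<le> fst z + T"
  shows "exit_point (cyl z T R) (spacetime (\<lambda>t w. X t w - x0) t0 w)
    = (let \<sigma> = hitX (ball (snd z + x0) R) (fst z + T - t0) w in (t0 + \<sigma>, X \<sigma> w - x0))"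
  unfolding exit_point_cyl[OF assms] hit_shift ..

lemma sgp_caloric:
  assumes f: "bdd_borel K f" and R: "0 < R" "(2 * R)\<^sup>2 < t"
  shows "caloric (\<lambda>t w. X t w - x0) (\<lambda>y. P (y + x0)) (closure (pcyl (2 * R)))
    (\<lambda>(\<tau>, y). sgp (max 0 (t - \<tau>)) f (y + x0))"
  unfolding caloric_def
proof (intro conjI allI impI)
  let ?u = "\<lambda>(\<tau>, y). sgp (max 0 (t - \<tau>)) f (y + x0)"
  have "(\<lambda>z :: real \<times> (real ^ 'n). (t - fst z, snd z + x0)) \<in> borel \<Otimes>\<^sub>M borel \<rightarrow>\<^sub>M borel \<Otimes>\<^sub>M borel" by measurable
  from measurable_compose[OF this sgp_joint_meas[OF bdd_borelD(1)[OF f]]]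
  show "?u \<in> borel_measurable borel" by (simp add: borel_prod case_prod_unfold)
  have "\<bar>?u z\<bar> \<le> K" for z
    using bdd_borelD(2)[OF sgp_bdd_borel[OF max.cobounded1 f]] by (simp add: case_prod_unfold)
  then show "bounded (?u ` closure (pcyl (2 * R)))" by (intro boundedI[of _ K]) auto
  fix z :: "real \<times> (real ^ 'n)" and T r t0 y0
  assume A: "0 < T \<and> 0 < r \<and> closure (cyl z T r) \<subseteq> closure (pcyl (2 * R))" and M: "(t0, y0) \<in> cyl z T r"
  have "(fst z + T, snd z) \<in> closure (cyl z T r)" using A by (simp add: closure_cyl)
  then have "(fst z + T, snd z) \<in> closure (pcyl (2 * R))" using A by blast
  then have zT: "fst z + T < t" using R by (simp add: closure_cyl)
  have t0: "fst z \<le> t0" "t0 < fst z + T" using M by (auto simp: cyl_def)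
  let ?\<sigma> = "hitX (ball (snd z + x0) r) (fst z + T - t0)"
  have "stopping (fst z + T - t0) ?\<sigma>" using t0 by (intro stopping_hitX) auto
  then have \<sigma>: "stopping (t - t0) ?\<sigma>" using zT unfolding stopping_def by (meson diff_right_mono less_imp_le order_trans)
  have "?u (t0, y0) = sgp (t - t0) f (y0 + x0)" using t0 zT by (simp add: max_absorb2)
  also have "\<dots> = (\<integral>w. sgp (t - t0 - ?\<sigma> w) f (X (?\<sigma> w) w) \<partial>P (y0 + x0))"
    by (rule sgp_stopping[OF f \<sigma>]) (use t0 zT in simp)
  also have "\<dots> = (\<integral>w. ?u (exit_point (cyl z T r) (spacetime (\<lambda>t w. X t w - x0) t0 w)) \<partial>P (y0 + x0))"
  proof (rule Bochner_Integration.integral_cong[OF refl])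
    fix w assume "w \<in> space (P (y0 + x0))"
    then have "max 0 (t - (t0 + ?\<sigma> w)) = t - t0 - ?\<sigma> w" using stoppingD(2)[OF \<sigma>, of w] by simp
    then show "sgp (t - t0 - ?\<sigma> w) f (X (?\<sigma> w) w) = ?u (exit_point (cyl z T r) (spacetime (\<lambda>t w. X t w - x0) t0 w))"
      unfolding exit_point_shift[OF t0(1) less_imp_le[OF t0(2)]] by (simp add: Let_def)
  qed
  finally show "?u (t0, y0) = (\<integral>w. ?u (exit_point (cyl z T r) (spacetime (\<lambda>t w. X t w - x0) t0 w)) \<partial>P (y0 + x0))" .
qed

lemma sgp_holder:
  assumes f: "bdd_borel K f" and t: "0 < t" and c: "\<And>s y. t / 2 \<le> s \<Longrightarrow> s \<le> t \<Longrightarrow> \<bar>sgp s f y\<bar> \<le> c"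
    and s: "7 / 8 * t < s1" "s1 \<le> t" "7 / 8 * t < s2" "s2 \<le> t"
    and x: "norm (x1 - x0) < sqrt (t / 8)" "norm (x2 - x0) < sqrt (t / 8)"
  shows "\<bar>sgp s1 f x1 - sgp s2 f x2\<bar> \<le> \<bar>N\<alpha>\<bar> * sqrt (t / 8) powr (- \<alpha>0) * (norm (x1 - x2) + sqrt \<bar>s1 - s2\<bar>) powr \<alpha>0 * c"
proof -
  define R where "R = sqrt (t / 8)"
  have R: "0 < R" "R\<^sup>2 = t / 8" using t by (auto simp: R_def)
  then have R2: "(2 * R)\<^sup>2 = t / 2" by (simp add: power_mult_distrib)
  let ?u = "\<lambda>(\<tau>, y). sgp (max 0 (t - \<tau>)) f (y + x0)"
  let ?z1 = "(t - s1, x1 - x0)" and ?z2 = "(t - s2, x2 - x0)"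
  have cal: "caloric (\<lambda>t w. X t w - x0) (\<lambda>y. P (y + x0)) (closure (pcyl (2 * R))) ?u"
    by (rule sgp_caloric[OF f R(1)]) (use R2 t in simp)
  have z: "?z1 \<in> pcyl R" "?z2 \<in> pcyl R" using s x R by (auto simp: cyl_def R_def[symmetric])
  let ?S = "SUP z\<in>closure (pcyl (2 * R)). \<bar>?u z\<bar>"
  let ?\<rho> = "R powr (- \<alpha>0) * pdist ?z1 ?z2 powr \<alpha>0"
  have cl: "closure (pcyl (2 * R)) = {0..t / 2} \<times> cball (0 :: real ^ 'n) (2 * R)"
    using R R2 t by (subst closure_cyl) auto
  have "0 < t / 2" using t by simp
  then have S: "?S \<le> c"
    unfolding cl using t R(1) by (intro cSUP_least) (auto intro!: c)
  have c0: "0 \<le> c" using c[of t 0] t by (intro order_trans[OF abs_ge_zero]) auto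
  have "\<bar>?u z\<bar> \<le> K" for z
    using bdd_borelD(2)[OF sgp_bdd_borel[OF max.cobounded1 f]] by (simp add: case_prod_unfold)
  then have "bdd_above ((\<lambda>z. \<bar>?u z\<bar>) ` closure (pcyl (2 * R)))" by (intro bdd_aboveI2[where M = K])
  moreover have "(0 :: real, 0 :: real ^ 'n) \<in> closure (pcyl (2 * R))" unfolding cl using t R(1) by simp
  ultimately have S0: "0 \<le> ?S" by (rule cSUP_upper2) (rule abs_ge_zero)
  have "\<bar>?u ?z1 - ?u ?z2\<bar> \<le> N\<alpha> * R powr (- \<alpha>0) * pdist ?z1 ?z2 powr \<alpha>0 * ?S"
    using holder[of x0] R(1) cal \<alpha>0_pos z unfolding caloric_holder_def by (metis order_refl)
  also have "\<dots> \<le> \<bar>N\<alpha>\<bar> * R powr (- \<alpha>0) * pdist ?z1 ?z2 powr \<alpha>0 * c"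
    using S S0 by (intro mult_mono mult_right_mono) (auto intro!: mult_nonneg_nonneg)
  finally have "\<bar>?u ?z1 - ?u ?z2\<bar> \<le> \<bar>N\<alpha>\<bar> * R powr (- \<alpha>0) * pdist ?z1 ?z2 powr \<alpha>0 * c" .
  moreover have "?u ?z1 = sgp s1 f x1" "?u ?z2 = sgp s2 f x2" using s t by (simp_all add: max_absorb2)
  moreover have "pdist ?z1 ?z2 = norm (x1 - x2) + sqrt \<bar>s1 - s2\<bar>" by (simp add: pdist_def abs_minus_commute)
  ultimately show ?thesis by (simp only: R_def)
qed

lemma sgp_tendsto:
  assumes f: "bdd_borel K f" and s: "s \<longlonglongrightarrow> s0" "0 < s0" and x: "x \<longlonglongrightarrow> x0"
  shows "(\<lambda>n. sgp (s n) f (x n)) \<longlonglongrightarrow> sgp s0 f x0"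
proof -
  define t where "t = 16 / 15 * s0"
  have t: "0 < t" "7 / 8 * t < s0" "s0 < t" using s(2) by (auto simp: t_def)
  have r: "0 < sqrt (t / 8)" using t by simp
  let ?B = "\<lambda>n. \<bar>N\<alpha>\<bar> * sqrt (t / 8) powr (- \<alpha>0) * (norm (x n - x0) + sqrt \<bar>s n - s0\<bar>) powr \<alpha>0 * K"
  have "\<forall>\<^sub>F n in sequentially. norm (sgp (s n) f (x n) - sgp s0 f x0) \<le> ?B n"
    using order_tendstoD(1)[OF s(1) t(2)] order_tendstoD(2)[OF s(1) t(3)] tendstoD[OF x r]
  proof eventually_elim
    case (elim n)
    show ?case unfolding real_norm_def
    proof (rule sgp_holder[OF f t(1)])
      show "\<bar>sgp u f y\<bar> \<le> K" if "t / 2 \<le> u" for u y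
        by (rule bdd_borelD(2)[OF sgp_bdd_borel[OF _ f]]) (use that t in simp)
    qed (use elim t r in \<open>auto simp: dist_norm\<close>)
  qed
  moreover have "?B \<longlonglongrightarrow> 0"
  proof -
    have "(\<lambda>n. (norm (x n - x0) + sqrt \<bar>s n - s0\<bar>) powr \<alpha>0) \<longlonglongrightarrow> 0"
    proof (rule tendsto_zero_powrI[where b = \<alpha>0])
      have "(\<lambda>n. norm (x n - x0) + sqrt \<bar>s n - s0\<bar>) \<longlonglongrightarrow> norm (x0 - x0) + sqrt \<bar>s0 - s0\<bar>"
        by (intro tendsto_intros x s)
      then show "(\<lambda>n. norm (x n - x0) + sqrt \<bar>s n - s0\<bar>) \<longlonglongrightarrow> 0" by simp
    qed (use \<alpha>0_pos in auto)
    then show ?thesis using tendsto_mult[OF tendsto_mult[OF tendsto_const[of "\<bar>N\<alpha>\<bar> * sqrt (t / 8) powr (- \<alpha>0)"]] tendsto_const[of K]] by fastforce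
  qed
  ultimately have "(\<lambda>n. sgp (s n) f (x n) - sgp s0 f x0) \<longlonglongrightarrow> 0"
    by (rule Lim_null_comparison)
  then show ?thesis by (rule LIM_zero_cancel)
qed

end

section \<open>Smoothing of the semigroup\<close>

definition holder_gap :: "real \<Rightarrow> real \<Rightarrow> real" where
  "holder_gap \<alpha> N = min (1 / 16) (1 / 8 * (1 / (4 * (\<bar>N\<bar> + 1))) powr (2 / \<alpha>))"

lemma holder_gap:
  assumes "0 < \<alpha>"
  shows "0 < holder_gap \<alpha> N" "holder_gap \<alpha> N < 1 / 8" "\<bar>N\<bar> * (8 * holder_gap \<alpha> N) powr (\<alpha> / 2) \<le> 1 / 4"
proof -
  show pos: "0 < holder_gap \<alpha> N" by (simp add: holder_gap_def)
  show "holder_gap \<alpha> N < 1 / 8" by (simp add: holder_gap_def min_less_iff_disj)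
  let ?q = "1 / (4 * (\<bar>N\<bar> + 1))"
  have q: "0 < ?q" by simp
  have "8 * holder_gap \<alpha> N \<le> ?q powr (2 / \<alpha>)" by (simp add: holder_gap_def min_def)
  then have "(8 * holder_gap \<alpha> N) powr (\<alpha> / 2) \<le> (?q powr (2 / \<alpha>)) powr (\<alpha> / 2)"
    using assms pos by (intro powr_mono2) auto
  also have "\<dots> = ?q" unfolding powr_powr using assms q by (simp del: divide_less_0_1_iff zero_less_divide_1_iff)
  finally have "\<bar>N\<bar> * (8 * holder_gap \<alpha> N) powr (\<alpha> / 2) \<le> \<bar>N\<bar> * ?q" by (intro mult_left_mono) auto
  also have "\<dots> \<le> 1 / 4" by (simp add: field_simps)
  finally show "\<bar>N\<bar> * (8 * holder_gap \<alpha> N) powr (\<alpha> / 2) \<le> 1 / 4" .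
qed

definition resolvent_const :: "real \<Rightarrow> real \<Rightarrow> real \<Rightarrow> real \<Rightarrow> real" where
  "resolvent_const d p N R0 = exp 1 * (N * R0 powr (2 - d / p))"

definition smoothing_const :: "real \<Rightarrow> real \<Rightarrow> real \<Rightarrow> real \<Rightarrow> real \<Rightarrow> real \<Rightarrow> real" where
  "smoothing_const d \<alpha> N\<alpha> p N R0 = 2 * (resolvent_const d p N R0 / holder_gap \<alpha> N\<alpha>)"

context holder_diffusion
begin

lemma p_pos: "0 < p" using p_large by (intro order.strict_trans[OF _ p_large]) (simp add: add_nonneg_pos)

lemma beta_bounds: "0 < real CARD('n) / (2 * p)" "real CARD('n) / (2 * p) < 1"
  using p_large p_pos by (auto simp: field_simps)

lemma resolvent_const_pos: "0 < resolvent_const (real CARD('n)) p Np R0" using Np_pos R0_pos by (simp add: resolvent_const_def)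

lemma smoothing_const_pos: "0 < smoothing_const (real CARD('n)) \<alpha>0 N\<alpha> p Np R0" using resolvent_const_pos holder_gap(1)[OF \<alpha>0_pos] by (simp add: smoothing_const_def)

lemma disc_bound:
  assumes f: "f \<in> borel_measurable borel" "\<And>y. 0 \<le> f y" and t: "0 < t"
  shows "(\<integral>\<^sup>+w. (\<integral>\<^sup>+s. ennreal (f (X (max 0 s) w)) * indicator {0..t} s \<partial>lborel) \<partial>P x)
    \<le> ennreal (resolvent_const (real CARD('n)) p Np R0 * t powr (1 - (real CARD('n) / (2 * p)))) * Lp_norm p UNIV f"
proof -
  let ?f = "\<lambda>y. f (y + x)"
  let ?L = "\<integral>\<^sup>+w. (\<integral>\<^sup>+s\<in>{0..}. ennreal (exp (- (1 / t) * occupation (\<lambda>t w. X t w - x) (- ball 0 0) s w) * ?f (X s w - x)) \<partial>lborel) \<partial>P (0 + x)"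
  have occ: "occupation (\<lambda>t w. X t w - x) UNIV s w = s" if "0 \<le> s" for s w
    using that by (simp add: occupation_def set_lebesgue_integral_def)
  have fm: "?f \<in> borel_measurable borel" using f(1) by measurable
  have "(\<integral>\<^sup>+w. (\<integral>\<^sup>+s. ennreal (f (X (max 0 s) w)) * indicator {0..t} s \<partial>lborel) \<partial>P x) \<le> (\<integral>\<^sup>+w. ennreal (exp 1) *
      (\<integral>\<^sup>+s\<in>{0..}. ennreal (exp (- (1 / t) * occupation (\<lambda>t w. X t w - x) (- ball 0 0) s w) * ?f (X s w - x)) \<partial>lborel) \<partial>P (0 + x))"
  proof (simp only: add_0, rule nn_integral_mono)
    fix w assume w: "w \<in> space (P x)"
    have "(\<lambda>s. ennreal (exp (- (1 / t) * s) * f (X (max 0 s) w)) * indicator {0..} s) \<in> borel_measurable lborel"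
    proof -
      have "(\<lambda>s. f (X (max 0 s) w)) \<in> borel_measurable lborel" by (rule X_path_meas) (use w f in auto)
      then show ?thesis by measurable
    qed
    note m = this
    have "(\<integral>\<^sup>+s. ennreal (f (X (max 0 s) w)) * indicator {0..t} s \<partial>lborel)
      \<le> (\<integral>\<^sup>+s. ennreal (exp 1) * (ennreal (exp (- (1 / t) * s) * f (X (max 0 s) w)) * indicator {0..} s) \<partial>lborel)"
    proof (rule nn_integral_mono)
      fix s
      show "ennreal (f (X (max 0 s) w)) * indicator {0..t} s \<le> ennreal (exp 1) * (ennreal (exp (- (1 / t) * s) * f (X (max 0 s) w)) * indicator {0..} s)"
      proof (cases "s \<in> {0..t}")
        case True
        then have "1 \<le> exp (1 - s / t)" using t by simp
        then have "1 * f (X (max 0 s) w) \<le> exp (1 - s / t) * f (X (max 0 s) w)" by (intro mult_right_mono f)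
        also have "\<dots> = exp 1 * (exp (- (1 / t) * s) * f (X (max 0 s) w))" by (simp add: exp_diff exp_minus field_simps)
        finally have "f (X (max 0 s) w) \<le> exp 1 * (exp (- (1 / t) * s) * f (X (max 0 s) w))" by simp
        then show ?thesis using True f(2) by (simp add: ennreal_mult[symmetric] ennreal_leI)
      qed simp
    qed
    also have "\<dots> = ennreal (exp 1) * (\<integral>\<^sup>+s. ennreal (exp (- (1 / t) * s) * f (X (max 0 s) w)) * indicator {0..} s \<partial>lborel)"
      by (rule nn_integral_cmult[OF m])
    also have "(\<integral>\<^sup>+s. ennreal (exp (- (1 / t) * s) * f (X (max 0 s) w)) * indicator {0..} s \<partial>lborel)
      = (\<integral>\<^sup>+s\<in>{0..}. ennreal (exp (- (1 / t) * occupation (\<lambda>t w. X t w - x) (- ball 0 0) s w) * ?f (X s w - x)) \<partial>lborel)"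
      by (intro nn_integral_cong) (auto simp: indicator_def occ)
    finally show "(\<integral>\<^sup>+s. ennreal (f (X (max 0 s) w)) * indicator {0..t} s \<partial>lborel) \<le> ennreal (exp 1) *
      (\<integral>\<^sup>+s\<in>{0..}. ennreal (exp (- (1 / t) * occupation (\<lambda>t w. X t w - x) (- ball 0 0) s w) * ?f (X s w - x)) \<partial>lborel)" .
  qed
  also have "\<dots> = ennreal (exp 1) * ?L"
  proof (rule nn_integral_cmult)
    have m: "(\<lambda>w. \<integral>\<^sup>+s. ennreal (exp (- (1 / t) * s) * f (X (max 0 s) w)) * indicator {0..} s \<partial>lborel) \<in> borel_measurable GX"
    proof (rule lborel.borel_measurable_nn_integral)
      have "(\<lambda>q :: 'w \<times> real. exp (- (1 / t) * snd q)) \<in> borel_measurable (GX \<Otimes>\<^sub>M lborel)"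
        "(\<lambda>q :: 'w \<times> real. indicator {0..} (snd q) :: ennreal) \<in> borel_measurable (GX \<Otimes>\<^sub>M lborel)" by measurable
      then show "(\<lambda>(w, s). ennreal (exp (- (1 / t) * s) * f (X (max 0 s) w)) * indicator {0..} s) \<in> borel_measurable (GX \<Otimes>\<^sub>M lborel)"
        using X_path_joint[OF f(1)] by (simp add: case_prod_unfold)
    qed
    have "(\<lambda>w. \<integral>\<^sup>+s\<in>{0..}. ennreal (exp (- (1 / t) * occupation (\<lambda>t w. X t w - x) (- ball 0 0) s w) * ?f (X s w - x)) \<partial>lborel)
      = (\<lambda>w. \<integral>\<^sup>+s. ennreal (exp (- (1 / t) * s) * f (X (max 0 s) w)) * indicator {0..} s \<partial>lborel)"
      by (intro ext nn_integral_cong) (auto simp: indicator_def occ)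
    then show "(\<lambda>w. \<integral>\<^sup>+s\<in>{0..}. ennreal (exp (- (1 / t) * occupation (\<lambda>t w. X t w - x) (- ball 0 0) s w) * ?f (X s w - x)) \<partial>lborel)
      \<in> borel_measurable (P (0 + x))" using meas_GX_P[OF m] by simp
  qed
  also have "\<dots> \<le> ennreal (exp 1) * (ennreal (Np * (0 * sqrt (1 / t) + R0) powr (2 - real CARD('n) / p) * (1 / t) powr (real CARD('n) / (2 * p) - 1))
      * Lp_norm p UNIV (\<lambda>y. ?f y / exp_weight \<mu> R0 0 (1 / t) y))"
  proof (rule mult_left_mono)
    have "0 < 1 / t" using t by simp
    then show "?L \<le> ennreal (Np * (0 * sqrt (1 / t) + R0) powr (2 - real CARD('n) / p) * (1 / t) powr (real CARD('n) / (2 * p) - 1))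
      * Lp_norm p UNIV (\<lambda>y. ?f y / exp_weight \<mu> R0 0 (1 / t) y)"
      using disc[of x, unfolded discounted_Lp_bound_def, rule_format, of ?f "1 / t" 0] fm f(2) by simp
  qed simp
  also have "\<dots> \<le> ennreal (exp 1) * (ennreal (Np * (0 * sqrt (1 / t) + R0) powr (2 - real CARD('n) / p) * (1 / t) powr (real CARD('n) / (2 * p) - 1))
      * Lp_norm p UNIV f)"
  proof (intro mult_left_mono)
    have "1 \<le> exp_weight \<mu> R0 0 (1 / t) y" for y :: "real ^ 'n"
      using \<mu>_pos t by (simp add: exp_weight_def infdist_nonneg)
    then have "norm (?f y / exp_weight \<mu> R0 0 (1 / t) y) \<le> norm (?f y)" for y
      using divide_left_mono[of 1 "exp_weight \<mu> R0 0 (1 / t) y" "\<bar>?f y\<bar>"] by (simp add: abs_divide exp_weight_def)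
    then have "Lp_norm p UNIV (\<lambda>y. ?f y / exp_weight \<mu> R0 0 (1 / t) y) \<le> Lp_norm p UNIV ?f"
      by (intro Lp_norm_mono p_pos) auto
    then show "Lp_norm p UNIV (\<lambda>y. ?f y / exp_weight \<mu> R0 0 (1 / t) y) \<le> Lp_norm p UNIV f"
      unfolding Lp_norm_shift[OF f(1)] .
  qed auto
  also have "\<dots> = ennreal (resolvent_const (real CARD('n)) p Np R0 * t powr (1 - (real CARD('n) / (2 * p)))) * Lp_norm p UNIV f"
  proof -
    have "(1 / t) powr ((real CARD('n) / (2 * p)) - 1) = t powr (1 - (real CARD('n) / (2 * p)))" using t by (simp add: powr_divide powr_minus_divide[symmetric])
    then show ?thesis using Np_pos t unfolding resolvent_const_def
      by (simp add: mult.assoc[symmetric] ennreal_mult[symmetric])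
  qed
  finally show ?thesis .
qed

lemma nn_sgp:
  assumes "bdd_borel K f" "\<And>y. 0 \<le> f y" "0 \<le> s"
  shows "(\<integral>\<^sup>+w. ennreal (f (X s w)) \<partial>P x) = ennreal (sgp s f x)"
  unfolding sgp_def using assms by (intro nn_integral_eq_integral integrable_f_X) auto

lemma sgp_nonneg: "(\<And>y. 0 \<le> f y) \<Longrightarrow> 0 \<le> sgp s f x"
  unfolding sgp_def by simp

lemma sgp_average:
  assumes f: "bdd_borel K f" "\<And>y. 0 \<le> f y" and M: "0 \<le> M" "Lp_norm p UNIV f \<le> ennreal M"
    and h: "0 < h" "h \<le> t" and v: "\<And>s. t - h \<le> s \<Longrightarrow> s \<le> t \<Longrightarrow> v \<le> sgp s f x"
  shows "h * v \<le> resolvent_const (real CARD('n)) p Np R0 * t powr (1 - (real CARD('n) / (2 * p))) * M"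
proof (cases "0 \<le> v")
  case True
  have t: "0 < t" using h by simp
  have "ennreal (h * v) = (\<integral>\<^sup>+s. ennreal v * indicator {t - h..t} s \<partial>lborel)"
    using h True by (simp add: nn_integral_cmult ennreal_mult[symmetric] mult.commute)
  also have "\<dots> \<le> (\<integral>\<^sup>+s. ennreal (sgp (max 0 s) f x) * indicator {0..t} s \<partial>lborel)"
    using h v by (intro nn_integral_mono) (auto simp: indicator_def max_absorb2 intro!: ennreal_leI)
  also have "\<dots> = (\<integral>\<^sup>+s. (\<integral>\<^sup>+w. ennreal (f (X (max 0 s) w)) * indicator {0..t} s \<partial>P x) \<partial>lborel)"
  proof (rule nn_integral_cong)
    fix s
    have "(\<lambda>w. ennreal (f (X (max 0 s) w))) \<in> borel_measurable (P x)"
      using measurable_compose[OF X_meas_P[of "max 0 s" x] bdd_borelD(1)[OF f(1)]] by simp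
    then show "ennreal (sgp (max 0 s) f x) * indicator {0..t} s = (\<integral>\<^sup>+w. ennreal (f (X (max 0 s) w)) * indicator {0..t} s \<partial>P x)"
      by (simp only: nn_integral_multc nn_sgp[OF f max.cobounded1])
  qed
  also have "\<dots> = (\<integral>\<^sup>+w. (\<integral>\<^sup>+s. ennreal (f (X (max 0 s) w)) * indicator {0..t} s \<partial>lborel) \<partial>P x)"
  proof (rule path_Fubini[symmetric])
    have "(\<lambda>q :: 'w \<times> real. indicator {0..t} (snd q) :: ennreal) \<in> borel_measurable (GX \<Otimes>\<^sub>M lborel)" by measurable
    then show "(\<lambda>(w, s). ennreal (f (X (max 0 s) w)) * indicator {0..t} s) \<in> borel_measurable (GX \<Otimes>\<^sub>M lborel)"
      using X_path_joint[OF bdd_borelD(1)[OF f(1)]] by (simp add: case_prod_unfold)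
  qed
  also have "\<dots> \<le> ennreal (resolvent_const (real CARD('n)) p Np R0 * t powr (1 - (real CARD('n) / (2 * p)))) * Lp_norm p UNIV f"
    by (rule disc_bound[OF bdd_borelD(1)[OF f(1)] f(2) t])
  also have "\<dots> \<le> ennreal (resolvent_const (real CARD('n)) p Np R0 * t powr (1 - (real CARD('n) / (2 * p)))) * ennreal M" by (rule mult_left_mono[OF M(2)]) simp
  also have "\<dots> = ennreal (resolvent_const (real CARD('n)) p Np R0 * t powr (1 - (real CARD('n) / (2 * p))) * M)" using resolvent_const_pos M by (simp add: ennreal_mult)
  finally show ?thesis using resolvent_const_pos M by (simp add: ennreal_le_iff)
next
  case False
  have "h * v \<le> 0" using False h by (simp add: mult_nonneg_nonpos)
  also have "0 \<le> resolvent_const (real CARD('n)) p Np R0 * t powr (1 - (real CARD('n) / (2 * p))) * M" using resolvent_const_pos M by simp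
  finally show ?thesis .
qed

text \<open>
  Hoelder continuity in time bounds \<open>sgp t f x\<close> by its time average over \<open>[t - \<eta> t, t]\<close> plus a
  quarter of the supremum over \<open>[t / 2, t]\<close>; the average is controlled by property (ii) of \<open>d\<^sub>0\<close>.
\<close>

lemma sgp_boot_step:
  assumes f: "bdd_borel K f" "\<And>y. 0 \<le> f y" and M: "0 \<le> M" "Lp_norm p UNIV f \<le> ennreal M"
    and t: "0 < t" and c: "\<And>s y. t / 2 \<le> s \<Longrightarrow> s \<le> t \<Longrightarrow> sgp s f y \<le> c"
  shows "sgp t f x \<le> smoothing_const (real CARD('n)) \<alpha>0 N\<alpha> p Np R0 / 2 * t powr (- (real CARD('n) / (2 * p))) * M + c / 4"
proof -
  define \<eta> where "\<eta> = holder_gap \<alpha>0 N\<alpha>"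
  have \<eta>: "0 < \<eta>" "\<eta> < 1 / 8" "\<bar>N\<alpha>\<bar> * (8 * \<eta>) powr (\<alpha>0 / 2) \<le> 1 / 4"
    using holder_gap[OF \<alpha>0_pos, of N\<alpha>] by (auto simp: \<eta>_def)
  have c0: "0 \<le> c" using order_trans[OF sgp_nonneg[OF f(2)] c[of t x]] t by simp
  have "sgp t f x - c / 4 \<le> sgp s f x" if s: "t - \<eta> * t \<le> s" "s \<le> t" for s
  proof -
    have "\<eta> * t < 1 / 8 * t" using \<eta> t by (intro mult_strict_right_mono) auto
    then have s78: "7 / 8 * t < s" using s by simp
    have "\<bar>sgp t f x - sgp s f x\<bar> \<le> \<bar>N\<alpha>\<bar> * sqrt (t / 8) powr (- \<alpha>0) * (norm (x - x) + sqrt \<bar>t - s\<bar>) powr \<alpha>0 * c"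
      by (rule sgp_holder[OF f(1) t, of c t s x x x]) (use s78 s t c sgp_nonneg[OF f(2)] in auto)
    also have "\<dots> \<le> \<bar>N\<alpha>\<bar> * sqrt (t / 8) powr (- \<alpha>0) * (sqrt (8 * \<eta>) * sqrt (t / 8)) powr \<alpha>0 * c"
    proof (intro mult_right_mono mult_left_mono c0 powr_mono2)
      have "norm (x - x) + sqrt \<bar>t - s\<bar> \<le> sqrt (\<eta> * t)" using s by simp
      also have "\<dots> = sqrt (8 * \<eta>) * sqrt (t / 8)" by (simp add: real_sqrt_mult[symmetric])
      finally show "norm (x - x) + sqrt \<bar>t - s\<bar> \<le> sqrt (8 * \<eta>) * sqrt (t / 8)" .
    qed (use \<alpha>0_pos in auto)
    also have "\<dots> = (\<bar>N\<alpha>\<bar> * sqrt (8 * \<eta>) powr \<alpha>0) * c"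
    proof -
      have "sqrt (t / 8) powr (- \<alpha>0) * (sqrt (8 * \<eta>) * sqrt (t / 8)) powr \<alpha>0 = sqrt (8 * \<eta>) powr \<alpha>0"
        using t \<eta>(1) by (simp add: powr_mult powr_minus field_simps)
      then show ?thesis by (simp only: mult.assoc)
    qed
    also have "sqrt (8 * \<eta>) powr \<alpha>0 = (8 * \<eta>) powr (\<alpha>0 / 2)"
      using \<eta>(1) by (simp add: powr_half_sqrt[symmetric] powr_powr)
    also have "\<bar>N\<alpha>\<bar> * (8 * \<eta>) powr (\<alpha>0 / 2) * c \<le> 1 / 4 * c" by (intro mult_right_mono c0 \<eta>)
    finally show ?thesis by linarith
  qed
  then have "\<eta> * t * (sgp t f x - c / 4) \<le> resolvent_const (real CARD('n)) p Np R0 * t powr (1 - (real CARD('n) / (2 * p))) * M"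
    using \<eta> t by (intro sgp_average[OF f M]) auto
  also have "t powr (1 - (real CARD('n) / (2 * p))) = t * t powr (- (real CARD('n) / (2 * p)))" using t by (simp add: powr_diff powr_minus field_simps)
  finally have "\<eta> * t * (sgp t f x - c / 4) \<le> \<eta> * t * (resolvent_const (real CARD('n)) p Np R0 / \<eta> * t powr (- (real CARD('n) / (2 * p))) * M)"
    using \<eta>(1) by (simp add: mult_ac)
  then have "sgp t f x - c / 4 \<le> resolvent_const (real CARD('n)) p Np R0 / \<eta> * t powr (- (real CARD('n) / (2 * p))) * M" using \<eta> t by (simp only: mult_le_cancel_left_pos mult_pos_pos)
  moreover have "smoothing_const (real CARD('n)) \<alpha>0 N\<alpha> p Np R0 / 2 = resolvent_const (real CARD('n)) p Np R0 / \<eta>" by (simp add: smoothing_const_def \<eta>_def)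
  ultimately show ?thesis by simp
qed

lemma sgp_Lp_bounded:
  assumes f: "bdd_borel K f" "\<And>y. 0 \<le> f y" and M: "0 \<le> M" "Lp_norm p UNIV f \<le> ennreal M" and t: "0 < t"
  shows "sgp t f x \<le> smoothing_const (real CARD('n)) \<alpha>0 N\<alpha> p Np R0 * t powr (- (real CARD('n) / (2 * p))) * M"
proof -
  have K0: "0 \<le> K" by (rule bdd_borel_nonneg[OF f(1)])
  have DS0: "0 \<le> smoothing_const (real CARD('n)) \<alpha>0 N\<alpha> p Np R0" using smoothing_const_pos by simp
  have *: "\<forall>t>0. \<forall>x. sgp t f x \<le> smoothing_const (real CARD('n)) \<alpha>0 N\<alpha> p Np R0 * t powr (- (real CARD('n) / (2 * p))) * M + K / 2 ^ k" for k :: nat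
  proof (induction k)
    case 0
    have "sgp t f x \<le> smoothing_const (real CARD('n)) \<alpha>0 N\<alpha> p Np R0 * t powr (- (real CARD('n) / (2 * p))) * M + K" if "0 < t" for t x
    proof -
      have "\<bar>sgp t f x\<bar> \<le> K" by (rule bdd_borelD(2)[OF sgp_bdd_borel[OF less_imp_le[OF that] f(1)]])
      moreover have "0 \<le> smoothing_const (real CARD('n)) \<alpha>0 N\<alpha> p Np R0 * t powr (- (real CARD('n) / (2 * p))) * M" using DS0 M by simp
      ultimately show ?thesis by linarith
    qed
    then show ?case by simp
  next
    case (Suc k)
    show ?case
    proof (intro allI impI)
      fix t :: real and x :: "real ^ 'n" assume t: "0 < t"
      let ?c = "smoothing_const (real CARD('n)) \<alpha>0 N\<alpha> p Np R0 * (2 * t powr (- (real CARD('n) / (2 * p)))) * M + K / 2 ^ k"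
      have "sgp s f y \<le> ?c" if s: "t / 2 \<le> s" "s \<le> t" for s y
      proof -
        have "s powr (- (real CARD('n) / (2 * p))) \<le> (t / 2) powr (- (real CARD('n) / (2 * p)))" using s t beta_bounds by (intro powr_mono2') auto
        also have "\<dots> = 2 powr (real CARD('n) / (2 * p)) * t powr (- (real CARD('n) / (2 * p)))" using t by (simp add: powr_divide powr_minus field_simps)
        also have "\<dots> \<le> 2 powr 1 * t powr (- (real CARD('n) / (2 * p)))" using beta_bounds by (intro mult_right_mono powr_mono) auto
        finally have "smoothing_const (real CARD('n)) \<alpha>0 N\<alpha> p Np R0 * s powr (- (real CARD('n) / (2 * p))) * M \<le> smoothing_const (real CARD('n)) \<alpha>0 N\<alpha> p Np R0 * (2 * t powr (- (real CARD('n) / (2 * p)))) * M"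
          using DS0 M by (intro mult_right_mono mult_left_mono) auto
        moreover have "sgp s f y \<le> smoothing_const (real CARD('n)) \<alpha>0 N\<alpha> p Np R0 * s powr (- (real CARD('n) / (2 * p))) * M + K / 2 ^ k" using Suc s t by simp
        ultimately show ?thesis by linarith
      qed
      then have "sgp t f x \<le> smoothing_const (real CARD('n)) \<alpha>0 N\<alpha> p Np R0 / 2 * t powr (- (real CARD('n) / (2 * p))) * M + ?c / 4" by (rule sgp_boot_step[OF f M t])
      also have "\<dots> = smoothing_const (real CARD('n)) \<alpha>0 N\<alpha> p Np R0 * t powr (- (real CARD('n) / (2 * p))) * M + K / 2 ^ k / 4" by (simp add: field_simps)
      also have "\<dots> \<le> smoothing_const (real CARD('n)) \<alpha>0 N\<alpha> p Np R0 * t powr (- (real CARD('n) / (2 * p))) * M + K / 2 ^ Suc k" using K0 by (simp add: field_simps)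
      finally show "sgp t f x \<le> smoothing_const (real CARD('n)) \<alpha>0 N\<alpha> p Np R0 * t powr (- (real CARD('n) / (2 * p))) * M + K / 2 ^ Suc k" .
    qed
  qed
  have "(\<lambda>k. smoothing_const (real CARD('n)) \<alpha>0 N\<alpha> p Np R0 * t powr (- (real CARD('n) / (2 * p))) * M + K * (1 / 2) ^ k) \<longlonglongrightarrow> smoothing_const (real CARD('n)) \<alpha>0 N\<alpha> p Np R0 * t powr (- (real CARD('n) / (2 * p))) * M + K * 0"
    by (intro tendsto_intros LIMSEQ_power_zero) auto
  note lim = this
  have "sgp t f x \<le> smoothing_const (real CARD('n)) \<alpha>0 N\<alpha> p Np R0 * t powr (- (real CARD('n) / (2 * p))) * M + K * 0"
    by (rule LIMSEQ_le_const[OF lim]) (use * t in \<open>auto simp: power_divide\<close>)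
  then show ?thesis by simp
qed

lemma P_Lp_bound:
  assumes f: "f \<in> borel_measurable borel" "\<And>y. 0 \<le> f y" and t: "0 < t"
  shows "(\<integral>\<^sup>+w. ennreal (f (X t w)) \<partial>P x) \<le> ennreal (smoothing_const (real CARD('n)) \<alpha>0 N\<alpha> p Np R0 * t powr (- (real CARD('n) / (2 * p)))) * Lp_norm p UNIV f"
proof (cases "Lp_norm p UNIV f = \<infinity>")
  case True
  then show ?thesis using smoothing_const_pos t by (simp add: ennreal_mult_top)
next
  case False
  define M where "M = enn2real (Lp_norm p UNIV f)"
  have M: "0 \<le> M" "Lp_norm p UNIV f = ennreal M" using False by (auto simp: M_def less_top)
  let ?g = "\<lambda>n y. min (f y) (real n)"
  have g: "bdd_borel (real n) (?g n)" "\<And>y. 0 \<le> ?g n y" for n using f by (auto simp: bdd_borel_def)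
  have gM: "Lp_norm p UNIV (?g n) \<le> ennreal M" for n
    unfolding M(2)[symmetric] using f by (intro Lp_norm_mono p_pos) auto
  have sup: "ennreal (f y) = (SUP n. ennreal (?g n y))" for y
  proof (rule antisym)
    obtain n :: nat where "f y \<le> real n" using real_arch_simple by blast
    then have "ennreal (f y) = ennreal (?g n y)" by simp
    then show "ennreal (f y) \<le> (SUP n. ennreal (?g n y))" by (metis SUP_upper UNIV_I)
  qed (auto intro!: SUP_least ennreal_leI)
  have "(\<integral>\<^sup>+w. ennreal (f (X t w)) \<partial>P x) = (SUP n. \<integral>\<^sup>+w. ennreal (?g n (X t w)) \<partial>P x)"
    unfolding sup
  proof (rule nn_integral_monotone_convergence_SUP)
    show "incseq (\<lambda>n w. ennreal (?g n (X t w)))" by (auto simp: incseq_def le_fun_def intro!: ennreal_leI)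
    show "(\<lambda>w. ennreal (?g n (X t w))) \<in> borel_measurable (P x)" for n
      using measurable_compose[OF X_meas_P[OF less_imp_le[OF t]] bdd_borelD(1)[OF g(1)]] by simp
  qed
  also have "\<dots> \<le> ennreal (smoothing_const (real CARD('n)) \<alpha>0 N\<alpha> p Np R0 * t powr (- (real CARD('n) / (2 * p))) * M)"
    unfolding nn_sgp[OF g less_imp_le[OF t]]
    by (intro SUP_least ennreal_leI sgp_Lp_bounded[OF g M(1) gM t])
  also have "\<dots> = ennreal (smoothing_const (real CARD('n)) \<alpha>0 N\<alpha> p Np R0 * t powr (- (real CARD('n) / (2 * p)))) * Lp_norm p UNIV f" using M smoothing_const_pos by (simp add: ennreal_mult)
  finally show ?thesis .
qed

end

section \<open>Expectations at the exit point\<close>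

lemma hit_min:
  assumes "T' \<le> T"
  shows "hit O1 T' y = min (hit O1 T y) T'"
proof (rule antisym)
  show "hit O1 T' y \<le> min (hit O1 T y) T'"
    unfolding hit_def[of _ T]
  proof (rule min.boundedI[OF cInf_greatest hit_le])
    fix t assume "t \<in> insert T {t. 0 \<le> t \<and> y t \<notin> O1}"
    then show "hit O1 T' y \<le> t" using assms hit_le[of O1 T' y] by (auto intro: hit_lower order_trans)
  qed simp
  show "min (hit O1 T y) T' \<le> hit O1 T' y"
    unfolding hit_def[of _ T']
  proof (rule cInf_greatest)
    fix t assume "t \<in> insert T' {t. 0 \<le> t \<and> y t \<notin> O1}"
    then show "min (hit O1 T y) T' \<le> t" by (auto intro: min.coboundedI1 hit_lower)
  qed simp
qed

lemma hit_restart: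
  fixes y :: "real \<Rightarrow> 'a::topological_space"
  assumes y: "continuous_on {0..} y" and O1: "open O1" and s: "0 \<le> s" "s < hit O1 T y"
  shows "hit O1 T y = s + hit O1 (T - s) (\<lambda>u. y (u + s))"
proof (rule antisym)
  let ?y = "\<lambda>u. y (u + s)"
  have c: "continuous_on {0..} ?y" by (rule continuous_on_compose2[OF y]) (use s in \<open>auto intro!: continuous_intros\<close>)
  have sT: "s \<le> T" using s hit_le[of O1 T y] by simp
  show "hit O1 T y \<le> s + hit O1 (T - s) ?y"
  proof (cases "hit O1 (T - s) ?y < T - s")
    case True
    from hit_not_in[OF c O1 True] show ?thesis
      using hit_lower[of "hit O1 (T - s) ?y + s" y O1 T] hit_nonneg[of "T - s" O1 ?y] s sT by simp
  next
    case False
    then show ?thesis using hit_le[of O1 T y] by simp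
  qed
  show "s + hit O1 (T - s) ?y \<le> hit O1 T y"
  proof (cases "hit O1 T y < T")
    case True
    from hit_not_in[OF y O1 True] show ?thesis
      using hit_lower[of "hit O1 T y - s" ?y O1 "T - s"] s by simp
  next
    case False
    then show ?thesis using hit_le[of O1 T y] hit_le[of O1 "T - s" ?y] by simp
  qed
qed

context holder_diffusion
begin

context
  fixes R T2 S :: real and g :: "real \<times> (real ^ 'n) \<Rightarrow> real"
  assumes R: "0 < R" and T2: "T2 = (2 * R)\<^sup>2" and g: "g \<in> borel_measurable borel" "\<And>z. \<bar>g z\<bar> \<le> S"
begin

lemma T2_pos: "0 < T2" using R T2 by simp

definition ext :: "real \<Rightarrow> 'w \<Rightarrow> real" where "ext t0 w = min (hitX (ball 0 (2 * R)) T2 w) (T2 - t0)"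

definition bdval :: "real \<Rightarrow> 'w \<Rightarrow> real" where "bdval t0 w = g (t0 + ext t0 w, X (max 0 (ext t0 w)) w)"

definition bdsol :: "real \<times> (real ^ 'n) \<Rightarrow> real" where "bdsol z = (\<integral>w. bdval (fst z) w \<partial>P (snd z))"

lemma ext_eq: "0 \<le> t0 \<Longrightarrow> ext t0 w = hitX (ball 0 (2 * R)) (T2 - t0) w"
  unfolding ext_def by (subst hit_min[of "T2 - t0" T2]) auto

lemma ext_nonneg: "0 \<le> t0 \<Longrightarrow> t0 \<le> T2 \<Longrightarrow> 0 \<le> ext t0 w"
  by (simp add: ext_eq hit_nonneg)

lemma bdval_meas: "(\<lambda>(z, w). bdval (fst z) w) \<in> borel_measurable ((borel :: (real \<times> (real ^ 'n)) measure) \<Otimes>\<^sub>M GX)"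
proof -
  let ?M = "(borel :: (real \<times> (real ^ 'n)) measure) \<Otimes>\<^sub>M GX"
  have [measurable]: "hitX (ball 0 (2 * R)) T2 \<in> borel_measurable GX" using T2_pos by (intro hitX_meas) auto
  have f[measurable]: "(\<lambda>q. fst (fst q)) \<in> borel_measurable ?M" unfolding borel_prod[symmetric] by measurable
  have h: "(\<lambda>q. hitX (ball 0 (2 * R)) T2 (snd q)) \<in> borel_measurable ?M"
    by (rule measurable_compose[OF measurable_snd]) measurable
  have e: "(\<lambda>q. ext (fst (fst q)) (snd q)) \<in> borel_measurable ?M" unfolding ext_def by (intro borel_measurable_min h borel_measurable_diff borel_measurable_const) measurable
  have "(\<lambda>q. (ext (fst (fst q)) (snd q), snd q)) \<in> ?M \<rightarrow>\<^sub>M borel \<Otimes>\<^sub>M GX" using e by measurable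
  from measurable_compose[OF this X_joint]
  have x: "(\<lambda>q. X (max 0 (ext (fst (fst q)) (snd q))) (snd q)) \<in> ?M \<rightarrow>\<^sub>M borel" by simp
  have "(\<lambda>q. (fst (fst q) + ext (fst (fst q)) (snd q), X (max 0 (ext (fst (fst q)) (snd q))) (snd q))) \<in> ?M \<rightarrow>\<^sub>M borel"
    by (rule measurable_Pair[OF borel_measurable_add[OF f e] x, unfolded borel_prod])
  from measurable_compose[OF this g(1)] show ?thesis unfolding bdval_def by (simp add: case_prod_unfold)
qed

lemma bdval_bound: "\<bar>bdval t0 w\<bar> \<le> S" by (simp add: bdval_def g)

lemma S_nonneg: "0 \<le> S" using g(2)[of 0] by linarith

lemma bdval_meas1: "bdval t0 \<in> borel_measurable GX"
  using measurable_Pair2[OF bdval_meas, of "(t0, 0)"] by simp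

lemma bdsol_meas: "bdsol \<in> borel_measurable borel"
  unfolding bdsol_def[abs_def] by (rule expectation_meas[OF bdval_meas]) (simp add: borel_prod[symmetric])

lemma bdsol_bound: "\<bar>bdsol z\<bar> \<le> S"
  unfolding bdsol_def by (rule P_integral_bounded[OF bdval_bound])

lemma bdsol_bdd: "bdd_borel S (\<lambda>y. bdsol (t, y))"
  unfolding bdd_borel_def using bdsol_bound measurable_compose[OF _ bdsol_meas, of "\<lambda>y. (t, y)" borel]
  by (simp add: borel_prod[symmetric])

text \<open>
  A version of the conditional expectation of \<open>bdval t0\<close> given \<open>F s\<close>.
\<close>

definition stepval :: "real \<Rightarrow> real \<Rightarrow> 'w \<Rightarrow> real" where
  "stepval t0 s w = (if s < ext t0 w then bdsol (t0 + s, X s w) else bdval t0 w)"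

lemma ext_less_F:
  assumes "0 \<le> t0" "t0 \<le> T2" "0 \<le> s"
  shows "{w \<in> Om. s < ext t0 w} \<in> sets (F s)"
proof -
  have "stopping (T2 - t0) (hitX (ball 0 (2 * R)) (T2 - t0))" using assms by (intro stopping_hitX) auto
  from stoppingD(4)[OF this assms(3)] show ?thesis using assms by (simp add: ext_eq)
qed

lemma bdval_restart:
  assumes t0: "0 \<le> t0" and s: "0 \<le> s" and w: "w \<in> Om" "s < ext t0 w"
  shows "bdval t0 w = bdval (t0 + s) (theta s w)"
proof -
  have s': "s < hitX (ball 0 (2 * R)) (T2 - t0) w" using w t0 by (simp add: ext_eq)
  have "s \<le> T2 - t0" using s' hit_le[of "ball 0 (2 * R)" "T2 - t0" "\<lambda>t. X t w"] by simp
  have th: "X u (theta s w) = X (u + s) w" if "0 \<le> u" for u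
    using theta(2)[OF s w(1)] that by simp
  have "hitX (ball 0 (2 * R)) (T2 - t0) w = s + hit (ball 0 (2 * R)) (T2 - t0 - s) (\<lambda>u. X (u + s) w)"
    by (rule hit_restart[OF paths[OF w(1)] open_ball s s'])
  also have "hit (ball 0 (2 * R)) (T2 - t0 - s) (\<lambda>u. X (u + s) w) = hitX (ball 0 (2 * R)) (T2 - (t0 + s)) (theta s w)"
    unfolding hit_def using th by (intro arg_cong[where f = Inf]) (auto simp: diff_diff_eq)
  finally have e: "ext t0 w = s + ext (t0 + s) (theta s w)" using t0 s by (simp add: ext_eq)
  have "0 \<le> ext (t0 + s) (theta s w)" using t0 s \<open>s \<le> T2 - t0\<close> by (intro ext_nonneg) auto
  then show ?thesis unfolding bdval_def e using s th by (simp add: max_absorb2 add_ac)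
qed

lemma stepval_meas: "0 \<le> t0 \<Longrightarrow> t0 \<le> T2 \<Longrightarrow> 0 \<le> s \<Longrightarrow> stepval t0 s \<in> borel_measurable GX"
proof -
  assume A: "0 \<le> t0" "t0 \<le> T2" "0 \<le> s"
  have "hitX (ball 0 (2 * R)) (T2 - t0) \<in> borel_measurable GX" using A by (intro hitX_meas) auto
  then have [measurable]: "ext t0 \<in> borel_measurable GX"
    using A by (simp add: ext_eq cong: measurable_cong)
  have [measurable]: "(\<lambda>w. bdsol (t0 + s, X s w)) \<in> borel_measurable GX"
    by (rule measurable_compose[OF X_meas[OF A(3)] bdd_borelD(1)[OF bdsol_bdd]])
  note bdval_meas1[measurable]
  show ?thesis unfolding stepval_def[abs_def] by measurable
qed

lemma stepval_bound: "\<bar>stepval t0 s w\<bar> \<le> S"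
  by (simp add: stepval_def bdsol_bound bdval_bound)

lemma bdval_integrable: "integrable (P x) (bdval t0)"
  by (rule integrable_bounded_GX[OF bdval_meas1 bdval_bound])

lemma stepval_integrable: "0 \<le> t0 \<Longrightarrow> t0 \<le> T2 \<Longrightarrow> 0 \<le> s \<Longrightarrow> integrable (P x) (stepval t0 s)"
  by (rule integrable_bounded_GX[OF stepval_meas stepval_bound])

lemma stepval_markov:
  assumes t0: "0 \<le> t0" "t0 \<le> T2" and s: "0 \<le> s" and B: "B \<in> sets (F s)"
  shows "(\<integral>w. bdval t0 w * indicator B w \<partial>P x) = (\<integral>w. stepval t0 s w * indicator B w \<partial>P x)"
proof -
  let ?E = "{w \<in> Om. s < ext t0 w}"
  have E: "?E \<in> sets (F s)" by (rule ext_less_F[OF t0 s])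
  have BE: "B \<inter> ?E \<in> sets (F s)" and BE': "B - ?E \<in> sets (F s)" using B E by auto
  have split: "(\<integral>w. V w * indicator B w \<partial>P x) = (\<integral>w. V w * indicator (B \<inter> ?E) w \<partial>P x) + (\<integral>w. V w * indicator (B - ?E) w \<partial>P x)"
    if V: "integrable (P x) V" for V :: "'w \<Rightarrow> real"
  proof -
    have "(\<integral>w. V w * indicator B w \<partial>P x) = (\<integral>w. V w * indicator (B \<inter> ?E) w + V w * indicator (B - ?E) w \<partial>P x)"
      by (intro Bochner_Integration.integral_cong) (auto simp: indicator_def)
    also have "\<dots> = (\<integral>w. V w * indicator (B \<inter> ?E) w \<partial>P x) + (\<integral>w. V w * indicator (B - ?E) w \<partial>P x)"
      by (intro Bochner_Integration.integral_add integrable_real_mult_indicator[OF _ V] sets_F[OF s] BE BE')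
    finally show ?thesis .
  qed
  have 1: "(\<integral>w. bdval t0 w * indicator (B \<inter> ?E) w \<partial>P x) = (\<integral>w. stepval t0 s w * indicator (B \<inter> ?E) w \<partial>P x)"
  proof -
    have "(\<integral>w. bdval t0 w * indicator (B \<inter> ?E) w \<partial>P x) = (\<integral>w. bdval (t0 + s) (theta s w) * indicator (B \<inter> ?E) w \<partial>P x)"
      by (intro Bochner_Integration.integral_cong refl) (auto simp: indicator_def bdval_restart[OF t0(1) s])
    also have "\<dots> = (\<integral>w. (\<integral>w'. bdval (t0 + s) w' \<partial>P (X s w)) * indicator (B \<inter> ?E) w \<partial>P x)"
      by (rule markov_bounded[OF s bdval_meas1 BE bdval_bound])
    also have "\<dots> = (\<integral>w. stepval t0 s w * indicator (B \<inter> ?E) w \<partial>P x)"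
      by (intro Bochner_Integration.integral_cong refl) (auto simp: indicator_def stepval_def bdsol_def)
    finally show ?thesis .
  qed
  have 2: "(\<integral>w. bdval t0 w * indicator (B - ?E) w \<partial>P x) = (\<integral>w. stepval t0 s w * indicator (B - ?E) w \<partial>P x)"
    by (intro Bochner_Integration.integral_cong refl) (auto simp: indicator_def stepval_def)
  show ?thesis unfolding split[OF bdval_integrable] split[OF stepval_integrable[OF t0 s]] 1 2 ..
qed

lemma bdsol_near_sgp:
  assumes t: "0 \<le> t" and s: "0 \<le> s" "s < s'" "t + s' \<le> T2" and r: "0 < r" "ball x r \<subseteq> ball 0 (2 * R)"
    and dr: "0 \<le> e" "drift x r \<le> ennreal e"
  shows "\<bar>bdsol (t, x) - sgp s (\<lambda>y. bdsol (t + s, y)) x\<bar> \<le> 2 * S * (3 * real CARD('n) * s' / (\<delta> * r\<^sup>2) + 6 * N0 * e)"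
proof -
  have tT: "t \<le> T2" using s by simp
  have s'0: "0 < s'" using s by simp
  let ?E = "{w \<in> Om. hitX (ball x r) s' w = s'}"
  have E: "?E \<in> sets GX" by (rule hitX_eq_set) (use s in auto)
  have EP: "?E \<in> sets (P x)" using E sets_GX_sub by blast
  have "bdsol (t, x) = (\<integral>w. bdval t w \<partial>P x)" by (simp add: bdsol_def)
  also have "\<dots> = (\<integral>w. stepval t s w \<partial>P x)"
    using stepval_markov[OF t tT s(1) Om_in_F[OF s(1)], of x] unfolding P_integral_indicator_Om .
  finally have eq: "bdsol (t, x) = (\<integral>w. stepval t s w \<partial>P x)" .
  have i2: "integrable (P x) (\<lambda>w. bdsol (t + s, X s w))" by (rule integrable_f_X[OF s(1) bdsol_bdd])
  have i3: "integrable (P x) (\<lambda>w. 2 * S * indicator (Om - ?E) w)"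
  proof (intro integrable_mult_right P.integrable_const_bound[where B = 1] AE_I2)
    show "indicator (Om - ?E) \<in> borel_measurable (P x)"
      using sets.compl_sets[OF EP] by (intro borel_measurable_indicator) simp
  qed (simp add: indicator_def)
  have "\<bar>bdsol (t, x) - sgp s (\<lambda>y. bdsol (t + s, y)) x\<bar> = \<bar>\<integral>w. stepval t s w - bdsol (t + s, X s w) \<partial>P x\<bar>"
    unfolding eq sgp_def by (simp only: Bochner_Integration.integral_diff[OF stepval_integrable[OF t tT s(1)] i2])
  also have "\<dots> \<le> (\<integral>w. \<bar>stepval t s w - bdsol (t + s, X s w)\<bar> \<partial>P x)" by (rule integral_abs_bound)
  also have "\<dots> \<le> (\<integral>w. 2 * S * indicator (Om - ?E) w \<partial>P x)"
  proof (rule integral_mono[OF integrable_abs[OF Bochner_Integration.integrable_diff[OF stepval_integrable[OF t tT s(1)] i2]] i3])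
    fix w assume w: "w \<in> space (P x)"
    show "\<bar>stepval t s w - bdsol (t + s, X s w)\<bar> \<le> 2 * S * indicator (Om - ?E) w"
    proof (cases "w \<in> ?E")
      case True
      have "hitX (ball x r) s' w \<le> hitX (ball 0 (2 * R)) (T2 - t) w"
        by (rule hit_mono[OF r(2)]) (use s s'0 in auto)
      then have "s < ext t w" using True s t by (simp add: ext_eq)
      then show ?thesis using True by (simp add: stepval_def)
    next
      case False
      then show ?thesis using w stepval_bound[of t s w] bdsol_bound[of "(t + s, X s w)"] by (simp add: indicator_def)
    qed
  qed
  also have "\<dots> = 2 * S * measure (P x) (Om - ?E)" using EP sets.compl_sets[OF EP] by (simp add: Int_absorb2 Diff_subset)
  also have "measure (P x) (Om - ?E) = 1 - measure (P x) ?E" using P.prob_compl[OF EP] by simp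
  also have "2 * S * (1 - measure (P x) ?E) \<le> 2 * S * (3 * real CARD('n) * s' / (\<delta> * r\<^sup>2) + 6 * N0 * e)"
    using stay_prob[OF r(1) s'0 dr] S_nonneg by (intro mult_left_mono) auto
  finally show ?thesis .
qed

lemma bdsol_uniform_approx:
  assumes t: "0 \<le> t" "t < T2" and x: "norm x < 2 * R" and e: "0 < e"
  obtains \<rho> s where "0 < \<rho>" "\<rho> < s"
    "\<And>t' x'. 0 \<le> t' \<Longrightarrow> \<bar>t' - t\<bar> < \<rho> \<Longrightarrow> norm (x' - x) < \<rho> \<Longrightarrow>
       \<bar>bdsol (t', x') - sgp (t + s - t') (\<lambda>y. bdsol (t + s, y)) x'\<bar> \<le> e"
proof -
  define e1 where "e1 = e / (4 * (S + 1))"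
  have e1: "0 < e1" "2 * S * (2 * e1) \<le> e" using e S_nonneg by (auto simp: e1_def field_simps)
  have "0 < e1 / (6 * N0)" using e1 N0_pos by simp
  then obtain r0 where r0: "0 < r0" "drift x r0 \<le> ennreal (e1 / (6 * N0))" using drift_small by blast
  define r where "r = min r0 (2 * R - norm x) / 2"
  have r: "0 < r" "2 * r \<le> r0" "2 * r \<le> 2 * R - norm x" using r0 x by (auto simp: r_def)
  define s' where "s' = min (e1 * (\<delta> * r\<^sup>2) / (3 * real CARD('n))) ((T2 - t) / 2)"
  have "0 < e1 * (\<delta> * r\<^sup>2) / (3 * real CARD('n))" using e1 \<delta>_pos r by simp
  then have s'0: "0 < s'" using t by (simp add: s'_def)
  have s'2: "s' \<le> (T2 - t) / 2" and s'3: "s' \<le> e1 * (\<delta> * r\<^sup>2) / (3 * real CARD('n))"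
    unfolding s'_def by (rule min.cobounded2, rule min.cobounded1)
  note s' = s'0 s'2 s'3
  have "3 * real CARD('n) * s' / (\<delta> * r\<^sup>2) \<le> e1"
    using s'(3) \<delta>_pos r(1) by (simp add: field_simps)
  moreover have "6 * N0 * (e1 / (6 * N0)) = e1" using N0_pos by simp
  ultimately have small: "3 * real CARD('n) * s' / (\<delta> * r\<^sup>2) + 6 * N0 * (e1 / (6 * N0)) \<le> 2 * e1" by linarith
  show thesis
  proof (rule that[of "min r (s' / 4)" "s' / 2"])
    show "0 < min r (s' / 4)" "min r (s' / 4) < s' / 2" using r s' by auto
    fix t' x' assume t': "0 \<le> t'" "\<bar>t' - t\<bar> < min r (s' / 4)" and x': "norm (x' - x) < min r (s' / 4)"
    have b1: "ball x' r \<subseteq> ball x r0"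
    proof (rule subsetI)
      fix y assume "y \<in> ball x' r"
      then have "norm (y - x') < r" by (simp add: dist_norm norm_minus_commute)
      then have "norm (y - x) < r0" using norm_triangle_ineq[of "y - x'" "x' - x"] x' r(2) by simp
      then show "y \<in> ball x r0" by (simp add: dist_norm norm_minus_commute)
    qed
    have b2: "ball x' r \<subseteq> ball 0 (2 * R)"
    proof (rule subsetI)
      fix y assume "y \<in> ball x' r"
      then have "norm (y - x') < r" by (simp add: dist_norm norm_minus_commute)
      then have "norm y < 2 * R" using norm_triangle_ineq[of "y - x'" "x' - x"] norm_triangle_ineq[of "y - x" x] x' r(3) by simp
      then show "y \<in> ball 0 (2 * R)" by simp
    qed
    let ?s = "t + s' / 2 - t'"
    have "\<bar>t' - t\<bar> < s' / 4" using t'(2) unfolding min_less_iff_conj by blast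
    then have tt: "t' - t < s' / 4" "t - t' < s' / 4" by linarith+
    have "2 * s' \<le> T2 - t" using s'2 by simp
    then have s: "0 \<le> ?s" "?s < s'" "t' + s' \<le> T2" using tt s'0 by linarith+
    have "drift x' r \<le> ennreal (e1 / (6 * N0))" using drift_mono[OF b1] r0(2) by (rule order_trans)
    then have "\<bar>bdsol (t', x') - sgp ?s (\<lambda>y. bdsol (t' + ?s, y)) x'\<bar> \<le> 2 * S * (3 * real CARD('n) * s' / (\<delta> * r\<^sup>2) + 6 * N0 * (e1 / (6 * N0)))"
      by (intro bdsol_near_sgp[OF t'(1) s r(1) b2]) (use e1 N0_pos in auto)
    also have "\<dots> \<le> 2 * S * (2 * e1)" using small S_nonneg by (intro mult_left_mono) auto
    also have "\<dots> \<le> e" by (rule e1)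
    finally show "\<bar>bdsol (t', x') - sgp (t + s' / 2 - t') (\<lambda>y. bdsol (t + s' / 2, y)) x'\<bar> \<le> e" by simp
  qed
qed

lemma bdsol_tendsto:
  assumes t: "0 \<le> t" "t < T2" and x: "norm x < 2 * R"
    and tn: "tn \<longlonglongrightarrow> t" "\<And>n. 0 \<le> tn n" and xn: "xn \<longlonglongrightarrow> x"
  shows "(\<lambda>n. bdsol (tn n, xn n)) \<longlonglongrightarrow> bdsol (t, x)"
proof (rule LIMSEQ_I)
  fix e :: real assume e: "0 < e"
  then have "0 < e / 3" by simp
  then obtain \<rho> s where \<rho>: "0 < \<rho>" "\<rho> < s"
    "\<And>t' x'. 0 \<le> t' \<Longrightarrow> \<bar>t' - t\<bar> < \<rho> \<Longrightarrow> norm (x' - x) < \<rho> \<Longrightarrow>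
       \<bar>bdsol (t', x') - sgp (t + s - t') (\<lambda>y. bdsol (t + s, y)) x'\<bar> \<le> e / 3"
    using bdsol_uniform_approx[OF t x] by metis
  let ?f = "\<lambda>y. bdsol (t + s, y)"
  have "(\<lambda>n. sgp (t + s - tn n) ?f (xn n)) \<longlonglongrightarrow> sgp (t + s - t) ?f x"
    using \<rho>(1,2) by (intro sgp_tendsto[OF bdsol_bdd] tendsto_diff[OF tendsto_const tn(1)] xn) simp
  then have "\<forall>\<^sub>F n in sequentially. dist (sgp (t + s - tn n) ?f (xn n)) (sgp (t + s - t) ?f x) < e / 3"
    using e by (intro tendstoD) auto
  then have "\<forall>\<^sub>F n in sequentially. norm (bdsol (tn n, xn n) - bdsol (t, x)) < e"
    using tendstoD[OF tn(1) \<rho>(1)] tendstoD[OF xn \<rho>(1)]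
  proof eventually_elim
    case (elim n)
    have "\<bar>bdsol (tn n, xn n) - sgp (t + s - tn n) ?f (xn n)\<bar> \<le> e / 3"
      by (rule \<rho>(3)) (use elim tn(2) in \<open>auto simp: dist_norm\<close>)
    moreover have "\<bar>bdsol (t, x) - sgp (t + s - t) ?f x\<bar> \<le> e / 3"
      by (rule \<rho>(3)) (use \<rho>(1) t in auto)
    ultimately show ?case using elim(1) by (simp only: dist_norm real_norm_def)
  qed
  then show "\<exists>no. \<forall>n\<ge>no. norm (bdsol (tn n, xn n) - bdsol (t, x)) < e" by (simp add: eventually_sequentially)
qed

lemma pcyl_iff: "(t, x) \<in> pcyl (2 * R) \<longleftrightarrow> 0 \<le> t \<and> t < T2 \<and> norm x < 2 * R"
  by (auto simp: cyl_def T2)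

definition calsol :: "real \<times> (real ^ 'n) \<Rightarrow> real" where
  "calsol z = (if z \<in> pcyl (2 * R) then bdsol z else g z)"

lemma calsol_bound: "\<bar>calsol z\<bar> \<le> S" by (simp add: calsol_def bdsol_bound g)

lemma pcyl_borel: "pcyl (2 * R) \<in> sets (borel :: (real \<times> (real ^ 'n)) measure)"
  unfolding cyl_def borel_prod[symmetric] by (intro pair_measureI) auto

lemma calsol_meas: "calsol \<in> borel_measurable borel"
  unfolding calsol_def[abs_def] using pcyl_borel bdsol_meas g(1) by (intro measurable_If_set) auto

lemma stepval_eq_calsol:
  assumes t0: "0 \<le> t0" "t0 < T2" and w: "w \<in> Om" and s: "0 \<le> s" "s \<le> ext t0 w"
  shows "stepval t0 s w = calsol (t0 + s, X s w)"
proof (cases "s < ext t0 w")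
  case True
  then have s': "s < hitX (ball 0 (2 * R)) (T2 - t0) w" using t0 by (simp add: ext_eq)
  then have "X s w \<in> ball 0 (2 * R)" by (rule less_hit_imp_in[OF s(1)])
  moreover have "s < T2 - t0" using s' hit_le[of "ball 0 (2 * R)" "T2 - t0" "\<lambda>t. X t w"] by simp
  ultimately have "(t0 + s, X s w) \<in> pcyl (2 * R)" unfolding pcyl_iff using t0 s by simp
  then show ?thesis using True by (simp add: stepval_def calsol_def)
next
  case False
  then have se: "s = ext t0 w" using s by simp
  have "(t0 + s, X s w) \<notin> pcyl (2 * R)"
  proof (cases "ext t0 w < T2 - t0")
    case True
    have "X (hitX (ball 0 (2 * R)) (T2 - t0) w) w \<notin> ball 0 (2 * R)"
      by (rule hit_not_in[OF paths[OF w] open_ball]) (use True t0 in \<open>simp add: ext_eq\<close>)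
    then show ?thesis unfolding pcyl_iff using se t0 by (simp add: ext_eq)
  next
    case False
    then show ?thesis unfolding pcyl_iff using se by simp
  qed
  then show ?thesis using False se s by (simp add: stepval_def calsol_def bdval_def max_absorb2)
qed

lemma stepval_grid_tendsto:
  assumes t0: "0 \<le> t0" "t0 < T2" and T: "0 < T" "T \<le> T2 - t0" and \<sigma>: "stopping T \<sigma>" and w: "w \<in> Om"
    and le: "\<sigma> w \<le> ext t0 w"
  shows "(\<lambda>n. stepval t0 (grid T (Suc n) (\<sigma> w)) w) \<longlonglongrightarrow> stepval t0 (\<sigma> w) w"
proof -
  let ?s = "\<lambda>n. grid T (Suc n) (\<sigma> w)"
  have ge: "\<sigma> w \<le> ?s n" for n by (rule grid_ge[OF T(1)]) simp
  have lim: "?s \<longlonglongrightarrow> \<sigma> w" by (rule LIMSEQ_Suc[OF tendsto_grid[OF T(1)]])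
  have \<sigma>0: "0 \<le> \<sigma> w" by (rule stoppingD(1)[OF \<sigma> w])
  show ?thesis
  proof (cases "\<sigma> w < ext t0 w")
    case True
    then have s': "\<sigma> w < hitX (ball 0 (2 * R)) (T2 - t0) w" using t0 by (simp add: ext_eq)
    then have "X (\<sigma> w) w \<in> ball 0 (2 * R)" by (rule less_hit_imp_in[OF \<sigma>0])
    moreover have "\<sigma> w < T2 - t0" using s' hit_le[of "ball 0 (2 * R)" "T2 - t0" "\<lambda>t. X t w"] by simp
    ultimately have l: "(\<lambda>n. bdsol (t0 + ?s n, X (?s n) w)) \<longlonglongrightarrow> bdsol (t0 + \<sigma> w, X (\<sigma> w) w)"
      using t0 \<sigma>0 order_trans[OF \<sigma>0 ge]
      by (intro bdsol_tendsto tendsto_add tendsto_const lim LIMSEQ_Suc[OF X_grid_tendsto[OF \<sigma> T(1) w]]) auto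
    have ev: "\<forall>\<^sub>F n in sequentially. bdsol (t0 + ?s n, X (?s n) w) = stepval t0 (?s n) w"
      using order_tendstoD(2)[OF lim True] by eventually_elim (simp add: stepval_def)
    have eq: "stepval t0 (\<sigma> w) w = bdsol (t0 + \<sigma> w, X (\<sigma> w) w)" using True by (simp add: stepval_def)
    show ?thesis unfolding eq by (rule Lim_transform_eventually[OF l ev])
  next
    case False
    then have "stepval t0 (?s n) w = stepval t0 (\<sigma> w) w" for n using ge[of n] by (simp add: stepval_def)
    then show ?thesis by simp
  qed
qed

lemma bdsol_stopping:
  assumes t0: "0 \<le> t0" "t0 < T2" and T: "0 < T" "T \<le> T2 - t0" and \<sigma>: "stopping T \<sigma>"
    and le: "\<And>w. w \<in> Om \<Longrightarrow> \<sigma> w \<le> ext t0 w"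
  shows "bdsol (t0, x) = (\<integral>w. calsol (t0 + \<sigma> w, X (\<sigma> w) w) \<partial>P x)"
proof -
  let ?Yn = "\<lambda>n w. stepval t0 (grid T (Suc n) (\<sigma> w)) w"
  have t0': "t0 \<le> T2" using t0 by simp
  have eq: "\<bar>(\<integral>w. bdval t0 w * indicator B w \<partial>P x) - (\<integral>w. stepval t0 s w * indicator B w \<partial>P x)\<bar> \<le> 0 * s * measure (P x) B"
    if "0 \<le> s" "s \<le> T" "B \<in> sets (F s)" for s B
    using stepval_markov[OF t0(1) t0' that(1,3), of x] by simp
  have iY: "integrable (P x) (stepval t0 s)" if "0 \<le> s" "s \<le> T" for s by (rule stepval_integrable[OF t0(1) t0' that(1)])
  note ge = grid_expectation[where Y = "stepval t0" and C = 0, OF \<sigma> T(1) _ order_refl bdval_integrable iY eq]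
  have iYn: "integrable (P x) (?Yn n)" for n by (rule ge(1)) simp_all
  have EYn: "(\<integral>w. ?Yn n w \<partial>P x) = bdsol (t0, x)" for n
  proof -
    have "\<bar>(\<integral>w. bdval t0 w \<partial>P x) - (\<integral>w. ?Yn n w \<partial>P x)\<bar> \<le> 0 * T" by (rule ge(2)) simp_all
    then show ?thesis by (simp add: bdsol_def)
  qed
  have lim: "(\<lambda>n. ?Yn n w) \<longlonglongrightarrow> stepval t0 (\<sigma> w) w" if "w \<in> Om" for w
    by (rule stepval_grid_tendsto[OF t0 T \<sigma> that le[OF that]])
  have m: "(\<lambda>w. stepval t0 (\<sigma> w) w) \<in> borel_measurable (P x)"
    by (rule borel_measurable_LIMSEQ_real[of _ ?Yn]) (use lim borel_measurable_integrable[OF iYn] in auto)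
  have "(\<lambda>n. \<integral>w. ?Yn n w \<partial>P x) \<longlonglongrightarrow> (\<integral>w. stepval t0 (\<sigma> w) w \<partial>P x)"
  proof (rule integral_dominated_convergence[where w = "\<lambda>_. S"])
    show "?Yn n \<in> borel_measurable (P x)" for n by (rule borel_measurable_integrable[OF iYn])
    show "AE w in P x. (\<lambda>n. ?Yn n w) \<longlonglongrightarrow> stepval t0 (\<sigma> w) w" by (rule AE_I2) (use lim in simp)
    show "AE w in P x. norm (?Yn n w) \<le> S" for n by (rule AE_I2) (use stepval_bound in simp)
  qed (use m in auto)
  then have "bdsol (t0, x) = (\<integral>w. stepval t0 (\<sigma> w) w \<partial>P x)"
    unfolding EYn by (rule LIMSEQ_unique[OF tendsto_const])
  also have "\<dots> = (\<integral>w. calsol (t0 + \<sigma> w, X (\<sigma> w) w) \<partial>P x)"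
  proof (rule Bochner_Integration.integral_cong[OF refl])
    fix w assume "w \<in> space (P x)"
    then show "stepval t0 (\<sigma> w) w = calsol (t0 + \<sigma> w, X (\<sigma> w) w)"
      using stepval_eq_calsol[OF t0, of w "\<sigma> w"] stoppingD(1)[OF \<sigma>, of w] le[of w] by simp
  qed
  finally show ?thesis .
qed

lemma calsol_caloric: "caloric X P (closure (pcyl (2 * R))) calsol"
  unfolding caloric_def
proof (intro conjI allI impI)
  show "calsol \<in> borel_measurable borel" by (rule calsol_meas)
  show "bounded (calsol ` closure (pcyl (2 * R)))"
    by (intro boundedI[of _ S]) (auto simp: calsol_bound)
  fix z :: "real \<times> (real ^ 'n)" and T r t0 x0
  assume A: "0 < T \<and> 0 < r \<and> closure (cyl z T r) \<subseteq> closure (pcyl (2 * R))" and M: "(t0, x0) \<in> cyl z T r"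
  have cl: "closure (pcyl (2 * R)) = {0..T2} \<times> cball (0 :: real ^ 'n) (2 * R)"
    using R T2 by (subst closure_cyl) auto
  have sub: "{fst z..fst z + T} \<times> cball (snd z) r \<subseteq> {0..T2} \<times> cball (0 :: real ^ 'n) (2 * R)"
  proof -
    have "closure (cyl z T r) = {fst z..fst z + T} \<times> cball (snd z) r" using A by (intro closure_cyl) auto
    moreover have "closure (cyl z T r) \<subseteq> {0..T2} \<times> cball 0 (2 * R)" using A unfolding cl by blast
    ultimately show ?thesis by simp
  qed
  have "\<tau> \<in> {fst z..fst z + T} \<Longrightarrow> y \<in> cball (snd z) r \<Longrightarrow> \<tau> \<in> {0..T2} \<and> y \<in> cball 0 (2 * R)" for \<tau> y
    using subsetD[OF sub, of "(\<tau>, y)"] unfolding mem_Times_iff fst_conv snd_conv by blast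
  note sub' = this
  have z: "0 \<le> fst z" "fst z + T \<le> T2"
    using sub'[of "fst z" "snd z"] sub'[of "fst z + T" "snd z"] A by auto
  have "cball (snd z) r \<subseteq> cball 0 (2 * R)"
    using sub'[of "fst z"] A by auto
  then have bb: "ball (snd z) r \<subseteq> ball 0 (2 * R)"
    by (metis interior_cball interior_mono)
  have t0: "fst z \<le> t0" "t0 < fst z + T" and x0: "x0 \<in> ball (snd z) r" using M by (auto simp: cyl_def)
  have t0': "0 \<le> t0" "t0 < T2" using t0 z by auto
  let ?T = "fst z + T - t0" and ?\<sigma> = "hitX (ball (snd z) r) (fst z + T - t0)"
  have T': "0 < ?T" "?T \<le> T2 - t0" using t0 z by auto
  have \<sigma>: "stopping ?T ?\<sigma>" using t0 by (intro stopping_hitX) auto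
  have "(t0, x0) \<in> pcyl (2 * R)" unfolding pcyl_iff using t0' x0 bb by auto
  then have "calsol (t0, x0) = bdsol (t0, x0)" by (simp add: calsol_def)
  also have "\<dots> = (\<integral>w. calsol (t0 + ?\<sigma> w, X (?\<sigma> w) w) \<partial>P x0)"
    by (rule bdsol_stopping[OF t0' T' \<sigma>]) (use bb T' t0' in \<open>auto simp: ext_eq intro!: hit_mono\<close>)
  also have "\<dots> = (\<integral>w. calsol (exit_point (cyl z T r) (spacetime X t0 w)) \<partial>P x0)"
    unfolding exit_point_cyl[OF t0(1) less_imp_le[OF t0(2)]] by (simp add: Let_def)
  finally show "calsol (t0, x0) = (\<integral>w. calsol (exit_point (cyl z T r) (spacetime X t0 w)) \<partial>P x0)" .
qed

lemma bdsol_exit: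
  assumes "(t0, x0) \<in> pcyl (2 * R)"
  shows "bdsol (t0, x0) = (\<integral>w. g (exit_point (pcyl (2 * R)) (spacetime X t0 w)) \<partial>P x0)"
proof -
  have t0: "0 \<le> t0" "t0 < T2" using assms unfolding pcyl_iff by auto
  have "exit_point (cyl (0, 0) T2 (2 * R)) (spacetime X t0 w) = (t0 + ext t0 w, X (max 0 (ext t0 w)) w)" for w
    using t0 ext_nonneg[of t0 w] ext_eq[of t0 w] by (subst exit_point_cyl) (simp_all add: Let_def max_absorb2)
  then show ?thesis unfolding T2[symmetric] by (simp add: bdsol_def bdval_def)
qed

lemma exit_expectation_holder:
  assumes z: "z1 \<in> pcyl R" "z2 \<in> pcyl R" and \<alpha>: "0 < \<alpha>" "\<alpha> \<le> \<alpha>0"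
  shows "\<bar>(\<integral>w. g (exit_point (pcyl (2 * R)) (spacetime X (fst z1) w)) \<partial>P (snd z1))
      - (\<integral>w. g (exit_point (pcyl (2 * R)) (spacetime X (fst z2) w)) \<partial>P (snd z2))\<bar>
    \<le> \<bar>N\<alpha>\<bar> * (R powr (- \<alpha>) * pdist z1 z2 powr \<alpha> * S)"
proof -
  let ?S = "SUP z\<in>closure (pcyl (2 * R)). \<bar>calsol z\<bar>"
  have RR: "R\<^sup>2 \<le> T2" unfolding T2 using R by (simp add: power_mult_distrib)
  have in2: "z \<in> pcyl (2 * R)" if "z \<in> pcyl R" for z :: "real \<times> (real ^ 'n)"
    using that RR R unfolding cyl_def T2 by (auto simp: dist_norm)
  have eq: "calsol z = (\<integral>w. g (exit_point (pcyl (2 * R)) (spacetime X (fst z) w)) \<partial>P (snd z))" if "z \<in> pcyl R" for z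
    using in2[OF that] bdsol_exit[of "fst z" "snd z"] by (simp add: calsol_def)
  have "(0 :: real, 0 :: real ^ 'n) \<in> closure (pcyl (2 * R))" using R by (subst closure_cyl) auto
  note in0 = this
  have ne: "closure (pcyl (2 * R)) \<noteq> ({} :: (real \<times> (real ^ 'n)) set)"
    by (rule ex_in_conv[THEN iffD1, OF exI, OF in0])
  have S: "?S \<le> S" using ne by (intro cSUP_least calsol_bound)
  have "(\<lambda>t w. X t w - 0) = X" "(\<lambda>y. P (y + 0)) = P" by auto
  then have ch: "caloric_holder \<alpha>0 N\<alpha> X P" using holder[of 0] by simp
  have "\<bar>calsol z1 - calsol z2\<bar> \<le> N\<alpha> * R powr (- \<alpha>) * pdist z1 z2 powr \<alpha> * ?S"
    by (rule ch[unfolded caloric_holder_def, rule_format]) (intro conjI R calsol_caloric \<alpha> z)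
  moreover have "0 \<le> ?S"
  proof (rule cSUP_upper2)
    show "bdd_above ((\<lambda>z. \<bar>calsol z\<bar>) ` closure (pcyl (2 * R)))" by (intro bdd_aboveI2[where M = S] calsol_bound)
    show "(0 :: real, 0 :: real ^ 'n) \<in> closure (pcyl (2 * R))" by (rule in0)
    show "0 \<le> \<bar>calsol (0, 0)\<bar>" by (rule abs_ge_zero)
  qed
  moreover have "N\<alpha> * R powr (- \<alpha>) * pdist z1 z2 powr \<alpha> * ?S \<le> \<bar>N\<alpha>\<bar> * R powr (- \<alpha>) * pdist z1 z2 powr \<alpha> * S"
    using S \<open>0 \<le> ?S\<close> by (intro mult_mono mult_right_mono) (auto intro!: mult_nonneg_nonneg)
  ultimately show ?thesis using eq[OF z(1)] eq[OF z(2)] by (simp add: mult.assoc)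
qed

end

end

section \<open>Potentials of functions in \<open>L\<^sub>p\<close>\<close>

lemma young_scaled:
  fixes p q l v I :: real
  assumes pq: "1 < p" "1 < q" "1 / p + 1 / q = 1" and l: "0 < l" and v: "0 \<le> v" and I: "0 \<le> I"
  shows "v * I powr (1 / p) \<le> l powr p / p * I + l powr (- q) / q * v powr q"
proof -
  have "(l * I powr (1 / p)) * (v / l) \<le> (l * I powr (1 / p)) powr p / p + (v / l) powr q / q"
    by (rule Youngs_inequality[OF pq]) (use l v in auto)
  moreover have "(l * I powr (1 / p)) powr p = l powr p * I"
    using l I pq by (simp add: powr_mult powr_powr)
  moreover have "(v / l) powr q = l powr (- q) * v powr q"
    using l v by (simp add: powr_divide powr_minus field_simps)
  moreover have "(l * I powr (1 / p)) * (v / l) = v * I powr (1 / p)" using l by simp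
  ultimately show ?thesis by simp
qed

lemma nn_integral_powr_0:
  assumes "\<gamma> < 1" "0 \<le> c"
  shows "(\<integral>\<^sup>+t. ennreal (t powr (- \<gamma>)) * indicator {0..c} t \<partial>lborel) = ennreal (c powr (1 - \<gamma>) / (1 - \<gamma>))"
proof -
  have "((\<lambda>t. t powr (- \<gamma>)) has_integral (c powr (- \<gamma> + 1) / (- \<gamma> + 1))) {0..c}"
    by (rule has_integral_powr_from_0) (use assms in auto)
  from nn_integral_has_integral_lebesgue'[OF _ this] show ?thesis by simp
qed

lemma weighted_time_bound:
  fixes I :: "real \<Rightarrow> ennreal"
  assumes pq: "1 < p" "1 < q" "1 / p + 1 / q = 1" and \<kappa>: "\<kappa> * q < 1" and T: "0 < T"
    and I: "I \<in> borel_measurable lborel" "(\<integral>\<^sup>+t. I t \<partial>lborel) \<le> ennreal J" and J: "0 < J"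
  shows "(\<integral>\<^sup>+t. ennreal (t powr (- \<kappa>)) * (if I t = \<infinity> then \<infinity> else ennreal (enn2real (I t) powr (1 / p))) * indicator {0..T} t \<partial>lborel)
    \<le> ennreal ((1 / p + 1 / (q * (1 - \<kappa> * q))) * T powr (1 / q - \<kappa>) * J powr (1 / p))"
proof -
  \<comment> \<open>\<open>l\<close> makes the two terms of Young's inequality equal\<close>
  define Y where "Y = T powr (1 - \<kappa> * q) / J"
  define l where "l = Y powr (1 / (p * q))"
  have Y: "0 < Y" using T J by (simp add: Y_def)
  have l: "0 < l" using Y by (simp add: l_def)
  have lp: "l powr p = Y powr (1 / q)" using pq by (simp add: l_def powr_powr)
  have lq: "l powr (- q) = Y powr (- (1 / p))" using pq by (simp add: l_def powr_powr)
  have q1: "1 / q = 1 - 1 / p" using pq by simp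
  have e: "(1 - \<kappa> * q) * (1 / q) = 1 / q - \<kappa>" using pq by (simp add: field_simps)
  have Yq: "Y powr (1 / q) = T powr (1 / q - \<kappa>) / J powr (1 / q)"
    using T J by (simp only: Y_def powr_divide powr_powr e)
  have a1: "l powr p / p * J = T powr (1 / q - \<kappa>) * J powr (1 / p) / p"
  proof -
    have "J / J powr (1 / q) = J powr (1 / p)" using J pq(3) by (simp add: powr_diff q1)
    moreover have "l powr p / p * J = T powr (1 / q - \<kappa>) * (J / J powr (1 / q)) / p" unfolding lp Yq by simp
    ultimately show ?thesis by simp
  qed
  have a2: "l powr (- q) / q * (T powr (1 - \<kappa> * q) / (1 - \<kappa> * q)) = T powr (1 / q - \<kappa>) * J powr (1 / p) / (q * (1 - \<kappa> * q))"
  proof -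
    have "Y powr (- (1 / p)) = Y powr (1 / q) / Y" using Y by (simp add: q1 powr_diff powr_minus field_simps)
    then have "l powr (- q) * T powr (1 - \<kappa> * q) = T powr (1 / q - \<kappa>) * (J / J powr (1 / q))"
      unfolding lq Yq using T J by (simp add: Y_def)
    also have "J / J powr (1 / q) = J powr (1 / p)" using J by (simp add: q1 powr_diff)
    finally have "l powr (- q) * T powr (1 - \<kappa> * q) = T powr (1 / q - \<kappa>) * J powr (1 / p)" .
    then show ?thesis by simp
  qed
  let ?n = "\<lambda>t. if I t = \<infinity> then \<infinity> else ennreal (enn2real (I t) powr (1 / p))"
  have pt: "ennreal (t powr (- \<kappa>)) * ?n t * indicator {0..T} t
      \<le> ennreal (l powr p / p) * I t + ennreal (l powr (- q) / q) * (ennreal (t powr (- (\<kappa> * q))) * indicator {0..T} t)" for t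
  proof (cases "I t = \<infinity> \<or> t \<notin> {0..T}")
    case True
    then show ?thesis using l pq by (auto simp: ennreal_mult_top)
  next
    case False
    define i where "i = enn2real (I t)"
    have i: "0 \<le> i" "I t = ennreal i" using False by (auto simp: i_def less_top)
    have "t powr (- \<kappa>) * i powr (1 / p) \<le> l powr p / p * i + l powr (- q) / q * (t powr (- \<kappa>)) powr q"
      by (rule young_scaled[OF pq l _ i(1)]) simp
    then have "ennreal (t powr (- \<kappa>) * i powr (1 / p)) \<le> ennreal (l powr p / p * i + l powr (- q) / q * t powr (- (\<kappa> * q)))"
      by (intro ennreal_leI) (simp add: powr_powr)
    also have "\<dots> = ennreal (l powr p / p) * ennreal i + ennreal (l powr (- q) / q) * ennreal (t powr (- (\<kappa> * q)))"
      using i(1) pq(1,2) by (subst ennreal_plus) (simp_all add: ennreal_mult[symmetric] times_divide_eq_left)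
    finally show ?thesis using False i by (simp add: ennreal_mult)
  qed
  have m: "(\<lambda>t. ennreal (t powr (- (\<kappa> * q))) * indicator {0..T} t) \<in> borel_measurable lborel" by measurable
  have "(\<integral>\<^sup>+t. ennreal (t powr (- \<kappa>)) * ?n t * indicator {0..T} t \<partial>lborel)
     \<le> (\<integral>\<^sup>+t. ennreal (l powr p / p) * I t + ennreal (l powr (- q) / q) * (ennreal (t powr (- (\<kappa> * q))) * indicator {0..T} t) \<partial>lborel)"
    by (rule nn_integral_mono) (rule pt)
  also have "\<dots> = ennreal (l powr p / p) * (\<integral>\<^sup>+t. I t \<partial>lborel) + ennreal (l powr (- q) / q) * ennreal (T powr (1 - \<kappa> * q) / (1 - \<kappa> * q))"
    using I(1) m by (subst nn_integral_add) (auto simp: nn_integral_cmult nn_integral_powr_0[OF \<kappa> less_imp_le[OF T]])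
  also have "\<dots> \<le> ennreal (l powr p / p) * ennreal J + ennreal (l powr (- q) / q) * ennreal (T powr (1 - \<kappa> * q) / (1 - \<kappa> * q))"
    by (intro add_right_mono mult_left_mono I) simp
  also have "\<dots> = ennreal (l powr p / p * J + l powr (- q) / q * (T powr (1 - \<kappa> * q) / (1 - \<kappa> * q)))"
    using pq(1,2) J \<kappa> by (subst ennreal_plus) (simp_all add: ennreal_mult[symmetric])
  also have "l powr p / p * J + l powr (- q) / q * (T powr (1 - \<kappa> * q) / (1 - \<kappa> * q))
    = (1 / p + 1 / (q * (1 - \<kappa> * q))) * T powr (1 / q - \<kappa>) * J powr (1 / p)"
    unfolding a1 a2 by (simp add: field_simps)
  finally show ?thesis .
qed

lemma abs_integral_le_nn_integral:
  fixes f :: "'b \<Rightarrow> real"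
  shows "ennreal \<bar>\<integral>x. f x \<partial>M\<bar> \<le> (\<integral>\<^sup>+x. ennreal \<bar>f x\<bar> \<partial>M)"
proof (cases "integrable M f")
  case True
  from integral_norm_bound_ennreal[OF this] show ?thesis by simp
qed (simp add: not_integrable_integral_eq)

definition potential_const :: "real \<Rightarrow> real \<Rightarrow> real \<Rightarrow> real \<Rightarrow> real \<Rightarrow> real \<Rightarrow> real" where
  "potential_const d \<alpha> N\<alpha> p N R0 = smoothing_const d \<alpha> N\<alpha> p N R0 *
     ((1 / p + 1 / (p / (p - 1) * (1 - d / (2 * p) * (p / (p - 1))))) * 4 powr (1 - (d + 2) / (2 * p)))"

context holder_diffusion
begin

lemma potential_exponent:
  assumes "q = p / (p - 1)"
  shows "1 < p" "1 < q" "1 / p + 1 / q = 1" "(real CARD('n) / (2 * p)) * q < 1"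
    "1 / q - (real CARD('n) / (2 * p)) = 1 - (real CARD('n) + 2) / (2 * p)"
proof -
  have p1: "1 < p" using p_large by (intro order.strict_trans1[OF _ p_large]) simp
  show "1 < p" by (rule p1)
  show "1 < q" "1 / p + 1 / q = 1" using p1 by (auto simp: assms field_simps)
  have "(real CARD('n) / (2 * p)) * q = real CARD('n) / (2 * (p - 1))" using p1 by (simp add: assms)
  also have "\<dots> < 1" using p_large p1 by (simp add: field_simps)
  finally show "(real CARD('n) / (2 * p)) * q < 1" .
  show "1 / q - (real CARD('n) / (2 * p)) = 1 - (real CARD('n) + 2) / (2 * p)" using p1 by (simp add: assms field_simps)
qed

lemma potential_bound:
  fixes f :: "real \<times> (real ^ 'n) \<Rightarrow> real"
  assumes R: "0 < R" and f: "f \<in> borel_measurable borel" and z: "(t0, x0) \<in> pcyl (2 * R)"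
  shows "(\<integral>\<^sup>+w. (\<integral>\<^sup>+t\<in>before_exit (pcyl (2 * R)) (spacetime X t0 w). ennreal \<bar>f (t0 + t, X t w)\<bar> \<partial>lborel) \<partial>P x0)
    \<le> ennreal ((potential_const (real CARD('n)) \<alpha>0 N\<alpha> p Np R0) * R powr (2 - (real CARD('n) + 2) / p)) * Lp_norm p (pcyl (2 * R)) f"
proof -
  define T where "T = (2 * R)\<^sup>2"
  define C where "C = (pcyl (2 * R) :: (real \<times> (real ^ 'n)) set)"
  have T: "0 < T" using R by (simp add: T_def)
  have CT: "C = cyl (0, 0) T (2 * R)" by (simp add: C_def T_def)
  have C_iff: "(t, x) \<in> C \<longleftrightarrow> 0 \<le> t \<and> t < T \<and> norm x < 2 * R" for t x by (auto simp: CT cyl_def)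
  have t0: "0 \<le> t0" "t0 < T" using z C_iff[of t0 x0] unfolding C_def by auto
  have Cm: "C \<in> sets borel" unfolding CT cyl_def borel_prod[symmetric] by (intro pair_measureI) auto
  define q where "q = p / (p - 1)"
  note pq = potential_exponent[OF q_def]
  define F where "F = (\<lambda>t y. \<bar>f (t0 + t, y)\<bar> * indicator C (t0 + t, y))"
  define H where "H = (\<lambda>z. ennreal (norm (f z) powr p) * indicator C z)"
  have Hm: "H \<in> borel_measurable borel" unfolding H_def using f Cm by measurable
  have sh: "(\<lambda>q :: real \<times> (real ^ 'n). (t0 + fst q, snd q)) \<in> borel \<rightarrow>\<^sub>M borel"
    unfolding borel_prod[symmetric] by measurable
  have Fj: "(\<lambda>q. F (fst q) (snd q)) \<in> borel_measurable borel"
  proof -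
    have "(\<lambda>z. \<bar>f z\<bar> * indicator C z) \<in> borel_measurable borel" using f Cm by measurable
    from measurable_compose[OF sh this] show ?thesis by (simp add: F_def)
  qed
  have Fm: "F t \<in> borel_measurable borel" for t
    using measurable_compose[OF _ Fj, of "\<lambda>y. (t, y)" borel] by (simp add: borel_prod[symmetric])
  have F0: "0 \<le> F t y" for t y by (simp add: F_def)
  define I where "I = (\<lambda>t. \<integral>\<^sup>+y. H (t0 + t, y) \<partial>lborel)"
  have Hs: "(\<lambda>q. H (t0 + fst q, snd q)) \<in> borel_measurable borel" by (rule measurable_compose[OF sh Hm])
  have Im: "I \<in> borel_measurable lborel"
    unfolding I_def
    by (rule lborel.borel_measurable_nn_integral) (use Hs in \<open>simp add: case_prod_unfold lborel_prod\<close>)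
  have Lp_F: "Lp_norm p UNIV (F t) = (if I t = \<infinity> then \<infinity> else ennreal (enn2real (I t) powr (1 / p)))" for t
  proof -
    have "(\<integral>\<^sup>+y\<in>UNIV. ennreal (norm (F t y) powr p) \<partial>lborel) = I t"
      unfolding I_def H_def F_def using pq(1) by (intro nn_integral_cong) (auto simp: indicator_def)
    then show ?thesis by (simp add: Lp_norm_def Let_def)
  qed
  define J where "J = (\<integral>\<^sup>+z\<in>C. ennreal (norm (f z) powr p) \<partial>lborel)"
  have I_J: "(\<integral>\<^sup>+t. I t \<partial>lborel) = J"
  proof -
    have m: "(\<lambda>t. \<integral>\<^sup>+y. H (t, y) \<partial>lborel) \<in> borel_measurable borel"
    proof -
      have "(\<lambda>t. \<integral>\<^sup>+y. H (t, y) \<partial>lborel) \<in> borel_measurable lborel"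
        by (rule lborel.borel_measurable_nn_integral) (use Hm in \<open>simp add: case_prod_unfold lborel_prod\<close>)
      then show ?thesis by simp
    qed
    have "(\<integral>\<^sup>+t. I t \<partial>lborel) = (\<integral>\<^sup>+t. (\<integral>\<^sup>+y. H (t, y) \<partial>lborel) \<partial>lborel)"
      unfolding I_def using nn_integral_real_affine[OF m, of 1 t0] by simp
    also have "\<dots> = (\<integral>\<^sup>+z. H z \<partial>(lborel \<Otimes>\<^sub>M lborel))"
      by (rule lborel.nn_integral_fst) (use Hm in \<open>simp add: lborel_prod\<close>)
    also have "\<dots> = J" by (simp only: lborel_prod J_def H_def)
    finally show ?thesis .
  qed
  let ?L = "\<integral>\<^sup>+w. (\<integral>\<^sup>+t\<in>before_exit C (spacetime X t0 w). ennreal \<bar>f (t0 + t, X t w)\<bar> \<partial>lborel) \<partial>P x0"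
  have "?L \<le> (\<integral>\<^sup>+w. (\<integral>\<^sup>+t. ennreal (F t (X (max 0 t) w)) * indicator {0<..T} t \<partial>lborel) \<partial>P x0)"
  proof (rule nn_integral_mono, rule nn_integral_mono_AE)
    fix w
    have be: "before_exit C (spacetime X t0 w) = {t. 0 \<le> t \<and> t < hit (ball 0 (2 * R)) (T - t0) (\<lambda>t. X t w)}"
      unfolding CT using t0 by (subst before_exit_cyl) auto
    show "AE t in lborel. ennreal \<bar>f (t0 + t, X t w)\<bar> * indicator (before_exit C (spacetime X t0 w)) t
        \<le> ennreal (F t (X (max 0 t) w)) * indicator {0<..T} t"
      using AE_lborel_singleton[of "0 :: real"]
    proof eventually_elim
      case (elim t)
      show ?case
      proof (cases "t \<in> before_exit C (spacetime X t0 w)")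
        case True
        then have t: "0 \<le> t" "t < hit (ball 0 (2 * R)) (T - t0) (\<lambda>t. X t w)" unfolding be by auto
        have "X t w \<in> ball 0 (2 * R)" by (rule less_hit_imp_in[OF t])
        moreover have "t < T - t0" using t(2) hit_le[of "ball 0 (2 * R)" "T - t0" "\<lambda>t. X t w"] by simp
        ultimately have "(t0 + t, X t w) \<in> C" unfolding C_iff using t t0 by simp
        moreover have "t \<in> {0<..T}" using t elim t0 \<open>t < T - t0\<close> by auto
        ultimately show ?thesis using t True by (simp add: F_def max_absorb2)
      qed simp
    qed
  qed
  also have "\<dots> = (\<integral>\<^sup>+t. (\<integral>\<^sup>+w. ennreal (F t (X (max 0 t) w)) * indicator {0<..T} t \<partial>P x0) \<partial>lborel)"
  proof (rule path_Fubini)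
    have "(\<lambda>q :: 'w \<times> real. (snd q, fst q)) \<in> GX \<Otimes>\<^sub>M lborel \<rightarrow>\<^sub>M borel \<Otimes>\<^sub>M GX" by measurable
    from measurable_compose[OF this X_joint]
    have Xm: "(\<lambda>q. X (max 0 (snd q)) (fst q)) \<in> GX \<Otimes>\<^sub>M lborel \<rightarrow>\<^sub>M borel" by simp
    have sm: "(\<lambda>q. snd q) \<in> GX \<Otimes>\<^sub>M lborel \<rightarrow>\<^sub>M (borel :: real measure)" by measurable
    have "(\<lambda>q. (snd q, X (max 0 (snd q)) (fst q))) \<in> GX \<Otimes>\<^sub>M lborel \<rightarrow>\<^sub>M borel"
      by (rule measurable_Pair[OF sm Xm, unfolded borel_prod])
    from measurable_compose[OF this Fj]
    have 1: "(\<lambda>q. F (snd q) (X (max 0 (snd q)) (fst q))) \<in> borel_measurable (GX \<Otimes>\<^sub>M lborel)" by simp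
    have 2: "(\<lambda>q :: 'w \<times> real. indicator {0<..T} (snd q) :: ennreal) \<in> borel_measurable (GX \<Otimes>\<^sub>M lborel)" by measurable
    show "(\<lambda>(w, t). ennreal (F t (X (max 0 t) w)) * indicator {0<..T} t) \<in> borel_measurable (GX \<Otimes>\<^sub>M lborel)"
      using 1 2 by (simp add: case_prod_unfold)
  qed
  also have "\<dots> \<le> (\<integral>\<^sup>+t. ennreal (smoothing_const (real CARD('n)) \<alpha>0 N\<alpha> p Np R0) * (ennreal (t powr (- (real CARD('n) / (2 * p)))) * Lp_norm p UNIV (F t) * indicator {0..T} t) \<partial>lborel)"
  proof (rule nn_integral_mono)
    fix t
    show "(\<integral>\<^sup>+w. ennreal (F t (X (max 0 t) w)) * indicator {0<..T} t \<partial>P x0)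
       \<le> ennreal (smoothing_const (real CARD('n)) \<alpha>0 N\<alpha> p Np R0) * (ennreal (t powr (- (real CARD('n) / (2 * p)))) * Lp_norm p UNIV (F t) * indicator {0..T} t)"
    proof (cases "t \<in> {0<..T}")
      case True
      then have t: "0 < t" by simp
      have "(\<integral>\<^sup>+w. ennreal (F t (X t w)) \<partial>P x0) \<le> ennreal ((smoothing_const (real CARD('n)) \<alpha>0 N\<alpha> p Np R0) * t powr (- (real CARD('n) / (2 * p)))) * Lp_norm p UNIV (F t)"
        by (rule P_Lp_bound[OF Fm F0 t])
      then show ?thesis using True smoothing_const_pos by (simp add: max_absorb2 ennreal_mult mult.assoc)
    qed simp
  qed
  also have "\<dots> = ennreal (smoothing_const (real CARD('n)) \<alpha>0 N\<alpha> p Np R0) * (\<integral>\<^sup>+t. ennreal (t powr (- (real CARD('n) / (2 * p)))) * Lp_norm p UNIV (F t) * indicator {0..T} t \<partial>lborel)"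
  proof (rule nn_integral_cmult)
    have "(\<lambda>t. Lp_norm p UNIV (F t)) \<in> borel_measurable lborel" unfolding Lp_F using Im by measurable
    then show "(\<lambda>t. ennreal (t powr (- (real CARD('n) / (2 * p)))) * Lp_norm p UNIV (F t) * indicator {0..T} t) \<in> borel_measurable lborel" by measurable
  qed
  finally have L: "?L \<le> ennreal (smoothing_const (real CARD('n)) \<alpha>0 N\<alpha> p Np R0) * (\<integral>\<^sup>+t. ennreal (t powr (- (real CARD('n) / (2 * p)))) * Lp_norm p UNIV (F t) * indicator {0..T} t \<partial>lborel)" .
  define K where "K = (1 / p + 1 / (q * (1 - (real CARD('n) / (2 * p)) * q))) * T powr (1 / q - (real CARD('n) / (2 * p)))"
  have K: "0 < K" using pq T by (simp add: K_def add_pos_pos)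
  have DK: "(smoothing_const (real CARD('n)) \<alpha>0 N\<alpha> p Np R0) * K = (potential_const (real CARD('n)) \<alpha>0 N\<alpha> p Np R0) * R powr (2 - (real CARD('n) + 2) / p)"
  proof -
    have "T = 4 * R powr 2" using R by (simp add: T_def power_mult_distrib)
    then have "T powr (1 / q - (real CARD('n) / (2 * p))) = 4 powr (1 - (real CARD('n) + 2) / (2 * p)) * R powr (2 * (1 - (real CARD('n) + 2) / (2 * p)))"
      unfolding pq(5) using R by (simp only: powr_mult powr_powr)
    moreover have "2 * (1 - (real CARD('n) + 2) / (2 * p)) = 2 - (real CARD('n) + 2) / p" using pq(1) by (simp add: field_simps)
    ultimately show ?thesis unfolding K_def potential_const_def q_def by (simp only: mult.assoc)
  qed
  have bound: "?L \<le> ennreal ((smoothing_const (real CARD('n)) \<alpha>0 N\<alpha> p Np R0) * K * j powr (1 / p))" if j: "0 < j" "J \<le> ennreal j" for j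
  proof -
    have "?L \<le> ennreal (smoothing_const (real CARD('n)) \<alpha>0 N\<alpha> p Np R0) * ennreal (K * j powr (1 / p))"
      unfolding K_def
      by (rule order_trans[OF L mult_left_mono]) (unfold Lp_F, rule weighted_time_bound[OF pq(1-4) T Im], use I_J j in auto)
    then show ?thesis using smoothing_const_pos K by (simp add: ennreal_mult mult.assoc)
  qed
  have "?L \<le> ennreal ((smoothing_const (real CARD('n)) \<alpha>0 N\<alpha> p Np R0) * K) * Lp_norm p C f"
  proof (cases "J = \<infinity>")
    case True
    then have "Lp_norm p C f = \<infinity>" by (simp add: Lp_norm_def J_def)
    then show ?thesis using smoothing_const_pos K by (simp add: ennreal_mult_top)
  next
    case False
    define j where "j = enn2real J"
    have j: "0 \<le> j" "J = ennreal j" using False by (auto simp: j_def less_top)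
    have Lp: "Lp_norm p C f = ennreal (j powr (1 / p))" using False by (simp add: Lp_norm_def J_def j_def Let_def)
    show ?thesis
    proof (cases "j = 0")
      case False
      then show ?thesis using bound[of j] j smoothing_const_pos K by (simp add: Lp ennreal_mult)
    next
      case True
      have "?L \<le> 0"
      proof (rule ennreal_le_epsilon)
        fix e :: real assume e: "0 < e"
        have DK0: "0 < (smoothing_const (real CARD('n)) \<alpha>0 N\<alpha> p Np R0) * K" using smoothing_const_pos K by simp
        have "?L \<le> ennreal ((smoothing_const (real CARD('n)) \<alpha>0 N\<alpha> p Np R0) * K * ((e / ((smoothing_const (real CARD('n)) \<alpha>0 N\<alpha> p Np R0) * K)) powr p) powr (1 / p))"
          by (rule bound) (use e DK0 j True in auto)
        also have "(smoothing_const (real CARD('n)) \<alpha>0 N\<alpha> p Np R0) * K * ((e / ((smoothing_const (real CARD('n)) \<alpha>0 N\<alpha> p Np R0) * K)) powr p) powr (1 / p) = e" using e DK0 pq(1) K smoothing_const_pos by (simp add: powr_powr)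
        finally show "?L \<le> 0 + ennreal e" by simp
      qed
      then show ?thesis by simp
    qed
  qed
  then show ?thesis unfolding DK C_def .
qed

lemma potential_abs_bound:
  fixes f :: "real \<times> (real ^ 'n) \<Rightarrow> real"
  assumes R: "0 < R" and f: "f \<in> borel_measurable borel" "Lp_norm p (pcyl (2 * R)) f < \<infinity>" and z: "(t0, x0) \<in> pcyl (2 * R)"
  shows "\<bar>LINT w|P x0. (LINT t:before_exit (pcyl (2 * R)) (spacetime X t0 w)|lborel. f (t0 + t, X t w))\<bar>
    \<le> (potential_const (real CARD('n)) \<alpha>0 N\<alpha> p Np R0) * (R powr (2 - (real CARD('n) + 2) / p) * enn2real (Lp_norm p (pcyl (2 * R)) f))"
proof -
  let ?B = "\<lambda>w. before_exit (pcyl (2 * R)) (spacetime X t0 w)"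
  let ?c = "(potential_const (real CARD('n)) \<alpha>0 N\<alpha> p Np R0) * R powr (2 - (real CARD('n) + 2) / p)"
  have CF0: "0 \<le> (potential_const (real CARD('n)) \<alpha>0 N\<alpha> p Np R0)"
    using smoothing_const_pos potential_exponent[OF refl] unfolding potential_const_def by (intro mult_nonneg_nonneg add_nonneg_nonneg) auto
  have "ennreal \<bar>LINT w|P x0. (LINT t:?B w|lborel. f (t0 + t, X t w))\<bar>
    \<le> (\<integral>\<^sup>+w. ennreal \<bar>LINT t:?B w|lborel. f (t0 + t, X t w)\<bar> \<partial>P x0)"
    by (rule abs_integral_le_nn_integral)
  also have "\<dots> \<le> (\<integral>\<^sup>+w. (\<integral>\<^sup>+t\<in>?B w. ennreal \<bar>f (t0 + t, X t w)\<bar> \<partial>lborel) \<partial>P x0)"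
  proof (rule nn_integral_mono)
    fix w
    have "ennreal \<bar>LINT t:?B w|lborel. f (t0 + t, X t w)\<bar> \<le> (\<integral>\<^sup>+t. ennreal \<bar>indicator (?B w) t *\<^sub>R f (t0 + t, X t w)\<bar> \<partial>lborel)"
      unfolding set_lebesgue_integral_def by (rule abs_integral_le_nn_integral)
    also have "\<dots> = (\<integral>\<^sup>+t\<in>?B w. ennreal \<bar>f (t0 + t, X t w)\<bar> \<partial>lborel)"
      by (intro nn_integral_cong) (simp add: indicator_def)
    finally show "ennreal \<bar>LINT t:?B w|lborel. f (t0 + t, X t w)\<bar> \<le> (\<integral>\<^sup>+t\<in>?B w. ennreal \<bar>f (t0 + t, X t w)\<bar> \<partial>lborel)" .
  qed
  also have "\<dots> \<le> ennreal ?c * Lp_norm p (pcyl (2 * R)) f" by (rule potential_bound[OF R f(1) z])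
  also have "Lp_norm p (pcyl (2 * R)) f = ennreal (enn2real (Lp_norm p (pcyl (2 * R)) f))" using f(2) by simp
  also have "ennreal ?c * \<dots> = ennreal (?c * enn2real (Lp_norm p (pcyl (2 * R)) f))"
    using CF0 by (simp add: ennreal_mult)
  finally show ?thesis using CF0 by (simp add: ennreal_le_iff mult.assoc)
qed

end

context holder_diffusion
begin

lemma exit_point_pcyl:
  assumes R: "0 < R" and z: "(t0, x0) \<in> pcyl (2 * R)"
  shows "(\<lambda>w. exit_point (pcyl (2 * R)) (spacetime X t0 w)) \<in> GX \<rightarrow>\<^sub>M borel"
    "AE w in P x0. exit_point (pcyl (2 * R)) (spacetime X t0 w) \<in> closure (pcyl (2 * R))"
proof -
  define T where "T = (2 * R)\<^sup>2"
  have T: "0 < T" using R by (simp add: T_def)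
  have t0: "0 \<le> t0" "t0 < T" and x0: "x0 \<in> ball 0 (2 * R)" using z by (auto simp: cyl_def T_def)
  let ?\<sigma> = "hitX (ball 0 (2 * R)) (T - t0)"
  have \<sigma>0: "0 \<le> ?\<sigma> w" for w using t0 by (intro hit_nonneg) simp
  have ep: "exit_point (cyl (0, 0) T (2 * R)) (spacetime X t0 w) = (t0 + ?\<sigma> w, X (?\<sigma> w) w)" for w
    using t0 by (subst exit_point_cyl) (auto simp: Let_def)
  have m1: "(\<lambda>w. t0 + ?\<sigma> w) \<in> borel_measurable GX"
    using t0 by (intro borel_measurable_add borel_measurable_const hitX_meas) auto
  have m2: "(\<lambda>w. X (?\<sigma> w) w) \<in> GX \<rightarrow>\<^sub>M borel" using t0 by (intro X_hitX_meas) auto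
  show "(\<lambda>w. exit_point (pcyl (2 * R)) (spacetime X t0 w)) \<in> GX \<rightarrow>\<^sub>M borel"
    unfolding T_def[symmetric] ep by (rule measurable_Pair[OF m1 m2, unfolded borel_prod])
  have cl: "closure (cyl (0 :: real, 0 :: real ^ 'n) T (2 * R)) = {0..T} \<times> cball 0 (2 * R)"
    using R T by (subst closure_cyl) auto
  show "AE w in P x0. exit_point (pcyl (2 * R)) (spacetime X t0 w) \<in> closure (pcyl (2 * R))"
    unfolding T_def[symmetric] ep cl using AE_start AE_space
  proof eventually_elim
    case (elim w)
    then have w: "w \<in> Om" by simp
    have "X (?\<sigma> w) w \<in> closure (ball 0 (2 * R))"
      by (rule hit_in_closure[OF paths[OF w] _ \<sigma>0 order_refl]) (use elim x0 in simp)
    moreover have "t0 + ?\<sigma> w \<le> T" using hit_le[of "ball 0 (2 * R)" "T - t0" "\<lambda>t. X t w"] by simp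
    ultimately show ?case using R t0 \<sigma>0[of w] by simp
  qed
qed

lemma exit_expectation_holder_closure:
  assumes R: "0 < R" and g: "g \<in> borel_measurable borel" "bounded (g ` closure (pcyl (2 * R)))"
    and z: "z1 \<in> pcyl R" "z2 \<in> pcyl R" and \<alpha>: "0 < \<alpha>" "\<alpha> \<le> \<alpha>0"
  shows "\<bar>(\<integral>w. g (exit_point (pcyl (2 * R)) (spacetime X (fst z1) w)) \<partial>P (snd z1))
      - (\<integral>w. g (exit_point (pcyl (2 * R)) (spacetime X (fst z2) w)) \<partial>P (snd z2))\<bar>
    \<le> \<bar>N\<alpha>\<bar> * (R powr (- \<alpha>) * pdist z1 z2 powr \<alpha> * (SUP z\<in>closure (pcyl (2 * R)). \<bar>g z\<bar>))"
    "0 \<le> (SUP z\<in>closure (pcyl (2 * R)). \<bar>g z :: real\<bar>)"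
proof -
  let ?Q = "closure (pcyl (2 * R)) :: (real \<times> (real ^ 'n)) set"
  let ?S = "SUP z\<in>?Q. \<bar>g z\<bar>"
  define g' where "g' z = (if z \<in> ?Q then g z else 0)" for z
  have Q: "?Q \<in> sets borel" by simp
  have g'm: "g' \<in> borel_measurable borel"
    unfolding g'_def[abs_def] using Q g(1) by (intro measurable_If_set) auto
  obtain B where B: "\<And>z. z \<in> ?Q \<Longrightarrow> \<bar>g z\<bar> \<le> B"
    using g(2) unfolding bounded_iff by auto
  have bdd: "bdd_above ((\<lambda>z. \<bar>g z\<bar>) ` ?Q)" by (intro bdd_aboveI2[where M = B] B)
  have in0: "(0 :: real, 0 :: real ^ 'n) \<in> ?Q" using R by (subst closure_cyl) auto
  have up: "\<bar>g z\<bar> \<le> ?S" if "z \<in> ?Q" for z by (rule cSUP_upper[OF that bdd])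
  show S0: "0 \<le> ?S" by (rule order_trans[OF abs_ge_zero up[OF in0]])
  have g'b: "\<bar>g' z\<bar> \<le> ?S" for z using up[of z] S0 by (simp add: g'_def)
  have eq: "(\<integral>w. g (exit_point (pcyl (2 * R)) (spacetime X (fst z) w)) \<partial>P (snd z))
     = (\<integral>w. g' (exit_point (pcyl (2 * R)) (spacetime X (fst z) w)) \<partial>P (snd z))" if "z \<in> pcyl R" for z
  proof (rule integral_cong_AE)
    have "(fst z, snd z) \<in> pcyl (2 * R)"
    proof -
      have "R\<^sup>2 \<le> (2 * R)\<^sup>2" using R by (simp add: power_mult_distrib)
      then show ?thesis using that R by (auto simp: cyl_def dist_norm)
    qed
    note e = exit_point_pcyl[OF R this]
    show "(\<lambda>w. g (exit_point (pcyl (2 * R)) (spacetime X (fst z) w))) \<in> borel_measurable (P (snd z))"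
      by (rule meas_GX_P[OF measurable_compose[OF e(1) g(1)]])
    show "(\<lambda>w. g' (exit_point (pcyl (2 * R)) (spacetime X (fst z) w))) \<in> borel_measurable (P (snd z))"
      by (rule meas_GX_P[OF measurable_compose[OF e(1) g'm]])
    show "AE w in P (snd z). g (exit_point (pcyl (2 * R)) (spacetime X (fst z) w)) = g' (exit_point (pcyl (2 * R)) (spacetime X (fst z) w))"
      using e(2) by eventually_elim (simp only: g'_def if_True)
  qed
  show "\<bar>(\<integral>w. g (exit_point (pcyl (2 * R)) (spacetime X (fst z1) w)) \<partial>P (snd z1))
      - (\<integral>w. g (exit_point (pcyl (2 * R)) (spacetime X (fst z2) w)) \<partial>P (snd z2))\<bar>
    \<le> \<bar>N\<alpha>\<bar> * (R powr (- \<alpha>) * pdist z1 z2 powr \<alpha> * ?S)"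
    unfolding eq[OF z(1)] eq[OF z(2)] by (rule exit_expectation_holder[OF R refl g'm g'b z \<alpha>])
qed

theorem holder_estimate_sol:
  "holder_estimate \<alpha>0 p (\<bar>N\<alpha>\<bar> + 2 * (potential_const (real CARD('n)) \<alpha>0 N\<alpha> p Np R0)) X P"
  unfolding holder_estimate_def
proof (intro allI impI conjI ballI)
  fix R :: real and f g :: "real \<times> (real ^ 'n) \<Rightarrow> real"
  assume A: "0 < R \<and> g \<in> borel_measurable borel \<and> bounded (g ` closure (pcyl (2 * R))) \<and>
    f \<in> borel_measurable borel \<and> Lp_norm p (pcyl (2 * R)) f < \<infinity>"
  then have R: "0 < R" and g: "g \<in> borel_measurable borel" "bounded (g ` closure (pcyl (2 * R)))"
    and f: "f \<in> borel_measurable borel" "Lp_norm p (pcyl (2 * R)) f < \<infinity>" by blast+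
  {
    fix t0 and x0 :: "real ^ 'n" assume z: "(t0, x0) \<in> pcyl (2 * R)"
    have "ennreal ((potential_const (real CARD('n)) \<alpha>0 N\<alpha> p Np R0) * R powr (2 - (real CARD('n) + 2) / p)) * Lp_norm p (pcyl (2 * R)) f < \<infinity>"
      using f(2) by (simp add: ennreal_mult_less_top)
    then show "(\<integral>\<^sup>+w. (\<integral>\<^sup>+t\<in>before_exit (pcyl (2 * R)) (spacetime X t0 w). ennreal \<bar>f (t0 + t, X t w)\<bar> \<partial>lborel) \<partial>P x0) < \<infinity>"
      by (rule order.strict_trans1[OF potential_bound[OF R f(1) z]])
  }
  fix z1 z2 :: "real \<times> (real ^ 'n)" and \<alpha> :: real
  assume z: "z1 \<in> pcyl R" "z2 \<in> pcyl R" and "0 < \<alpha> \<and> \<alpha> \<le> \<alpha>0"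
  then have \<alpha>: "0 < \<alpha>" "\<alpha> \<le> \<alpha>0" by auto
  have in2: "z \<in> pcyl (2 * R)" if "z \<in> pcyl R" for z :: "real \<times> (real ^ 'n)"
  proof -
    have "R\<^sup>2 \<le> (2 * R)\<^sup>2" using R by (simp add: power_mult_distrib)
    then show ?thesis using that R by (auto simp: cyl_def dist_norm)
  qed
  define I where "I z = (LINT w|P (snd z). (LINT t:before_exit (pcyl (2 * R)) (spacetime X (fst z) w)|lborel. f (fst z + t, X t w)))" for z
  define h where "h z = (LINT w|P (snd z). g (exit_point (pcyl (2 * R)) (spacetime X (fst z) w)))" for z
  define E1 where "E1 = R powr (- \<alpha>) * pdist z1 z2 powr \<alpha> * (SUP z\<in>closure (pcyl (2 * R)). \<bar>g z\<bar>)"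
  define E2 where "E2 = R powr (2 - (real CARD('n) + 2) / p) * enn2real (Lp_norm p (pcyl (2 * R)) f)"
  have s: "sol X P (pcyl (2 * R)) f g z = I z + h z" for z
    by (simp only: sol_def case_prod_unfold I_def h_def)
  have I: "\<bar>I z\<bar> \<le> (potential_const (real CARD('n)) \<alpha>0 N\<alpha> p Np R0) * E2" if "z \<in> pcyl R" for z
    unfolding I_def E2_def by (rule potential_abs_bound[OF R f]) (use in2[OF that] in simp)
  have h: "\<bar>h z1 - h z2\<bar> \<le> \<bar>N\<alpha>\<bar> * E1"
    unfolding h_def E1_def by (rule exit_expectation_holder_closure(1)[OF R g z \<alpha>])
  have E1: "0 \<le> E1" unfolding E1_def
    by (intro mult_nonneg_nonneg exit_expectation_holder_closure(2)[OF R g z \<alpha>]) auto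
  have E2: "0 \<le> E2" by (simp add: E2_def)
  have CF0: "0 \<le> (potential_const (real CARD('n)) \<alpha>0 N\<alpha> p Np R0)"
    using smoothing_const_pos potential_exponent[OF refl] unfolding potential_const_def by (intro mult_nonneg_nonneg add_nonneg_nonneg) auto
  have "\<bar>(I z1 + h z1) - (I z2 + h z2)\<bar> \<le> \<bar>N\<alpha>\<bar> * E1 + 2 * (potential_const (real CARD('n)) \<alpha>0 N\<alpha> p Np R0) * E2"
    using I[OF z(1)] I[OF z(2)] h by linarith
  also have "\<dots> \<le> (\<bar>N\<alpha>\<bar> + 2 * (potential_const (real CARD('n)) \<alpha>0 N\<alpha> p Np R0)) * E1 + (\<bar>N\<alpha>\<bar> + 2 * (potential_const (real CARD('n)) \<alpha>0 N\<alpha> p Np R0)) * E2"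
    using E1 E2 CF0 by (intro add_mono mult_right_mono) auto
  also have "\<dots> = (\<bar>N\<alpha>\<bar> + 2 * (potential_const (real CARD('n)) \<alpha>0 N\<alpha> p Np R0)) * (E1 + E2)" by (simp only: distrib_left)
  finally show "\<bar>sol X P (pcyl (2 * R)) f g z1 - sol X P (pcyl (2 * R)) f g z2\<bar>
    \<le> (\<bar>N\<alpha>\<bar> + 2 * (potential_const (real CARD('n)) \<alpha>0 N\<alpha> p Np R0)) * (R powr (- \<alpha>) * pdist z1 z2 powr \<alpha> * (SUP z\<in>closure (pcyl (2 * R)). \<bar>g z\<bar>)
       + R powr (2 - (real CARD('n) + 2) / p) * enn2real (Lp_norm p (pcyl (2 * R)) f))"
    unfolding s E1_def E2_def .
qed

end

section \<open>Translations\<close>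

lemma partial_deriv_translate: "partial_deriv i (\<lambda>x. u (x - x0)) = (\<lambda>x. partial_deriv i u (x - x0))"
  by (intro ext) (simp only: partial_deriv_def diff_add_eq)

lemma C2_compact_support_translate:
  assumes "C2_compact_support (u :: real ^ 'n \<Rightarrow> real)"
  shows "C2_compact_support (\<lambda>x. u (x - x0))"
proof -
  have d: "(\<lambda>x. v (x - x0)) differentiable (at x)" if "\<forall>x. v differentiable (at x)" for v :: "real ^ 'n \<Rightarrow> real" and x
    using differentiable_chain_at[of "\<lambda>x. x - x0" x v] that by (simp add: o_def)
  have eq: "{x. u (x - x0) \<noteq> 0} = (\<lambda>x. x0 + x) ` {x. u x \<noteq> 0}"
  proof (intro set_eqI iffI)
    fix x assume "x \<in> {x. u (x - x0) \<noteq> 0}"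
    then show "x \<in> (\<lambda>x. x0 + x) ` {x. u x \<noteq> 0}" by (intro image_eqI[of _ _ "x - x0"]) auto
  qed auto
  show ?thesis
    using assms unfolding C2_compact_support_def partial_deriv_translate eq closure_translation
    by (auto intro!: d compact_translation continuous_on_compose2[of UNIV _ UNIV "\<lambda>x. x - x0"] continuous_intros)
qed

lemma diff_op_translate:
  "diff_op (\<lambda>y. a (y + x0)) (\<lambda>y. b (y + x0)) u (x - x0) = diff_op a b (\<lambda>x. u (x - x0)) x"
  unfolding diff_op_def partial_deriv_translate by simp

lemma quasi_diffusion_translate:
  fixes X :: "real \<Rightarrow> 'w \<Rightarrow> real ^ 'n"
  assumes "quasi_diffusion X F P a b"
  shows "quasi_diffusion (\<lambda>t w. X t w - x0) F (\<lambda>y. P (y + x0)) (\<lambda>y. a (y + x0)) (\<lambda>y. b (y + x0))"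
proof -
  interpret Q: quasi_diffusion X F P a b by fact
  have pre: "(\<lambda>y. y - x0) -` \<Gamma> \<in> sets borel" if "\<Gamma> \<in> sets borel" for \<Gamma> :: "(real ^ 'n) set"
    using measurable_sets[of "\<lambda>y. y - x0" borel borel \<Gamma>] that by simp
  show ?thesis
  proof (unfold_locales, goal_cases)
    case (1 x y) show ?case using Q.sets_P[of "x + x0" "y + x0"] .
  next
    case (2 t x) then show ?case by (rule Q.subalgebra_F)
  next
    case (3 s t) then show ?case by (rule Q.mono_F)
  next
    case (4 t)
    from Q.adapted[OF 4] show ?case by measurable
  next
    case (5 t \<Gamma>)
    have "(\<lambda>x. measure (P x) {w \<in> space (P x). X t w \<in> (\<lambda>y. y - x0) -` \<Gamma>}) \<in> borel_measurable borel"
      by (rule Q.transition_measurable[OF 5(1) pre[OF 5(2)]])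
    then have "(\<lambda>x. measure (P (x + x0)) {w \<in> space (P (x + x0)). X t w \<in> (\<lambda>y. y - x0) -` \<Gamma>}) \<in> borel_measurable borel"
      by (rule measurable_compose[rotated]) simp
    then show ?case by simp
  next
    case (6 x)
    have "{w \<in> space (P (x + x0)). X 0 w - x0 = x} = {w \<in> space (P (x + x0)). X 0 w = x + x0}" by (auto simp: algebra_simps)
    then show ?case using Q.start[of "x + x0"] by simp
  next
    case (7 t h \<Gamma> x)
    from Q.markov[OF 7(1,2) pre[OF 7(3)], of "x + x0"] show ?case by simp
  next
    case (8 t w x)
    from Q.shift[OF this] show ?case by auto
  next
    case (9 w x)
    from Q.continuous_paths[OF this] show ?case by (intro continuous_intros)
  next
    case (10 t x)
    from Q.drift_integrable[OF 10, of "x + x0"] show ?case by simp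
  next
    case (11 t u x)
    from Q.generator[OF 11(1) C2_compact_support_translate[OF 11(2), of x0], of "x + x0"]
    show ?case by (simp add: diff_op_translate)
  qed
qed

lemma Lp_norm_translate_ball:
  fixes x0 :: "'a::euclidean_space" and f :: "'a \<Rightarrow> 'b::real_normed_vector"
  assumes "f \<in> borel_measurable borel"
  shows "Lp_norm p (ball 0 r) (\<lambda>x. f (x + x0)) = Lp_norm p (ball x0 r) f"
proof -
  have [measurable]: "ball x0 r \<in> sets borel" by simp
  have m: "(\<lambda>x. ennreal (norm (f x) powr p) * indicator (ball x0 r) x) \<in> borel_measurable borel"
    using assms by measurable
  have "(\<integral>\<^sup>+x. ennreal (norm (f x) powr p) * indicator (ball x0 r) x \<partial>lborel)
    = (\<integral>\<^sup>+x. ennreal (norm (f x) powr p) * indicator (ball x0 r) x \<partial>distr lborel borel ((+) x0))"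
    by (simp only: lborel_distr_plus)
  also have "\<dots> = (\<integral>\<^sup>+x. ennreal (norm (f (x0 + x)) powr p) * indicator (ball x0 r) (x0 + x) \<partial>lborel)"
    by (rule nn_integral_distr) (use m in auto)
  also have "\<dots> = (\<integral>\<^sup>+x\<in>ball 0 r. ennreal (norm (f (x + x0)) powr p) \<partial>lborel)"
    by (intro nn_integral_cong) (simp add: indicator_def dist_norm add.commute)
  finally show ?thesis by (simp add: Lp_norm_def)
qed

lemma Lp_norm_translate_UNIV:
  fixes x0 :: "'a::euclidean_space" and f :: "'a \<Rightarrow> 'b::real_normed_vector"
  assumes "f \<in> borel_measurable borel"
  shows "Lp_norm p UNIV (\<lambda>x. f (x + x0)) = Lp_norm p UNIV f"
  using Lp_norm_shift[of "\<lambda>x. norm (f x)" p x0] assms by (simp add: Lp_norm_norm)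

lemma admissible_coeffs_translate:
  assumes "admissible_coeffs \<delta> nb a b"
  shows "admissible_coeffs \<delta> nb (\<lambda>y. a (y + x0)) (\<lambda>y. b (y + x0))"
  using assms unfolding admissible_coeffs_def by (auto simp: Lp_norm_translate_UNIV)

lemma before_exit_translate:
  "before_exit (ball 0 r) (\<lambda>t. y t - x0) = before_exit (ball x0 r) (y :: real \<Rightarrow> 'a::real_normed_vector)"
proof -
  have "y t - x0 \<notin> ball 0 r \<longleftrightarrow> y t \<notin> ball x0 r" for t by (simp add: dist_norm norm_minus_commute)
  then show ?thesis by (simp only: before_exit_def exit_time_def)
qed

lemma holder_diffusion_instance:
  fixes X :: "real \<Rightarrow> 'w \<Rightarrow> real ^ 'n"
  assumes \<delta>: "0 < \<delta>" and p: "real CARD('n) / 2 + 1 < p"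
    and N0: "0 < N0" "all_quasi_diffusions \<delta> nb (\<lambda>(X :: real \<Rightarrow> 'w \<Rightarrow> real ^ 'n) P. exit_Lp_bound (real CARD('n)) N0 X P)"
    and Np: "0 < Np" "0 < \<mu>" "2 \<le> R0" "all_quasi_diffusions \<delta> nb (\<lambda>(X :: real \<Rightarrow> 'w \<Rightarrow> real ^ 'n) P. discounted_Lp_bound p Np \<mu> R0 X P)"
    and \<alpha>0: "0 < \<alpha>0" "all_quasi_diffusions \<delta> nb (\<lambda>(X :: real \<Rightarrow> 'w \<Rightarrow> real ^ 'n) P. caloric_holder \<alpha>0 N\<alpha> X P)"
    and adm: "admissible_coeffs \<delta> nb a b" and Q: "quasi_diffusion X F P a b"
  shows "holder_diffusion X F P a b \<delta> N0 \<alpha>0 N\<alpha> p Np \<mu> R0"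
proof -
  interpret Q: quasi_diffusion X F P a b by (rule Q)
  have tr: "\<Phi> (\<lambda>t w. X t w - x0) (\<lambda>y. P (y + x0))" if "all_quasi_diffusions \<delta> nb \<Phi>" for \<Phi> x0
    using that[unfolded all_quasi_diffusions_def, rule_format, OF admissible_coeffs_translate[OF adm] quasi_diffusion_translate[OF Q]] .
  have b: "b \<in> borel_measurable borel" using adm by (simp add: admissible_coeffs_def)
  have "Lp_norm (real CARD('n)) UNIV b \<le> ennreal nb" using adm by (simp add: admissible_coeffs_def)
  also have "\<dots> < \<infinity>" by simp
  finally have bL: "Lp_norm (real CARD('n)) UNIV b < \<infinity>" .
  show ?thesis
  proof (unfold_locales, goal_cases)
    case 1 show ?case by (rule \<delta>)
  next
    case 2 show ?case using adm by (simp add: admissible_coeffs_def)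
  next
    case 3 show ?case using adm by (simp add: admissible_coeffs_def)
  next
    case 4 show ?case by (rule b)
  next
    case 5 show ?case by (rule bL)
  next
    case 6 show ?case by (rule N0(1))
  next
    case (7 f r x)
    have fm: "(\<lambda>y. f (y + x)) \<in> borel_measurable borel" using 7(1) by measurable
    have "(\<integral>\<^sup>+w. (\<integral>\<^sup>+t\<in>before_exit (ball 0 r) (\<lambda>t. X t w - x). ennreal ((\<lambda>y. f (y + x)) (X t w - x)) \<partial>lborel) \<partial>P (0 + x))
        \<le> ennreal (N0 * r powr (2 - real CARD('n) / real CARD('n))) * Lp_norm (real CARD('n)) (ball 0 r) (\<lambda>y. f (y + x))"
      by (rule tr[OF N0(2), of x, unfolded exit_Lp_bound_def, rule_format]) (use fm 7 in auto)
    then show ?case using 7(3) by (simp add: before_exit_translate Lp_norm_translate_ball[OF 7(1)])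
  next
    case 8 show ?case by (rule \<alpha>0(1))
  next
    case 9 show ?case by (rule p)
  next
    case 10 show ?case by (rule Np(2))
  next
    case 11 show ?case by (rule Np(1))
  next
    case 12 show ?case using Np(3) by simp
  next
    case (13 x0) show ?case by (rule tr[OF \<alpha>0(2)])
  next
    case (14 x0) show ?case by (rule tr[OF Np(4)])
  qed
qed

section \<open>Realisation on the space of trajectories\<close>

definition final_sets :: "('a \<Rightarrow> 'b) \<Rightarrow> 'a measure \<Rightarrow> 'b set set" where
  "final_sets \<phi> M = {A. A \<subseteq> \<phi> ` space M \<and> \<phi> -` A \<inter> space M \<in> sets M}"

definition final_alg :: "('a \<Rightarrow> 'b) \<Rightarrow> 'a measure \<Rightarrow> 'b measure" where
  "final_alg \<phi> M = sigma (\<phi> ` space M) (final_sets \<phi> M)"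

definition push :: "('a \<Rightarrow> 'b) \<Rightarrow> 'a measure \<Rightarrow> 'b measure" where
  "push \<phi> M = distr M (final_alg \<phi> M) \<phi>"

lemma sigma_algebra_final_sets: "sigma_algebra (\<phi> ` space M) (final_sets \<phi> M)"
  unfolding sigma_algebra_iff2
proof (intro conjI ballI allI impI)
  show "final_sets \<phi> M \<subseteq> Pow (\<phi> ` space M)" by (auto simp: final_sets_def)
  show "{} \<in> final_sets \<phi> M" by (simp add: final_sets_def)
  fix A assume A: "A \<in> final_sets \<phi> M"
  have "\<phi> -` (\<phi> ` space M - A) \<inter> space M = space M - (\<phi> -` A \<inter> space M)" by auto
  then show "\<phi> ` space M - A \<in> final_sets \<phi> M" using A by (auto simp: final_sets_def)
next
  fix A :: "nat \<Rightarrow> _" assume A: "range A \<subseteq> final_sets \<phi> M"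
  have "\<phi> -` (\<Union>i. A i) \<inter> space M = (\<Union>i. \<phi> -` A i \<inter> space M)" by auto
  moreover have "\<dots> \<in> sets M" using A by (intro sets.countable_UN) (auto simp: final_sets_def)
  ultimately show "(\<Union>i. A i) \<in> final_sets \<phi> M" using A by (auto simp: final_sets_def)
qed

lemma final_sets_mono: "space M = space N \<Longrightarrow> sets M \<subseteq> sets N \<Longrightarrow> final_sets \<phi> M \<subseteq> final_sets \<phi> N"
  unfolding final_sets_def by auto

lemma space_final_alg [simp]: "space (final_alg \<phi> M) = \<phi> ` space M"
  unfolding final_alg_def by (rule space_measure_of) (auto simp: final_sets_def)

lemma sets_final_alg: "sets (final_alg \<phi> M) = final_sets \<phi> M"
proof -
  have "final_sets \<phi> M \<subseteq> Pow (\<phi> ` space M)" by (auto simp: final_sets_def)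
  then show ?thesis
    unfolding final_alg_def by (simp only: sets_measure_of sigma_algebra.sigma_sets_eq[OF sigma_algebra_final_sets])
qed

lemma measurable_final_alg: "\<phi> \<in> M \<rightarrow>\<^sub>M final_alg \<phi> M"
  by (rule measurableI) (auto simp: sets_final_alg final_sets_def)

lemma measurable_final_alg_iff: "f \<in> final_alg \<phi> M \<rightarrow>\<^sub>M N \<longleftrightarrow> (\<lambda>w. f (\<phi> w)) \<in> M \<rightarrow>\<^sub>M N"
proof
  assume f: "(\<lambda>w. f (\<phi> w)) \<in> M \<rightarrow>\<^sub>M N"
  show "f \<in> final_alg \<phi> M \<rightarrow>\<^sub>M N"
  proof (rule measurableI)
    fix A assume A: "A \<in> sets N"
    have "\<phi> -` (f -` A \<inter> \<phi> ` space M) \<inter> space M = (\<lambda>w. f (\<phi> w)) -` A \<inter> space M" by auto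
    also have "\<dots> \<in> sets M" by (rule measurable_sets[OF f A])
    finally show "f -` A \<inter> space (final_alg \<phi> M) \<in> sets (final_alg \<phi> M)" by (auto simp: sets_final_alg final_sets_def)
  qed (use measurable_space[OF f] in auto)
qed (rule measurable_compose[OF measurable_final_alg])

lemma space_push [simp]: "space (push \<phi> M) = \<phi> ` space M" by (simp add: push_def)

lemma sets_push: "sets (push \<phi> M) = final_sets \<phi> M" by (simp add: push_def sets_final_alg)

lemma nn_integral_push:
  assumes "(\<lambda>w. f (\<phi> w)) \<in> borel_measurable M"
  shows "(\<integral>\<^sup>+y. f y \<partial>push \<phi> M) = (\<integral>\<^sup>+w. f (\<phi> w) \<partial>M)"
  unfolding push_def by (rule nn_integral_distr[OF measurable_final_alg]) (use assms in \<open>simp add: measurable_final_alg_iff\<close>)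

text \<open>
  No measurability is needed: for the final sigma-algebra, \<open>f\<close> is measurable iff \<open>f \<circ> \<phi>\<close> is.
\<close>

lemma integral_push:
  fixes f :: "'b \<Rightarrow> real"
  shows "(\<integral>y. f y \<partial>push \<phi> M) = (\<integral>w. f (\<phi> w) \<partial>M)"
proof (cases "(\<lambda>w. f (\<phi> w)) \<in> borel_measurable M")
  case True
  then show ?thesis unfolding push_def by (intro integral_distr[OF measurable_final_alg]) (simp add: measurable_final_alg_iff)
next
  case False
  then have "\<not> integrable M (\<lambda>w. f (\<phi> w))" by (auto dest: borel_measurable_integrable)
  moreover have "\<not> integrable (push \<phi> M) f"
  proof
    assume "integrable (push \<phi> M) f"
    then have "f \<in> borel_measurable (push \<phi> M)" by (rule borel_measurable_integrable)
    then show False using False by (simp add: push_def measurable_final_alg_iff)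
  qed
  ultimately show ?thesis by (simp add: not_integrable_integral_eq)
qed

lemma measure_push:
  assumes "{w \<in> space M. Q (\<phi> w)} \<in> sets M"
  shows "measure (push \<phi> M) {y \<in> space (push \<phi> M). Q y} = measure M {w \<in> space M. Q (\<phi> w)}"
proof -
  have eq: "\<phi> -` {y \<in> \<phi> ` space M. Q y} \<inter> space M = {w \<in> space M. Q (\<phi> w)}" by auto
  have "{y \<in> \<phi> ` space M. Q y} \<in> sets (final_alg \<phi> M)"
    unfolding sets_final_alg final_sets_def mem_Collect_eq eq using assms by blast
  from measure_distr[OF measurable_final_alg this] show ?thesis
    unfolding space_push unfolding push_def eq .
qed

lemma exit_time_cong: "(\<And>t. 0 \<le> t \<Longrightarrow> y t = y' t) \<Longrightarrow> exit_time Q y = exit_time Q y'"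
  unfolding exit_time_def by (intro arg_cong[where f = Inf] arg_cong[where f = "(`) ereal"]) auto

lemma before_exit_cong: "(\<And>t. 0 \<le> t \<Longrightarrow> y t = y' t) \<Longrightarrow> before_exit Q y = before_exit Q y'"
  unfolding before_exit_def using exit_time_cong[of y y' Q] by simp

lemma exit_point_cong:
  assumes "\<And>t. 0 \<le> t \<Longrightarrow> y t = y' t"
  shows "exit_point Q y = exit_point Q y'"
proof -
  have "0 \<le> exit_time Q y'" unfolding exit_time_def by (rule Inf_greatest) auto
  moreover have "exit_time Q y = exit_time Q y'" by (rule exit_time_cong) (rule assms)
  ultimately show ?thesis unfolding exit_point_def by (simp add: assms real_of_ereal_pos)
qed

context continuous_markov_process
begin

definition traj :: "'w \<Rightarrow> real \<Rightarrow> real ^ 'n" where "traj w = (\<lambda>t. if 0 \<le> t then X t w else 0)"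

lemma traj: "0 \<le> t \<Longrightarrow> traj w t = X t w" by (simp add: traj_def)

lemma spacetime_traj: "0 \<le> t \<Longrightarrow> spacetime (\<lambda>t y. y t) t0 (traj w) t = spacetime X t0 w t"
  by (simp add: spacetime_def traj)

lemma running_integral_meas:
  fixes f :: "real \<times> (real ^ 'n) \<Rightarrow> real"
  assumes f: "f \<in> borel_measurable borel" and z: "(t0, x0) \<in> pcyl R"
  shows "(\<lambda>w. \<integral>\<^sup>+t\<in>before_exit (pcyl R) (spacetime X t0 w). ennreal \<bar>f (t0 + t, X t w)\<bar> \<partial>lborel) \<in> borel_measurable GX"
proof -
  define T where "T = R\<^sup>2 - t0"
  have t0: "0 \<le> t0" "0 \<le> T" using z by (auto simp: cyl_def T_def)
  let ?\<sigma> = "hitX (ball 0 R) T"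
  have \<sigma>: "?\<sigma> \<in> borel_measurable GX" using t0 by (intro hitX_meas) auto
  have be: "before_exit (pcyl R) (spacetime X t0 w) = {t. 0 \<le> t \<and> t < ?\<sigma> w}" for w
    using t0 by (subst before_exit_cyl) (auto simp: T_def)
  have eq: "(\<lambda>w. \<integral>\<^sup>+t\<in>before_exit (pcyl R) (spacetime X t0 w). ennreal \<bar>f (t0 + t, X t w)\<bar> \<partial>lborel)
    = (\<lambda>w. \<integral>\<^sup>+t. ennreal \<bar>f (t0 + t, X (max 0 t) w)\<bar> * indicator {t. 0 \<le> t \<and> t < ?\<sigma> w} t \<partial>lborel)"
    unfolding be by (intro ext nn_integral_cong) (auto simp: indicator_def max_absorb2)
  show ?thesis unfolding eq
  proof (rule lborel.borel_measurable_nn_integral)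
    have "(\<lambda>q :: 'w \<times> real. (snd q, fst q)) \<in> GX \<Otimes>\<^sub>M lborel \<rightarrow>\<^sub>M borel \<Otimes>\<^sub>M GX" by measurable
    from measurable_compose[OF this X_joint]
    have Xm: "(\<lambda>q. X (max 0 (snd q)) (fst q)) \<in> GX \<Otimes>\<^sub>M lborel \<rightarrow>\<^sub>M borel" by simp
    have sm: "(\<lambda>q. t0 + snd q) \<in> GX \<Otimes>\<^sub>M lborel \<rightarrow>\<^sub>M (borel :: real measure)" by measurable
    have "(\<lambda>q. (t0 + snd q, X (max 0 (snd q)) (fst q))) \<in> GX \<Otimes>\<^sub>M lborel \<rightarrow>\<^sub>M borel"
      by (rule measurable_Pair[OF sm Xm, unfolded borel_prod])
    from measurable_compose[OF this f]
    have 1: "(\<lambda>q. f (t0 + snd q, X (max 0 (snd q)) (fst q))) \<in> borel_measurable (GX \<Otimes>\<^sub>M lborel)" by simp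
    have "{q \<in> space (GX \<Otimes>\<^sub>M lborel). 0 \<le> snd q \<and> snd q < ?\<sigma> (fst q)} \<in> sets (GX \<Otimes>\<^sub>M lborel)"
      using \<sigma> by measurable
    then have 2: "(indicator {q \<in> space (GX \<Otimes>\<^sub>M lborel). 0 \<le> snd q \<and> snd q < ?\<sigma> (fst q)} :: _ \<Rightarrow> ennreal) \<in> borel_measurable (GX \<Otimes>\<^sub>M lborel)"
      by (rule borel_measurable_indicator)
    have "(\<lambda>q. ennreal \<bar>f (t0 + snd q, X (max 0 (snd q)) (fst q))\<bar> * indicator {q \<in> space (GX \<Otimes>\<^sub>M lborel). 0 \<le> snd q \<and> snd q < ?\<sigma> (fst q)} q)
      \<in> borel_measurable (GX \<Otimes>\<^sub>M lborel)" using 1 2 by measurable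
    then show "(\<lambda>(w, t). ennreal \<bar>f (t0 + t, X (max 0 t) w)\<bar> * indicator {t. 0 \<le> t \<and> t < ?\<sigma> w} t) \<in> borel_measurable (GX \<Otimes>\<^sub>M lborel)"
      by (rule measurable_cong[THEN iffD1, rotated]) (auto simp: indicator_def)
  qed
qed

lemma sol_traj: "sol (\<lambda>t y. y t) (\<lambda>x. push traj (P x)) Q f g z = sol X P Q f g z"
proof -
  have be: "before_exit Q (spacetime (\<lambda>t y. y t) t0 (traj w)) = before_exit Q (spacetime X t0 w)"
    and ep: "exit_point Q (spacetime (\<lambda>t y. y t) t0 (traj w)) = exit_point Q (spacetime X t0 w)" for t0 w
    by (rule before_exit_cong exit_point_cong, rule spacetime_traj, assumption)+
  have 1: "(LINT t:before_exit Q (spacetime X t0 w)|lborel. f (t0 + t, traj w t))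
     = (LINT t:before_exit Q (spacetime X t0 w)|lborel. f (t0 + t, X t w))" for t0 w
    unfolding set_lebesgue_integral_def
    by (intro Bochner_Integration.integral_cong refl) (auto simp: indicator_def before_exit_def traj)
  show ?thesis unfolding sol_def integral_push be ep 1 ..
qed

lemma holder_estimate_traj:
  assumes "holder_estimate \<alpha>0 p N (\<lambda>t y. y t) (\<lambda>x. push traj (P x))"
  shows "holder_estimate \<alpha>0 p N X P"
proof -
  have be: "before_exit Q (spacetime (\<lambda>t y. y t) t0 (traj w)) = before_exit Q (spacetime X t0 w)" for Q t0 w
    by (rule before_exit_cong, rule spacetime_traj)
  have "(\<integral>\<^sup>+y. (\<integral>\<^sup>+t\<in>before_exit (pcyl R) (spacetime (\<lambda>t y. y t) t0 y). ennreal \<bar>f (t0 + t, y t)\<bar> \<partial>lborel) \<partial>push traj (P x0))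
     = (\<integral>\<^sup>+w. (\<integral>\<^sup>+t\<in>before_exit (pcyl R) (spacetime X t0 w). ennreal \<bar>f (t0 + t, X t w)\<bar> \<partial>lborel) \<partial>P x0)"
    if f: "f \<in> borel_measurable borel" and z: "(t0, x0) \<in> pcyl R" for f t0 x0 and R :: real
  proof -
    have eq: "(\<integral>\<^sup>+t\<in>before_exit (pcyl R) (spacetime (\<lambda>t y. y t) t0 (traj w)). ennreal \<bar>f (t0 + t, traj w t)\<bar> \<partial>lborel)
      = (\<integral>\<^sup>+t\<in>before_exit (pcyl R) (spacetime X t0 w). ennreal \<bar>f (t0 + t, X t w)\<bar> \<partial>lborel)" for w
      unfolding be by (intro nn_integral_cong) (auto simp: indicator_def before_exit_def traj)
    have "(\<integral>\<^sup>+y. (\<integral>\<^sup>+t\<in>before_exit (pcyl R) (spacetime (\<lambda>t y. y t) t0 y). ennreal \<bar>f (t0 + t, y t)\<bar> \<partial>lborel) \<partial>push traj (P x0))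
      = (\<integral>\<^sup>+w. (\<integral>\<^sup>+t\<in>before_exit (pcyl R) (spacetime (\<lambda>t y. y t) t0 (traj w)). ennreal \<bar>f (t0 + t, traj w t)\<bar> \<partial>lborel) \<partial>P x0)"
      by (rule nn_integral_push) (unfold eq, rule meas_GX_P[OF running_integral_meas[OF f z]])
    then show ?thesis unfolding eq .
  qed
  note nn = this
  show ?thesis
    unfolding holder_estimate_def
  proof (intro allI impI, goal_cases)
    case (1 R f g)
    note E = assms[unfolded holder_estimate_def, rule_format, OF 1, unfolded sol_traj]
    show ?case
    proof (intro conjI allI impI ballI)
      fix t0 and x0 :: "real ^ 'n" assume z: "(t0, x0) \<in> pcyl (2 * R)"
      have f: "f \<in> borel_measurable borel" using 1 by blast
      show "(\<integral>\<^sup>+w. (\<integral>\<^sup>+t\<in>before_exit (pcyl (2 * R)) (spacetime X t0 w). ennreal \<bar>f (t0 + t, X t w)\<bar> \<partial>lborel) \<partial>P x0) < \<infinity>"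
        unfolding nn[OF f z, symmetric] using E z by blast
    qed (use E in blast)
  qed
qed

lemma subalgebra_traj:
  assumes "0 \<le> t"
  shows "subalgebra (push traj (P x)) (final_alg traj (F t))"
proof -
  have "space (F t) = space (P x)" "sets (F t) \<subseteq> sets (P x)"
    using space_F[OF assms] sets_F[OF assms] by auto
  then show ?thesis
    unfolding subalgebra_def sets_push sets_final_alg space_push space_final_alg by (simp add: final_sets_mono)
qed

lemma traj_process: "continuous_markov_process (\<lambda>t y. y t) (\<lambda>t. final_alg traj (F t)) (\<lambda>x. push traj (P x))"
proof (intro continuous_markov_process.intro, goal_cases)
  case (1 x)
  show ?case unfolding push_def by (rule P.prob_space_distr[OF measurable_final_alg])
next
  case (2 x y)
  show ?case by (simp add: sets_push final_sets_def sets_P[of x y])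
next
  case (3 t x)
  show ?case by (rule subalgebra_traj[OF 3])
next
  case (4 s t)
  have "space (F s) = space (F t)" using space_F[of s] space_F[of t] 4 by simp
  then show ?case unfolding sets_final_alg by (intro final_sets_mono mono_F[OF 4])
next
  case (5 t)
  have "(\<lambda>w. traj w t) \<in> F t \<rightarrow>\<^sub>M borel" using adapted[OF 5] 5 by (simp add: traj)
  then show ?case by (simp add: measurable_final_alg_iff)
next
  case (6 t \<Gamma>)
  have S: "{w \<in> space (P x). X t w \<in> \<Gamma>} \<in> sets (P x)" for x
    using measurable_sets[OF X_meas_P[OF 6(1), of x] 6(2)] by (simp add: vimage_def Int_def conj_commute)
  have "measure (push traj (P x)) {y \<in> space (push traj (P x)). y t \<in> \<Gamma>} = measure (P x) {w \<in> space (P x). X t w \<in> \<Gamma>}" for x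
    using measure_push[of "P x" "\<lambda>y. y t \<in> \<Gamma>" traj] 6(1) S[of x] by (simp only: traj)
  then show ?case using transition_measurable[OF 6] by simp
next
  case (7 x)
  have "{w \<in> space (P x). X 0 w = x} \<in> sets (P x)"
    using measurable_sets[OF X_meas_P[of 0 x], of "{x}"] by (simp add: vimage_def Int_def conj_commute)
  then show ?case
    using measure_push[of "P x" "\<lambda>y. y 0 = x" traj] start[of x] by (simp only: traj order_refl)
next
  case (8 t h \<Gamma> x)
  have th: "0 \<le> t + h" using 8 by simp
  let ?M = "push traj (P x)" and ?A = "final_alg traj (F t)"
  have MP: "prob_space (push traj (P z))" for z unfolding push_def by (rule P.prob_space_distr[OF measurable_final_alg])
  interpret M: prob_space ?M by (rule MP)
  have sub: "subalgebra ?M ?A" by (rule subalgebra_traj[OF 8(1)])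
  interpret S: finite_measure_subalgebra ?M ?A by unfold_locales (rule sub)
  let ?k = "\<lambda>z. measure (P z) {w \<in> space (P z). X h w \<in> \<Gamma>}"
  have S: "{w \<in> space (P z). X u w \<in> \<Gamma>} \<in> sets (P z)" if "0 \<le> u" for u z
    using measurable_sets[OF X_meas_P[OF that, of z] 8(3)] by (simp add: vimage_def Int_def conj_commute)
  have k: "measure (push traj (P z)) {y \<in> space (push traj (P z)). y h \<in> \<Gamma>} = ?k z" for z
    using measure_push[of "P z" "\<lambda>y. y h \<in> \<Gamma>" traj] 8(2) S[OF 8(2), of z] by (simp only: traj)
  have kb: "?k \<in> borel_measurable borel" by (rule transition_measurable[OF 8(2,3)])
  have k1: "\<bar>?k z\<bar> \<le> 1" for z using P.prob_le_1[of z] by simp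
  have ib: "bdd_borel 1 (indicator \<Gamma>)" using 8(3) by (auto simp: bdd_borel_def indicator_def)
  have ks: "sgp h (indicator \<Gamma>) z = ?k z" for z
  proof -
    have "sgp h (indicator \<Gamma>) z = (\<integral>w. indicator {w \<in> space (P z). X h w \<in> \<Gamma>} w \<partial>P z)"
      unfolding sgp_def by (intro Bochner_Integration.integral_cong) (auto simp: indicator_def)
    then show ?thesis using S[OF 8(2), of z] by (simp add: Int_absorb2 subset_eq)
  qed
  show ?case unfolding k
  proof (rule S.real_cond_exp_charact)
    let ?I = "indicator {y \<in> space ?M. y (t + h) \<in> \<Gamma>} :: _ \<Rightarrow> real"
    have Im: "{y \<in> space ?M. y (t + h) \<in> \<Gamma>} \<in> sets ?M"
    proof -
      have "traj -` {y \<in> space ?M. y (t + h) \<in> \<Gamma>} \<inter> space (P x) = {w \<in> space (P x). X (t + h) w \<in> \<Gamma>}"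
        using th by (auto simp: traj)
      then show ?thesis using S[OF th, of x] by (auto simp: sets_push final_sets_def)
    qed
    show "integrable ?M ?I" by (rule M.integrable_const_bound[where B = 1]) (use Im in auto)
    show m: "(\<lambda>y. ?k (y t)) \<in> borel_measurable ?A"
      using measurable_compose[OF adapted[OF 8(1)] kb] 8(1) by (simp add: measurable_final_alg_iff traj)
    show "integrable ?M (\<lambda>y. ?k (y t))"
      by (rule M.integrable_const_bound[where B = 1]) (use k1 measurable_from_subalg[OF sub m] in auto)
    fix A assume A: "A \<in> sets ?A"
    let ?B = "traj -` A \<inter> Om"
    have B: "?B \<in> sets (F t)" using A 8(1) by (simp add: sets_final_alg final_sets_def space_F)
    have "(\<integral>y\<in>A. ?I y \<partial>?M) = (\<integral>w. indicator \<Gamma> (X (h + t) w) * indicator ?B w \<partial>P x)"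
      unfolding set_lebesgue_integral_def integral_push using th
      by (intro Bochner_Integration.integral_cong) (auto simp: indicator_def traj add.commute)
    also have "\<dots> = (\<integral>w. sgp h (indicator \<Gamma>) (X t w) * indicator ?B w \<partial>P x)"
      by (rule markov_sgp[OF 8(1,2) ib B])
    also have "\<dots> = (\<integral>y\<in>A. ?k (y t) \<partial>?M)"
      unfolding set_lebesgue_integral_def integral_push ks using 8(1)
      by (intro Bochner_Integration.integral_cong) (auto simp: indicator_def traj)
    finally show "(\<integral>y\<in>A. ?I y \<partial>?M) = (\<integral>y\<in>A. ?k (y t) \<partial>?M)" .
  qed
next
  case (9 t y x)
  then obtain w where w: "w \<in> space (P x)" "y = traj w" by auto
  from shift[OF 9(1) w(1)] obtain w' where "w' \<in> space (P x)" "\<forall>s\<ge>0. X s w' = X (s + t) w" by blast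
  then show ?case using w 9(1) by (intro bexI[of _ "traj w'"]) (auto simp: traj)
next
  case (10 y x)
  then obtain w where w: "w \<in> space (P x)" "y = traj w" by auto
  have "continuous_on {0..} (\<lambda>t. traj w t) \<longleftrightarrow> continuous_on {0..} (\<lambda>t. X t w)"
    by (rule continuous_on_cong) (auto simp: traj)
  then show ?case using continuous_paths[OF w(1)] w(2) by simp
qed

end

lemma (in quasi_diffusion) traj_quasi_diffusion:
  assumes b: "b \<in> borel_measurable borel"
  shows "quasi_diffusion (\<lambda>t y. y t) (\<lambda>t. final_alg traj (F t)) (\<lambda>x. push traj (P x)) a b"
proof (intro quasi_diffusion.intro traj_process quasi_diffusion_axioms.intro, goal_cases)
  case (1 t x)
  have eq: "(\<integral>\<^sup>+s\<in>{0..t}. ennreal (norm (b (traj w s))) \<partial>lborel) = (\<integral>\<^sup>+s\<in>{0..t}. ennreal (norm (b (X s w))) \<partial>lborel)" for w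
    by (intro nn_integral_cong) (auto simp: indicator_def traj)
  have "(\<integral>\<^sup>+s\<in>{0..t}. ennreal (norm (b (X s w))) \<partial>lborel) = (\<integral>\<^sup>+s. ennreal (norm (b (X (max 0 s) w))) * indicator {0..t} s \<partial>lborel)" for w
    by (intro nn_integral_cong) (auto simp: indicator_def max_absorb2)
  moreover have "(\<lambda>w. \<integral>\<^sup>+s. ennreal (norm (b (X (max 0 s) w))) * indicator {0..t} s \<partial>lborel) \<in> borel_measurable GX"
    by (rule nn_path_integral_meas[of "\<lambda>z. ennreal (norm (b z))" "\<lambda>_. t"]) (use b in measurable)
  ultimately have m: "(\<lambda>w. \<integral>\<^sup>+s\<in>{0..t}. ennreal (norm (b (X s w))) \<partial>lborel) \<in> borel_measurable (P x)"
    by (intro meas_GX_P) simp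
  have "(\<integral>\<^sup>+y. (\<integral>\<^sup>+s\<in>{0..t}. ennreal (norm (b (y s))) \<partial>lborel) \<partial>push traj (P x))
    = (\<integral>\<^sup>+w. (\<integral>\<^sup>+s\<in>{0..t}. ennreal (norm (b (traj w s))) \<partial>lborel) \<partial>P x)"
    by (rule nn_integral_push) (unfold eq, rule m)
  then show ?case unfolding eq using drift_integrable[OF 1, of x] by simp
next
  case (2 t u x)
  have "(LINT s:{0..t}|lborel. diff_op a b u (traj w s)) = (LINT s:{0..t}|lborel. diff_op a b u (X s w))" for w
    unfolding set_lebesgue_integral_def by (intro Bochner_Integration.integral_cong) (auto simp: indicator_def traj)
  then show ?case unfolding integral_push using generator[OF 2, of x] 2(1) by (simp add: traj)
qed

(* The constant N must be the same for all sample spaces, which cannot be said by quantifying over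
   the sample type 'w inside the formula. Instead: some N works for all processes whose
   sample points are trajectories, and every such N works for processes on any sample type 'w. *)

theorem theorem6p5:
  fixes \<delta> nb d0 \<alpha>0 p :: real
  assumes "0 < \<delta>" "\<delta> < 1" "0 < nb"
    and "is_d0 TYPE('n::finite) \<delta> nb d0"
    and "is_alpha0 TYPE('n) \<delta> nb \<alpha>0"
    and "d0 \<le> p" "real CARD('n) / 2 + 1 < p"
  shows "(\<exists>N. holder_constant TYPE(real \<Rightarrow> real ^ 'n) TYPE('n) \<delta> nb \<alpha>0 p N)
       \<and> (\<forall>N. holder_constant TYPE(real \<Rightarrow> real ^ 'n) TYPE('n) \<delta> nb \<alpha>0 p N
            \<longrightarrow> holder_constant TYPE('w) TYPE('n) \<delta> nb \<alpha>0 p N)"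
proof (intro conjI allI impI)
  have d0: "d0 \<le> real CARD('n)" using assms(4) by (simp add: is_d0_def)
  obtain N0 where N0: "0 < N0" "all_quasi_diffusions \<delta> nb
      (\<lambda>(X :: real \<Rightarrow> (real \<Rightarrow> real ^ 'n) \<Rightarrow> real ^ 'n) P. exit_Lp_bound (real CARD('n)) N0 X P)"
    using assms(4) d0 unfolding is_d0_def by blast
  obtain Np \<mu> R0 where Np: "0 < Np" "0 < \<mu>" "2 \<le> R0" "all_quasi_diffusions \<delta> nb
      (\<lambda>(X :: real \<Rightarrow> (real \<Rightarrow> real ^ 'n) \<Rightarrow> real ^ 'n) P. discounted_Lp_bound p Np \<mu> R0 X P)"
    using assms(4,6) unfolding is_d0_def by blast
  obtain N\<alpha> where \<alpha>0: "0 < \<alpha>0" "all_quasi_diffusions \<delta> nb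
      (\<lambda>(X :: real \<Rightarrow> (real \<Rightarrow> real ^ 'n) \<Rightarrow> real ^ 'n) P. caloric_holder \<alpha>0 N\<alpha> X P)"
    using assms(5) unfolding is_alpha0_def by blast
  show "\<exists>N. holder_constant TYPE(real \<Rightarrow> real ^ 'n) TYPE('n) \<delta> nb \<alpha>0 p N"
    unfolding holder_constant_def all_quasi_diffusions_def
  proof (rule exI, intro allI impI)
    fix a b F P and X :: "real \<Rightarrow> (real \<Rightarrow> real ^ 'n) \<Rightarrow> real ^ 'n"
    assume adm: "admissible_coeffs \<delta> nb a b" and Q: "quasi_diffusion X F P a b"
    show "holder_estimate \<alpha>0 p (\<bar>N\<alpha>\<bar> + 2 * potential_const (real CARD('n)) \<alpha>0 N\<alpha> p Np R0) X P"
      by (rule holder_diffusion.holder_estimate_sol[OF holder_diffusion_instance[OF assms(1,7) N0 Np \<alpha>0 adm Q]])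
  qed
next
  fix N assume N: "holder_constant TYPE(real \<Rightarrow> real ^ 'n) TYPE('n) \<delta> nb \<alpha>0 p N"
  show "holder_constant TYPE('w) TYPE('n) \<delta> nb \<alpha>0 p N"
    unfolding holder_constant_def all_quasi_diffusions_def
  proof (intro allI impI)
    fix a b F P and X :: "real \<Rightarrow> 'w \<Rightarrow> real ^ 'n"
    assume adm: "admissible_coeffs \<delta> nb a b" and Q: "quasi_diffusion X F P a b"
    interpret quasi_diffusion X F P a b by (rule Q)
    have b: "b \<in> borel_measurable borel" using adm by (simp add: admissible_coeffs_def)
    show "holder_estimate \<alpha>0 p N X P"
      using N unfolding holder_constant_def all_quasi_diffusions_def
      by (intro holder_estimate_traj) (use adm traj_quasi_diffusion[OF b] in blast)
  qed
qed

end
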